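(* Assume that the following conditions (H2) and (H3) hold for the same closed set $\mathcal{T}\subset\mathbb{R}^n$: (H2) $\mathcal{T}$ is nonempty and closed with compact boundary, $\mathcal{V}(x)=0$ for all $x\in\mathcal{T}$, and $\lim_{x\to\bar x}\mathcal{V}(x)=0$ for all $\bar x\in\partial\mathcal{T}$; (H3) if $A$ is unbounded: for any $x$ with $V(x)<+\infty$ there is $\varepsilon>0$ such that $\liminf_{s\to+\infty}\mathbf{d}(\xi_x(s,w_0,w))=0$ for every $(w_0,w)\in\Gamma$ with $J(+\infty,x,w_0,w)\le V(x)+\varepsilon$; if $A$ is compact: for any $x$ with $\mathcal{V}(x)<+\infty$ there is $\varepsilon>0$ such that $\liminf_{t\to+\infty}\mathbf{d}(y_x(t,\alpha))=0$ for every $\alpha\in\mathcal{A}$ with $\mathcal{J}(+\infty,x,\alpha)\le\mathcal{V}(x)+\varepsilon$. Assume moreover one of the following alternatives: (i) either (H0)$_1$ or (H0)$_2$ (see context) holds, $\mathcal{V}$ is continuous in $Dom(\mathcal{V})$, and $\lim_{x\to\bar x}\mathcal{V}(x)=+\infty$ for all $\bar x\in\partial Dom(\mathcal{V})$; (ii) either (CV) or (CV)$'$ (see context) holds. Then $\mathcal{V}$ ($\equiv V^r\equiv\Sigma$) is the unique nonnegative viscosity solution to $H(x,Du(x))=0$ in $Dom(\mathcal{V})$ among the pairs $(u,\Omega)\in\mathcal{S}$ with $\Omega\supset\mathcal{T}$ and $u\equiv0$ on $\mathcal{T}$; that is, $(\mathcal{V},Dom(\mathcal{V}))$ is such a pair,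 and any such pair $(u,\Omega)$ satisfies $\Omega=Dom(\mathcal{V})$ and $u=\mathcal{V}$. Moreover $\mathcal{V}$ is continuous. If in (i) the requirement that (H0)$_1$ or (H0)$_2$ holds is dropped, then $\mathcal{V}$ (possibly $\neq V^r$) is the unique solution just among the continuous functions.
   Context: Notation. $\mathbb{R}_+=[0,+\infty)$; $\overline{B(0,1)}$ is the closed unit ball of $\mathbb{R}^m$; $\mathbf{d}(x)$ is the distance of $x$ from $\mathcal{T}$; $Dom(u)=\{x\in\mathbb{R}^n: u(x)<+\infty\}$; $u_*,u^*$ are the lower and upper semicontinuous envelopes. A modulus is a function $\omega:\mathbb{R}_+\times\mathbb{R}_+\to\mathbb{R}_+$ such that $\omega(\cdot,R)$ is increasing in a neighborhood of $0$, continuous at $0$, with $\omega(0,R)=0$ for every $R>0$, and $\omega(r,\cdot)$ is increasing for every $r$. Data (standing assumptions). $A\subset\mathbb{R}^m$ is either compact or an (unbounded) convex, closed, nontrivial cone containing the origin. $f:\mathbb{R}^n\times A\to\mathbb{R}^n$ and $l:\mathbb{R}^n\times A\to\mathbb{R}$ are continuous; there are integers $q\ge p\ge 1$, $M>0$ and, for every $R>0$, constants $L_R,M_R>0$ and a modulus $\omega(\cdot,R)$ such that, for all $a\in A$ and all $|x|,|x_1|,|x_2|\le R$, $|f(x_1,a)-f(x_2,a)|\le L_R(1+|a|^p)|x_1-x_2|$, $|l(x_1,a)-l(x_2,a)|\le(1+|a|^q)\omega(|x_1-x_2|,R)$, $0\le l(x,a)\le M_R(1+|a|^q)$; and $|f(x,a)|\le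 M(1+|a|^p)(1+|x|)$ for all $(x,a)$. It is also assumed that for any $R>0$ there is $\bar L_R>0$ with $\omega(r,R)=\bar L_R\,r$. If $A$ is unbounded, moreover: there are $C_1\ge0$, $C_2>0$ with $l(x,a)\ge C_2|a|^q-C_1$ for all $(x,a)\in\mathbb{R}^n\times A$ (same $q$), and for $\Phi\in\{f,l\}$ there is a continuous function $\Phi^\infty$ with $\lim_{\rho\to0^+}\rho^q\Phi(x,\rho^{-1}a)=\Phi^\infty(x,a)$ uniformly on compact subsets of $\mathbb{R}^n\times A$. Original problem. $\mathcal{A}$ is the set of Borel measurable $\alpha:\mathbb{R}_+\to A$ belonging to $L^q_{loc}(\mathbb{R}_+,A)$ (all Borel $\alpha$ if $A$ is compact); $y_x(\cdot,\alpha)$ is the solution of $\dot y=f(y,\alpha)$, $y(0)=x$. For $t\in[0,+\infty]$, $\mathcal{J}(t,x,\alpha)=\int_0^t l(y_x(\tau,\alpha),\alpha(\tau))\,d\tau$; $\mathcal{V}(t,x)=\inf_{\alpha\in\mathcal{A}}\mathcal{J}(t,x,\alpha)$ for finite $t$, $\mathcal{V}(x)=\inf_{\alpha\in\mathcal{A}}\mathcal{J}(+\infty,x,\alpha)\in[0,+\infty]$, and $\Sigma(x)=\lim_{t\to+\infty}\mathcal{V}(t,x)=\sup_{t>0}\mathcal{V}(t,x)$. Extended problem ($A$ unbounded). For $\Phi\in\{f,l\}$, $\overline{\Phi}(x,w_0,w)=w_0^q\Phi(x,w_0^{-1}w)$ if $w_0\ne0$ and $\overline\Phi(x,0,w)=\Phi^\infty(x,w)$,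 for $(x,w_0,w)\in\mathbb{R}^n\times\mathbb{R}_+\times A$. $S(A)=\{(w_0,w)\in\mathbb{R}_+\times A:\ w_0^q+|w|^q=1\}$; $\Gamma$ is the set of Borel measurable functions $(w_0,w):\mathbb{R}_+\to S(A)$. For $(w_0,w)\in\Gamma$, $\xi_x(\cdot,w_0,w)$ is the solution of $\xi'=\overline f(\xi,w_0,w)$, $\xi(0)=x$; $J(+\infty,x,w_0,w)=\int_0^{+\infty}\overline l(\xi_x(s,w_0,w),w_0(s),w(s))\,ds$ and $V(x)=\inf_{(w_0,w)\in\Gamma}J(+\infty,x,w_0,w)\in[0,+\infty]$. Relaxed problem, $A$ compact. $A^r=\mathcal{P}(A)$ is the set of Radon probability measures on $A$ with the weak$^*$ topology, $\mathcal{A}^r=L^\infty(\mathbb{R}_+,\mathcal{P}(A))$; $f^r(x,\mu)=\int_A f(x,a)\,d\mu$, $l^r(x,\mu)=\int_A l(x,a)\,d\mu$; $y^r_x(\cdot,\mu)$ solves $\dot y^r=f^r(y^r,\mu)$, $y^r(0)=x$; $V^r(x)=\inf_{\mu\in\mathcal{A}^r}\int_0^{+\infty} l^r(y^r_x(\tau,\mu),\mu(\tau))\,d\tau$. Relaxed problem, $A$ unbounded. $A^r=\mathcal{P}(\overline{B(0,1)}\cap A)$, $\Gamma^r=L^\infty(\mathbb{R}_+,A^r)$; for $\psi\in\{\overline f,\overline l\}$, $\psi^r(x,\mu)=\int_{\overline{B(0,1)}\cap A}\psi(x,(1-|w|^q)^{1/q},w)\,d\mu$; $\xi^r_x(\cdot,\mu)$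 solves $\dot\xi^r=\overline f^r(\xi^r,\mu)$, $\xi^r(0)=x$; $V^r(x)=\inf_{\mu\in\Gamma^r}\int_0^{+\infty}\overline l^r(\xi^r_x(s,\mu),\mu(s))\,ds$. Conditions. (H0)$_1$: the structural bounds above hold with $L_R$, $M_R$ and $\omega(\cdot)=\omega(\cdot,R)$ independent of $R$, $|f(x,a)|\le M(1+|a|^p)$ for all $(x,a)$, and $\int_0^1(\omega(s)/s)\,ds<+\infty$. (H0)$_2$: for every $x$ with $V^r(x)<+\infty$ there exist a relaxed control $\mu$ attaining $V^r(x)$ and $\bar R>0$ such that $|\xi^r_x(s,\mu)|\le\bar R$ for all $s\ge0$ if $A$ is unbounded (resp. $|y^r_x(t,\mu)|\le\bar R$ for all $t\ge 0$ if $A$ is compact), and $\int_0^1(\omega(s,\bar R+3)/s)\,ds<+\infty$. (CV): $A$ is compact and for each $x\in\mathbb{R}^n$ the set $\{(\lambda,\gamma)\in\mathbb{R}^{n+1}:\exists a\in A,\ \lambda=f(x,a),\ l(x,a)\le\gamma\}$ is convex. (CV)$'$: $A$ is unbounded and for each $x\in\mathbb{R}^n\setminus\mathcal{T}$ the set $\{(\lambda_0,\lambda,\gamma)\in\mathbb{R}^{1+n+1}:\exists(w_0,w)\in[0,1]\times(\overline{B(0,1)}\cap A),\ (\lambda_0,\lambda)=(w_0^q,\overline f(x,w_0,w)),\ \overline l(x,w_0,w)\le\gamma\}$ is convex. Hamiltonian. $H(x,p)=\max_{a\in A}\{-\langle f(x,a),p\rangle-l(x,a)\}$ if $A$ is compact;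 $H(x,p)=\max_{(w_0,w)\in S(A)}\{-\langle\overline f(x,w_0,w),p\rangle-\overline l(x,w_0,w)\}$ if $A$ is unbounded. Solutions are in the viscosity sense: a locally bounded $u$ is a subsolution in an open set if $H(x,D\varphi(x))\le0$ whenever $\varphi\in C^1$ and $u^*-\varphi$ has a local maximum at $x$; $u:\mathbb{R}^n\to\mathbb{R}\cup\{+\infty\}$ is a supersolution if at each $x$ either $u_*(x)=+\infty$, or $H(x,D\varphi(x))\ge0$ whenever $\varphi\in C^1$ and $u_*-\varphi$ has a local minimum at $x$. $\mathcal{S}$ is the set of pairs $(u,\Omega)$ with $\Omega\subset\mathbb{R}^n$ open and $u:\mathbb{R}^n\to\mathbb{R}_+\cup\{+\infty\}$ a supersolution of $H(x,Du)=0$ in $\mathbb{R}^n$, which is a locally bounded subsolution of $H(x,Du)=0$ in $\Omega$, and satisfies $\lim_{x\to\bar x}u(x)=+\infty$ for all $\bar x\in\partial\Omega$.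
   Formalization: Besides u≡0 on T, competitors u must satisfy lim u(x)=0 at every point of ∂T; without this uniqueness fails (A=[-1,1], f=a, l=|x|, T={0}: u=x²/2+c off 0, u(0)=0). The added condition is automatic for continuous u and for V. *)

theory Defs
  imports "HOL-Analysis.Analysis" "HOL-Probability.Probability"
begin

section \<open>Data\<close>

text \<open>
  A modulus is a function on \<open>[0,\<infinity>) \<times> [0,\<infinity>)\<close>; values at negative arguments are irrelevant.
\<close>

definition is_modulus :: "(real \<Rightarrow> real \<Rightarrow> real) \<Rightarrow> bool" where
  "is_modulus \<omega> \<longleftrightarrow>
     (\<forall>r\<ge>0. \<forall>R\<ge>0. 0 \<le> \<omega> r R) \<and>
     (\<forall>R>0. (\<exists>\<delta>>0. mono_on {0..\<delta>} (\<lambda>r. \<omega> r R)) \<and>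
            continuous (at 0 within {0..}) (\<lambda>r. \<omega> r R) \<and> \<omega> 0 R = 0) \<and>
     (\<forall>r\<ge>0. mono_on {0..} (\<lambda>R. \<omega> r R))"

definition structural_bounds ::
  "(real^'m) set \<Rightarrow> (real^'n \<Rightarrow> real^'m \<Rightarrow> real^'n) \<Rightarrow> (real^'n \<Rightarrow> real^'m \<Rightarrow> real) \<Rightarrow>
   nat \<Rightarrow> nat \<Rightarrow> (real \<Rightarrow> real) \<Rightarrow> (real \<Rightarrow> real) \<Rightarrow> (real \<Rightarrow> real \<Rightarrow> real) \<Rightarrow> bool" where
  "structural_bounds A f l p q L B \<omega> \<longleftrightarrow>
     is_modulus \<omega> \<and>
     (\<forall>R>0. L R > 0 \<and> B R > 0 \<and>
        (\<forall>a\<in>A. \<forall>x1 x2. norm x1 \<le> R \<and> norm x2 \<le> R \<longrightarrow>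
           norm (f x1 a - f x2 a) \<le> L R * (1 + norm a ^ p) * norm (x1 - x2) \<and>
           \<bar>l x1 a - l x2 a\<bar> \<le> (1 + norm a ^ q) * \<omega> (norm (x1 - x2)) R) \<and>
        (\<forall>a\<in>A. \<forall>x. norm x \<le> R \<longrightarrow> 0 \<le> l x a \<and> l x a \<le> B R * (1 + norm a ^ q)))"

definition recession ::
  "(real^'m) set \<Rightarrow> nat \<Rightarrow> (real^'n \<Rightarrow> real^'m \<Rightarrow> 'b::real_normed_vector) \<Rightarrow>
   (real^'n \<Rightarrow> real^'m \<Rightarrow> 'b) \<Rightarrow> bool" where
  "recession A q \<Phi> \<Phi>_inf \<longleftrightarrow>
     continuous_on (UNIV \<times> A) (\<lambda>(x, a). \<Phi>_inf x a) \<and>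
     (\<forall>K. compact K \<and> K \<subseteq> UNIV \<times> A \<longrightarrow>
        uniform_limit K (\<lambda>\<rho> (x, a). \<rho> ^ q *\<^sub>R \<Phi> x (a /\<^sub>R \<rho>)) (\<lambda>(x, a). \<Phi>_inf x a) (at_right 0))"

text \<open>
  The control set is nonempty in the compact case (otherwise there are no controls).
  A library \<^const>\<open>convex_cone\<close> is nonempty and closed under multiplication by all
  \<open>c \<ge> 0\<close>, so it contains the origin, and it is unbounded as soon as it is not \<open>{0}\<close>.
  The functions \<open>f_inf\<close>, \<open>l_inf\<close> are only relevant (and only constrained) for unbounded \<open>A\<close>.
\<close>

definition standing_assumptions ::
  "(real^'m) set \<Rightarrow> (real^'n \<Rightarrow> real^'m \<Rightarrow> real^'n) \<Rightarrow> (real^'n \<Rightarrow> real^'m \<Rightarrow> real) \<Rightarrow>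
   (real^'n \<Rightarrow> real^'m \<Rightarrow> real^'n) \<Rightarrow> (real^'n \<Rightarrow> real^'m \<Rightarrow> real) \<Rightarrow>
   nat \<Rightarrow> nat \<Rightarrow> (real \<Rightarrow> real \<Rightarrow> real) \<Rightarrow> bool" where
  "standing_assumptions A f l f_inf l_inf p q \<omega> \<longleftrightarrow>
     (compact A \<and> A \<noteq> {} \<or> closed A \<and> convex_cone A \<and> A \<noteq> {0} \<and> \<not> bounded A) \<and>
     continuous_on (UNIV \<times> A) (\<lambda>(x, a). f x a) \<and>
     continuous_on (UNIV \<times> A) (\<lambda>(x, a). l x a) \<and>
     1 \<le> p \<and> p \<le> q \<and>
     (\<exists>L B. structural_bounds A f l p q L B \<omega>) \<and>
     (\<exists>M>0. \<forall>x. \<forall>a\<in>A. norm (f x a) \<le> M * (1 + norm a ^ p) * (1 + norm x)) \<and>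
     (\<forall>R>0. \<exists>Lb>0. \<forall>r\<ge>0. \<omega> r R = Lb * r) \<and>
     (\<not> bounded A \<longrightarrow>
        (\<exists>C1\<ge>0. \<exists>C2>0. \<forall>x. \<forall>a\<in>A. l x a \<ge> C2 * norm a ^ q - C1) \<and>
        recession A q f f_inf \<and> recession A q l l_inf)"


section \<open>Trajectories, costs and values\<close>

text \<open>
  Caratheodory solutions on \<open>[0,\<infinity>)\<close> of \<open>y' = g (y, \<alpha>)\<close>, \<open>y 0 = x\<close>, in integral form. Under the
  standing assumptions there is exactly one solution on \<open>[0,\<infinity>)\<close> for every admissible control,
  so that \<open>trajectory\<close> is determined at all times \<open>t \<ge> 0\<close>; only those times are ever used.
\<close>

definition solves ::
  "('x \<Rightarrow> 'c \<Rightarrow> 'x::euclidean_space) \<Rightarrow> 'x \<Rightarrow> (real \<Rightarrow> 'c) \<Rightarrow> (real \<Rightarrow> 'x) \<Rightarrow> bool" where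
  "solves g x \<alpha> y \<longleftrightarrow>
     (\<forall>t\<ge>0. set_integrable lborel {0..t} (\<lambda>s. g (y s) (\<alpha> s)) \<and>
            y t = x + (LINT s:{0..t}|lborel. g (y s) (\<alpha> s)))"

definition trajectory ::
  "('x \<Rightarrow> 'c \<Rightarrow> 'x::euclidean_space) \<Rightarrow> 'x \<Rightarrow> (real \<Rightarrow> 'c) \<Rightarrow> real \<Rightarrow> 'x" where
  "trajectory g x \<alpha> = (SOME y. solves g x \<alpha> y)"

text \<open>The time interval \<open>I\<close> is \<open>{0..t}\<close>, or \<open>{0..}\<close> for the infinite horizon.\<close>

definition cost ::
  "('x \<Rightarrow> 'c \<Rightarrow> 'x::euclidean_space) \<Rightarrow> ('x \<Rightarrow> 'c \<Rightarrow> real) \<Rightarrow> real set \<Rightarrow> 'x \<Rightarrow> (real \<Rightarrow> 'c) \<Rightarrow> ereal"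
  where
  "cost g h I x \<alpha> =
     enn2ereal (\<integral>\<^sup>+ s\<in>I. ennreal (h (trajectory g x \<alpha> s) (\<alpha> s)) \<partial>lborel)"

definition controls :: "(real^'m) set \<Rightarrow> nat \<Rightarrow> (real \<Rightarrow> real^'m) set" where
  "controls A q =
     {\<alpha> \<in> restrict_space borel {0..} \<rightarrow>\<^sub>M restrict_space borel A.
        \<not> compact A \<longrightarrow> (\<forall>t\<ge>0. set_integrable lborel {0..t} (\<lambda>s. norm (\<alpha> s) ^ q))}"

definition value_upto ::
  "(real^'m) set \<Rightarrow> (real^'n \<Rightarrow> real^'m \<Rightarrow> real^'n) \<Rightarrow> (real^'n \<Rightarrow> real^'m \<Rightarrow> real) \<Rightarrow> nat \<Rightarrow>
   real \<Rightarrow> real^'n \<Rightarrow> ereal" where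
  "value_upto A f l q t x = (INF \<alpha>\<in>controls A q. cost f l {0..t} x \<alpha>)"

definition value_fun ::
  "(real^'m) set \<Rightarrow> (real^'n \<Rightarrow> real^'m \<Rightarrow> real^'n) \<Rightarrow> (real^'n \<Rightarrow> real^'m \<Rightarrow> real) \<Rightarrow> nat \<Rightarrow>
   real^'n \<Rightarrow> ereal" where
  "value_fun A f l q x = (INF \<alpha>\<in>controls A q. cost f l {0..} x \<alpha>)"

definition value_sup ::
  "(real^'m) set \<Rightarrow> (real^'n \<Rightarrow> real^'m \<Rightarrow> real^'n) \<Rightarrow> (real^'n \<Rightarrow> real^'m \<Rightarrow> real) \<Rightarrow> nat \<Rightarrow>
   real^'n \<Rightarrow> ereal" where
  "value_sup A f l q x = (SUP t\<in>{0<..}. value_upto A f l q t x)"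


subsection \<open>Extended problem\<close>

definition ext_fun ::
  "nat \<Rightarrow> (real^'n \<Rightarrow> real^'m \<Rightarrow> 'b::real_vector) \<Rightarrow> (real^'n \<Rightarrow> real^'m \<Rightarrow> 'b) \<Rightarrow>
   real^'n \<Rightarrow> real \<times> (real^'m) \<Rightarrow> 'b" where
  "ext_fun q \<Phi> \<Phi>_inf x = (\<lambda>(w0, w). if w0 \<noteq> 0 then w0 ^ q *\<^sub>R \<Phi> x (w /\<^sub>R w0) else \<Phi>_inf x w)"

definition ext_set :: "(real^'m) set \<Rightarrow> nat \<Rightarrow> (real \<times> (real^'m)) set" where
  "ext_set A q = {(w0, w). 0 \<le> w0 \<and> w \<in> A \<and> w0 ^ q + norm w ^ q = 1}"

definition ext_controls :: "(real^'m) set \<Rightarrow> nat \<Rightarrow> (real \<Rightarrow> real \<times> (real^'m)) set" where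
  "ext_controls A q = restrict_space borel {0..} \<rightarrow>\<^sub>M restrict_space borel (ext_set A q)"

definition ext_value ::
  "(real^'m) set \<Rightarrow> (real^'n \<Rightarrow> real^'m \<Rightarrow> real^'n) \<Rightarrow> (real^'n \<Rightarrow> real^'m \<Rightarrow> real) \<Rightarrow>
   (real^'n \<Rightarrow> real^'m \<Rightarrow> real^'n) \<Rightarrow> (real^'n \<Rightarrow> real^'m \<Rightarrow> real) \<Rightarrow> nat \<Rightarrow> real^'n \<Rightarrow> ereal" where
  "ext_value A f l f_inf l_inf q x =
     (INF w\<in>ext_controls A q. cost (ext_fun q f f_inf) (ext_fun q l l_inf) {0..} x w)"


subsection \<open>Relaxed problem\<close>

text \<open>
  On a compact subset \<open>K\<close> of \<open>\<real>\<^sup>m\<close> every Borel probability measure is Radon. Relaxed controls are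
  the functions \<open>[0,\<infinity>) \<rightarrow> P(K)\<close> that are Borel measurable with respect to the weak-star
  topology; essential boundedness is automatic, and every class in \<open>L\<^sup>\<infinity>([0,\<infinity>), P(K))\<close> has such a
  representative since \<open>P(K)\<close> is compact and metrizable.
\<close>

definition prob_measures :: "(real^'m) set \<Rightarrow> (real^'m) measure set" where
  "prob_measures K = {\<mu>. sets \<mu> = sets (restrict_space borel K) \<and> prob_space \<mu>}"

definition weak_star :: "(real^'m) set \<Rightarrow> (real^'m) measure topology" where
  "weak_star K = topology_generated_by
     {{\<mu> \<in> prob_measures K. (\<integral>a. \<phi> a \<partial>\<mu>) \<in> U} | (\<phi> :: real^'m \<Rightarrow> real) U.
        continuous_on K \<phi> \<and> open U}"

definition relaxed_controls :: "(real^'m) set \<Rightarrow> (real \<Rightarrow> (real^'m) measure) set" where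
  "relaxed_controls K =
     restrict_space borel {0..} \<rightarrow>\<^sub>M sigma (prob_measures K) {U. openin (weak_star K) U}"

definition relax ::
  "(real^'n \<Rightarrow> real^'m \<Rightarrow> 'b::{banach, second_countable_topology}) \<Rightarrow>
   real^'n \<Rightarrow> (real^'m) measure \<Rightarrow> 'b" where
  "relax \<psi> x \<mu> = (\<integral>a. \<psi> x a \<partial>\<mu>)"

definition relaxed_base :: "(real^'m) set \<Rightarrow> (real^'m) set" where
  "relaxed_base A = (if compact A then A else cball 0 1 \<inter> A)"

definition relaxed_fun ::
  "(real^'m) set \<Rightarrow> nat \<Rightarrow> (real^'n \<Rightarrow> real^'m \<Rightarrow> 'b) \<Rightarrow> (real^'n \<Rightarrow> real^'m \<Rightarrow> 'b) \<Rightarrow>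
   real^'n \<Rightarrow> (real^'m) measure \<Rightarrow> 'b::{banach, second_countable_topology}" where
  "relaxed_fun A q \<Phi> \<Phi>_inf =
     (if compact A then relax \<Phi>
      else relax (\<lambda>x w. ext_fun q \<Phi> \<Phi>_inf x (root q (1 - norm w ^ q), w)))"

definition relaxed_value ::
  "(real^'m) set \<Rightarrow> (real^'n \<Rightarrow> real^'m \<Rightarrow> real^'n) \<Rightarrow> (real^'n \<Rightarrow> real^'m \<Rightarrow> real) \<Rightarrow>
   (real^'n \<Rightarrow> real^'m \<Rightarrow> real^'n) \<Rightarrow> (real^'n \<Rightarrow> real^'m \<Rightarrow> real) \<Rightarrow> nat \<Rightarrow> real^'n \<Rightarrow> ereal" where
  "relaxed_value A f l f_inf l_inf q x =
     (INF \<mu>\<in>relaxed_controls (relaxed_base A).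
        cost (relaxed_fun A q f f_inf) (relaxed_fun A q l l_inf) {0..} x \<mu>)"


section \<open>Conditions\<close>

definition Dom :: "('x \<Rightarrow> ereal) \<Rightarrow> 'x set" where
  "Dom u = {x. u x < \<infinity>}"

text \<open>\<open>H0_1\<close>: the structural bounds hold with some constants and some modulus not depending on \<open>R\<close>.\<close>

definition H0_1 ::
  "(real^'m) set \<Rightarrow> (real^'n \<Rightarrow> real^'m \<Rightarrow> real^'n) \<Rightarrow> (real^'n \<Rightarrow> real^'m \<Rightarrow> real) \<Rightarrow>
   nat \<Rightarrow> nat \<Rightarrow> bool" where
  "H0_1 A f l p q \<longleftrightarrow>
     (\<exists>L0 B0 \<omega>0. structural_bounds A f l p q (\<lambda>_. L0) (\<lambda>_. B0) (\<lambda>r _. \<omega>0 r) \<and>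
        set_integrable lebesgue {0..1} (\<lambda>s. \<omega>0 s / s)) \<and>
     (\<exists>M>0. \<forall>x. \<forall>a\<in>A. norm (f x a) \<le> M * (1 + norm a ^ p))"

definition H0_2 ::
  "(real^'m) set \<Rightarrow> (real^'n \<Rightarrow> real^'m \<Rightarrow> real^'n) \<Rightarrow> (real^'n \<Rightarrow> real^'m \<Rightarrow> real) \<Rightarrow>
   (real^'n \<Rightarrow> real^'m \<Rightarrow> real^'n) \<Rightarrow> (real^'n \<Rightarrow> real^'m \<Rightarrow> real) \<Rightarrow> nat \<Rightarrow>
   (real \<Rightarrow> real \<Rightarrow> real) \<Rightarrow> bool" where
  "H0_2 A f l f_inf l_inf q \<omega> \<longleftrightarrow>
     (\<forall>x. relaxed_value A f l f_inf l_inf q x < \<infinity> \<longrightarrow>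
        (\<exists>\<mu>\<in>relaxed_controls (relaxed_base A). \<exists>R>0.
           cost (relaxed_fun A q f f_inf) (relaxed_fun A q l l_inf) {0..} x \<mu>
             = relaxed_value A f l f_inf l_inf q x \<and>
           (\<forall>s\<ge>0. norm (trajectory (relaxed_fun A q f f_inf) x \<mu> s) \<le> R) \<and>
           set_integrable lebesgue {0..1} (\<lambda>s. \<omega> s (R + 3) / s)))"

definition H2 ::
  "(real^'m) set \<Rightarrow> (real^'n \<Rightarrow> real^'m \<Rightarrow> real^'n) \<Rightarrow> (real^'n \<Rightarrow> real^'m \<Rightarrow> real) \<Rightarrow> nat \<Rightarrow>
   (real^'n) set \<Rightarrow> bool" where
  "H2 A f l q T \<longleftrightarrow>
     T \<noteq> {} \<and> closed T \<and> compact (frontier T) \<and>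
     (\<forall>x\<in>T. value_fun A f l q x = 0) \<and>
     (\<forall>x\<in>frontier T. (value_fun A f l q \<longlongrightarrow> 0) (at x))"

definition H3 ::
  "(real^'m) set \<Rightarrow> (real^'n \<Rightarrow> real^'m \<Rightarrow> real^'n) \<Rightarrow> (real^'n \<Rightarrow> real^'m \<Rightarrow> real) \<Rightarrow>
   (real^'n \<Rightarrow> real^'m \<Rightarrow> real^'n) \<Rightarrow> (real^'n \<Rightarrow> real^'m \<Rightarrow> real) \<Rightarrow> nat \<Rightarrow>
   (real^'n) set \<Rightarrow> bool" where
  "H3 A f l f_inf l_inf q T \<longleftrightarrow>
     (if compact A then
        \<forall>x. value_fun A f l q x < \<infinity> \<longrightarrow>
          (\<exists>\<epsilon>>0. \<forall>\<alpha>\<in>controls A q.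
             cost f l {0..} x \<alpha> \<le> value_fun A f l q x + ereal \<epsilon> \<longrightarrow>
             Liminf at_top (\<lambda>t. ereal (infdist (trajectory f x \<alpha> t) T)) = 0)
      else
        \<forall>x. ext_value A f l f_inf l_inf q x < \<infinity> \<longrightarrow>
          (\<exists>\<epsilon>>0. \<forall>w\<in>ext_controls A q.
             cost (ext_fun q f f_inf) (ext_fun q l l_inf) {0..} x w
               \<le> ext_value A f l f_inf l_inf q x + ereal \<epsilon> \<longrightarrow>
             Liminf at_top (\<lambda>s. ereal (infdist (trajectory (ext_fun q f f_inf) x w s) T)) = 0))"

definition CV ::
  "(real^'m) set \<Rightarrow> (real^'n \<Rightarrow> real^'m \<Rightarrow> real^'n) \<Rightarrow> (real^'n \<Rightarrow> real^'m \<Rightarrow> real) \<Rightarrow> bool" where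
  "CV A f l \<longleftrightarrow>
     compact A \<and> (\<forall>x. convex {(v, \<gamma>). \<exists>a\<in>A. v = f x a \<and> l x a \<le> \<gamma>})"

definition CV' ::
  "(real^'m) set \<Rightarrow> (real^'n \<Rightarrow> real^'m \<Rightarrow> real^'n) \<Rightarrow> (real^'n \<Rightarrow> real^'m \<Rightarrow> real) \<Rightarrow>
   (real^'n \<Rightarrow> real^'m \<Rightarrow> real^'n) \<Rightarrow> (real^'n \<Rightarrow> real^'m \<Rightarrow> real) \<Rightarrow> nat \<Rightarrow>
   (real^'n) set \<Rightarrow> bool" where
  "CV' A f l f_inf l_inf q T \<longleftrightarrow>
     \<not> bounded A \<and>
     (\<forall>x. x \<notin> T \<longrightarrow>
        convex {(v0, v, \<gamma>). \<exists>w0\<in>{0..1}. \<exists>w\<in>cball 0 1 \<inter> A.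
          v0 = w0 ^ q \<and> v = ext_fun q f f_inf x (w0, w) \<and> ext_fun q l l_inf x (w0, w) \<le> \<gamma>})"


section \<open>Hamiltonian and viscosity solutions\<close>

text \<open>Under the standing assumptions both suprema are maxima of continuous functions on compacta.\<close>

definition hamiltonian ::
  "(real^'m) set \<Rightarrow> (real^'n \<Rightarrow> real^'m \<Rightarrow> real^'n) \<Rightarrow> (real^'n \<Rightarrow> real^'m \<Rightarrow> real) \<Rightarrow>
   (real^'n \<Rightarrow> real^'m \<Rightarrow> real^'n) \<Rightarrow> (real^'n \<Rightarrow> real^'m \<Rightarrow> real) \<Rightarrow> nat \<Rightarrow>
   real^'n \<Rightarrow> real^'n \<Rightarrow> real" where
  "hamiltonian A f l f_inf l_inf q x p =
     (if compact A then SUP a\<in>A. - (f x a \<bullet> p) - l x a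
      else SUP w\<in>ext_set A q. - (ext_fun q f f_inf x w \<bullet> p) - ext_fun q l l_inf x w)"

definition lsc_env :: "('x::topological_space \<Rightarrow> ereal) \<Rightarrow> 'x \<Rightarrow> ereal" where
  "lsc_env u x = Liminf (nhds x) u"

definition usc_env :: "('x::topological_space \<Rightarrow> ereal) \<Rightarrow> 'x \<Rightarrow> ereal" where
  "usc_env u x = Limsup (nhds x) u"

definition C1_on :: "('x::real_inner) set \<Rightarrow> ('x \<Rightarrow> real) \<Rightarrow> ('x \<Rightarrow> 'x) \<Rightarrow> bool" where
  "C1_on \<Omega> \<phi> D \<longleftrightarrow> (\<forall>z\<in>\<Omega>. GDERIV \<phi> z :> D z) \<and> continuous_on \<Omega> D"

definition locally_bounded_on :: "('x::topological_space) set \<Rightarrow> ('x \<Rightarrow> ereal) \<Rightarrow> bool" where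
  "locally_bounded_on \<Omega> u \<longleftrightarrow> (\<forall>x\<in>\<Omega>. \<exists>B::real. \<forall>\<^sub>F z in nhds x. \<bar>u z\<bar> \<le> ereal B)"

definition viscosity_subsolution ::
  "('x::real_inner \<Rightarrow> 'x \<Rightarrow> real) \<Rightarrow> 'x set \<Rightarrow> ('x \<Rightarrow> ereal) \<Rightarrow> bool" where
  "viscosity_subsolution H \<Omega> u \<longleftrightarrow>
     locally_bounded_on \<Omega> u \<and>
     (\<forall>x\<in>\<Omega>. \<forall>\<phi> D. C1_on \<Omega> \<phi> D \<and>
        (\<forall>\<^sub>F z in nhds x. usc_env u z - ereal (\<phi> z) \<le> usc_env u x - ereal (\<phi> x)) \<longrightarrow>
        H x (D x) \<le> 0)"

definition viscosity_supersolution ::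
  "('x::real_inner \<Rightarrow> 'x \<Rightarrow> real) \<Rightarrow> ('x \<Rightarrow> ereal) \<Rightarrow> bool" where
  "viscosity_supersolution H u \<longleftrightarrow>
     (\<forall>x. lsc_env u x = \<infinity> \<or>
        (\<forall>\<phi> D. C1_on UNIV \<phi> D \<and>
           (\<forall>\<^sub>F z in nhds x. lsc_env u x - ereal (\<phi> x) \<le> lsc_env u z - ereal (\<phi> z)) \<longrightarrow>
           H x (D x) \<ge> 0))"

definition solution_pairs ::
  "('x::real_inner \<Rightarrow> 'x \<Rightarrow> real) \<Rightarrow> (('x \<Rightarrow> ereal) \<times> 'x set) set" where
  "solution_pairs H =
     {(u, \<Omega>). open \<Omega> \<and> (\<forall>x. 0 \<le> u x) \<and> viscosity_supersolution H u \<and>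
        viscosity_subsolution H \<Omega> u \<and> (\<forall>x\<in>frontier \<Omega>. (u \<longlongrightarrow> \<infinity>) (at x))}"

text \<open>
  The boundary condition \<open>u = 0\<close> on \<open>T\<close> for a possibly discontinuous viscosity solution is imposed
  on both semicontinuous envelopes, i.e. \<open>u\<close> vanishes on \<open>T\<close> and tends to \<open>0\<close> at the points of the
  frontier of \<open>T\<close>. Prescribing only the pointwise values of \<open>u\<close> on \<open>T\<close> would not determine the
  solution: for \<open>n = m = 1\<close>, \<open>A = [-1,1]\<close>, \<open>f(x,a) = a\<close>, \<open>l(x,a) = \<bar>x\<bar>\<close>, \<open>T = {0}\<close> the value function
  is \<open>x\<^sup>2/2\<close>, but for every \<open>c > 0\<close> the function equal to \<open>x\<^sup>2/2 + c\<close> off \<open>0\<close> and to \<open>0\<close> at \<open>0\<close> is also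
  a supersolution on \<open>\<real>\<close> and a locally bounded subsolution on \<open>\<real>\<close>.
\<close>

definition target_solution_pairs ::
  "('x::real_inner \<Rightarrow> 'x \<Rightarrow> real) \<Rightarrow> 'x set \<Rightarrow> (('x \<Rightarrow> ereal) \<times> 'x set) set" where
  "target_solution_pairs H T =
     {(u, \<Omega>) \<in> solution_pairs H. T \<subseteq> \<Omega> \<and> (\<forall>x\<in>T. u x = 0) \<and>
        (\<forall>x\<in>frontier T. (u \<longlongrightarrow> 0) (at x))}"

end

theory Submission
  imports Defs "HOL-Library.Diagonal_Subsequence"
begin

text \<open>
  A supersolution \<open>u \<ge> 0\<close> satisfies \<open>\<Sigma> \<le> u\<^sub>*\<close>: minimizing \<open>u\<^sub>*(z) + c(t) \<bar>z - y(t)\<bar>\<^sup>2\<close> along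
  a trajectory \<open>y\<close> that is built step by step from constant controls, with \<open>c\<close> large and decaying like
  \<open>exp (- 2 L t)\<close>, the penalty absorbs the Lipschitz error of each step. Dually, along every trajectory
  inside \<open>\<Omega>\<close> a subsolution grows at most by the running cost. Following a near-optimal trajectory to the
  target, these two facts give uniqueness as soon as \<open>V \<le> \<Sigma>\<close>.

  To prove \<open>V \<le> \<Sigma>\<close>, let trajectories with bounded costs over the horizons \<open>n\<close> converge. If \<open>V\<close> is lower
  semicontinuous, then controls from far out in the sequence are concatenated on unit intervals; solving
  backward in time, with tolerances that shrink fast enough, yields a trajectory from a point close to \<open>x\<close> that
  stays close to the limit forever. Under the convexity hypothesis, forward convex combinations of velocity
  and cost converge almost everywhere (as in Komlos' theorem), and a measurable selection realizes
  the limit by a control.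

  For unbounded \<open>A\<close>, the time change with speed \<open>1 + \<bar>\<alpha>\<bar>\<^sup>q\<close> embeds the original controls into the
  extended system, which has compact control set \<open>{w \<in> A. \<bar>w\<bar> \<le> 1}\<close>. Conversely, an extended control
  whose time component is positive and has infinite integral comes from an original one. This can be arranged at
  small cost, because the original problem is cheap near the target.
\<close>

section \<open>Trajectories\<close>

text \<open>Once a control is inserted, an ordinary, relaxed, extended or time-reversed system is
  just a time-dependent field, measurable in time and locally Lipschitz in the state
  (\<open>adm\<close>). The supersolution property is proved for such fields, so it covers
  \<open>V\<close> and \<open>Vrel\<close> alike. As \<open>Sig\<close> lies below every nonnegative
  supersolution, Sig \<le> Vrel \<le> V always holds, and everything hinges on V \<le> Sig.

  Half of the continuity of \<open>V\<close> comes from the target: a control that steers x near T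
  does almost the same from nearby points, and the rest is cheap, so \<open>V\<close> is upper
  semicontinuous. The alternatives (continuity on the domain, or convexity) are there for lower
  semicontinuity.

  In the uniqueness proof a subsolution is controlled only inside its own set \<Omega>, which is not
  known to contain the near-optimal trajectory. The trajectory is therefore read from its end: after
  its last time outside \<Omega> the subsolution stays bounded along it, which contradicts the
  blow-up at the frontier.\<close>

lemmas HK_integrable_diff = Henstock_Kurzweil_Integration.integrable_diff
lemmas HK_integral_diff = Henstock_Kurzweil_Integration.integral_diff
lemmas HK_integral_cong = Henstock_Kurzweil_Integration.integral_cong

lemma set_integrable_imp_HK:
 fixes g :: "real \<Rightarrow> 'x::euclidean_space"
 assumes "set_integrable lborel {a..b} g"
 shows "g integrable_on {a..b}" "(LINT s:{a..b}|lborel. g s) = integral {a..b} g"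
 using set_borel_integral_eq_integral[OF assms] by auto

lemma bounded_set_integrable:
 fixes g :: "real \<Rightarrow> 'x::euclidean_space"
 assumes "set_borel_measurable borel {a..b} g" "\<And>s. s \<in> {a..b} ==> norm (g s) \<le> B"
 shows "set_integrable lborel {a..b} g"
proof -
 have "set_integrable lborel {a..b} (\<lambda>_. B)"
  by (intro borel_integrable_atLeastAtMost' continuous_intros)
 moreover have "(\<lambda>s. indicator {a..b} s *\<^sub>R g s) \<in> borel_measurable lborel"
  using assms(1) by (simp add: set_borel_measurable_def)
 ultimately show ?thesis unfolding set_integrable_def
  by (rule Bochner_Integration.integrable_bound) (auto intro!: AE_I2 split: split_indicator intro: order_trans[OF assms(2)])
qed

lemma set_borel_measurable_sub:
 fixes g :: "'a::topological_space \<Rightarrow> 'b::{second_countable_topology, real_normed_vector}"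
 assumes "set_borel_measurable borel S g" "T \<subseteq> S" "T \<in> sets borel"
 shows "set_borel_measurable borel T g"
proof -
 have "(\<lambda>x. indicator T x *\<^sub>R g x) = (\<lambda>x. indicator T x *\<^sub>R (indicator S x *\<^sub>R g x))"
  by (rule ext) (use assms(2) in \<open>auto split: split_indicator\<close>)
 moreover have "(\<lambda>x. indicator T x *\<^sub>R (indicator S x *\<^sub>R g x)) \<in> borel_measurable borel"
  by (rule borel_measurable_scaleR[OF borel_measurable_indicator[OF assms(3)]
     assms(1)[unfolded set_borel_measurable_def]])
 ultimately show ?thesis by (simp only: set_borel_measurable_def)
qed

lemma integral_exp:
 assumes "k \<noteq> 0" "0 \<le> t"
 shows "((\<lambda>s. exp (k * s)) has_integral (exp (k * t) - 1) / k) {0..t::real}"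
proof -
 have "((\<lambda>s. exp (k * s)) has_integral (exp (k*t)/k - exp (k*0)/k)) {0..t}" using assms
  by (intro fundamental_theorem_of_calculus)
    (auto intro!: derivative_eq_intros simp: has_real_derivative_iff_has_vector_derivative[symmetric])
 then show ?thesis by (simp add: diff_divide_distrib)
qed

text \<open>Not the sharp constant, but the maximum of \<open>u t * exp (-2 L t)\<close> absorbs itself without
  any differentiation.\<close>

lemma gronwall_weak:
 fixes u :: "real \<Rightarrow> real"
 assumes cont: "continuous_on {0..S} u" and "0 \<le> L" "0 \<le> C"
  and le: "\<And>t. t \<in> {0..S} ==> u t \<le> C + L * integral {0..t} u"
  and t: "t \<in> {0..S}"
 shows "u t \<le> 2 * C * exp (2 * L * t)"
proof (cases "L = 0")
 case True
 then show ?thesis using le[OF t] \<open>0 \<le> C\<close> by simp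
next
 case False
 then have L: "0 < L" using assms by simp
 let ?v = "\<lambda>t. exp (-(2 * L * t)) * u t"
 have "continuous_on {0..S} ?v" using cont by (intro continuous_intros)
 moreover have "compact {0..S}" "{0..S} \<noteq> {}" using t by auto
 ultimately obtain t0 where t0: "t0 \<in> {0..S}" "\<And>s. s \<in> {0..S} ==> ?v s \<le> ?v t0"
  using continuous_attains_sup[of "{0..S}" ?v] by blast
 define m where "m = ?v t0"
 have um: "u s \<le> m * exp (2 * L * s)" if "s \<in> {0..S}" for s
 proof -
  have "u s = exp (2 * L * s) * ?v s" by (simp add: exp_minus field_simps)
  also have "\<dots> \<le> exp (2 * L * s) * m" using t0(2)[OF that] unfolding m_def by (intro mult_left_mono) auto
  finally show ?thesis by (simp add: mult.commute)
 qed
 have m2: "m \<le> 2 * C"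
 proof (cases "m \<le> 0")
  case True then show ?thesis using \<open>0 \<le> C\<close> by linarith
 next
  case False
  have E: "((\<lambda>s. m * exp ((2 * L) * s)) has_integral m * ((exp ((2 * L) * t0) - 1)/(2 * L))) {0..t0}"
   using integral_exp[of "2*L" t0] L t0(1) by (intro has_integral_mult_right) auto
  have "u integrable_on {0..t0}"
   by (rule integrable_continuous_interval, rule continuous_on_subset[OF cont]) (use t0 in auto)
  then have "integral {0..t0} u \<le> integral {0..t0} (\<lambda>s. m * exp ((2 * L) * s))"
   using E um t0(1) by (intro integral_le) (auto simp: has_integral_integrable)
  also have "\<dots> = m * ((exp ((2 * L) * t0) - 1)/(2 * L))" using E by (rule integral_unique)
  finally have I: "L * integral {0..t0} u \<le> L * (m * ((exp ((2 * L) * t0) - 1)/(2 * L)))"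
   using L by (intro mult_left_mono) auto
  also have "\<dots> = m / 2 * (exp (2 * L * t0) - 1)" using L by simp
  \<comment> \<open>The weight 2L instead of L halves the integral term, so that it can be absorbed:
    m \<le> C + m/2.\<close>
  finally have "u t0 \<le> C + m/2 * (exp (2 * L * t0) - 1)" using le[OF t0(1)] by linarith
  then have "m \<le> exp (-(2 * L * t0)) * (C + m/2 * (exp (2 * L * t0) - 1))"
   unfolding m_def by (intro mult_left_mono) auto
  also have "\<dots> = exp (-(2 * L * t0)) * C + m/2 * (1 - exp (-(2 * L * t0)))"
   by (simp add: exp_minus field_simps)
  also have "\<dots> \<le> 1 * C + m/2 * 1"
   using False L t0(1) \<open>0 \<le> C\<close> by (intro add_mono mult_right_mono mult_left_mono) auto
  finally show ?thesis by simp
 qed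
 have "u t \<le> m * exp (2 * L * t)" using um[OF t] .
 also have "\<dots> \<le> 2 * C * exp (2 * L * t)" using m2 by (intro mult_right_mono) auto
 finally show ?thesis .
qed

text \<open>A Caratheodory field with constants that depend on a radius but not on time. The target
  type differs from the state type so that running costs are covered as well. Measurability is asked
  only for a frozen state; along curves it is derived.\<close>

definition lfield :: "(real \<Rightarrow> real) \<Rightarrow> (real \<Rightarrow> real) \<Rightarrow>
  (real \<Rightarrow> 'x::euclidean_space \<Rightarrow> 'y::euclidean_space) \<Rightarrow> bool" where
 "lfield B L F \<longleftrightarrow>
   (\<forall>x. set_borel_measurable borel {0..} (\<lambda>t. F t x)) \<and> (\<forall>R. 0 \<le> L R) \<and>
   (\<forall>R t x. 0 \<le> t \<longrightarrow> norm x \<le> R \<longrightarrow> norm (F t x) \<le> B R) \<and>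
   (\<forall>R t x y. 0 \<le> t \<longrightarrow> norm x \<le> R \<longrightarrow> norm y \<le> R \<longrightarrow> norm (F t x - F t y) \<le> L R * norm (x - y))"

definition lin_growth :: "real \<Rightarrow> (real \<Rightarrow> 'x::euclidean_space \<Rightarrow> 'x) \<Rightarrow> bool" where
 "lin_growth M F \<longleftrightarrow> 0 \<le> M \<and> (\<forall>t\<ge>0. \<forall>x. norm (F t x) \<le> M * (1 + norm x))"

section \<open>Fields along continuous curves\<close>

lemma lfieldD:
 assumes "lfield B L F"
 shows "set_borel_measurable borel {0..} (\<lambda>t. F t x)" "0 \<le> L R"
  "0 \<le> t ==> norm x \<le> R ==> norm (F t x) \<le> B R"
  "0 \<le> t ==> norm x \<le> R ==> norm y \<le> R ==> norm (F t x - F t y) \<le> L R * norm (x - y)"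
 using assms unfolding lfield_def by auto

text \<open>Simple functions approximate the curve. Along each of them the field is a countable
  patchwork of slices with frozen state, hence measurable, and the Lipschitz bound carries
  measurability to the limit.\<close>

lemma lfield_measurable_comp:
 fixes y :: "real \<Rightarrow> 'x::euclidean_space" and F :: "real \<Rightarrow> 'x \<Rightarrow> 'y::euclidean_space"
 assumes F: "lfield B L F" and y: "continuous_on {a..b} y" and "0 \<le> a"
 shows "set_borel_measurable borel {a..b} (\<lambda>t. F t (y t))"
proof -
 have "bounded (y ` {a..b})" by (intro compact_imp_bounded compact_continuous_image y) auto
 then obtain R where R: "\<And>t. t \<in> {a..b} ==> norm (y t) \<le> R" unfolding bounded_iff by blast
 show ?thesis
 proof (cases "a \<le> b")
  case False
  then show ?thesis by (simp add: set_borel_measurable_def)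
 next
  case ab: True
  \<comment> \<open>Clamping the time extends the curve continuously to the whole line, where the
    approximation by simple functions is available.\<close>
  let ?c = "\<lambda>t. max a (min b t)"
  have "(\<lambda>t. y (?c t)) \<in> borel_measurable borel"
   by (intro borel_measurable_continuous_onI continuous_on_compose2[OF y]) (use ab in \<open>auto intro!: continuous_intros\<close>)
  from borel_measurable_implies_sequence_metric[OF this, of 0]
  obtain g where g: "\<And>n. simple_function borel (g n)" "\<And>t. (\<lambda>n. g n t) \<longlonglongrightarrow> y (?c t)"
   "\<And>n t. dist (g n t) 0 \<le> 2 * dist (y (?c t)) 0" by auto
  \<comment> \<open>The approximants are only bounded by twice the norm of the limit; hence the
    radius 2R in the Lipschitz constant below.\<close>
  have gR: "norm (g n t) \<le> 2 * R" for n t using g(3)[of n t] R[of "?c t"] ab by simp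
  have meas: "(\<lambda>t. indicator {a..b} t *\<^sub>R F t (g n t)) \<in> borel_measurable borel" for n
  proof (rule measurable_compose_countable'[where I = "range (g n)"])
   show "(\<lambda>t. indicator {a..b} t *\<^sub>R F t z) \<in> borel_measurable borel" for z
    using set_borel_measurable_sub[OF lfieldD(1)[OF F], of "{a..b}"] \<open>0 \<le> a\<close>
    by (auto simp: set_borel_measurable_def)
   show "g n \<in> borel \<rightarrow>\<^sub>M count_space (range (g n))" "countable (range (g n))"
    using g(1)[of n] by (auto simp: simple_function_def measurable_count_space_eq2 countable_finite)
  qed
  have lim: "(\<lambda>n. indicator {a..b} t *\<^sub>R F t (g n t)) \<longlonglongrightarrow> indicator {a..b} t *\<^sub>R F t (y t)" for t
  proof (cases "t \<in> {a..b}")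
   case True
   have "(\<lambda>n. norm (g n t - y t)) \<longlonglongrightarrow> 0"
    using g(2)[of t] True by (auto intro: tendsto_norm_zero LIM_zero)
   then have z: "(\<lambda>n. L (2 * R) * norm (g n t - y t)) \<longlonglongrightarrow> 0" by (rule tendsto_mult_right_zero)
   have "norm (y t) \<le> 2 * R" using R[OF True] norm_ge_zero[of "y t"] by linarith
   then have "(\<lambda>n. F t (g n t) - F t (y t)) \<longlonglongrightarrow> 0" by (intro Lim_null_comparison[OF _ z])
      (use True gR \<open>0 \<le> a\<close> in \<open>auto intro!: always_eventually lfieldD(4)[OF F]\<close>)
   then show ?thesis using True by (simp add: LIM_zero_iff)
  qed simp
  show ?thesis
   unfolding set_borel_measurable_def by (rule borel_measurable_LIMSEQ_metric[OF meas lim])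
 qed
qed

lemma lfield_integrable_comp:
 fixes y :: "real \<Rightarrow> 'x::euclidean_space" and F :: "real \<Rightarrow> 'x \<Rightarrow> 'y::euclidean_space"
 assumes F: "lfield B L F" and y: "continuous_on {a..b} y" and "0 \<le> a"
 shows "set_integrable lborel {a..b} (\<lambda>t. F t (y t))"
proof -
 have "bounded (y ` {a..b})" by (intro compact_imp_bounded compact_continuous_image y) auto
 then obtain R where R: "\<And>t. t \<in> {a..b} ==> norm (y t) \<le> R" unfolding bounded_iff by blast
 show ?thesis by (rule bounded_set_integrable[OF lfield_measurable_comp[OF assms], of "B R"])
    (use R \<open>0 \<le> a\<close> in \<open>auto intro!: lfieldD(3)[OF F]\<close>)
qed

text \<open>Integrability is Lebesgue's, as in \<open>solves\<close>, while the value is written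
  with the gauge integral, whose interval calculus is used throughout;
  \<open>set_integrable_imp_HK\<close> identifies the two. For negative \<open>S\<close> the
  condition is empty.\<close>

definition solon :: "real \<Rightarrow> (real \<Rightarrow> 'x \<Rightarrow> 'x::euclidean_space) \<Rightarrow> 'x \<Rightarrow> (real \<Rightarrow> 'x) \<Rightarrow> bool" where
 "solon S F x y \<longleftrightarrow> (\<forall>t\<in>{0..S}. set_integrable lborel {0..t} (\<lambda>s. F s (y s)) \<and>
   y t = x + integral {0..t} (\<lambda>s. F s (y s)))"

definition sol :: "(real \<Rightarrow> 'x \<Rightarrow> 'x::euclidean_space) \<Rightarrow> 'x \<Rightarrow> (real \<Rightarrow> 'x) \<Rightarrow> bool" where
 "sol F x y \<longleftrightarrow> (\<forall>S. solon S F x y)"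

lemma solves_eq_sol: "solves g x \<alpha> y \<longleftrightarrow> sol (\<lambda>s z. g z (\<alpha> s)) x y"
proof -
 have "solves g x \<alpha> y \<longleftrightarrow> (\<forall>t\<ge>0. set_integrable lborel {0..t} (\<lambda>s. g (y s) (\<alpha> s)) \<and>
   y t = x + integral {0..t} (\<lambda>s. g (y s) (\<alpha> s)))"
  unfolding solves_def by (intro all_cong conj_cong refl) (simp only: set_integrable_imp_HK(2))
 also have "\<dots> \<longleftrightarrow> sol (\<lambda>s z. g z (\<alpha> s)) x y"
  unfolding sol_def solon_def by (meson atLeastAtMost_iff order_refl)
 finally show ?thesis .
qed

section \<open>Integral solutions: a priori bounds, perturbation, uniqueness\<close>

lemma solonD:
 assumes "solon S F x y" "0 \<le> t" "t \<le> S"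
 shows "set_integrable lborel {0..t} (\<lambda>s. F s (y s))" "y t = x + integral {0..t} (\<lambda>s. F s (y s))"
 using assms unfolding solon_def by auto

lemma solon_mono: "solon S F x y ==> S' \<le> S ==> solon S' F x y" unfolding solon_def by auto

lemma solon_0: "solon S F x y ==> 0 \<le> S ==> y 0 = x" by (drule solonD(2)[of _ _ _ _ 0]) auto

lemma solon_continuous:
 assumes "solon S F x y"
 shows "continuous_on {0..S} y"
proof (cases "0 \<le> S")
 case True
 then have "(\<lambda>s. F s (y s)) integrable_on {0..S}"
  using solonD(1)[OF assms, of S] set_integrable_imp_HK(1) by blast
 then have "continuous_on {0..S} (\<lambda>t. x + integral {0..t} (\<lambda>s. F s (y s)))"
  by (intro continuous_intros indefinite_integral_continuous_1)
 then show ?thesis by (rule continuous_on_eq) (use solonD(2)[OF assms] in auto)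
qed auto

lemma solon_diff:
 assumes "solon S F x y" "0 \<le> s" "s \<le> t" "t \<le> S"
 shows "y t - y s = integral {s..t} (\<lambda>r. F r (y r))" "(\<lambda>r. F r (y r)) integrable_on {s..t}"
proof -
 have i: "(\<lambda>s. F s (y s)) integrable_on {0..t}"
  using solonD(1)[OF assms(1), of t] assms set_integrable_imp_HK(1) by force
 then show "(\<lambda>r. F r (y r)) integrable_on {s..t}"
  by (rule integrable_on_subinterval) (use assms in auto)
 show "y t - y s = integral {s..t} (\<lambda>r. F r (y r))"
  using solonD(2)[OF assms(1), of t] solonD(2)[OF assms(1), of s] assms
   Henstock_Kurzweil_Integration.integral_combine[OF assms(2,3) i] by (simp add: algebra_simps)
qed

text \<open>The a priori bound that \<open>gronwall_weak\<close> yields for 1 + |y(t)| under linear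
  growth, when |y(0)| \<le> r.\<close>

definition rb :: "real \<Rightarrow> real \<Rightarrow> real \<Rightarrow> real" where
 "rb M r t = 2 * (1 + r) * exp (2 * M * t)"

lemma rb_mono: "0 \<le> M ==> 0 \<le> r ==> r \<le> r' ==> t \<le> t' ==> rb M r t \<le> rb M r' t'"
 unfolding rb_def by (intro mult_mono) (auto intro: mult_left_mono)

lemma rb_ge: "0 \<le> M ==> 0 \<le> r ==> 0 \<le> t ==> r < rb M r t"
proof -
 assume a: "0 \<le> M" "0 \<le> r" "0 \<le> t"
 have "2 * (1 + r) * 1 \<le> 2 * (1 + r) * exp (2 * M * t)" using a by (intro mult_left_mono) auto
 moreover have "r < 2 * (1 + r) * 1" using a by simp
 ultimately show ?thesis unfolding rb_def by (rule less_le_trans[rotated])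
qed

lemma solon_bound:
 assumes y: "solon S F x y" and M: "lin_growth M F" and t: "0 \<le> t" "t \<le> S" "norm x \<le> r"
 shows "norm (y t) \<le> rb M r t"
proof -
 have M0: "0 \<le> M" using M by (simp add: lin_growth_def)
 have "1 + norm (y t) \<le> 2 * (1 + norm x) * exp (2 * M * t)"
 proof (rule gronwall_weak[of S])
  show c: "continuous_on {0..S} (\<lambda>t. 1 + norm (y t))"
   by (intro continuous_intros solon_continuous[OF y])
  fix t assume t: "t \<in> {0..S}"
  have ci: "(\<lambda>t. 1 + norm (y t)) integrable_on {0..t}"
   by (rule integrable_continuous_interval, rule continuous_on_subset[OF c]) (use t in auto)
  have "norm (integral {0..t} (\<lambda>s. F s (y s))) \<le> integral {0..t} (\<lambda>s. M * (1 + norm (y s)))"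
   by (rule integral_norm_bound_integral)
     (use t M integrable_on_mult_right[OF ci] set_integrable_imp_HK(1)[OF solonD(1)[OF y, of t]] in
      \<open>auto simp: lin_growth_def\<close>)
  also have "\<dots> = M * integral {0..t} (\<lambda>s. 1 + norm (y s))" by simp
  finally show "1 + norm (y t) \<le> 1 + norm x + M * integral {0..t} (\<lambda>s. 1 + norm (y s))"
   using solonD(2)[OF y, of t] t norm_triangle_ineq[of x "integral {0..t} (\<lambda>s. F s (y s))"] by auto
 qed (use t M0 in auto)
 moreover have "2 * (1 + norm x) * exp (2 * M * t) \<le> rb M r t"
  unfolding rb_def using t(3) by (intro mult_right_mono) auto
 ultimately show ?thesis by linarith
qed

lemma solon_lipschitz:
 assumes y: "solon S F x y" and M: "lin_growth M F" and st: "0 \<le> s" "s \<le> t" "t \<le> S" and "norm x \<le> r"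
 shows "norm (y t - y s) \<le> M * (1 + rb M r S) * (t - s)"
proof -
 have r: "0 \<le> r" using assms(6) norm_ge_zero order_trans by blast
 have M0: "0 \<le> M" using M by (simp add: lin_growth_def)
 have "norm (F u (y u)) \<le> M * (1 + rb M r S)" if "u \<in> {s..t}" for u
 proof -
  have "norm (y u) \<le> rb M r u" using solon_bound[OF y M, of u r] that st assms(6) by auto
  also have "\<dots> \<le> rb M r S" using that st M0 r by (intro rb_mono) auto
  finally have "M * (1 + norm (y u)) \<le> M * (1 + rb M r S)" using M0 by (intro mult_left_mono) auto
  moreover have "norm (F u (y u)) \<le> M * (1 + norm (y u))" using M that st by (auto simp: lin_growth_def)
  ultimately show ?thesis by linarith
 qed
 then have "norm (integral (cbox s t) (\<lambda>r. F r (y r))) \<le> M * (1 + rb M r S) * measure lborel (cbox s t)"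
  using solon_diff(2)[OF y st(1-3)] M0 rb_ge[of M r S] r st by (intro integrable_bound) auto
 then show ?thesis using solon_diff(1)[OF y st(1-3)] st by simp
qed

text \<open>Inserting \<open>F s (z s)\<close> splits the difference of the velocities into a
  Lipschitz term in y - z and an error of size \<epsilon> measured along \<open>z\<close> alone;
  then \<open>gronwall_weak\<close> applies.\<close>

lemma solon_perturb:
 assumes y: "solon S F x y" and z: "solon S G x' z" and F: "lfield B L F"
  and bd: "\<And>t. 0 \<le> t ==> t \<le> S ==> norm (y t) \<le> R" "\<And>t. 0 \<le> t ==> t \<le> S ==> norm (z t) \<le> R"
  and close: "\<And>s. 0 \<le> s ==> s \<le> S ==> norm (F s (z s) - G s (z s)) \<le> \<epsilon>" "0 \<le> \<epsilon>" and t: "0 \<le> t" "t \<le> S"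
 shows "norm (y t - z t) \<le> 2 * (norm (x - x') + \<epsilon> * S) * exp (2 * L R * t)"
proof (rule gronwall_weak[of S])
 show c: "continuous_on {0..S} (\<lambda>t. norm (y t - z t))"
  by (intro continuous_intros solon_continuous[OF y] solon_continuous[OF z])
 fix t assume t: "t \<in> {0..S}"
 have ci: "(\<lambda>t. norm (y t - z t)) integrable_on {0..t}"
  by (rule integrable_continuous_interval, rule continuous_on_subset[OF c]) (use t in auto)
 have i: "(\<lambda>s. F s (y s)) integrable_on {0..t}" "(\<lambda>s. G s (z s)) integrable_on {0..t}"
  using set_integrable_imp_HK(1)[OF solonD(1)[OF y, of t]] set_integrable_imp_HK(1)[OF solonD(1)[OF z, of t]] t by auto
 have "norm (integral {0..t} (\<lambda>s. F s (y s) - G s (z s))) \<le> integral {0..t} (\<lambda>s. L R * norm (y s - z s) + \<epsilon>)"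
 proof (rule integral_norm_bound_integral)
  show "(\<lambda>s. F s (y s) - G s (z s)) integrable_on {0..t}" by (intro HK_integrable_diff i)
  show "(\<lambda>s. L R * norm (y s - z s) + \<epsilon>) integrable_on {0..t}"
   by (intro Henstock_Kurzweil_Integration.integrable_add integrable_on_mult_right ci integrable_const_ivl)
  show "norm (F s (y s) - G s (z s)) \<le> L R * norm (y s - z s) + \<epsilon>" if "s \<in> {0..t}" for s
   using norm_triangle_ineq[of "F s (y s) - F s (z s)" "F s (z s) - G s (z s)"]
    lfieldD(4)[OF F, of s "y s" R "z s"] bd[of s] close(1)[of s] that t by simp
 qed
 also have "\<dots> = L R * integral {0..t} (\<lambda>s. norm (y s - z s)) + \<epsilon> * t"
  using ci t by (subst Henstock_Kurzweil_Integration.integral_add) (auto intro!: integrable_on_mult_right)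
 also have "\<epsilon> * t \<le> \<epsilon> * S" using t close(2) by (intro mult_left_mono) auto
 finally have *: "norm (integral {0..t} (\<lambda>s. F s (y s) - G s (z s))) \<le> L R * integral {0..t} (\<lambda>s. norm (y s - z s)) + \<epsilon> * S"
  by simp
 have "y t - z t = (x - x') + integral {0..t} (\<lambda>s. F s (y s) - G s (z s))"
  using solonD(2)[OF y, of t] solonD(2)[OF z, of t] t i by (subst HK_integral_diff) auto
 then show "norm (y t - z t) \<le> norm (x - x') + \<epsilon> * S + L R * integral {0..t} (\<lambda>s. norm (y s - z s))"
  using norm_triangle_ineq[of "x - x'" "integral {0..t} (\<lambda>s. F s (y s) - G s (z s))"] * by simp
qed (use t close(2) lfieldD(2)[OF F] in auto)

lemmas solon_dependence = solon_perturb[where G = F and F = F and \<epsilon> = 0 for F, simplified]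

lemma solon_unique:
 assumes y: "solon S F x y" and z: "solon S F x z" and F: "lfield B L F" and t: "0 \<le> t" "t \<le> S"
 shows "y t = z t"
proof -
 have "bounded (y ` {0..S} \<union> z ` {0..S})"
  by (intro bounded_Un[THEN iffD2] conjI compact_imp_bounded compact_continuous_image
     solon_continuous[OF y] solon_continuous[OF z]) auto
 then obtain R where R: "\<And>u. u \<in> y ` {0..S} \<union> z ` {0..S} ==> norm u \<le> R"
  unfolding bounded_iff by blast
 have "norm (y t - z t) \<le> 2 * norm (x - x) * exp (2 * L R * t)"
  by (rule solon_dependence[OF y z F _ _ t]) (auto intro: R)
 then show ?thesis by simp
qed

section \<open>Shift, reflection and concatenation in time\<close>

lemma set_integral_affine:
 fixes g :: "real \<Rightarrow> 'x::euclidean_space"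
 assumes g: "set_integrable lborel {a..b} g"
 shows set_integrable_shift: "set_integrable lborel {a + c..b + c} (\<lambda>s. g (s - c))"
  and integral_shift_real: "integral {a + c..b + c} (\<lambda>s. g (s - c)) = integral {a..b} g"
  and set_integrable_reflect: "set_integrable lborel {c - b..c - a} (\<lambda>s. g (c - s))"
  and integral_reflect: "integral {c - b..c - a} (\<lambda>s. g (c - s)) = integral {a..b} g"
proof -
 have i: "integrable lborel (\<lambda>s. indicator {a..b} s *\<^sub>R g s)"
  using g by (simp add: set_integrable_def)
 have e1: "(\<lambda>s. indicator {a..b} (- c + 1 * s) *\<^sub>R g (- c + 1 * s))
   = (\<lambda>s. indicator {a + c..b + c} s *\<^sub>R g (s - c))" by (rule ext) (auto split: split_indicator)
 have e2: "(\<lambda>s. indicator {a..b} (c + (- 1) * s) *\<^sub>R g (c + (- 1) * s))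
   = (\<lambda>s. indicator {c - b..c - a} s *\<^sub>R g (c - s))" by (rule ext) (auto split: split_indicator)
 show 1: "set_integrable lborel {a + c..b + c} (\<lambda>s. g (s - c))"
  using lborel_integrable_real_affine[OF i, of 1 "- c"] unfolding e1 set_integrable_def by simp
 show 2: "set_integrable lborel {c - b..c - a} (\<lambda>s. g (c - s))"
  using lborel_integrable_real_affine[OF i, of "- 1" c] unfolding e2 set_integrable_def by simp
 show "integral {a + c..b + c} (\<lambda>s. g (s - c)) = integral {a..b} g"
  using lborel_integral_real_affine[of 1 "\<lambda>s. indicator {a..b} s *\<^sub>R g s" "- c"]
  unfolding e1 set_integrable_imp_HK(2)[OF 1, symmetric] set_integrable_imp_HK(2)[OF g, symmetric]
  by (simp add: set_lebesgue_integral_def)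
 show "integral {c - b..c - a} (\<lambda>s. g (c - s)) = integral {a..b} g"
  using lborel_integral_real_affine[of "- 1" "\<lambda>s. indicator {a..b} s *\<^sub>R g s" c]
  unfolding e2 set_integrable_imp_HK(2)[OF 2, symmetric] set_integrable_imp_HK(2)[OF g, symmetric]
  by (simp add: set_lebesgue_integral_def)
qed

lemma set_integral_concat:
 fixes g h :: "real \<Rightarrow> 'x::euclidean_space"
 assumes g: "set_integrable lborel {a..b} g" and h: "set_integrable lborel {b..c} h" and ab: "a \<le> b" "b \<le> c"
 shows set_integrable_concat: "set_integrable lborel {a..c} (\<lambda>s. if s < b then g s else h s)"
  and integral_concat: "integral {a..c} (\<lambda>s. if s < b then g s else h s) = integral {a..b} g + integral {b..c} h"
proof -
 let ?k = "\<lambda>s. if s < b then g s else h s"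
 have "set_integrable lborel {a..<b} g" by (rule set_integrable_subset[OF g]) auto
 then have 1: "set_integrable lborel {a..<b} ?k"
  by (rule set_integrable_cong[THEN iffD1, rotated -1]) auto
 have 2: "set_integrable lborel {b..c} ?k"
  using h by (rule set_integrable_cong[THEN iffD1, rotated -1]) auto
 have "{a..c} = {a..<b} \<union> {b..c}" using ab by auto
 then show 3: "set_integrable lborel {a..c} ?k" using set_integrable_Un[OF 1 2] by simp
 have "integral {a..c} ?k = integral {a..b} ?k + integral {b..c} ?k"
  using Henstock_Kurzweil_Integration.integral_combine[OF ab set_integrable_imp_HK(1)[OF 3]] by simp
 also have "integral {a..b} ?k = integral {a..b} g" by (rule integral_spike[of "{b}"]) auto
 also have "integral {b..c} ?k = integral {b..c} h" by (rule HK_integral_cong) auto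
 finally show "integral {a..c} ?k = integral {a..b} g + integral {b..c} h" .
qed

lemma solon_cong:
 assumes "\<And>t. 0 \<le> t ==> t \<le> S ==> F t (y t) = G t (z t)" "\<And>t. 0 \<le> t ==> t \<le> S ==> y t = z t"
 shows "solon S F x y = solon S G x z"
proof -
 have "set_integrable lborel {0..t} (\<lambda>s. F s (y s)) = set_integrable lborel {0..t} (\<lambda>s. G s (z s))"
  "integral {0..t} (\<lambda>s. F s (y s)) = integral {0..t} (\<lambda>s. G s (z s))" if "t \<in> {0..S}" for t
  using that assms(1) by (intro set_integrable_cong HK_integral_cong; simp)+
 then show ?thesis unfolding solon_def using assms(2) by auto
qed

lemma solon_shift:
 assumes y: "solon S F x y" and t0: "0 \<le> t0" "t0 \<le> S"
 shows "solon (S - t0) (\<lambda>t. F (t + t0)) (y t0) (\<lambda>t. y (t + t0))" unfolding solon_def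
proof (intro ballI conjI)
 fix t assume t: "t \<in> {0..S - t0}"
 have i: "set_integrable lborel {t0..t + t0} (\<lambda>s. F s (y s))"
  by (rule set_integrable_subset[OF solonD(1)[OF y, of "t + t0"]]) (use t t0 in auto)
 show "set_integrable lborel {0..t} (\<lambda>s. F (s + t0) (y (s + t0)))"
  using set_integrable_shift[OF i, of "- t0"] by simp
 show "y (t + t0) = y t0 + integral {0..t} (\<lambda>s. F (s + t0) (y (s + t0)))"
  using integral_shift_real[OF i, of "- t0"] solon_diff(1)[OF y t0(1), of "t + t0"] t
  by (simp add: algebra_simps)
qed

lemma solon_concat:
 assumes y: "solon t0 F x y" and z: "solon S G (y t0) z" and t0: "0 \<le> t0"
 shows "solon (t0 + S) (\<lambda>t. if t < t0 then F t else G (t - t0)) x (\<lambda>t. if t < t0 then y t else z (t - t0))"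
 unfolding solon_def
proof (intro ballI conjI)
 let ?H = "\<lambda>t. if t < t0 then F t else G (t - t0)" and ?w = "\<lambda>t. if t < t0 then y t else z (t - t0)"
 fix t assume t: "t \<in> {0..t0 + S}"
 have eq: "?H s (?w s) = (if s < t0 then F s (y s) else G (s - t0) (z (s - t0)))" for s by auto
 have "set_integrable lborel {0..t} (\<lambda>s. ?H s (?w s)) \<and> ?w t = x + integral {0..t} (\<lambda>s. ?H s (?w s))"
 proof (cases "t < t0")
  case True
  then have "solon t F x y = solon t ?H x ?w" by (intro solon_cong) auto
  then have "solon t ?H x ?w" using solon_mono[OF y, of t] True by auto
  from solonD[OF this, of t] show ?thesis using t by auto
 next
  case False
  have g: "set_integrable lborel {0..t0} (\<lambda>s. F s (y s))" using solonD(1)[OF y t0] by simp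
  have h0: "set_integrable lborel {0..t - t0} (\<lambda>s. G s (z s))" using solonD(1)[OF z, of "t - t0"] t False by auto
  have h: "set_integrable lborel {t0..t} (\<lambda>s. G (s - t0) (z (s - t0)))"
   using set_integrable_shift[OF h0, of t0] by simp
  have "integral {t0..t} (\<lambda>s. G (s - t0) (z (s - t0))) = integral {0..t - t0} (\<lambda>s. G s (z s))"
   using integral_shift_real[OF h0, of t0] by simp
  then show ?thesis
   unfolding eq using set_integrable_concat[OF g h] integral_concat[OF g h] False t0
    solonD(2)[OF y t0] solonD(2)[OF z, of "t - t0"] t by simp
 qed
 then show "set_integrable lborel {0..t} (\<lambda>s. ?H s (?w s))" "?w t = x + integral {0..t} (\<lambda>s. ?H s (?w s))"
  by auto
qed

section \<open>Global existence\<close>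

lemma integral_le_exp:
 fixes g :: "real \<Rightarrow> 'x::euclidean_space"
 assumes "g integrable_on {0..t}" "\<And>s. s \<in> {0..t} ==> norm (g s) \<le> c * exp (k * s)" "0 < k" "0 \<le> t" "0 \<le> c"
 shows "norm (integral {0..t} g) \<le> c * exp (k * t) / k"
proof -
 have E: "((\<lambda>s. c * exp (k * s)) has_integral c * ((exp (k * t) - 1) / k)) {0..t}"
  using integral_exp[of k t] assms by (intro has_integral_mult_right) auto
 have "norm (integral {0..t} g) \<le> integral {0..t} (\<lambda>s. c * exp (k * s))"
  using E assms by (intro integral_norm_bound_integral) auto
 also have "\<dots> = c * ((exp (k * t) - 1) / k)" using E by (rule integral_unique)
 also have "\<dots> \<le> c * (exp (k * t) / k)" using assms by (intro mult_left_mono divide_right_mono) auto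
 finally show ?thesis by simp
qed

text \<open>Picard's operator is treated on the whole half line at once. For u = exp(-k t) y the
  integral operator contracts with factor K/k, and k = 2K + 1 makes this at most 1/2. The weight
  also keeps u bounded, so that Banach's theorem applies in the space of bounded continuous
  functions.\<close>

lemma global_lipschitz_sol_exists:
 fixes F :: "real \<Rightarrow> 'x::euclidean_space \<Rightarrow> 'x"
 assumes F: "lfield B (\<lambda>_. K) F"
 shows "\<exists>y. \<forall>S. solon S F x y"
proof -
 define k where "k = 2 * K + 1"
 have K0: "0 \<le> K" using lfieldD(2)[OF F] by simp
 then have k: "0 < k" "K / k \<le> 1 / 2" by (auto simp: k_def field_simps)
 define M0 where "M0 = B 0"
 have M0: "norm (F t 0) \<le> M0" if "0 \<le> t" for t
  using lfieldD(3)[OF F, of t 0 0] that by (simp add: M0_def)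
 then have M00: "0 \<le> M0" using norm_ge_zero order_trans by blast
 have Lip: "norm (F t a - F t b) \<le> K * norm (a - b)" if "0 \<le> t" for t a b
  using lfieldD(4)[OF F that, of a "max (norm a) (norm b)" b] by simp
 define Y :: "(real \<Rightarrow>\<^sub>C 'x) \<Rightarrow> real \<Rightarrow> 'x" where "Y u s = exp (k * s) *\<^sub>R apply_bcontfun u s" for u s
 \<comment> \<open>The function space consists of functions on the whole line;
   \<open>max 0 t\<close> continues the image constantly to negative times.\<close>
 define G where "G u t = exp (- (k * max 0 t)) *\<^sub>R (x + integral {0..max 0 t} (\<lambda>s. F s (Y u s)))" for u t
 have Yc: "continuous_on T (Y u)" for u T
  unfolding Y_def by (intro continuous_intros continuous_on_apply_bcontfun)
 have int: "set_integrable lborel {0..t} (\<lambda>s. F s (Y u s))" for u t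
  by (rule lfield_integrable_comp[OF F Yc]) simp
 note hint = set_integrable_imp_HK(1)[OF int]
 have Gc: "continuous_on UNIV (G u)" for u
 proof -
  have i: "continuous_on {0..b} (\<lambda>t. integral {0..t} (\<lambda>s. F s (Y u s)))" for b
   by (rule indefinite_integral_continuous_1[OF hint])
  have "isCont (\<lambda>t. integral {0..max 0 t} (\<lambda>s. F s (Y u s))) t" for t
  proof -
   have "continuous_on {..<\<bar>t\<bar> + 1} (\<lambda>t. integral {0..max 0 t} (\<lambda>s. F s (Y u s)))"
    by (rule continuous_on_compose2[OF i[of "\<bar>t\<bar> + 1"], of _ "\<lambda>t. max 0 t"])
      (auto intro!: continuous_intros)
   then show ?thesis by (rule continuous_on_interior) (auto simp: interior_open)
  qed
  then have "continuous_on UNIV (\<lambda>t. integral {0..max 0 t} (\<lambda>s. F s (Y u s)))"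
   by (simp add: continuous_at_imp_continuous_on)
  then show ?thesis unfolding G_def by (intro continuous_intros)
 qed
 have Fb: "norm (F s (Y u s)) \<le> (M0 + K * norm u) * exp (k * s)" if "0 \<le> s" for u s
 proof -
  have "norm (F s (Y u s)) \<le> norm (F s 0) + norm (F s (Y u s) - F s 0)"
   by (metis add.commute diff_add_cancel norm_triangle_ineq)
  also have "\<dots> \<le> M0 + K * (exp (k * s) * norm u)"
  proof (intro add_mono M0 that)
   have "norm (F s (Y u s) - F s 0) \<le> K * norm (Y u s)" using Lip[OF that, of "Y u s" 0] by simp
   also have "\<dots> \<le> K * (exp (k * s) * norm u)"
    unfolding Y_def using K0 by (intro mult_left_mono) (auto intro: norm_bounded)
   finally show "norm (F s (Y u s) - F s 0) \<le> K * (exp (k * s) * norm u)" .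
  qed
  also have "M0 \<le> M0 * exp (k * s)" using M00 k that by (simp add: mult_le_cancel_left1)
  finally show ?thesis by (simp add: algebra_simps)
 qed
 have Gb: "norm (G u t) \<le> norm x + (M0 + K * norm u) / k" for u t
 proof -
  let ?t = "max 0 t"
  have "norm (integral {0..?t} (\<lambda>s. F s (Y u s))) \<le> (M0 + K * norm u) * exp (k * ?t) / k"
   by (rule integral_le_exp[OF hint]) (use Fb M00 K0 k in auto)
  then have "norm (x + integral {0..?t} (\<lambda>s. F s (Y u s))) \<le> norm x * exp (k * ?t) + (M0 + K * norm u) * exp (k * ?t) / k"
   using k by (intro order_trans[OF norm_triangle_ineq] add_mono) (auto simp: mult_le_cancel_left1)
  then have "norm (G u t) \<le> exp (- (k * ?t)) * (norm x * exp (k * ?t) + (M0 + K * norm u) * exp (k * ?t) / k)"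
   unfolding G_def norm_scaleR by (intro mult_mono) auto
  also have "\<dots> = norm x + (M0 + K * norm u) / k" by (simp add: exp_minus field_simps)
  finally show ?thesis .
 qed
 have Gin: "G u \<in> bcontfun" for u unfolding bcontfun_def using Gc Gb by (auto simp: bounded_iff)
 define \<Phi> where "\<Phi> u = Bcontfun (G u)" for u
 have \<Phi>: "apply_bcontfun (\<Phi> u) = G u" for u unfolding \<Phi>_def by (rule Bcontfun_inverse[OF Gin])
 have "\<exists>!u. \<Phi> u = u"
 proof (rule banach_fix_type[where c = "1/2"], goal_cases)
  case 3
  show ?case
  proof (intro allI)
  fix u v :: "real \<Rightarrow>\<^sub>C 'x"
  show "dist (\<Phi> u) (\<Phi> v) \<le> 1/2 * dist u v"
  proof (rule dist_bound)
   fix t :: real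
   let ?t = "max 0 t"
   have "norm (integral {0..?t} (\<lambda>s. F s (Y u s) - F s (Y v s))) \<le> (K * dist u v) * exp (k * ?t) / k"
   proof (rule integral_le_exp)
    show "(\<lambda>s. F s (Y u s) - F s (Y v s)) integrable_on {0..?t}" by (intro HK_integrable_diff hint)
    fix s assume s: "s \<in> {0..?t}"
    have "norm (F s (Y u s) - F s (Y v s)) \<le> K * norm (Y u s - Y v s)" using s by (intro Lip) auto
    also have "Y u s - Y v s = exp (k * s) *\<^sub>R (apply_bcontfun u s - apply_bcontfun v s)"
     by (simp add: Y_def scaleR_diff_right)
    also have "K * norm \<dots> \<le> K * (exp (k * s) * dist u v)"
     using K0 dist_fun_lt_imp_dist_val_lt dist_bounded[of u s v]
     by (intro mult_left_mono) (auto simp: dist_norm)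
    finally show "norm (F s (Y u s) - F s (Y v s)) \<le> K * dist u v * exp (k * s)"
     by (simp add: algebra_simps)
   qed (use K0 k in auto)
   then have "exp (- (k * ?t)) * norm (integral {0..?t} (\<lambda>s. F s (Y u s) - F s (Y v s)))
     \<le> exp (- (k * ?t)) * ((K * dist u v) * exp (k * ?t) / k)" by (intro mult_left_mono) auto
   also have "\<dots> = K / k * dist u v" by (simp add: exp_minus field_simps)
   also have "\<dots> \<le> 1/2 * dist u v" using k by (intro mult_right_mono) auto
   finally have "exp (- (k * ?t)) * norm (integral {0..?t} (\<lambda>s. F s (Y u s) - F s (Y v s))) \<le> 1/2 * dist u v" .
   moreover have "G u t - G v t = exp (- (k * ?t)) *\<^sub>R integral {0..?t} (\<lambda>s. F s (Y u s) - F s (Y v s))"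
    unfolding G_def HK_integral_diff[OF hint hint] by (simp add: scaleR_diff_right[symmetric])
   ultimately show "dist (apply_bcontfun (\<Phi> u) t) (apply_bcontfun (\<Phi> v) t) \<le> 1/2 * dist u v"
    unfolding \<Phi> dist_norm by simp
  qed
  qed
 qed auto
 then obtain u where "\<Phi> u = u" by auto
 then have u: "apply_bcontfun u = G u" using \<Phi> by metis
 have "Y u t = x + integral {0..t} (\<lambda>s. F s (Y u s))" if "0 \<le> t" for t
 proof -
  have "Y u t = exp (k * t) *\<^sub>R G u t" by (simp add: Y_def u)
  also have "\<dots> = x + integral {0..t} (\<lambda>s. F s (Y u s))" using that by (simp add: G_def exp_minus)
  finally show ?thesis .
 qed
 then show ?thesis using int unfolding solon_def by (intro exI[of _ "Y u"]) auto
qed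

text \<open>Projecting the state onto the ball of radius \<open>R n\<close> makes the field globally
  Lipschitz without increasing its growth. The a priori bound shows that the projection is inactive
  up to time n, and uniqueness makes the solutions for different n agree, so they can be patched
  together.\<close>

lemma sol_exists:
 fixes F :: "real \<Rightarrow> 'x::euclidean_space \<Rightarrow> 'x"
 assumes F: "lfield B L F" and M: "lin_growth M F"
 shows "\<exists>y. sol F x y"
proof -
 have M0: "0 \<le> M" using M by (simp add: lin_growth_def)
 define R where "R n = rb M (norm x) (real n)" for n
 have R0: "0 \<le> R n" for n unfolding R_def rb_def by simp
 define P :: "real \<Rightarrow> 'x \<Rightarrow> 'x" where "P r = closest_point (cball 0 r)" for r
 define Fn where "Fn n t z = F t (P (R n) z)" for n t z
 have PR: "norm (P r z) \<le> r" if "0 \<le> r" for r z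
  using closest_point_in_set[of "cball 0 r" z] that by (simp add: P_def)
 have Pl: "norm (P r z - P r z') \<le> norm (z - z')" if "0 \<le> r" for r z z'
  using closest_point_lipschitz[of "cball 0 r" z z'] that by (simp add: P_def dist_norm)
 have Pid: "P r z = z" if "norm z \<le> r" for r z
  using closest_point_self[of z "cball 0 r"] that by (simp add: P_def)
 have Pn: "norm (P r z) \<le> norm z" if "0 \<le> r" for r z
  using Pl[OF that, of z 0] Pid[of 0 r] that by simp
 have lf: "lfield (\<lambda>_. B (R n)) (\<lambda>_. L (R n)) (Fn n)" for n unfolding lfield_def Fn_def
 proof (intro conjI allI impI)
  show "set_borel_measurable borel {0..} (\<lambda>t. F t (P (R n) z))" for z by (rule lfieldD(1)[OF F])
  show "0 \<le> L (R n)" by (rule lfieldD(2)[OF F])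
  show "norm (F t (P (R n) z)) \<le> B (R n)" if "0 \<le> t" for t z
   by (rule lfieldD(3)[OF F that PR[OF R0]])
  show "norm (F t (P (R n) z) - F t (P (R n) z')) \<le> L (R n) * norm (z - z')" if "0 \<le> t" for t z z'
   by (rule order_trans[OF lfieldD(4)[OF F that PR[OF R0] PR[OF R0]]])
     (intro mult_left_mono Pl R0 lfieldD(2)[OF F])
 qed
 have lg: "lin_growth M (Fn n)" for n unfolding lin_growth_def
 proof (intro conjI allI impI M0)
  fix t :: real and z assume "0 \<le> t"
  then have "norm (Fn n t z) \<le> M * (1 + norm (P (R n) z))"
   using M by (simp add: Fn_def lin_growth_def)
  also have "\<dots> \<le> M * (1 + norm z)" using M0 Pn[OF R0] by (intro mult_left_mono add_left_mono) auto
  finally show "norm (Fn n t z) \<le> M * (1 + norm z)" .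
 qed
 from global_lipschitz_sol_exists[OF lf]
 have "\<forall>n. \<exists>y. \<forall>S. solon S (Fn n) x y" by blast
 then obtain y where y: "\<And>n S. solon S (Fn n) x (y n)" by metis
 have yF: "solon (real n) F x (y n)" for n
 proof -
  have "solon (real n) (Fn n) x (y n) = solon (real n) F x (y n)"
  proof (rule solon_cong)
   fix t assume t: "0 \<le> t" "t \<le> real n"
   have "norm (y n t) \<le> rb M (norm x) t" by (rule solon_bound[OF y lg t(1) order_refl order_refl])
   also have "\<dots> \<le> R n" unfolding R_def using M0 t by (intro rb_mono) auto
   finally show "Fn n t (y n t) = F t (y n t)" by (simp add: Fn_def Pid)
  qed simp
  then show ?thesis using y by simp
 qed
 define w where "w t = y (nat \<lceil>t\<rceil>) t" for t
 have wy: "w t = y n t" if "0 \<le> t" "t \<le> real n" for t n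
 proof -
  have le: "t \<le> real (nat \<lceil>t\<rceil>)" "nat \<lceil>t\<rceil> \<le> n" using that by linarith+
  have "solon (real (nat \<lceil>t\<rceil>)) F x (y n)" by (rule solon_mono[OF yF]) (use le in simp)
  from solon_unique[OF yF this F that(1) le(1)] show ?thesis by (simp add: w_def)
 qed
 have "solon S F x w" for S
 proof -
  obtain n where n: "S \<le> real n" using real_arch_simple by blast
  have "solon (real n) F x (y n) = solon (real n) F x w" by (rule solon_cong) (use wy in auto)
  then show ?thesis using yF solon_mono[OF _ n] by blast
 qed
 then show ?thesis unfolding sol_def by blast
qed

section \<open>Flow, running cost and total cost\<close>

definition flow :: "(real \<Rightarrow> 'x \<Rightarrow> 'x::euclidean_space) \<Rightarrow> 'x \<Rightarrow> real \<Rightarrow> 'x" where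
 "flow F x = (SOME y. sol F x y)"

lemma trajectory_eq_flow: "trajectory g x \<alpha> = flow (\<lambda>s z. g z (\<alpha> s)) x"
 unfolding trajectory_def flow_def solves_eq_sol ..

lemma flow_sol:
 assumes "lfield B L F" "lin_growth M F"
 shows "solon S F x (flow F x)"
 using someI_ex[OF sol_exists[OF assms, of x]] unfolding flow_def sol_def by blast

lemma flow_eqI:
 assumes "lfield B L F" "lin_growth M F" "solon S F x y" "0 \<le> t" "t \<le> S"
 shows "flow F x t = y t" by (rule solon_unique[OF flow_sol[OF assms(1,2)] assms(3,1,4,5)])

lemma lfield_shift: "lfield B L F ==> 0 \<le> t0 ==> lfield B L (\<lambda>t. F (t + t0))" unfolding lfield_def
proof (intro conjI allI impI; (elim conjE)?)
 fix x assume t0: "0 \<le> t0" and "\<forall>x. set_borel_measurable borel {0..} (\<lambda>t. F t x)"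
 then have "(\<lambda>t. indicator {0..} t *\<^sub>R F t x) \<in> borel_measurable borel" by (simp add: set_borel_measurable_def)
 then have "(\<lambda>t. indicator {0..} (t + t0) *\<^sub>R F (t + t0) x) \<in> borel_measurable borel"
  by (rule measurable_compose[rotated]) simp
 then have "set_borel_measurable borel {-t0..} (\<lambda>t. F (t + t0) x)"
  unfolding set_borel_measurable_def
  by (rule measurable_cong[THEN iffD1, rotated]) (auto split: split_indicator)
 then show "set_borel_measurable borel {0..} (\<lambda>t. F (t + t0) x)"
  by (rule set_borel_measurable_sub) (use t0 in auto)
qed (use add_nonneg_nonneg in blast)+

lemma lin_growth_shift: "lin_growth M F ==> 0 \<le> t0 ==> lin_growth M (\<lambda>t. F (t + t0))"
 unfolding lin_growth_def by (metis add_nonneg_nonneg)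

lemma flow_shift:
 assumes "lfield B L F" "lin_growth M F" "0 \<le> t0" "0 \<le> t"
 shows "flow (\<lambda>t. F (t + t0)) (flow F x t0) t = flow F x (t + t0)"
 using assms solon_shift[OF flow_sol[OF assms(1,2)], of t0 "t + t0" x]
 by (intro flow_eqI[OF lfield_shift lin_growth_shift]) auto

lemma flow_cong:
 assumes "\<And>t. 0 \<le> t ==> F t = G t"
 shows "flow F x = flow G x"
proof -
 have "solon S F x y = solon S G x y" for S y by (rule solon_cong) (use assms in auto)
 then have "sol F x = sol G x" unfolding sol_def by (intro ext) simp
 then show ?thesis unfolding flow_def by simp
qed

definition pcost :: "(real \<Rightarrow> 'x \<Rightarrow> 'x::euclidean_space) \<Rightarrow> (real \<Rightarrow> 'x \<Rightarrow> real) \<Rightarrow> real set \<Rightarrow> 'x \<Rightarrow> ereal" where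
 "pcost F ell I x = enn2ereal (\<integral>\<^sup>+ s\<in>I. ennreal (ell s (flow F x s)) \<partial>lborel)"

lemma cost_eq_pcost: "cost g h I x \<alpha> = pcost (\<lambda>s z. g z (\<alpha> s)) (\<lambda>s z. h z (\<alpha> s)) I x"
 unfolding cost_def pcost_def trajectory_eq_flow ..

lemma pcost_nonneg: "0 \<le> pcost F ell I x" unfolding pcost_def by simp

lemma pcost_cong:
 assumes "\<And>t. 0 \<le> t ==> F t = G t" "\<And>t. 0 \<le> t ==> ell t = m t" "I \<subseteq> {0..}"
 shows "pcost F ell I x = pcost G m I x"
proof -
 have "flow F x = flow G x" by (rule flow_cong[OF assms(1)])
 then show ?thesis unfolding pcost_def using assms(2,3)
  by (intro arg_cong[of _ _ enn2ereal] nn_integral_cong) (auto split: split_indicator)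
qed

definition rc :: "(real \<Rightarrow> 'x \<Rightarrow> 'x::euclidean_space) \<Rightarrow> (real \<Rightarrow> 'x \<Rightarrow> real) \<Rightarrow> 'x \<Rightarrow> real \<Rightarrow> real" where
 "rc F ell x t = integral {0..t} (\<lambda>s. ell s (flow F x s))"

lemma enn2ereal_nn_integral_upto:
 fixes g :: "real \<Rightarrow> real"
 assumes "set_integrable lborel {0..t} g" "\<And>s. 0 \<le> s ==> 0 \<le> g s"
 shows "enn2ereal (\<integral>\<^sup>+ s\<in>{0..t}. ennreal (g s) \<partial>lborel) = ereal (integral {0..t} g)"
proof -
 have "(\<integral>\<^sup>+ s\<in>{0..t}. ennreal (g s) \<partial>lborel) = (\<integral>\<^sup>+ s. ennreal (indicator {0..t} s *\<^sub>R g s) \<partial>lborel)"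
  by (intro nn_integral_cong) (auto split: split_indicator)
 also have "\<dots> = ennreal (\<integral>s. indicator {0..t} s *\<^sub>R g s \<partial>lborel)"
  by (rule nn_integral_eq_integral) (use assms in \<open>auto simp: set_integrable_def split: split_indicator\<close>)
 also have "(\<integral>s. indicator {0..t} s *\<^sub>R g s \<partial>lborel) = integral {0..t} g"
  using set_integrable_imp_HK(2)[OF assms(1)] by (simp add: set_lebesgue_integral_def)
 finally show ?thesis
  using integral_nonneg[OF set_integrable_imp_HK(1)[OF assms(1)]] assms(2) by (simp add: enn2ereal_ennreal)
qed

lemma enn2ereal_nn_integral_SUP:
 fixes g :: "real \<Rightarrow> real"
 assumes i: "\<And>t. set_integrable lborel {0..t} g" and g: "\<And>s. 0 \<le> s ==> 0 \<le> g s"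
 shows "enn2ereal (\<integral>\<^sup>+ s\<in>{0..}. ennreal (g s) \<partial>lborel) = (SUP n. ereal (integral {0..real n} g))"
proof -
 let ?h = "\<lambda>n s. ennreal (g s) * indicator {0..real n} s"
 have "(\<lambda>s. indicator {0..real n} s *\<^sub>R g s) \<in> borel_measurable lborel" for n
  using i[of "real n"] unfolding set_integrable_def by (auto dest: borel_measurable_integrable)
 then have m: "?h n \<in> borel_measurable lborel" for n
  by (rule measurable_cong[THEN iffD1, rotated, OF measurable_compose[OF _ measurable_ennreal]])
    (auto split: split_indicator)
 have "(SUP n. ?h n s) = ennreal (g s) * indicator {0..} s" for s
 proof (cases "0 \<le> s")
  case True
  obtain N where N: "s \<le> real N" using real_arch_simple by blast
  show ?thesis
  proof (rule antisym)
   show "(SUP n. ?h n s) \<le> ennreal (g s) * indicator {0..} s"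
    by (rule SUP_least) (auto split: split_indicator)
   show "ennreal (g s) * indicator {0..} s \<le> (SUP n. ?h n s)"
    by (rule SUP_upper2[of N]) (use N True in auto)
  qed
 qed auto
 then have "(\<integral>\<^sup>+ s\<in>{0..}. ennreal (g s) \<partial>lborel) = (\<integral>\<^sup>+ s. (SUP n. ?h n s) \<partial>lborel)" by simp
 also have "\<dots> = (SUP n. \<integral>\<^sup>+ s. ?h n s \<partial>lborel)"
  by (rule nn_integral_monotone_convergence_SUP[OF _ m])
    (auto simp: incseq_def le_fun_def split: split_indicator)
 finally have "enn2ereal (\<integral>\<^sup>+ s\<in>{0..}. ennreal (g s) \<partial>lborel) = (SUP n. enn2ereal (\<integral>\<^sup>+ s. ?h n s \<partial>lborel))"
  by (simp, subst Sup_ennreal.rep_eq) (auto simp: image_image sup_max max_absorb2 intro!: max_absorb2 SUP_upper2[of 0])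
 then show ?thesis using enn2ereal_nn_integral_upto[OF i g] by simp
qed

text \<open>A control system after insertion of a control. Velocity and running cost share
  \<open>B\<close> and \<open>L\<close>; since these are uniform in time, shifts and concatenations
  stay inside the locale with the same constants.\<close>

locale adm =
 fixes M :: real and B L :: "real \<Rightarrow> real"
  and F :: "real \<Rightarrow> 'x::euclidean_space \<Rightarrow> 'x" and ell :: "real \<Rightarrow> 'x \<Rightarrow> real"
 assumes F: "lfield B L F" and lg: "lin_growth M F" and ell: "lfield B L ell"
  and ell_nonneg: "0 \<le> t ==> 0 \<le> ell t x"
begin

lemma M0: "0 \<le> M" using lg by (simp add: lin_growth_def)

lemma flow_solon: "solon S F x (flow F x)" by (rule flow_sol[OF F lg])

lemma flow_0 [simp]: "flow F x 0 = x" using solon_0[OF flow_solon, of 0] by simp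

lemma flow_continuous: "continuous_on {0..S} (flow F x)" by (rule solon_continuous[OF flow_solon])

lemma flow_bound: "0 \<le> t ==> norm x \<le> r ==> norm (flow F x t) \<le> rb M r t"
 by (rule solon_bound[OF flow_solon lg _ order_refl])

lemma flow_bound': "0 \<le> t ==> t \<le> S ==> norm x \<le> r ==> norm (flow F x t) \<le> rb M r S"
 using flow_bound[of t x r] rb_mono[OF M0, of r r t S] order_trans[OF norm_ge_zero[of x], of r] by simp

lemma flow_lipschitz:
 "0 \<le> s ==> s \<le> t ==> t \<le> S ==> norm x \<le> r ==> norm (flow F x t - flow F x s) \<le> M * (1 + rb M r S) * (t - s)"
 by (rule solon_lipschitz[OF flow_solon lg])

lemma flow_dependence:
 assumes "norm x \<le> r" "norm x' \<le> r" "0 \<le> t" "t \<le> S"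
 shows "norm (flow F x t - flow F x' t) \<le> 2 * norm (x - x') * exp (2 * L (rb M r S) * t)"
 by (rule solon_dependence[OF flow_solon flow_solon F _ _ assms(3,4)])
   (use assms flow_bound' in auto)

lemma ell_integrable: "set_integrable lborel {a..b} (\<lambda>s. ell s (flow F x s))" if "0 \<le> a"
 by (rule lfield_integrable_comp[OF ell continuous_on_subset[OF flow_continuous[of b]] that]) (use that in auto)

lemmas ell_integrable_HK = set_integrable_imp_HK(1)[OF ell_integrable]

lemma rc_0 [simp]: "rc F ell x 0 = 0" by (simp add: rc_def)

lemma rc_diff:
 assumes "0 \<le> s" "s \<le> t"
 shows "rc F ell x t - rc F ell x s = integral {s..t} (\<lambda>s. ell s (flow F x s))"
 using Henstock_Kurzweil_Integration.integral_combine[OF assms ell_integrable_HK[OF order_refl]]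
 by (simp add: rc_def algebra_simps)

lemma rc_mono: "0 \<le> s ==> s \<le> t ==> rc F ell x s \<le> rc F ell x t"
 using rc_diff[of s t x] integral_nonneg[OF ell_integrable_HK[where a = s and b = t and x = x]] ell_nonneg by force

lemma rc_nonneg: "0 \<le> t ==> 0 \<le> rc F ell x t" using rc_mono[of 0 t x] by simp

lemma pcost_upto: "pcost F ell {0..t} x = ereal (rc F ell x t)" if "0 \<le> t"
 unfolding pcost_def rc_def by (rule enn2ereal_nn_integral_upto[OF ell_integrable ell_nonneg]) simp

lemma pcost_SUP: "pcost F ell {0..} x = (SUP n. ereal (rc F ell x (real n)))"
 unfolding pcost_def rc_def by (rule enn2ereal_nn_integral_SUP[OF ell_integrable ell_nonneg]) simp

lemma pcost_le_iff: "pcost F ell {0..} x \<le> c \<longleftrightarrow> (\<forall>t\<ge>0. ereal (rc F ell x t) \<le> c)"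
proof
 assume c: "pcost F ell {0..} x \<le> c"
 show "\<forall>t\<ge>0. ereal (rc F ell x t) \<le> c"
 proof (intro allI impI)
  fix t :: real assume t: "0 \<le> t"
  obtain n where "t \<le> real n" using real_arch_simple by blast
  then have "ereal (rc F ell x t) \<le> ereal (rc F ell x (real n))" using rc_mono[OF t] by simp
  also have "\<dots> \<le> pcost F ell {0..} x" unfolding pcost_SUP by (rule SUP_upper) simp
  finally show "ereal (rc F ell x t) \<le> c" using c by simp
 qed
qed (auto simp: pcost_SUP intro: SUP_least)

lemma rc_le_pcost: "0 \<le> t ==> ereal (rc F ell x t) \<le> pcost F ell {0..} x"
 using pcost_le_iff[of x "pcost F ell {0..} x"] by simp

lemma adm_shift: "0 \<le> t0 ==> adm M B L (\<lambda>t. F (t + t0)) (\<lambda>t. ell (t + t0))"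
 using F lg ell ell_nonneg by unfold_locales (auto intro: lfield_shift lin_growth_shift)

lemma rc_shift:
 assumes "0 \<le> t0" "0 \<le> t"
 shows "rc F ell x (t0 + t) = rc F ell x t0 + rc (\<lambda>t. F (t + t0)) (\<lambda>t. ell (t + t0)) (flow F x t0) t"
proof -
 have i: "set_integrable lborel {t0..t0 + t} (\<lambda>s. ell s (flow F x s))"
  by (rule ell_integrable[OF assms(1)])
 have "integral {0..t} (\<lambda>s. ell (s + t0) (flow F x (s + t0))) = integral {t0..t0 + t} (\<lambda>s. ell s (flow F x s))"
  using integral_shift_real[OF i, of "- t0"] by simp
 moreover have "integral {0..t} (\<lambda>s. ell (s + t0) (flow F x (s + t0))) =
   rc (\<lambda>t. F (t + t0)) (\<lambda>t. ell (t + t0)) (flow F x t0) t"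
  unfolding rc_def using flow_shift[OF F lg assms(1)] by (intro HK_integral_cong) auto
 ultimately show ?thesis using rc_diff[of t0 "t0 + t" x] assms by simp
qed

lemma pcost_split:
 assumes t0: "0 \<le> t0"
 shows "pcost F ell {0..} x = ereal (rc F ell x t0) + pcost (\<lambda>t. F (t + t0)) (\<lambda>t. ell (t + t0)) {0..} (flow F x t0)"
  (is "?P = ereal ?r + ?Q")
proof -
 interpret s: adm M B L "\<lambda>t. F (t + t0)" "\<lambda>t. ell (t + t0)" by (rule adm_shift[OF t0])
 show ?thesis
 proof (rule antisym)
  show "?P \<le> ereal ?r + ?Q" unfolding pcost_le_iff
  proof (intro allI impI)
   fix t :: real assume t: "0 \<le> t"
   have "rc F ell x t \<le> rc F ell x (t0 + t)" using t t0 by (intro rc_mono) auto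
   then have "ereal (rc F ell x t) \<le> ereal ?r + ereal (rc (\<lambda>t. F (t + t0)) (\<lambda>t. ell (t + t0)) (flow F x t0) t)"
    using rc_shift[OF t0 t] by simp
   also have "\<dots> \<le> ereal ?r + ?Q" by (intro add_left_mono s.rc_le_pcost t)
   finally show "ereal (rc F ell x t) \<le> ereal ?r + ?Q" .
  qed
  have "?Q \<le> ?P - ereal ?r" unfolding s.pcost_le_iff
  proof (intro allI impI)
   fix t :: real assume t: "0 \<le> t"
   have "ereal (rc F ell x (t0 + t)) \<le> ?P" using t t0 by (intro rc_le_pcost) auto
   then show "ereal (rc (\<lambda>t. F (t + t0)) (\<lambda>t. ell (t + t0)) (flow F x t0) t) \<le> ?P - ereal ?r"
    using rc_shift[OF t0 t, of x] by (cases ?P) auto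
  qed
  then show "ereal ?r + ?Q \<le> ?P" by (cases ?P; cases ?Q) auto
 qed
qed

end

section \<open>Concatenation of systems\<close>

lemma lfield_concat:
 assumes F: "lfield B L F" and G: "lfield B L G" and t0: "0 \<le> t0"
 shows "lfield B L (\<lambda>t. if t < t0 then F t else G (t - t0))" unfolding lfield_def
proof (intro conjI allI impI)
 fix x
 have 1: "(\<lambda>t. indicator {0..} t *\<^sub>R F t x) \<in> borel_measurable borel"
  using lfieldD(1)[OF F] by (simp add: set_borel_measurable_def)
 have 2: "(\<lambda>t. indicator {0..} (t - t0) *\<^sub>R G (t - t0) x) \<in> borel_measurable borel"
  using lfieldD(1)[OF G, of x] unfolding set_borel_measurable_def by (rule measurable_compose[rotated]) simp
 have "(\<lambda>t. if t < t0 then indicator {0..} t *\<^sub>R F t x else indicator {0..} (t - t0) *\<^sub>R G (t - t0) x) \<in> borel_measurable borel"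
  using 1 2 by (intro measurable_If) auto
 then show "set_borel_measurable borel {0..} (\<lambda>t. (if t < t0 then F t else G (t - t0)) x)"
  unfolding set_borel_measurable_def
  by (rule measurable_cong[THEN iffD1, rotated]) (use t0 in \<open>auto split: split_indicator\<close>)
qed (use lfieldD[OF F] lfieldD[OF G] in auto)

lemma adm_concat:
 assumes "adm M B L F ell" "adm M B L G m" and t0: "0 \<le> t0"
 defines "H \<equiv> \<lambda>t. if t < t0 then F t else G (t - t0)" and "h \<equiv> \<lambda>t. if t < t0 then ell t else m (t - t0)"
 shows "adm M B L H h" and "0 \<le> t ==> t \<le> t0 ==> flow H x t = flow F x t"
  and "0 \<le> t ==> t \<le> t0 ==> rc H h x t = rc F ell x t"
  and "0 \<le> t ==> flow H x (t0 + t) = flow G (flow F x t0) t"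
  and "0 \<le> t ==> rc H h x (t0 + t) = rc F ell x t0 + rc G m (flow F x t0) t"
  and "pcost H h {0..} x = ereal (rc F ell x t0) + pcost G m {0..} (flow F x t0)"
proof -
 interpret F: adm M B L F ell by fact
 interpret G: adm M B L G m by fact
 show H: "adm M B L H h" unfolding H_def h_def
 proof
  show "lin_growth M (\<lambda>t. if t < t0 then F t else G (t - t0))"
   using F.lg G.lg unfolding lin_growth_def by auto
 qed (use F.F G.F F.ell G.ell t0 F.ell_nonneg G.ell_nonneg in \<open>auto intro!: lfield_concat\<close>)
 interpret H: adm M B L H h by fact
 have "solon (t0 + 0) H x (\<lambda>t. if t < t0 then flow F x t else flow G (flow F x t0) (t - t0))"
  unfolding H_def by (rule solon_concat[OF F.flow_solon G.flow_solon t0])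
 from flow_eqI[OF H.F H.lg this]
 show *: "flow H x t = flow F x t" if "0 \<le> t" "t \<le> t0" for t using that by auto
 show "rc H h x t = rc F ell x t" if "0 \<le> t" "t \<le> t0" for t
  unfolding rc_def by (rule integral_spike[of "{t0}"]) (use that * in \<open>auto simp: h_def\<close>)
 note rt = this[OF t0 order_refl]
 have sH: "(\<lambda>t. H (t + t0)) t = G t" "(\<lambda>t. h (t + t0)) t = m t" if "0 \<le> t" for t
  using that by (auto simp: H_def h_def)
 have fe: "flow (\<lambda>t. H (t + t0)) z = flow G z" for z by (rule flow_cong) (use sH in auto)
 show "flow H x (t0 + t) = flow G (flow F x t0) t" if "0 \<le> t" for t
  using flow_shift[OF H.F H.lg t0 that, of x] *[OF t0 order_refl] fe by (simp add: add.commute)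
 show "rc H h x (t0 + t) = rc F ell x t0 + rc G m (flow F x t0) t" if t: "0 \<le> t" for t
 proof -
  have "rc (\<lambda>t. H (t + t0)) (\<lambda>t. h (t + t0)) z t = rc G m z t" for z
   unfolding rc_def fe by (rule HK_integral_cong) (use sH in auto)
  then show ?thesis using H.rc_shift[OF t0 t, of x] *[OF t0 order_refl] rt by simp
 qed
 have "pcost (\<lambda>t. H (t + t0)) (\<lambda>t. h (t + t0)) {0..} z = pcost G m {0..} z" for z
  by (rule pcost_cong) (use sH in auto)
 then show "pcost H h {0..} x = ereal (rc F ell x t0) + pcost G m {0..} (flow F x t0)"
  using H.pcost_split[OF t0, of x] *[OF t0 order_refl] rt by simp
qed

section \<open>Compact control systems\<close>

text \<open>Freezing a control at its value at time 0 for negative times turns it into a measurable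
  function on the whole line, where compositions with shifts and other changes of time are easy.
  \<open>control_restrict\<close> is the way back.\<close>

lemma control_total:
 assumes "\<alpha> \<in> restrict_space borel {0::real..} \<rightarrow>\<^sub>M N"
 shows "(\<lambda>s. \<alpha> (max 0 s)) \<in> borel \<rightarrow>\<^sub>M N"
proof -
 have "(\<lambda>s::real. max 0 s) \<in> borel \<rightarrow>\<^sub>M restrict_space borel {0..}"
  by (rule measurable_restrict_space2) auto
 then show ?thesis using assms by (rule measurable_compose)
qed

lemma control_restrict:
 assumes "\<beta> \<in> borel \<rightarrow>\<^sub>M N" "\<And>s. 0 \<le> s ==> \<alpha> s = \<beta> s"
 shows "\<alpha> \<in> restrict_space borel {0::real..} \<rightarrow>\<^sub>M N"
proof -
 have "\<beta> \<in> restrict_space borel {0..} \<rightarrow>\<^sub>M N" using assms(1) by (rule measurable_restrict_space1)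
 then show ?thesis
  by (rule measurable_cong[THEN iffD1, rotated]) (use assms(2) in \<open>auto simp: space_restrict_space\<close>)
qed

lemma control_shift:
 assumes "\<alpha> \<in> restrict_space borel {0::real..} \<rightarrow>\<^sub>M N" "0 \<le> t0"
 shows "(\<lambda>s. \<alpha> (s + t0)) \<in> restrict_space borel {0..} \<rightarrow>\<^sub>M N"
proof (rule control_restrict)
 show "(\<lambda>s. \<alpha> (max 0 (s + t0))) \<in> borel \<rightarrow>\<^sub>M N"
  by (rule measurable_compose[OF _ control_total[OF assms(1)]]) simp
qed (use assms(2) in auto)

lemma control_concat:
 assumes "\<alpha> \<in> restrict_space borel {0::real..} \<rightarrow>\<^sub>M N" "\<beta> \<in> restrict_space borel {0..} \<rightarrow>\<^sub>M N" "0 \<le> t0"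
 shows "(\<lambda>s. if s < t0 then \<alpha> s else \<beta> (s - t0)) \<in> restrict_space borel {0..} \<rightarrow>\<^sub>M N"
proof (rule control_restrict)
 show "(\<lambda>s. if s < t0 then \<alpha> (max 0 s) else \<beta> (max 0 (s - t0))) \<in> borel \<rightarrow>\<^sub>M N"
  by (intro measurable_If control_total assms measurable_compose[OF _ control_total[OF assms(2)]]) auto
qed (use assms(3) in auto)

text \<open>All bounds are uniform over the control set: for compact \<open>A\<close> the powers of
  the control are absorbed in the constants, for unbounded \<open>A\<close> the extended controls
  are bounded. The control type is left open because the instances include a ball, a box with an
  extra time component, and time-reversed systems.\<close>

locale csys =
 fixes K :: "'c::euclidean_space set" and f :: "'x::euclidean_space \<Rightarrow> 'c \<Rightarrow> 'x" and l :: "'x \<Rightarrow> 'c \<Rightarrow> real"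
  and M :: real and B L :: "real \<Rightarrow> real"
 assumes K: "compact K" "K \<noteq> {}"
  and f_cont: "continuous_on (UNIV \<times> K) (\<lambda>(x, a). f x a)"
  and l_cont: "continuous_on (UNIV \<times> K) (\<lambda>(x, a). l x a)"
  and M_nonneg: "0 \<le> M" and L_nonneg: "0 \<le> L R"
  and growth: "a \<in> K ==> norm (f x a) \<le> M * (1 + norm x)"
  and f_bound: "a \<in> K ==> norm x \<le> R ==> norm (f x a) \<le> B R"
  and l_bound: "a \<in> K ==> norm x \<le> R ==> l x a \<le> B R"
  and f_lip: "a \<in> K ==> norm x \<le> R ==> norm y \<le> R ==> norm (f x a - f y a) \<le> L R * norm (x - y)"
  and l_lip: "a \<in> K ==> norm x \<le> R ==> norm y \<le> R ==> \<bar>l x a - l y a\<bar> \<le> L R * norm (x - y)"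
  and l_nonneg: "a \<in> K ==> 0 \<le> l x a"
begin

definition ctrls :: "(real \<Rightarrow> 'c) set" where
 "ctrls = restrict_space borel {0..} \<rightarrow>\<^sub>M restrict_space borel K"

definition FF :: "(real \<Rightarrow> 'c) \<Rightarrow> real \<Rightarrow> 'x \<Rightarrow> 'x" where "FF \<alpha> = (\<lambda>s z. f z (\<alpha> s))"
definition LL :: "(real \<Rightarrow> 'c) \<Rightarrow> real \<Rightarrow> 'x \<Rightarrow> real" where "LL \<alpha> = (\<lambda>s z. l z (\<alpha> s))"

abbreviation "traj \<alpha> x \<equiv> flow (FF \<alpha>) x"
abbreviation "run \<alpha> x t \<equiv> rc (FF \<alpha>) (LL \<alpha>) x t"
abbreviation "J \<alpha> x \<equiv> pcost (FF \<alpha>) (LL \<alpha>) {0..} x"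

definition V :: "'x \<Rightarrow> ereal" where "V x = (INF \<alpha>\<in>ctrls. J \<alpha> x)"
definition Sig :: "'x \<Rightarrow> ereal" where "Sig x = (SUP t\<in>{0<..}. INF \<alpha>\<in>ctrls. pcost (FF \<alpha>) (LL \<alpha>) {0..t} x)"
definition Ham :: "'x \<Rightarrow> 'x \<Rightarrow> real" where "Ham x p = (SUP a\<in>K. - (f x a \<bullet> p) - l x a)"

lemma ctrls_in: "\<alpha> \<in> ctrls ==> 0 \<le> t ==> \<alpha> t \<in> K"
 unfolding ctrls_def by (auto dest!: measurable_space simp: space_restrict_space)

lemma const_ctrl: "a \<in> K ==> (\<lambda>_. a) \<in> ctrls"
 unfolding ctrls_def by (rule measurable_const) (simp add: space_restrict_space)

lemma lfield_ctrl:
 fixes g :: "'x \<Rightarrow> 'c \<Rightarrow> 'y::euclidean_space"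
 assumes \<alpha>: "\<alpha> \<in> ctrls" and c: "continuous_on (UNIV \<times> K) (\<lambda>(x, a). g x a)"
  and "\<And>R a x. a \<in> K ==> norm x \<le> R ==> norm (g x a) \<le> B' R"
  and "\<And>R a x y. a \<in> K ==> norm x \<le> R ==> norm y \<le> R ==> norm (g x a - g y a) \<le> L' R * norm (x - y)"
  and "\<And>R. 0 \<le> L' R"
 shows "lfield B' L' (\<lambda>s z. g z (\<alpha> s))" unfolding lfield_def
proof (intro conjI allI impI)
 fix x
 have "continuous_on K (g x)"
  by (rule continuous_on_compose2[OF c, of _ "\<lambda>a. (x, a)", simplified]) (auto intro!: continuous_intros)
 then have "g x \<in> borel_measurable (restrict_space borel K)"
  by (rule borel_measurable_continuous_on_restrict)
 then have "(\<lambda>s. g x (\<alpha> s)) \<in> borel_measurable (restrict_space borel {0..})"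
  using \<alpha> unfolding ctrls_def by (rule measurable_compose[rotated])
 then show "set_borel_measurable borel {0..} (\<lambda>t. g x (\<alpha> t))"
  unfolding set_borel_measurable_def by (subst (asm) borel_measurable_restrict_space_iff) auto
qed (use assms ctrls_in[OF \<alpha>] in auto)

lemma adm_ctrl:
 assumes \<alpha>: "\<alpha> \<in> ctrls"
 shows "adm M B L (FF \<alpha>) (LL \<alpha>)"
proof
 show "lfield B L (FF \<alpha>)" unfolding FF_def by (rule lfield_ctrl[OF \<alpha> f_cont f_bound f_lip L_nonneg])
 show "lfield B L (LL \<alpha>)" unfolding LL_def
  by (rule lfield_ctrl[OF \<alpha> l_cont]) (use l_bound l_nonneg l_lip L_nonneg in auto)
 show "lin_growth M (FF \<alpha>)"
  unfolding FF_def lin_growth_def using M_nonneg growth ctrls_in[OF \<alpha>] by auto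
 show "0 \<le> LL \<alpha> t x" if "0 \<le> t" for t x unfolding LL_def using l_nonneg ctrls_in[OF \<alpha> that] .
qed

section \<open>Dynamic programming\<close>

lemma V_nonneg: "0 \<le> V x" unfolding V_def by (rule INF_greatest) (rule pcost_nonneg)

lemma V_le_J: "\<alpha> \<in> ctrls ==> V x \<le> J \<alpha> x" unfolding V_def by (rule INF_lower)

lemma ctrls_shift: "\<alpha> \<in> ctrls ==> 0 \<le> t0 ==> (\<lambda>s. \<alpha> (s + t0)) \<in> ctrls"
 unfolding ctrls_def by (rule control_shift)

definition cat :: "real \<Rightarrow> (real \<Rightarrow> 'c) \<Rightarrow> (real \<Rightarrow> 'c) \<Rightarrow> real \<Rightarrow> 'c" where
 "cat t0 \<alpha> \<beta> = (\<lambda>s. if s < t0 then \<alpha> s else \<beta> (s - t0))"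

lemma ctrls_cat: "\<alpha> \<in> ctrls ==> \<beta> \<in> ctrls ==> 0 \<le> t0 ==> cat t0 \<alpha> \<beta> \<in> ctrls"
 unfolding ctrls_def cat_def by (rule control_concat)

lemma cat_props:
 assumes "\<alpha> \<in> ctrls" "\<beta> \<in> ctrls" and t0: "0 \<le> t0"
 shows "0 \<le> t ==> t \<le> t0 ==> traj (cat t0 \<alpha> \<beta>) x t = traj \<alpha> x t"
  and "0 \<le> t ==> t \<le> t0 ==> run (cat t0 \<alpha> \<beta>) x t = run \<alpha> x t"
  and "0 \<le> t ==> traj (cat t0 \<alpha> \<beta>) x (t0 + t) = traj \<beta> (traj \<alpha> x t0) t"
  and "0 \<le> t ==> run (cat t0 \<alpha> \<beta>) x (t0 + t) = run \<alpha> x t0 + run \<beta> (traj \<alpha> x t0) t"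
  and "J (cat t0 \<alpha> \<beta>) x = ereal (run \<alpha> x t0) + J \<beta> (traj \<alpha> x t0)"
proof -
 have e: "(\<lambda>t. if t < t0 then FF \<alpha> t else FF \<beta> (t - t0)) = FF (cat t0 \<alpha> \<beta>)"
  "(\<lambda>t. if t < t0 then LL \<alpha> t else LL \<beta> (t - t0)) = LL (cat t0 \<alpha> \<beta>)"
  by (auto simp: FF_def LL_def cat_def fun_eq_iff)
 note c = adm_concat[OF adm_ctrl[OF assms(1)] adm_ctrl[OF assms(2)] t0, unfolded e]
 show "0 \<le> t ==> t \<le> t0 ==> traj (cat t0 \<alpha> \<beta>) x t = traj \<alpha> x t"
  "0 \<le> t ==> t \<le> t0 ==> run (cat t0 \<alpha> \<beta>) x t = run \<alpha> x t"
  "0 \<le> t ==> traj (cat t0 \<alpha> \<beta>) x (t0 + t) = traj \<beta> (traj \<alpha> x t0) t"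
  "0 \<le> t ==> run (cat t0 \<alpha> \<beta>) x (t0 + t) = run \<alpha> x t0 + run \<beta> (traj \<alpha> x t0) t"
  "J (cat t0 \<alpha> \<beta>) x = ereal (run \<alpha> x t0) + J \<beta> (traj \<alpha> x t0)" using c(2-6) by auto
qed

lemma V_dpp_le:
 assumes \<alpha>: "\<alpha> \<in> ctrls" and t0: "0 \<le> t0"
 shows "V x \<le> ereal (run \<alpha> x t0) + V (traj \<alpha> x t0)"
proof -
 have "V x - ereal (run \<alpha> x t0) \<le> V (traj \<alpha> x t0)" unfolding V_def[of "traj \<alpha> x t0"]
 proof (rule INF_greatest)
  fix \<beta> assume \<beta>: "\<beta> \<in> ctrls"
  have "V x \<le> ereal (run \<alpha> x t0) + J \<beta> (traj \<alpha> x t0)"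
   using V_le_J[OF ctrls_cat[OF \<alpha> \<beta> t0], of x] cat_props(5)[OF \<alpha> \<beta> t0, of x] by simp
  then show "V x - ereal (run \<alpha> x t0) \<le> J \<beta> (traj \<alpha> x t0)"
   by (cases "V x"; cases "J \<beta> (traj \<alpha> x t0)") (auto simp: algebra_simps)
 qed
 then show ?thesis by (cases "V x"; cases "V (traj \<alpha> x t0)") (auto simp: algebra_simps)
qed

lemma shift_props:
 assumes \<alpha>: "\<alpha> \<in> ctrls" and t0: "0 \<le> t0"
 shows "J \<alpha> x = ereal (run \<alpha> x t0) + J (\<lambda>s. \<alpha> (s + t0)) (traj \<alpha> x t0)"
  and "0 \<le> t ==> traj (\<lambda>s. \<alpha> (s + t0)) (traj \<alpha> x t0) t = traj \<alpha> x (t + t0)"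
  and "0 \<le> t ==> run \<alpha> x (t0 + t) = run \<alpha> x t0 + run (\<lambda>s. \<alpha> (s + t0)) (traj \<alpha> x t0) t"
proof -
 interpret adm M B L "FF \<alpha>" "LL \<alpha>" by (rule adm_ctrl[OF \<alpha>])
 have e: "(\<lambda>t. FF \<alpha> (t + t0)) = FF (\<lambda>s. \<alpha> (s + t0))" "(\<lambda>t. LL \<alpha> (t + t0)) = LL (\<lambda>s. \<alpha> (s + t0))"
  by (auto simp: FF_def LL_def fun_eq_iff)
 show "J \<alpha> x = ereal (run \<alpha> x t0) + J (\<lambda>s. \<alpha> (s + t0)) (traj \<alpha> x t0)"
  using pcost_split[OF t0, of x] e by simp
 show "0 \<le> t ==> traj (\<lambda>s. \<alpha> (s + t0)) (traj \<alpha> x t0) t = traj \<alpha> x (t + t0)"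
  using flow_shift[OF F lg t0, of t x] e by simp
 show "0 \<le> t ==> run \<alpha> x (t0 + t) = run \<alpha> x t0 + run (\<lambda>s. \<alpha> (s + t0)) (traj \<alpha> x t0) t"
  using rc_shift[OF t0, of t x] e by simp
qed

lemma V_dpp_ge:
 assumes \<alpha>: "\<alpha> \<in> ctrls" and t0: "0 \<le> t0"
 shows "ereal (run \<alpha> x t0) + V (traj \<alpha> x t0) \<le> J \<alpha> x"
 unfolding shift_props(1)[OF \<alpha> t0] by (intro add_left_mono V_le_J ctrls_shift \<alpha> t0)

lemma near_optimal:
 assumes "V x < \<infinity>" "0 < e"
 obtains \<alpha> where "\<alpha> \<in> ctrls" "J \<alpha> x \<le> V x + ereal e"
proof -
 have "V x < V x + ereal e" using assms V_nonneg[of x] by (cases "V x") auto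
 then obtain \<alpha> where "\<alpha> \<in> ctrls" "J \<alpha> x < V x + ereal e" unfolding V_def INF_less_iff by blast
 then show ?thesis using that by force
qed

lemma f_cont_a: "continuous_on K (f x)" and l_cont_a: "continuous_on K (l x)"
proof -
 have "continuous_on K (\<lambda>a. (x, a))" by (intro continuous_intros)
 then show "continuous_on K (f x)" "continuous_on K (l x)"
  using continuous_on_compose2[OF f_cont, of K "\<lambda>a. (x, a)"] continuous_on_compose2[OF l_cont, of K "\<lambda>a. (x, a)"]
  by auto
qed

lemma Ham_attained:
 obtains a where "a \<in> K" "Ham x p = - (f x a \<bullet> p) - l x a" "\<And>b. b \<in> K ==> - (f x b \<bullet> p) - l x b \<le> Ham x p"
proof -
 have "continuous_on K (\<lambda>a. - (f x a \<bullet> p) - l x a)" by (intro continuous_intros f_cont_a l_cont_a)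
 from continuous_attains_sup[OF K this] obtain a
  where a: "a \<in> K" "\<And>b. b \<in> K ==> - (f x b \<bullet> p) - l x b \<le> - (f x a \<bullet> p) - l x a" by blast
 then have "Ham x p = - (f x a \<bullet> p) - l x a" unfolding Ham_def by (intro cSup_eq_maximum) auto
 with a show ?thesis by (intro that[of a]) auto
qed

lemma Ham_ge: "a \<in> K ==> - (f x a \<bullet> p) - l x a \<le> Ham x p" using Ham_attained[of x p] by metis

end

section \<open>Viscosity sub- and supersolutions\<close>

lemma integral_norm_le_const:
 fixes g :: "real \<Rightarrow> 'x::euclidean_space"
 assumes "g integrable_on {a..b}" "\<And>s. a \<le> s ==> s \<le> b ==> norm (g s) \<le> c" "a \<le> b"
 shows "norm (integral {a..b} g) \<le> c * (b - a)"
proof -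
 have "0 \<le> c" using assms(2)[of a] assms(3) norm_ge_zero order_trans by blast
 then show ?thesis using integrable_bound[of c g a b] assms by (auto simp: content_real)
qed

context adm
begin

lemma const_integrable:
 assumes "0 \<le> a"
 shows "(\<lambda>s. F s z) integrable_on {a..b}" "(\<lambda>s. ell s z) integrable_on {a..b}"
 using set_integrable_imp_HK(1)[OF lfield_integrable_comp[OF F continuous_on_const assms]]
  set_integrable_imp_HK(1)[OF lfield_integrable_comp[OF ell continuous_on_const assms]] by auto

text \<open>The fields are frozen at a point \<open>z\<close> off the trajectory, since viscosity
  inequalities hold at contact points and not at trajectory points. The price is the distance from
  \<open>z\<close> to \<open>y\<close> in the error; the extra 1 in \<open>R\<close> leaves room for
  contact points at distance up to 1.\<close>

lemma step_estimates:
 assumes y: "norm y \<le> r" and h: "0 \<le> h" "h \<le> 1"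
 defines "R \<equiv> rb M r 1 + 1" and "C \<equiv> M * (1 + rb M r 1)"
 assumes z: "norm z \<le> R"
 shows "norm (flow F y h - y) \<le> C * h"
  and "norm (flow F y h - y - integral {0..h} (\<lambda>s. F s z)) \<le> L R * (norm (z - y) + C * h) * h"
  and "\<bar>rc F ell y h - integral {0..h} (\<lambda>s. ell s z)\<bar> \<le> L R * (norm (z - y) + C * h) * h"
proof -
 have C0: "0 \<le> C" unfolding C_def using M0 y rb_ge[of M r 1] norm_ge_zero[of y]
  by (intro mult_nonneg_nonneg) linarith+
 have d: "norm (flow F y s - y) \<le> C * s" if "0 \<le> s" "s \<le> h" for s
  using flow_lipschitz[of 0 s 1 y r] that h y unfolding C_def by simp
 show "norm (flow F y h - y) \<le> C * h" using d[of h] h by simp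
 have b: "norm (flow F y s) \<le> R" if "0 \<le> s" "s \<le> h" for s
  using flow_bound'[of s 1 y r] that h y unfolding R_def by simp
 have dz: "norm (flow F y s - z) \<le> norm (z - y) + C * h" if "0 \<le> s" "s \<le> h" for s
 proof -
  have "norm (flow F y s - z) \<le> norm (flow F y s - y) + norm (y - z)"
   using norm_triangle_ineq[of "flow F y s - y" "y - z"] by simp
  also have "\<dots> \<le> C * h + norm (z - y)"
   using d[OF that] C0 that mult_left_mono[of s h C] by (simp add: norm_minus_commute)
  finally show ?thesis by simp
 qed
 have est: "L R * norm (flow F y s - z) \<le> L R * (norm (z - y) + C * h)" if "0 \<le> s" "s \<le> h" for s
  by (intro mult_left_mono dz that lfieldD(2)[OF F])
 have fi: "(\<lambda>s. F s (flow F y s)) integrable_on {0..h}" using solon_diff(2)[OF flow_solon[of h y]] h by simp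
 have "flow F y h - y - integral {0..h} (\<lambda>s. F s z) = integral {0..h} (\<lambda>s. F s (flow F y s) - F s z)"
  using solon_diff(1)[OF flow_solon[of h y], of 0 h] h
  by (subst HK_integral_diff) (auto intro: fi const_integrable)
 moreover have "norm (integral {0..h} (\<lambda>s. F s (flow F y s) - F s z)) \<le> L R * (norm (z - y) + C * h) * (h - 0)"
 proof (rule integral_norm_le_const)
  fix s assume s: "0 \<le> s" "s \<le> h"
  show "norm (F s (flow F y s) - F s z) \<le> L R * (norm (z - y) + C * h)"
   by (rule order_trans[OF lfieldD(4)[OF F s(1) b[OF s] z] est[OF s]])
 qed (auto intro!: HK_integrable_diff fi const_integrable h)
 ultimately show "norm (flow F y h - y - integral {0..h} (\<lambda>s. F s z)) \<le> L R * (norm (z - y) + C * h) * h"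
  by simp
 have "rc F ell y h - integral {0..h} (\<lambda>s. ell s z) = integral {0..h} (\<lambda>s. ell s (flow F y s) - ell s z)"
  unfolding rc_def by (subst HK_integral_diff) (auto intro: ell_integrable_HK const_integrable)
 moreover have "norm (integral {0..h} (\<lambda>s. ell s (flow F y s) - ell s z)) \<le> L R * (norm (z - y) + C * h) * (h - 0)"
 proof (rule integral_norm_le_const)
  fix s assume s: "0 \<le> s" "s \<le> h"
  show "norm (ell s (flow F y s) - ell s z) \<le> L R * (norm (z - y) + C * h)"
   by (rule order_trans[OF lfieldD(4)[OF ell s(1) b[OF s] z] est[OF s]])
 qed (auto intro!: HK_integrable_diff ell_integrable_HK const_integrable h)
 ultimately show "\<bar>rc F ell y h - integral {0..h} (\<lambda>s. ell s z)\<bar> \<le> L R * (norm (z - y) + C * h) * h"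
  by simp
qed

end

section \<open>Semicontinuous envelopes and test functions\<close>

lemma lsc_env_le: "lsc_env u x \<le> u x" unfolding lsc_env_def
proof (rule Liminf_least)
 fix P assume "eventually P (nhds x)"
 then have "P x" by (rule eventually_nhds_x_imp_x)
 then show "Inf (u ` Collect P) \<le> u x" by (auto intro: INF_lower)
qed

lemma usc_env_ge: "u x \<le> usc_env u x" unfolding usc_env_def
proof (rule Limsup_greatest)
 fix P assume "eventually P (nhds x)"
 then have "P x" by (rule eventually_nhds_x_imp_x)
 then show "u x \<le> Sup (u ` Collect P)" by (auto intro: SUP_upper)
qed

lemma lsc_env_lsc:
 fixes u :: "'x::topological_space \<Rightarrow> ereal"
 assumes "y < lsc_env u x"
 shows "\<forall>\<^sub>F z in nhds x. y < lsc_env u z"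
proof -
 obtain y' where y': "y < y'" "y' < lsc_env u x" using dense[OF assms] by blast
 then have "\<forall>\<^sub>F z in nhds x. y' < u z" unfolding lsc_env_def using less_LiminfD by blast
 then have "\<forall>\<^sub>F z in nhds x. \<forall>\<^sub>F z' in nhds z. y' < u z'" by (simp add: eventually_eventually)
 then show ?thesis
 proof eventually_elim
  case (elim z)
  have "y' \<le> lsc_env u z" unfolding lsc_env_def
   by (rule Liminf_bounded) (use elim in \<open>auto elim: eventually_mono\<close>)
  then show ?case using y' by simp
 qed
qed

lemma usc_env_usc:
 fixes u :: "'x::topological_space \<Rightarrow> ereal"
 assumes "usc_env u x < y"
 shows "\<forall>\<^sub>F z in nhds x. usc_env u z < y"
proof -
 obtain y' where y': "y' < y" "usc_env u x < y'" using dense[OF assms] by blast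
 then have "\<forall>\<^sub>F z in nhds x. u z < y'" unfolding usc_env_def using Limsup_lessD by blast
 then have "\<forall>\<^sub>F z in nhds x. \<forall>\<^sub>F z' in nhds z. u z' < y'" by (simp add: eventually_eventually)
 then show ?thesis
 proof eventually_elim
  case (elim z)
  have "usc_env u z \<le> y'" unfolding usc_env_def
   by (rule Limsup_bounded) (use elim in \<open>auto elim: eventually_mono\<close>)
  then show ?case using y' by simp
 qed
qed

text \<open>Without a minimum every x has a witness \<open>s x\<close> of smaller value, and
  \<open>g\<close> exceeds \<open>g (s x)\<close> on a neighbourhood of x. Among the finitely many
  neighbourhoods that cover S, the one with the smallest witness gives a contradiction, because that
  witness lies in some neighbourhood of the cover.\<close>

lemma lsc_attains_inf:
 fixes g :: "'x::topological_space \<Rightarrow> 'b::{linorder_topology}"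
 assumes S: "compact S" "S \<noteq> {}"
  and lsc: "\<And>x y. x \<in> S ==> y < g x ==> \<forall>\<^sub>F z in nhds x. y < g z"
 shows "\<exists>x\<in>S. \<forall>z\<in>S. g x \<le> g z"
proof (rule ccontr)
 assume "\<not> ?thesis"
 then have "\<forall>x\<in>S. \<exists>z\<in>S. g z < g x" by (auto simp: not_le)
 then obtain s where s: "\<And>x. x \<in> S ==> s x \<in> S \<and> g (s x) < g x" by metis
 have "\<exists>U. open U \<and> x \<in> U \<and> (\<forall>z\<in>U. g (s x) < g z)" if "x \<in> S" for x
  using lsc[OF that, of "g (s x)"] s[OF that] unfolding eventually_nhds by blast
 then obtain U where U: "\<And>x. x \<in> S ==> open (U x) \<and> x \<in> U x \<and> (\<forall>z\<in>U x. g (s x) < g z)" by metis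
 obtain C where C: "C \<subseteq> S" "finite C" "S \<subseteq> (\<Union>x\<in>C. U x)"
  by (rule compactE_image[OF S(1), of S U]) (use U in auto)
 then have "C \<noteq> {}" using S(2) by auto
 then obtain x where x: "x \<in> C" "\<And>c. c \<in> C ==> g (s x) \<le> g (s c)"
  using arg_min_if_finite(1,2)[OF C(2), of "\<lambda>c. g (s c)"] by (metis not_le)
 have "s x \<in> S" using s x C by auto
 then obtain c where "c \<in> C" "s x \<in> U c" using C by auto
 then have "g (s c) < g (s x)" using U C by blast
 then show False using x(2)[OF \<open>c \<in> C\<close>] by simp
qed

lemma GDERIV_quadratic: "GDERIV (\<lambda>z. c * (norm (z - y))\<^sup>2) z :> (2 * c) *\<^sub>R (z - y)"
proof -
 have "GDERIV (\<lambda>z. c * ((z - y) \<bullet> (z - y))) z :> (2 * c) *\<^sub>R (z - y)" unfolding gderiv_def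
  by (auto intro!: derivative_eq_intros simp: fun_eq_iff inner_commute algebra_simps)
 then show ?thesis by (simp add: power2_norm_eq_inner)
qed

lemma C1_quadratic: "C1_on \<Omega> (\<lambda>z. c * (norm (z - y))\<^sup>2) (\<lambda>z. (2 * c) *\<^sub>R (z - y))"
 unfolding C1_on_def by (auto intro!: GDERIV_quadratic continuous_intros)

context adm
begin

lemma integral_ham:
 assumes h: "0 \<le> h" and c: "\<And>s. 0 \<le> s ==> - (F s z \<bullet> p) - ell s z \<le> c"
 shows "- (integral {0..h} (\<lambda>s. F s z) \<bullet> p) - integral {0..h} (\<lambda>s. ell s z) \<le> c * h"
proof -
 note i = const_integrable[OF order_refl, of z h]
 have ip: "(\<lambda>s. F s z \<bullet> p) integrable_on {0..h}"
  using integrable_linear[OF i(1) bounded_linear_inner_left[of p]] by (simp add: o_def)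
 have e: "integral {0..h} (\<lambda>s. F s z) \<bullet> p = integral {0..h} (\<lambda>s. F s z \<bullet> p)"
  using integral_linear[OF i(1) bounded_linear_inner_left[of p]] by (simp add: o_def)
 have "- (integral {0..h} (\<lambda>s. F s z) \<bullet> p) - integral {0..h} (\<lambda>s. ell s z)
   = integral {0..h} (\<lambda>s. - (F s z \<bullet> p) - ell s z)" unfolding e
  by (subst HK_integral_diff[OF integrable_neg[OF ip] i(2)])
    simp
 also have "\<dots> \<le> integral {0..h} (\<lambda>s. c)" by (rule integral_le)
    (use ip i c in \<open>auto intro!: HK_integrable_diff integrable_neg\<close>)
 finally show ?thesis using h by (simp add: mult.commute)
qed

end

lemma lsc_env_nonneg: "(\<And>x. 0 \<le> u x) ==> 0 \<le> lsc_env u x"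
 unfolding lsc_env_def by (rule Liminf_bounded) simp

lemma lsc_env_approx:
 fixes u :: "'x::metric_space \<Rightarrow> ereal"
 assumes "lsc_env u x < c" "0 < d"
 obtains z where "dist z x < d" "u z < c"
proof -
 have "\<not> (\<forall>\<^sub>F z in nhds x. c \<le> u z)"
  using assms(1) Liminf_bounded[of c u "nhds x"] unfolding lsc_env_def by auto
 moreover have "\<forall>\<^sub>F z in nhds x. dist z x < d" using assms(2) by (auto simp: eventually_nhds_metric)
 ultimately have "\<exists>z. dist z x < d \<and> u z < c" by (metis (mono_tags, lifting) eventually_mono not_le)
 then show ?thesis using that by blast
qed

text \<open>Mean value inequality for \<phi> minus its linear part at x. Both points may vary,
  because the displacements to be estimated start at a point that only approximates the contact
  point.\<close>

lemma C1_on_linearization: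
 fixes \<phi> :: "'x::euclidean_space \<Rightarrow> real"
 assumes C1: "C1_on \<Omega> \<phi> D" and x: "x \<in> \<Omega>" "open \<Omega>" and e: "0 < e"
 obtains d where "0 < d" "ball x d \<subseteq> \<Omega>"
  "\<And>z z'. z \<in> ball x d ==> z' \<in> ball x d ==> \<bar>\<phi> z' - \<phi> z - D x \<bullet> (z' - z)\<bar> \<le> e * norm (z' - z)"
proof -
 have "continuous (at x) D" using C1 x by (auto simp: C1_on_def continuous_on_eq_continuous_at)
 then obtain d1 where d1: "0 < d1" "\<And>z. dist z x < d1 ==> dist (D z) (D x) < e"
  using e unfolding continuous_at_eps_delta by blast
 obtain d2 where d2: "0 < d2" "ball x d2 \<subseteq> \<Omega>" using x by (meson openE)
 define d where "d = min d1 d2"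
 have sub: "ball x d \<subseteq> \<Omega>" using d2 by (auto simp: d_def)
 show ?thesis
 proof (rule that[of d])
  show "0 < d" using d1 d2 by (simp add: d_def)
  show "ball x d \<subseteq> \<Omega>" by fact
  fix z z' assume z: "z \<in> ball x d" and z': "z' \<in> ball x d"
  have "norm ((\<phi> z' - D x \<bullet> z') - (\<phi> z - D x \<bullet> z)) \<le> e * norm (z' - z)"
  proof (rule differentiable_bound[where S = "ball x d" and f' = "\<lambda>z h. h \<bullet> D z - D x \<bullet> h"])
   fix \<zeta> assume \<zeta>: "\<zeta> \<in> ball x d"
   then have "GDERIV \<phi> \<zeta> :> D \<zeta>" using C1 sub by (auto simp: C1_on_def)
   then have "(\<phi> has_derivative (\<lambda>h. h \<bullet> D \<zeta>)) (at \<zeta>)" by (simp add: gderiv_def)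
   then show "((\<lambda>z. \<phi> z - D x \<bullet> z) has_derivative (\<lambda>h. h \<bullet> D \<zeta> - D x \<bullet> h)) (at \<zeta> within ball x d)"
    by (rule has_derivative_diff[OF has_derivative_at_withinI
       bounded_linear.has_derivative[OF bounded_linear_inner_right has_derivative_ident]])
   have "(\<lambda>h. h \<bullet> D \<zeta> - D x \<bullet> h) = (\<lambda>h. h \<bullet> (D \<zeta> - D x))"
    by (auto simp: inner_diff_right inner_commute)
   moreover have "onorm (\<lambda>h. h \<bullet> (D \<zeta> - D x)) \<le> norm (D \<zeta> - D x)"
    by (rule onorm_bound) (auto simp: mult.commute Cauchy_Schwarz_ineq2)
   moreover have "norm (D \<zeta> - D x) < e" using d1(2)[of \<zeta>] \<zeta> by (auto simp: d_def dist_norm norm_minus_commute)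
   ultimately show "onorm (\<lambda>h. h \<bullet> D \<zeta> - D x \<bullet> h) \<le> e" by simp
  qed (use z z' in auto)
  then show "\<bar>\<phi> z' - \<phi> z - D x \<bullet> (z' - z)\<bar> \<le> e * norm (z' - z)"
   by (simp add: inner_diff_right algebra_simps)
 qed
qed

context csys
begin

text \<open>The hypothesis speaks of fields instead of controls so that relaxed controls are
  covered. If the Hamiltonian were negative at the contact point, the cost plus the increase of
  \<phi> over a short time h would be at least a fixed multiple of h along every such field, whereas
  almost optimality bounds it by a smaller multiple.\<close>

lemma dpp_supersolution:
 assumes W0: "\<And>x. 0 \<le> W x"
  and dpp: "\<And>x e. W x < \<infinity> ==> 0 < e ==> \<exists>F ell. adm M B L F ell \<and>
    (\<forall>t\<ge>0. \<forall>z p. - (F t z \<bullet> p) - ell t z \<le> Ham z p) \<and>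
    (\<forall>h\<ge>0. ereal (rc F ell x h) + W (flow F x h) \<le> W x + ereal e)"
 shows "viscosity_supersolution Ham W" unfolding viscosity_supersolution_def disj_imp
proof (intro allI impI)
 fix x0 \<phi> D
 assume fin: "lsc_env W x0 \<noteq> \<infinity>"
  and "C1_on UNIV \<phi> D \<and> (\<forall>\<^sub>F z in nhds x0. lsc_env W x0 - ereal (\<phi> x0) \<le> lsc_env W z - ereal (\<phi> z))"
 then have C1: "C1_on UNIV \<phi> D"
  and ev: "\<forall>\<^sub>F z in nhds x0. lsc_env W x0 - ereal (\<phi> x0) \<le> lsc_env W z - ereal (\<phi> z)" by auto
 obtain w0 where w0: "lsc_env W x0 = ereal w0"
  using fin lsc_env_nonneg[of W x0, OF W0] by (cases "lsc_env W x0") auto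
 define p where "p = D x0"
 show "0 \<le> Ham x0 (D x0)"
 proof (rule ccontr)
  assume "\<not> 0 \<le> Ham x0 (D x0)"
  \<comment> \<open>Six units of size k h are gained, and five are lost: almost optimality,
    approximation of the lower envelope, linearization of \<phi>, passage from x0 to z0 in \<phi>,
    and freezing of the fields.\<close>
  define k where "k = - Ham x0 p / 6"
  have k: "0 < k" "Ham x0 p = - 6 * k" using \<open>\<not> 0 \<le> _\<close> by (auto simp: k_def p_def)
  define r where "r = norm x0 + 1"
  define R where "R = rb M r 1 + 1"
  define C where "C = M * (1 + rb M r 1)"
  have r0: "0 \<le> r" by (simp add: r_def)
  have rR: "r < R" using rb_ge[OF M_nonneg r0, of 1] by (simp add: R_def)
  have C0: "0 \<le> C" unfolding C_def using M_nonneg rb_ge[OF M_nonneg r0, of 1] r0 by simp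
  define \<eta> where "\<eta> = k / (C + 1)"
  have \<eta>: "0 < \<eta>" "\<eta> * C \<le> k" using k C0 by (auto simp: \<eta>_def field_simps)
  obtain d1 where d1: "0 < d1" "\<And>z z'. z \<in> ball x0 d1 ==> z' \<in> ball x0 d1 ==>
    \<bar>\<phi> z' - \<phi> z - p \<bullet> (z' - z)\<bar> \<le> \<eta> * norm (z' - z)"
   using C1_on_linearization[OF C1 UNIV_I open_UNIV \<eta>(1), of x0] unfolding p_def by metis
  obtain d2 where d2: "0 < d2" "\<And>z. dist z x0 < d2 ==> lsc_env W x0 - ereal (\<phi> x0) \<le> lsc_env W z - ereal (\<phi> z)"
   using ev unfolding eventually_nhds_metric by blast
  define d where "d = min d1 d2"
  have d: "0 < d" using d1 d2 by (simp add: d_def)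
  define Q where "Q = (1 + norm p) * L R * (1 + C) + 1"
  have Q: "1 \<le> Q" unfolding Q_def using L_nonneg C0 by simp
  define h where "h = min 1 (min (d / (2 * (C + 1))) (k / Q))"
  have h: "0 < h" "h \<le> 1" using d C0 Q k by (auto simp: h_def)
  have hd: "C * h < d / 2"
  proof -
   have "(C + 1) * h \<le> (C + 1) * (d / (2 * (C + 1)))" using C0 by (intro mult_left_mono) (auto simp: h_def)
   also have "\<dots> = d / 2" using C0 by (simp add: field_simps)
   finally show ?thesis using h by (simp add: algebra_simps)
  qed
  have hQ: "(1 + norm p) * (L R * (1 + C)) * h \<le> k"
  proof -
   have "Q * h \<le> Q * (k / Q)" using Q by (intro mult_left_mono) (auto simp: h_def)
   then have "Q * h \<le> k" using Q by simp
   then show ?thesis using h unfolding Q_def by (simp add: algebra_simps)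
  qed
  \<comment> \<open>The starting point z0 is chosen after the time step, because its distance to x0
    has to be small compared with h.\<close>
  define \<zeta> where "\<zeta> = min (min (d / 2) 1) (min h (h * k / (norm p + \<eta> + 1)))"
  have np: "0 < norm p + \<eta> + 1" using \<eta>(1) norm_ge_zero[of p] by linarith
  have "0 < h * k / (norm p + \<eta> + 1)" using h k np by simp
  then have \<zeta>: "0 < \<zeta>" using d h by (simp add: \<zeta>_def)
  have \<zeta>p: "(norm p + \<eta>) * \<zeta> \<le> h * k"
  proof -
   have "(norm p + \<eta>) * \<zeta> \<le> (norm p + \<eta> + 1) * (h * k / (norm p + \<eta> + 1))"
    by (rule mult_mono) (use \<zeta> np in \<open>simp_all add: \<zeta>_def\<close>)
   also have "\<dots> = h * k" using np by simp
   finally show ?thesis .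
  qed
  have "lsc_env W x0 < ereal (w0 + h * k)" using w0 h k by simp
  from lsc_env_approx[OF this \<zeta>] obtain z0 where z0: "dist z0 x0 < \<zeta>" "W z0 < ereal (w0 + h * k)" .
  have "W z0 < \<infinity>" using z0 by auto
  from dpp[OF this, of "h * k"] h k obtain F ell where adm: "adm M B L F ell"
   and ham: "\<And>t z p. 0 \<le> t ==> - (F t z \<bullet> p) - ell t z \<le> Ham z p"
   and dp: "\<And>h'. 0 \<le> h' ==> ereal (rc F ell z0 h') + W (flow F z0 h') \<le> W z0 + ereal (h * k)"
   by auto
  interpret adm M B L F ell by fact
  define y where "y = flow F z0 h"
  have nz0: "norm (z0 - x0) < \<zeta>" using z0 by (simp add: dist_norm)
  have z0r: "norm z0 \<le> r" using nz0 norm_triangle_ineq[of "z0 - x0" x0] by (simp add: r_def \<zeta>_def)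
  have x0R: "norm x0 \<le> rb M r 1 + 1" using rR by (simp add: r_def R_def)
  note st = step_estimates[OF z0r less_imp_le[OF h(1)] h(2) x0R, folded R_def C_def y_def]
  have yd: "y \<in> ball x0 d" "z0 \<in> ball x0 d" "x0 \<in> ball x0 d"
  proof -
   show "z0 \<in> ball x0 d" using z0 d by (simp add: dist_commute \<zeta>_def)
   have "norm (y - x0) \<le> norm (y - z0) + norm (z0 - x0)" using norm_triangle_ineq[of "y - z0" "z0 - x0"] by simp
   also have "\<dots> < d / 2 + d / 2" using st(1) hd nz0 by (intro add_strict_mono) (auto simp: \<zeta>_def)
   finally show "y \<in> ball x0 d" by (simp add: dist_norm norm_minus_commute)
  qed (use d in simp)
  have "ereal (w0 - \<phi> x0) \<le> lsc_env W y - ereal (\<phi> y)"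
   using d2(2)[of y] yd(1) w0 by (simp add: d_def dist_commute)
  then have "ereal (w0 - \<phi> x0 + \<phi> y) \<le> lsc_env W y" by (cases "lsc_env W y") auto
  also have "\<dots> \<le> W y" by (rule lsc_env_le)
  finally have "ereal (rc F ell z0 h) + ereal (w0 - \<phi> x0 + \<phi> y) \<le> ereal (rc F ell z0 h) + W y"
   by (rule add_left_mono)
  also have "\<dots> \<le> W z0 + ereal (h * k)" using dp[of h] h by (simp add: y_def)
  also have "\<dots> \<le> ereal (w0 + h * k) + ereal (h * k)" by (intro add_right_mono less_imp_le[OF z0(2)])
  finally have m: "rc F ell z0 h + \<phi> y - \<phi> x0 \<le> 2 * (h * k)" by simp
  have p1: "\<phi> y - \<phi> z0 \<ge> p \<bullet> (y - z0) - k * h"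
  proof -
   have "\<eta> * norm (y - z0) \<le> \<eta> * (C * h)" using st(1) \<eta> by (intro mult_left_mono) auto
   also have "\<dots> \<le> k * h" using mult_right_mono[OF \<eta>(2), of h] h by (simp add: algebra_simps)
   finally show ?thesis using d1(2)[of z0 y] yd by (simp add: d_def)
  qed
  have p2: "\<phi> z0 - \<phi> x0 \<ge> - (h * k)"
  proof -
   have "\<bar>p \<bullet> (z0 - x0)\<bar> + \<eta> * norm (z0 - x0) \<le> (norm p + \<eta>) * norm (z0 - x0)"
    using Cauchy_Schwarz_ineq2[of p "z0 - x0"] by (simp add: algebra_simps)
   also have "\<dots> \<le> (norm p + \<eta>) * \<zeta>" using nz0 \<eta> by (intro mult_left_mono) auto
   also note \<zeta>p
   finally show ?thesis using d1(2)[of x0 z0] yd by (simp add: d_def)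
  qed
  define G where "G = integral {0..h} (\<lambda>s. F s x0)"
  define \<Lambda> where "\<Lambda> = integral {0..h} (\<lambda>s. ell s x0)"
  have I: "- (G \<bullet> p) - \<Lambda> \<le> - 6 * k * h" unfolding G_def \<Lambda>_def
  proof (rule integral_ham)
   show "- (F s x0 \<bullet> p) - ell s x0 \<le> - 6 * k" if "0 \<le> s" for s
    using ham[OF that, of x0 p] k(2) by linarith
  qed (use h in linarith)
  define E where "E = L R * (norm (x0 - z0) + C * h) * h"
  have "norm (x0 - z0) \<le> h" using nz0 by (simp add: norm_minus_commute \<zeta>_def)
  then have "L R * (norm (x0 - z0) + C * h) * h \<le> L R * (h + C * h) * h"
   using L_nonneg h by (intro mult_right_mono mult_left_mono) auto
  then have E: "(1 + norm p) * E \<le> (1 + norm p) * (L R * (h + C * h) * h)"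
   unfolding E_def by (intro mult_left_mono) auto
  have "(1 + norm p) * (L R * (h + C * h) * h) = ((1 + norm p) * (L R * (1 + C)) * h) * h" by algebra
  also have "\<dots> \<le> k * h" using hQ h by (intro mult_right_mono) auto
  finally have E2: "(1 + norm p) * E \<le> k * h" using E by simp
  have "p \<bullet> (y - z0) = p \<bullet> G + p \<bullet> (y - z0 - G)" by (simp add: inner_diff_right)
  moreover have "\<bar>p \<bullet> (y - z0 - G)\<bar> \<le> norm p * E"
   using Cauchy_Schwarz_ineq2[of p "y - z0 - G"] mult_left_mono[OF st(2), of "norm p"]
   unfolding E_def G_def by simp
  moreover have "\<bar>rc F ell z0 h - \<Lambda>\<bar> \<le> E" using st(3) unfolding E_def \<Lambda>_def by simp
  moreover have "(1 + norm p) * E = E + norm p * E" by (simp add: distrib_right)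
  ultimately have "rc F ell z0 h + p \<bullet> (y - z0) \<ge> 6 * k * h - (1 + norm p) * E"
   using I inner_commute[of G p] by linarith
  then have "6 * k * h - k * h \<le> rc F ell z0 h + p \<bullet> (y - z0)" using E2 by linarith
  then have "5 * (k * h) \<le> rc F ell z0 h + p \<bullet> (y - z0)" by linarith
  then have "5 * (k * h) \<le> 4 * (k * h)" using m p1 p2 mult.commute[of h k] by linarith
  then show False using mult_pos_pos[OF k(1) h(1)] by linarith
 qed
qed

end

section \<open>Supersolutions dominate the finite-horizon values\<close>

lemma lsc_add:
 fixes w :: "'x::metric_space \<Rightarrow> ereal"
 assumes w: "\<And>y. y < w x ==> \<forall>\<^sub>F z in nhds x. y < w z" and q: "isCont q x"
  and y: "y < w x + ereal (q x)"
 shows "\<forall>\<^sub>F z in nhds x. y < w z + ereal (q z)"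
proof -
 have "y - ereal (q x) < w x" using y by (cases y; cases "w x") auto
 then obtain v where v: "y - ereal (q x) < v" "v < w x" using dense by blast
 then obtain v' where v': "v = ereal v'" by (cases v) auto
 have qt: "(q \<longlongrightarrow> q x) (nhds x)" using q by (simp add: tendsto_at_iff_tendsto_nhds isCont_def)
 show ?thesis
 proof (cases y)
  case (real y')
  have "y' - v' < q x" using v v' real by auto
  then have "\<forall>\<^sub>F z in nhds x. y' - v' < q z" by (rule order_tendstoD(1)[OF qt])
  then show ?thesis using w[OF v(2)]
  proof eventually_elim
   case (elim z)
   then show ?case using v' real by (cases "w z") auto
  qed
 next
  case PInf then show ?thesis using y by simp
 next
  case MInf
  show ?thesis using w[OF v(2)]
  proof eventually_elim
   case (elim z)
   then show ?case using v' MInf by (cases "w z") auto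
  qed
 qed
qed

text \<open>Besides the drift term in \<open>G\<close>, the only first-order contribution comes from
  d \<bullet> (\<Delta> - G). It produces the factor \<open>1 + 2 * h * Lr\<close>, which the
  stepwise decrease of the penalty constant cancels.\<close>

lemma sq_step:
 fixes d \<Delta> G :: "'x::real_inner"
 assumes e: "norm (\<Delta> - G) \<le> Lr * (norm d + C * h) * h" and \<Delta>: "norm \<Delta> \<le> C * h" and d: "norm d \<le> 1"
  and nn: "0 \<le> Lr" "0 \<le> C" "0 \<le> h"
 shows "(norm (d - \<Delta>))\<^sup>2 \<le> (norm d)\<^sup>2 * (1 + 2 * h * Lr) - 2 * (d \<bullet> G) + (2 * Lr * C + C\<^sup>2) * h\<^sup>2"
proof -
 have "(norm (d - \<Delta>))\<^sup>2 = (norm d)\<^sup>2 - 2 * (d \<bullet> \<Delta>) + (norm \<Delta>)\<^sup>2"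
  by (simp add: power2_norm_eq_inner inner_diff_left inner_diff_right inner_commute)
 also have "d \<bullet> \<Delta> = d \<bullet> G + d \<bullet> (\<Delta> - G)" by (simp add: inner_diff_right)
 finally have 1: "(norm (d - \<Delta>))\<^sup>2 = (norm d)\<^sup>2 - 2 * (d \<bullet> G) - 2 * (d \<bullet> (\<Delta> - G)) + (norm \<Delta>)\<^sup>2" by simp
 have 2: "(norm \<Delta>)\<^sup>2 \<le> C\<^sup>2 * h\<^sup>2" using power_mono[OF \<Delta> norm_ge_zero, of 2] by (simp add: power_mult_distrib)
 have "- (d \<bullet> (\<Delta> - G)) \<le> norm d * norm (\<Delta> - G)" using Cauchy_Schwarz_ineq2[of d "\<Delta> - G"] by simp
 also have "\<dots> \<le> norm d * (Lr * (norm d + C * h) * h)" by (intro mult_left_mono e) simp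
 also have "\<dots> = (norm d)\<^sup>2 * (h * Lr) + norm d * (Lr * C * h\<^sup>2)" by (simp add: power2_eq_square algebra_simps)
 also have "norm d * (Lr * C * h\<^sup>2) \<le> 1 * (Lr * C * h\<^sup>2)" using nn d by (intro mult_right_mono) auto
 finally have 3: "- (d \<bullet> (\<Delta> - G)) \<le> (norm d)\<^sup>2 * (h * Lr) + Lr * C * h\<^sup>2" by simp
 have "(norm d)\<^sup>2 * (1 + 2 * h * Lr) + (2 * Lr * C + C\<^sup>2) * h\<^sup>2
   = (norm d)\<^sup>2 + 2 * ((norm d)\<^sup>2 * (h * Lr) + Lr * C * h\<^sup>2) + C\<^sup>2 * h\<^sup>2" by (simp add: algebra_simps)
 moreover have "P \<le> a - 2 * g + b"
  if "a + b = n + 2 * s + c" "P = n - 2 * g - 2 * e + t" "t \<le> c" "- e \<le> s" for P a b n s c g e t :: real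
  using that by linarith
 ultimately show ?thesis using 1 2 3 by blast
qed

lemma divide_le_self: "0 \<le> x ==> 1 \<le> q ==> x / q \<le> (x::real)"
 using divide_left_mono[of 1 q x] by simp

text \<open>The order of the choices matters. The final penalty \<open>cm\<close> makes the error
  from the distance to the contact point small; the initial one is larger by exp(2 Lr S), so that N
  divisions by 1 + 2 h Lr do not lead below \<open>cm\<close>; only then is the step h made small,
  against an error coefficient \<open>D\<close> that depends on the initial penalty.\<close>

lemma penalty_schedule:
 fixes S Lr E \<eta> cmin hm :: real and D :: "real \<Rightarrow> real"
 assumes S: "0 < S" and Lr: "0 \<le> Lr" and E: "0 \<le> E" and \<eta>: "0 < \<eta>" and hm: "0 < hm" and D: "\<And>t. 0 \<le> t ==> 0 \<le> D t"
 obtains cm h N and c :: "nat \<Rightarrow> real" where "0 < cm" "cmin < cm" "0 < h" "h \<le> 1" "h \<le> hm" "real N * h = S"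
  "\<And>k. c (Suc k) = c k / (1 + 2 * h * Lr)" "\<And>k. k \<le> N ==> cm \<le> c k \<and> c k \<le> c 0"
  "S * (Lr * sqrt (E / cm) + D (c 0) * h) \<le> \<eta>"
proof -
 define v where "v = 2 * S * Lr / \<eta>"
 define cm where "cm = max 1 (cmin + 1) + E * v\<^sup>2"
 have Ev: "0 \<le> E * v\<^sup>2" using E by simp
 then have cm: "0 < cm" "cmin < cm" "E * v\<^sup>2 \<le> cm" by (auto simp: cm_def)
 have small: "S * (Lr * sqrt (E / cm)) \<le> \<eta> / 2"
 proof -
  have "(E / cm) * v\<^sup>2 \<le> 1" using cm by (simp add: divide_le_eq)
  then have "(sqrt (E / cm) * v)\<^sup>2 \<le> 1\<^sup>2" using E cm by (simp add: power_mult_distrib)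
  then have "sqrt (E / cm) * v \<le> 1" by (rule power2_le_imp_le) simp
  then show ?thesis using \<eta> by (simp add: v_def field_simps)
 qed
 define c0 where "c0 = cm * exp (2 * Lr * S)"
 have c0: "0 \<le> c0" using cm by (simp add: c0_def)
 obtain N where N: "max S (max (2 * S * D c0 * S / \<eta>) (S / hm)) < real N" using reals_Archimedean2 by blast
 then have N0: "0 < N" using S by (cases N) auto
 define h where "h = S / real N"
 have h: "0 < h" "h \<le> 1" "h \<le> hm" "real N * h = S" using S N N0 hm by (auto simp: h_def field_simps)
 have "2 * S * D c0 * S \<le> real N * \<eta>" using N \<eta> by (simp add: divide_less_eq)
 then have hD: "S * (D c0 * h) \<le> \<eta> / 2" using N0 by (simp add: h_def field_simps)
 define q where "q = 1 + 2 * h * Lr"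
 have q: "1 \<le> q" using h Lr by (simp add: q_def)
 define c where "c k = c0 / q ^ k" for k
 have ck: "cm \<le> c k \<and> c k \<le> c 0" if "k \<le> N" for k
 proof
  have "q ^ k \<le> q ^ N" using q that by (rule power_increasing[rotated])
  also have "\<dots> \<le> exp (2 * h * Lr) ^ N"
   using q exp_ge_add_one_self[of "2 * h * Lr"] by (intro power_mono) (auto simp: q_def)
  also have "\<dots> = exp (2 * Lr * S)" using h(4) by (simp add: exp_of_nat_mult[symmetric] mult.commute mult.left_commute)
  finally have "cm * q ^ k \<le> c0" unfolding c0_def using cm by (intro mult_left_mono) auto
  then show "cm \<le> c k" using q by (simp add: c_def le_divide_eq)
  show "c k \<le> c 0" unfolding c_def using c0 q by (simp add: divide_le_self)
 qed
 have cS: "c (Suc k) = c k / (1 + 2 * h * Lr)" for k by (simp add: c_def q_def)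
 have er: "S * (Lr * sqrt (E / cm) + D (c 0) * h) \<le> \<eta>" using small hD by (simp add: c_def distrib_left)
 show ?thesis by (rule that[of cm h N c]) (rule cm h cS er | erule ck)+
qed

text \<open>The decrease of the penalty also divides the gain 2 c dg h, which has to pay for the
  cost lam h. As lam is at most b, the loss is of second order in h.\<close>

lemma step_arith_super:
 fixes c :: real
 assumes X: "X \<le> nd2 * (1 + 2 * h * Lr) - 2 * (h * dg) + Q * h\<^sup>2" and l: "0 \<le> lam" "lam \<le> b" "lam \<le> 2 * c * dg"
  and nn: "0 < c" "0 \<le> Lr" "0 \<le> h" "0 \<le> Q"
 shows "c / (1 + 2 * h * Lr) * X + lam * h \<le> c * nd2 + (c * Q + 2 * Lr * b) * h\<^sup>2"
proof -
 define q where "q = 1 + 2 * h * Lr"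
 have q: "1 \<le> q" using nn by (simp add: q_def)
 have "c / q * X \<le> c / q * (nd2 * q - 2 * (h * dg) + Q * h\<^sup>2)"
  using X nn q unfolding q_def by (intro mult_left_mono) auto
 also have "\<dots> = c * nd2 - (2 * c * dg) * h / q + c * Q * h\<^sup>2 / q" using q by (simp add: field_simps)
 also have "c * Q * h\<^sup>2 / q \<le> c * Q * h\<^sup>2" using nn q by (intro divide_le_self) auto
 finally have 0: "c / q * X \<le> c * nd2 - (2 * c * dg) * h / q + c * Q * h\<^sup>2" by simp
 have "lam * h / q \<le> (2 * c * dg) * h / q" using l nn q by (intro divide_right_mono mult_right_mono) auto
 with 0 have 1: "c / q * X \<le> c * nd2 - lam * h / q + c * Q * h\<^sup>2" by linarith
 have "lam * h * (1 - 2 * h * Lr) * q \<le> lam * h"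
 proof -
  have "(1 - 2 * h * Lr) * q = 1 - (2 * h * Lr)\<^sup>2" by (simp add: q_def power2_eq_square algebra_simps)
  also have "\<dots> \<le> 1" by simp
  finally have "lam * h * ((1 - 2 * h * Lr) * q) \<le> lam * h * 1" using l nn by (intro mult_left_mono) auto
  then show ?thesis by (simp add: mult.assoc)
 qed
 then have "lam * h * (1 - 2 * h * Lr) \<le> lam * h / q" using q by (simp add: le_divide_eq)
 moreover have "lam * (2 * Lr * h\<^sup>2) \<le> b * (2 * Lr * h\<^sup>2)" using l nn by (intro mult_right_mono) auto
 moreover have "lam * h * (1 - 2 * h * Lr) = lam * h - lam * (2 * Lr * h\<^sup>2)" by (simp add: power2_eq_square algebra_simps)
 moreover have "(c * Q + 2 * Lr * b) * h\<^sup>2 = c * Q * h\<^sup>2 + b * (2 * Lr * h\<^sup>2)" by (simp add: algebra_simps)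
 ultimately show ?thesis using 1 unfolding q_def[symmetric] by linarith
qed

lemma step_arith_sub:
 fixes c :: real
 assumes X: "X \<le> nd2 * (1 + 2 * h * Lr) - 2 * dG + Q * h\<^sup>2" and l: "0 \<le> \<Lambda>" "- \<Lambda> \<le> 2 * c * dG"
  and nn: "0 < c" "0 \<le> Lr" "0 \<le> h" "0 \<le> Q"
 shows "c / (1 + 2 * h * Lr) * X \<le> c * nd2 + \<Lambda> + c * Q * h\<^sup>2"
proof -
 define q where "q = 1 + 2 * h * Lr"
 have q: "1 \<le> q" using nn by (simp add: q_def)
 have "c / q * X \<le> c / q * (nd2 * q - 2 * dG + Q * h\<^sup>2)"
  using X nn q unfolding q_def by (intro mult_left_mono) auto
 also have "\<dots> = c * nd2 + (- (2 * c * dG)) / q + c * Q * h\<^sup>2 / q" using q by (simp add: field_simps)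
 also have "c * Q * h\<^sup>2 / q \<le> c * Q * h\<^sup>2" using nn q by (intro divide_le_self) auto
 also have "(- (2 * c * dG)) / q \<le> \<Lambda> / q" using l q by (intro divide_right_mono) auto
 also have "\<Lambda> / q \<le> \<Lambda>" using l q by (intro divide_le_self)
 finally show ?thesis unfolding q_def by simp
qed

context csys
begin

text \<open>The penalty beats \<open>E\<close>, so the minimum of \<open>lsc_env u\<close> plus c |z
  - y|^2 over the unit ball lies in the interior and the paraboloid is a test function there. The
  viscosity inequality then provides a control with l(z,a) \<le> 2c (z - y) \<bullet> f(z,a): along
  this constant control the squared distance drops fast enough to pay for the cost.\<close>

lemma super_step:
 assumes sup: "viscosity_supersolution Ham u" and u0: "\<And>x. 0 \<le> u x"
  and y: "norm y \<le> r" and h: "0 \<le> h" "h \<le> 1"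
  and z0: "lsc_env u z0 = ereal a0" and c: "a0 + c * (norm (z0 - y))\<^sup>2 \<le> E" "E < c"
  and cpos: "0 < c"
 defines "R \<equiv> rb M r 1 + 1" and "C \<equiv> M * (1 + rb M r 1)"
 shows "\<exists>a\<in>K. \<exists>z a1. lsc_env u z = ereal a1 \<and>
   a1 + c / (1 + 2 * h * L R) * (norm (z - traj (\<lambda>_. a) y h))\<^sup>2 + run (\<lambda>_. a) y h
   \<le> a0 + c * (norm (z0 - y))\<^sup>2 + h * L R * sqrt (E / c) + (c * (2 * L R * C + C\<^sup>2) + 2 * L R * B R + L R * C) * h\<^sup>2"
proof -
 define w where "w = lsc_env u"
 have w0: "0 \<le> w z" for z unfolding w_def by (rule lsc_env_nonneg[OF u0])
 have a0: "0 \<le> a0" using w0[of z0] z0 by (simp add: w_def)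
 have "0 \<le> c * (norm (z0 - y))\<^sup>2" using cpos by simp
 then have c0: "0 < c" "0 \<le> E" using cpos a0 c by linarith+
 have r0: "0 \<le> r" using y norm_ge_zero order_trans by blast
 define g where "g z = w z + ereal (c * (norm (z - y))\<^sup>2)" for z
 have lsc: "\<forall>\<^sub>F z in nhds x. v < g z" if "v < g x" for v x
  unfolding g_def by (rule lsc_add) (use that lsc_env_lsc in \<open>auto simp: g_def w_def intro!: continuous_intros\<close>)
 obtain z where z: "z \<in> cball y 1" "\<And>\<zeta>. \<zeta> \<in> cball y 1 ==> g z \<le> g \<zeta>"
  using lsc_attains_inf[of "cball y 1" g] lsc by auto
 \<comment> \<open>The previous contact point is a competitor: since E < c, it lies in the unit
   ball.\<close>
 have z0in: "z0 \<in> cball y 1"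
 proof -
  have "c * (norm (z0 - y))\<^sup>2 \<le> c * 1" using a0 c by linarith
  then have "(norm (z0 - y))\<^sup>2 \<le> 1\<^sup>2" using c0 by (simp add: mult_le_cancel_left)
  then have "norm (z0 - y) \<le> 1" by (rule power2_le_imp_le) simp
  then show ?thesis by (simp add: dist_norm norm_minus_commute)
 qed
 have gz: "g z \<le> ereal (a0 + c * (norm (z0 - y))\<^sup>2)" using z(2)[OF z0in] z0 by (simp add: g_def w_def)
 then obtain a1 where a1: "w z = ereal a1" using w0[of z] by (cases "w z") (auto simp: g_def)
 have le1: "a1 + c * (norm (z - y))\<^sup>2 \<le> a0 + c * (norm (z0 - y))\<^sup>2" using gz a1 by (simp add: g_def)
 have a1n: "0 \<le> a1" using w0[of z] a1 by simp
 define nd where "nd = norm (z - y)"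
 have ndE: "c * nd\<^sup>2 \<le> E" using le1 c(1) a1n by (simp add: nd_def)
 have nd: "nd \<le> sqrt (E / c)"
  by (rule real_le_rsqrt) (use ndE c0 in \<open>simp add: le_divide_eq mult.commute\<close>)
 have "sqrt (E / c) < 1" using c0 c(2) by (simp add: divide_less_eq)
 then have nd1: "nd < 1" by (rule le_less_trans[OF nd])
 define \<phi> where "\<phi> = (\<lambda>z. (- c) * (norm (z - y))\<^sup>2)"
 define p where "p = (2 * (- c)) *\<^sub>R (z - y)"
 have "\<forall>\<^sub>F \<zeta> in nhds z. \<zeta> \<in> ball y 1"
  using nd1 by (intro eventually_nhds_in_open) (auto simp: nd_def dist_norm norm_minus_commute)
 then have "\<forall>\<^sub>F \<zeta> in nhds z. lsc_env u z - ereal (\<phi> z) \<le> lsc_env u \<zeta> - ereal (\<phi> \<zeta>)"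
 proof eventually_elim
  case (elim \<zeta>)
  have "g z \<le> g \<zeta>" by (rule z(2)) (use elim in auto)
  then show ?case by (simp add: g_def w_def \<phi>_def minus_ereal_def)
 qed
 moreover have "C1_on UNIV \<phi> (\<lambda>z. (2 * (- c)) *\<^sub>R (z - y))" unfolding \<phi>_def by (rule C1_quadratic)
 ultimately have "0 \<le> Ham z p" using sup a1 unfolding viscosity_supersolution_def p_def w_def
  by (metis (no_types, lifting) PInfty_neq_ereal(1) infinity_ereal_def)
 then obtain a where a: "a \<in> K" "0 \<le> - (f z a \<bullet> p) - l z a" using Ham_attained[of z p] by metis
 interpret adm M B L "FF (\<lambda>_. a)" "LL (\<lambda>_. a)" by (rule adm_ctrl[OF const_ctrl[OF a(1)]])
 have zR: "norm z \<le> rb M r 1 + 1"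
  using norm_triangle_ineq[of "z - y" y] nd1 y rb_ge[OF M_nonneg r0, of 1] by (simp add: nd_def)
 note st = step_estimates[OF y h zR, folded R_def C_def]
 have C0: "0 \<le> C" unfolding C_def using M_nonneg rb_ge[OF M_nonneg r0, of 1] r0 by simp
 define y' where "y' = traj (\<lambda>_. a) y h"
 define dg where "dg = (z - y) \<bullet> f z a"
 have int: "integral {0..h} (\<lambda>s. FF (\<lambda>_. a) s z) = h *\<^sub>R f z a" "integral {0..h} (\<lambda>s. LL (\<lambda>_. a) s z) = h * l z a"
  using h by (auto simp: FF_def LL_def)
 have "(norm ((z - y) - (y' - y)))\<^sup>2 \<le> (norm (z - y))\<^sup>2 * (1 + 2 * h * L R) - 2 * ((z - y) \<bullet> (h *\<^sub>R f z a))
   + (2 * L R * C + C\<^sup>2) * h\<^sup>2"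
  by (rule sq_step) (use st int nd1 h C0 L_nonneg in \<open>auto simp: y'_def nd_def\<close>)
 then have X: "(norm (z - y'))\<^sup>2 \<le> nd\<^sup>2 * (1 + 2 * h * L R) - 2 * (h * dg) + (2 * L R * C + C\<^sup>2) * h\<^sup>2"
  by (simp add: nd_def dg_def)
 have "l z a \<le> 2 * c * dg" using a(2) by (simp add: p_def dg_def inner_commute)
 then have 1: "c / (1 + 2 * h * L R) * (norm (z - y'))\<^sup>2 + l z a * h
   \<le> c * nd\<^sup>2 + (c * (2 * L R * C + C\<^sup>2) + 2 * L R * B R) * h\<^sup>2"
  using step_arith_super[OF X l_nonneg[OF a(1)] l_bound[OF a(1) zR[folded R_def]]] c0 L_nonneg h C0 by simp
 have "run (\<lambda>_. a) y h \<le> h * l z a + L R * (nd + C * h) * h" using st(3) int by (simp add: nd_def)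
 also have "L R * (nd + C * h) * h = h * L R * nd + L R * C * h\<^sup>2" by (simp add: power2_eq_square algebra_simps)
 also have "h * L R * nd \<le> h * L R * sqrt (E / c)" using nd h L_nonneg by (intro mult_left_mono) auto
 finally have "run (\<lambda>_. a) y h \<le> h * l z a + h * L R * sqrt (E / c) + L R * C * h\<^sup>2" by simp
 with 1 le1 have "a1 + c / (1 + 2 * h * L R) * (norm (z - y'))\<^sup>2 + run (\<lambda>_. a) y h
   \<le> a0 + c * (norm (z0 - y))\<^sup>2 + h * L R * sqrt (E / c) + (c * (2 * L R * C + C\<^sup>2) + 2 * L R * B R + L R * C) * h\<^sup>2"
  by (simp add: nd_def algebra_simps)
 then show ?thesis using a(1) a1 unfolding w_def y'_def by blast
qed

lemma supersolution_le_upto: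
 assumes sup: "viscosity_supersolution Ham u" and u0: "\<And>x. 0 \<le> u x"
  and W: "lsc_env u x = ereal W" and S: "0 < S" and \<eta>: "0 < \<eta>" "\<eta> \<le> 1"
 shows "\<exists>\<alpha>\<in>ctrls. run \<alpha> x S \<le> W + \<eta>"
proof -
 have W0: "0 \<le> W" using lsc_env_nonneg[of u x, OF u0] W by simp
 define r where "r = rb M (norm x) S"
 define R where "R = rb M r 1 + 1"
 define C where "C = M * (1 + rb M r 1)"
 define Lr where "Lr = L R"
 define E where "E = W + 1"
 have Lr0: "0 \<le> Lr" unfolding Lr_def by (rule L_nonneg)
 have r0: "0 \<le> r" unfolding r_def rb_def by simp
 have C0: "0 \<le> C" unfolding C_def using M_nonneg rb_ge[OF M_nonneg r0, of 1] r0 by simp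
 have b0: "0 \<le> B R"
 proof -
  obtain a where "a \<in> K" using K by auto
  then show ?thesis using l_nonneg[of a 0] l_bound[of a 0 R] rb_ge[OF M_nonneg r0, of 1] r0 by (simp add: R_def)
 qed
 have E1: "1 \<le> E" using W0 by (simp add: E_def)
 define D where "D t = t * (2 * Lr * C + C\<^sup>2) + 2 * Lr * B R + Lr * C" for t
 have E0: "0 \<le> E" and D0: "0 \<le> D t" if "0 \<le> t" for t using that Lr0 C0 b0 E1 by (simp_all add: D_def)
 obtain cm h N and c :: "nat \<Rightarrow> real" where cm: "E < cm" and h: "0 < h" "h \<le> 1" "real N * h = S"
  and cS: "\<And>k. c (Suc k) = c k / (1 + 2 * h * Lr)" and ck: "\<And>k. k \<le> N ==> cm \<le> c k \<and> c k \<le> c 0"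
  and er': "S * (Lr * sqrt (E / cm) + D (c 0) * h) \<le> \<eta>"
  by (rule penalty_schedule[where cmin = E and D = D, OF S Lr0 E0[OF order_refl] \<eta>(1) zero_less_one D0]) (assumption, rule that)
 define q where "q = 1 + 2 * h * Lr"
 define er where "er = Lr * sqrt (E / cm) + D (c 0) * h"
 note er = er'[folded er_def]
 have er0: "0 \<le> er" unfolding er_def using Lr0 E1 cm D0[of "c 0"] ck[of 0] h by simp
 \<comment> \<open>Invariant: penalized value plus cost so far grows by at most \<open>er\<close>
   per unit of time. As the total error is at most 1, it also preserves the bound by E = W + 1 that
   \<open>super_step\<close> requires.\<close>
 have step: "\<exists>\<alpha>\<in>ctrls. \<exists>z a. lsc_env u z = ereal a \<and>
   a + c k * (norm (z - traj \<alpha> x (real k * h)))\<^sup>2 + run \<alpha> x (real k * h) \<le> W + real k * h * er"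
  if "k \<le> N" for k using that
 proof (induction k)
  case 0
  obtain a where "a \<in> K" using K by auto
  then have c: "(\<lambda>_. a) \<in> ctrls" by (rule const_ctrl)
  interpret adm M B L "FF (\<lambda>_. a)" "LL (\<lambda>_. a)" by (rule adm_ctrl[OF c])
  show ?case using W by (intro bexI[OF _ c] exI[of _ x] exI[of _ W]) simp
 next
  case (Suc k)
  then obtain \<alpha> z a where \<alpha>: "\<alpha> \<in> ctrls" and z: "lsc_env u z = ereal a"
   and le: "a + c k * (norm (z - traj \<alpha> x (real k * h)))\<^sup>2 + run \<alpha> x (real k * h) \<le> W + real k * h * er" by auto
  interpret adm M B L "FF \<alpha>" "LL \<alpha>" by (rule adm_ctrl[OF \<alpha>])
  define y where "y = traj \<alpha> x (real k * h)"
  have kh: "0 \<le> real k * h" "real k * h \<le> S"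
   using h Suc.prems mult_right_mono[of "real k" "real N" h] by auto
  have y: "norm y \<le> r" unfolding y_def r_def by (rule flow_bound'[OF kh order_refl])
  have "real k * h * er \<le> S * er" using kh er0 by (intro mult_right_mono)
  then have E: "a + c k * (norm (z - y))\<^sup>2 \<le> E"
   using le rc_nonneg[OF kh(1), of x] er \<eta> by (simp add: E_def y_def)
  have ck': "cm \<le> c k" "c k \<le> c 0" "0 < c k" "E < c k" using ck[of k] Suc.prems cm E1 by auto
  from super_step[OF sup u0 y less_imp_le[OF h(1)] h(2) z E ck'(4,3), folded R_def C_def, folded Lr_def, folded q_def]
  obtain a' z' a1 where a': "a' \<in> K" and z': "lsc_env u z' = ereal a1"
   and le2: "a1 + c k / q * (norm (z' - traj (\<lambda>_. a') y h))\<^sup>2 + run (\<lambda>_. a') y h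
    \<le> a + c k * (norm (z - y))\<^sup>2 + h * Lr * sqrt (E / c k) + (c k * (2 * Lr * C + C\<^sup>2) + 2 * Lr * B R + Lr * C) * h\<^sup>2"
   by blast
  have "sqrt (E / c k) \<le> sqrt (E / cm)" using ck' cm E1 by (intro real_sqrt_le_mono divide_left_mono) auto
  then have 1: "h * Lr * sqrt (E / c k) \<le> h * Lr * sqrt (E / cm)" using h Lr0 by (intro mult_left_mono) auto
  have "c k * (2 * Lr * C + C\<^sup>2) + 2 * Lr * B R + Lr * C \<le> D (c 0)"
   unfolding D_def using ck' Lr0 C0 by (intro add_right_mono mult_right_mono) auto
  then have 2: "(c k * (2 * Lr * C + C\<^sup>2) + 2 * Lr * B R + Lr * C) * h\<^sup>2 \<le> D (c 0) * h\<^sup>2" by (intro mult_right_mono) auto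
  have 3: "h * Lr * sqrt (E / cm) + D (c 0) * h\<^sup>2 = h * er" by (simp add: er_def power2_eq_square algebra_simps)
  define \<beta> where "\<beta> = cat (real k * h) \<alpha> (\<lambda>_. a')"
  have \<beta>: "\<beta> \<in> ctrls" unfolding \<beta>_def by (intro ctrls_cat \<alpha> const_ctrl a' kh)
  have t: "real (Suc k) * h = real k * h + h" by (simp add: algebra_simps)
  note cp = cat_props(3,4)[OF \<alpha> const_ctrl[OF a'] kh(1) less_imp_le[OF h(1)], of x, folded \<beta>_def y_def]
  note cS = cS[of k, folded q_def]
  have "a1 + c (Suc k) * (norm (z' - traj \<beta> x (real (Suc k) * h)))\<^sup>2 + run \<beta> x (real (Suc k) * h)
    \<le> W + real (Suc k) * h * er"
   unfolding t cp cS using le[folded y_def] le2 1 2 3 by (simp add: distrib_right)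
  then show ?case using \<beta> z' by blast
 qed
 from step[OF order_refl] obtain \<alpha> z a where \<alpha>: "\<alpha> \<in> ctrls" and z: "lsc_env u z = ereal a"
  and le: "a + c N * (norm (z - traj \<alpha> x (real N * h)))\<^sup>2 + run \<alpha> x (real N * h) \<le> W + real N * h * er" by auto
 have "0 \<le> a" using lsc_env_nonneg[of u z, OF u0] z by simp
 moreover have "0 \<le> c N * (norm (z - traj \<alpha> x (real N * h)))\<^sup>2" using ck[of N] cm E1 by simp
 ultimately have "run \<alpha> x S \<le> W + \<eta>" using le er unfolding h(3) by linarith
 with \<alpha> show ?thesis by blast
qed

text \<open>At the end of each finite horizon the remaining value and the penalty are nonnegative
  and are dropped; this bounds every finite-horizon value, hence \<open>Sig\<close>, and does not
  yet speak about \<open>V\<close>.\<close>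

lemma Sig_le_supersolution:
 assumes sup: "viscosity_supersolution Ham u" and u0: "\<And>x. 0 \<le> u x"
 shows "Sig x \<le> lsc_env u x"
proof (cases "lsc_env u x")
 case (real W)
 show ?thesis unfolding Sig_def
 proof (rule SUP_least)
  fix S :: real assume "S \<in> {0<..}"
  then have S: "0 < S" by simp
  show "(INF \<alpha>\<in>ctrls. pcost (FF \<alpha>) (LL \<alpha>) {0..S} x) \<le> lsc_env u x"
  proof (rule ereal_le_epsilon2)
   fix e :: real assume e: "0 < e"
   obtain \<alpha> where \<alpha>: "\<alpha> \<in> ctrls" "run \<alpha> x S \<le> W + min e 1"
    using supersolution_le_upto[OF sup u0 real S, of "min e 1"] e by auto
   interpret adm M B L "FF \<alpha>" "LL \<alpha>" by (rule adm_ctrl[OF \<alpha>(1)])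
   have "(INF \<alpha>\<in>ctrls. pcost (FF \<alpha>) (LL \<alpha>) {0..S} x) \<le> pcost (FF \<alpha>) (LL \<alpha>) {0..S} x"
    by (rule INF_lower[OF \<alpha>(1)])
   also have "\<dots> = ereal (run \<alpha> x S)" using S by (intro pcost_upto) simp
   also have "\<dots> \<le> lsc_env u x + ereal e" using \<alpha>(2) real by simp
   finally show "(INF \<alpha>\<in>ctrls. pcost (FF \<alpha>) (LL \<alpha>) {0..S} x) \<le> lsc_env u x + ereal e" .
  qed
 qed
next
 case MInf then show ?thesis using lsc_env_nonneg[of u x, OF u0] by simp
qed simp

end

section \<open>Subsolutions along trajectories\<close>

lemma usc_env_nonneg: "(\<And>x. 0 \<le> u x) ==> 0 \<le> usc_env u x" using usc_env_ge order_trans by blast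

lemma minus_usc_env_lsc:
 fixes u :: "'x::topological_space \<Rightarrow> ereal"
 assumes "v < - usc_env u x"
 shows "\<forall>\<^sub>F z in nhds x. v < - usc_env u z"
proof -
 have "usc_env u x < - v" using assms ereal_less_uminus_reorder by blast
 from usc_env_usc[OF this] show ?thesis
  by (rule eventually_mono) (simp add: ereal_less_uminus_reorder)
qed

lemma usc_env_locally_bounded:
 assumes "locally_bounded_on \<Omega> u" "x \<in> \<Omega>"
 shows "usc_env u x < \<infinity>"
proof -
 obtain b :: real where "\<forall>\<^sub>F z in nhds x. \<bar>u z\<bar> \<le> ereal b"
  using assms unfolding locally_bounded_on_def by blast
 moreover have "v \<le> ereal b" if "\<bar>v\<bar> \<le> ereal b" for v using that by (cases v) auto
 ultimately have "\<forall>\<^sub>F z in nhds x. u z \<le> ereal b" by (auto elim: eventually_mono)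
 then have "usc_env u x \<le> ereal b" unfolding usc_env_def by (rule Limsup_bounded)
 then show ?thesis by auto
qed

context csys
begin

text \<open>Mirror image of \<open>super_step\<close> with a maximum of \<open>usc_env u\<close>
  minus the penalty. At the contact point the Hamiltonian inequality holds for every control, so the
  trajectory of an arbitrary given control can be followed. Comparing the maximum with the value at
  \<open>y\<close> itself bounds the distance by sqrt(Bu/c).\<close>

lemma sub_step:
 assumes sub: "viscosity_subsolution Ham \<Omega> u" and u0: "\<And>x. 0 \<le> u x" and \<alpha>: "\<alpha> \<in> ctrls"
  and y: "norm y \<le> r" and h: "0 \<le> h" "h \<le> 1"
  and \<rho>: "0 < \<rho>" "\<rho> \<le> 1" "cball y \<rho> \<subseteq> \<Omega>" and Bu: "\<And>z. z \<in> cball y \<rho> ==> usc_env u z \<le> ereal Bu"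
  and z0: "usc_env u z0 = ereal a0" "z0 \<in> cball y \<rho>" and c: "0 < c" "Bu < c * \<rho>\<^sup>2"
 defines "R \<equiv> rb M r 1 + 1" and "C \<equiv> M * (1 + rb M r 1)"
 shows "\<exists>z a1. usc_env u z = ereal a1 \<and> norm (z - y) \<le> sqrt (Bu / c) \<and>
   a0 - c * (norm (z0 - y))\<^sup>2 \<le> a1 - c / (1 + 2 * h * L R) * (norm (z - traj \<alpha> y h))\<^sup>2 + run \<alpha> y h
   + h * L R * sqrt (Bu / c) + (c * (2 * L R * C + C\<^sup>2) + L R * C) * h\<^sup>2"
proof -
 define U where "U = usc_env u"
 have U0: "0 \<le> U z" for z unfolding U_def by (rule usc_env_nonneg[OF u0])
 have yin: "y \<in> cball y \<rho>" using \<rho> by simp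
 have Bu0: "0 \<le> Bu" using order_trans[OF U0[of y, unfolded U_def] Bu[OF yin]] by simp
 have r0: "0 \<le> r" using y norm_ge_zero order_trans by blast
 define g where "g z = - U z + ereal (c * (norm (z - y))\<^sup>2)" for z
 have lsc: "\<forall>\<^sub>F z in nhds x. v < g z" if "v < g x" for v x
  unfolding g_def by (rule lsc_add) (use that minus_usc_env_lsc in \<open>auto simp: g_def U_def intro!: continuous_intros\<close>)
 obtain z where z: "z \<in> cball y \<rho>" "\<And>\<zeta>. \<zeta> \<in> cball y \<rho> ==> g z \<le> g \<zeta>"
  using lsc_attains_inf[of "cball y \<rho>" g] lsc \<rho> by auto
 obtain a1 where a1: "U z = ereal a1" using U0[of z] Bu[OF z(1)] by (cases "U z") (auto simp: U_def)
 obtain ay where ay: "U y = ereal ay" using U0[of y] Bu[OF yin] by (cases "U y") (auto simp: U_def)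
 have ay0: "0 \<le> ay" using U0[of y] ay by simp
 have le1: "a0 - c * (norm (z0 - y))\<^sup>2 \<le> a1 - c * (norm (z - y))\<^sup>2"
  using z(2)[OF z0(2)] z0(1) a1 by (simp add: g_def U_def)
 define nd where "nd = norm (z - y)"
 have "c * nd\<^sup>2 \<le> a1 - ay" using z(2)[OF yin] a1 ay by (simp add: g_def nd_def)
 moreover have "a1 \<le> Bu" using Bu[OF z(1)] a1 by (simp add: U_def)
 ultimately have ndE: "c * nd\<^sup>2 \<le> Bu" using ay0 by linarith
 have nd: "nd \<le> sqrt (Bu / c)"
  by (rule real_le_rsqrt) (use ndE c in \<open>simp add: le_divide_eq mult.commute\<close>)
 have "Bu / c < \<rho>\<^sup>2" using c by (simp add: divide_less_eq mult.commute)
 from real_sqrt_less_mono[OF this] have "sqrt (Bu / c) < \<rho>" using \<rho> by simp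
 then have nd1: "nd < \<rho>" by (rule le_less_trans[OF nd])
 define \<phi> where "\<phi> = (\<lambda>z. c * (norm (z - y))\<^sup>2)"
 define p where "p = (2 * c) *\<^sub>R (z - y)"
 have "\<forall>\<^sub>F \<zeta> in nhds z. \<zeta> \<in> ball y \<rho>"
  using nd1 by (intro eventually_nhds_in_open) (auto simp: nd_def dist_norm norm_minus_commute)
 then have "\<forall>\<^sub>F \<zeta> in nhds z. usc_env u \<zeta> - ereal (\<phi> \<zeta>) \<le> usc_env u z - ereal (\<phi> z)"
 proof eventually_elim
  case (elim \<zeta>)
  then have \<zeta>: "\<zeta> \<in> cball y \<rho>" by auto
  obtain b where b: "U \<zeta> = ereal b" using U0[of \<zeta>] Bu[OF \<zeta>] by (cases "U \<zeta>") (auto simp: U_def)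
  show ?case using z(2)[OF \<zeta>] a1 b by (simp add: g_def U_def[symmetric] \<phi>_def)
 qed
 moreover have "C1_on \<Omega> \<phi> (\<lambda>z. (2 * c) *\<^sub>R (z - y))" unfolding \<phi>_def by (rule C1_quadratic)
 moreover have "z \<in> \<Omega>" using z \<rho> by blast
 ultimately have Hp: "Ham z p \<le> 0" using sub unfolding viscosity_subsolution_def p_def by blast
 have ham: "- (f z a \<bullet> p) - l z a \<le> 0" if "a \<in> K" for a using Ham_ge[OF that, of z p] Hp by linarith
 interpret adm M B L "FF \<alpha>" "LL \<alpha>" by (rule adm_ctrl[OF \<alpha>])
 have zR: "norm z \<le> rb M r 1 + 1"
  using norm_triangle_ineq[of "z - y" y] nd1 y \<rho> rb_ge[OF M_nonneg r0, of 1] by (simp add: nd_def)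
 note st = step_estimates[OF y h zR, folded R_def C_def]
 have C0: "0 \<le> C" unfolding C_def using M_nonneg rb_ge[OF M_nonneg r0, of 1] r0 by simp
 define y' where "y' = traj \<alpha> y h"
 define G where "G = integral {0..h} (\<lambda>s. FF \<alpha> s z)"
 define \<Lambda> where "\<Lambda> = integral {0..h} (\<lambda>s. LL \<alpha> s z)"
 have "(norm ((z - y) - (y' - y)))\<^sup>2 \<le> (norm (z - y))\<^sup>2 * (1 + 2 * h * L R) - 2 * ((z - y) \<bullet> G)
   + (2 * L R * C + C\<^sup>2) * h\<^sup>2"
  by (rule sq_step) (use st nd1 \<rho> h C0 L_nonneg in \<open>auto simp: y'_def nd_def G_def\<close>)
 then have X: "(norm (z - y'))\<^sup>2 \<le> nd\<^sup>2 * (1 + 2 * h * L R) - 2 * ((z - y) \<bullet> G) + (2 * L R * C + C\<^sup>2) * h\<^sup>2"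
  by (simp add: nd_def)
 have \<Lambda>0: "0 \<le> \<Lambda>" unfolding \<Lambda>_def
  by (rule integral_nonneg[OF const_integrable(2)]) (use ell_nonneg in auto)
 have "- (G \<bullet> p) - \<Lambda> \<le> 0 * h" unfolding G_def \<Lambda>_def
 proof (rule integral_ham[OF h(1)])
  show "- (FF \<alpha> s z \<bullet> p) - LL \<alpha> s z \<le> 0" if "0 \<le> s" for s
   using ham[OF ctrls_in[OF \<alpha> that]] by (simp add: FF_def LL_def)
 qed
 then have "- \<Lambda> \<le> 2 * c * ((z - y) \<bullet> G)" by (simp add: p_def inner_commute)
 then have 1: "c / (1 + 2 * h * L R) * (norm (z - y'))\<^sup>2 \<le> c * nd\<^sup>2 + \<Lambda> + c * (2 * L R * C + C\<^sup>2) * h\<^sup>2"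
  using step_arith_sub[OF X \<Lambda>0] c L_nonneg h C0 by simp
 have "\<Lambda> \<le> run \<alpha> y h + L R * (nd + C * h) * h" using st(3) by (simp add: nd_def \<Lambda>_def)
 also have "L R * (nd + C * h) * h = h * L R * nd + L R * C * h\<^sup>2" by (simp add: power2_eq_square algebra_simps)
 also have "h * L R * nd \<le> h * L R * sqrt (Bu / c)" using nd h L_nonneg by (intro mult_left_mono) auto
 finally have "\<Lambda> \<le> run \<alpha> y h + h * L R * sqrt (Bu / c) + L R * C * h\<^sup>2" by simp
 with 1 le1 have "a0 - c * (norm (z0 - y))\<^sup>2 \<le> a1 - c / (1 + 2 * h * L R) * (norm (z - y'))\<^sup>2 + run \<alpha> y h
   + h * L R * sqrt (Bu / c) + (c * (2 * L R * C + C\<^sup>2) + L R * C) * h\<^sup>2"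
  by (simp add: nd_def algebra_simps)
 then show ?thesis using a1 nd unfolding U_def y'_def nd_def by blast
qed

lemma usc_env_bounded_on_tube:
 fixes u :: "'x \<Rightarrow> ereal"
 assumes lb: "locally_bounded_on \<Omega> u" and \<Omega>: "open \<Omega>" and Y: "compact Y" "Y \<subseteq> \<Omega>" "Y \<noteq> {}" and u0: "\<And>x. 0 \<le> u x"
 obtains \<rho> Bu where "0 < \<rho>" "\<rho> \<le> 1" "\<And>y. y \<in> Y ==> cball y \<rho> \<subseteq> \<Omega>"
  "\<And>y z. y \<in> Y ==> z \<in> cball y \<rho> ==> usc_env u z \<le> ereal Bu"
proof -
 obtain e where e: "0 < e" "\<And>y z. y \<in> Y ==> z \<in> - \<Omega> ==> e \<le> dist y z"
  using separate_compact_closed[OF Y(1), of "- \<Omega>"] \<Omega> Y(2) by (metis Compl_disjoint2 Int_commute closed_Compl disjoint_eq_subset_Compl double_compl)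
 define \<rho> where "\<rho> = min 1 (e / 2)"
 have \<rho>: "0 < \<rho>" "\<rho> \<le> 1" using e by (auto simp: \<rho>_def)
 have sub: "cball y \<rho> \<subseteq> \<Omega>" if "y \<in> Y" for y using e(2)[OF that] e(1) by (force simp: \<rho>_def)
 define T where "T = {y + b |y b. y \<in> Y \<and> b \<in> cball 0 \<rho>}"
 have T: "compact T" unfolding T_def by (intro compact_sums Y) simp
 have Tin: "z \<in> T" if "y \<in> Y" "z \<in> cball y \<rho>" for y z
  unfolding T_def using that by (intro CollectI exI[of _ y] exI[of _ "z - y"]) (auto simp: dist_norm norm_minus_commute)
 have T\<Omega>: "T \<subseteq> \<Omega>"
 proof
  fix z assume "z \<in> T"
  then obtain y b where "z = y + b" "y \<in> Y" "b \<in> cball 0 \<rho>" by (auto simp: T_def)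
  then show "z \<in> \<Omega>" using sub[of y] by (auto simp: dist_norm)
 qed
 have "T \<noteq> {}" using Y(3) Tin \<rho> by (metis centre_in_cball empty_iff ex_in_conv less_imp_le)
 from lsc_attains_inf[OF T this, of "\<lambda>z. - usc_env u z"] minus_usc_env_lsc
 obtain x where x: "x \<in> T" "\<And>z. z \<in> T ==> - usc_env u x \<le> - usc_env u z" by blast
 have "usc_env u x < \<infinity>" using usc_env_locally_bounded[OF lb] x T\<Omega> by blast
 moreover have "0 \<le> usc_env u x" by (rule usc_env_nonneg[OF u0])
 ultimately obtain Bu where "usc_env u x = ereal Bu" by (cases "usc_env u x") auto
 then have "usc_env u z \<le> ereal Bu" if "z \<in> T" for z
  using x(2)[OF that] ereal_minus_le_minus[of "usc_env u x" "usc_env u z"] by simp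
 then show ?thesis using that[OF \<rho> sub] Tin by blast
qed

text \<open>The penalized maximum points accompany the trajectory. With a large penalty the last of
  them is so close to the endpoint that upper semicontinuity of the envelope at the endpoint
  finishes the estimate.\<close>

lemma subsolution_dpp:
 assumes sub: "viscosity_subsolution Ham \<Omega> u" and u0: "\<And>x. 0 \<le> u x" and \<Omega>: "open \<Omega>"
  and \<alpha>: "\<alpha> \<in> ctrls" and S: "0 < S" and in\<Omega>: "\<And>t. 0 \<le> t ==> t \<le> S ==> traj \<alpha> x t \<in> \<Omega>"
 shows "usc_env u x \<le> ereal (run \<alpha> x S) + usc_env u (traj \<alpha> x S)"
proof -
 interpret adm M B L "FF \<alpha>" "LL \<alpha>" by (rule adm_ctrl[OF \<alpha>])
 define Y where "Y = traj \<alpha> x ` {0..S}"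
 have Y: "compact Y" "Y \<subseteq> \<Omega>" "Y \<noteq> {}"
  unfolding Y_def using S in\<Omega> by (auto intro!: compact_continuous_image flow_continuous)
 have lb: "locally_bounded_on \<Omega> u" using sub by (simp add: viscosity_subsolution_def)
 obtain \<rho> Bu where \<rho>: "0 < \<rho>" "\<rho> \<le> 1" "\<And>y. y \<in> Y ==> cball y \<rho> \<subseteq> \<Omega>"
  and Bu: "\<And>y z. y \<in> Y ==> z \<in> cball y \<rho> ==> usc_env u z \<le> ereal Bu"
  using usc_env_bounded_on_tube[OF lb \<Omega> Y u0] by metis
 define U where "U = usc_env u"
 have U0: "0 \<le> U z" for z unfolding U_def by (rule usc_env_nonneg[OF u0])
 have fin: "\<exists>a. U z = ereal a" if "y \<in> Y" "z \<in> cball y \<rho>" for y z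
  using U0[of z] Bu[OF that] by (cases "U z") (auto simp: U_def)
 define xS where "xS = traj \<alpha> x S"
 have x0Y: "x \<in> Y" unfolding Y_def using S by (intro image_eqI[of _ _ 0]) auto
 have xSY: "xS \<in> Y" unfolding Y_def xS_def using S by auto
 obtain Ux where Ux: "U x = ereal Ux" using fin[OF x0Y, of x] \<rho> by auto
 obtain US where US: "U xS = ereal US" using fin[OF xSY, of xS] \<rho> by auto
 have Bu0: "0 \<le> Bu" using order_trans[OF U0[of x, unfolded U_def] Bu[OF x0Y]] \<rho> by simp
 have "Ux \<le> run \<alpha> x S + US + 2 * \<eta>" if \<eta>: "0 < \<eta>" "\<eta> \<le> 1" for \<eta>
 proof -
  have "usc_env u xS < ereal (US + \<eta>)" using US \<eta> by (simp add: U_def)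
  from usc_env_usc[OF this] obtain \<delta> where \<delta>: "0 < \<delta>" "\<And>z. dist z xS < \<delta> ==> U z < ereal (US + \<eta>)"
   unfolding eventually_nhds_metric U_def by blast
  define r where "r = rb M (norm x) S"
  define R where "R = rb M r 1 + 1"
  define C where "C = M * (1 + rb M r 1)"
  define Lr where "Lr = L R"
  have Lr0: "0 \<le> Lr" unfolding Lr_def by (rule L_nonneg)
  have r0: "0 \<le> r" unfolding r_def rb_def by simp
  have C0: "0 \<le> C" unfolding C_def using M_nonneg rb_ge[OF M_nonneg r0, of 1] r0 by simp
  define E where "E = Bu + run \<alpha> x S + 1"
  define D where "D t = t * (2 * Lr * C + C\<^sup>2) + Lr * C" for t
  have D0: "0 \<le> D t" if "0 \<le> t" for t using that Lr0 C0 by (simp add: D_def)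
  have hm: "0 < \<rho> / (2 * (C + 1))" using \<rho> C0 by simp
  \<comment> \<open>The first lower bound for \<open>cm\<close> keeps each maximum point within
    \<rho>/2 of the trajectory, and the bound on h limits the motion during one step to the other
    \<rho>/2, so the point is admissible in the next ball. The second brings the last maximum point
    within \<delta> of the endpoint.\<close>
  obtain cm h N and c :: "nat \<Rightarrow> real" where cm0: "0 < cm" and cm: "max (4 * Bu / \<rho>\<^sup>2) (E / \<delta>\<^sup>2) < cm"
   and h: "0 < h" "h \<le> 1" "real N * h = S" and h': "h \<le> \<rho> / (2 * (C + 1))"
   and cS: "\<And>k. c (Suc k) = c k / (1 + 2 * h * Lr)" and ck: "\<And>k. k \<le> N ==> cm \<le> c k \<and> c k \<le> c 0"
   and er': "S * (Lr * sqrt (Bu / cm) + D (c 0) * h) \<le> \<eta>"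
   by (rule penalty_schedule[where cmin = "max (4 * Bu / \<rho>\<^sup>2) (E / \<delta>\<^sup>2)" and D = D, OF S Lr0 Bu0 \<eta>(1) hm D0])
     (assumption, rule that)
  have Bu4: "4 * Bu < cm * \<rho>\<^sup>2" and E\<delta>: "E < cm * \<delta>\<^sup>2" using cm \<rho> \<delta> by (auto simp: divide_less_eq)
  have "Bu / cm \<le> (\<rho> / 2)\<^sup>2" using Bu4 cm0 by (simp add: power_divide field_simps)
  then have small\<rho>: "sqrt (Bu / cm) \<le> \<rho> / 2" using \<rho> by (intro real_le_lsqrt) auto
  have BuC: "Bu < cm * \<rho>\<^sup>2" using Bu4 Bu0 by linarith
  have "h * (2 * (C + 1)) \<le> \<rho>" using h' C0 by (simp add: le_divide_eq)
  then have hC: "C * h \<le> \<rho> / 2" using h by (simp add: algebra_simps)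
  define q where "q = 1 + 2 * h * Lr"
  define er where "er = Lr * sqrt (Bu / cm) + D (c 0) * h"
  note er = er'[folded er_def]
  have step: "\<exists>z a. usc_env u z = ereal a \<and> z \<in> cball (traj \<alpha> x (real k * h)) \<rho> \<and>
    Ux - run \<alpha> x (real k * h) - real k * h * er \<le> a - c k * (norm (z - traj \<alpha> x (real k * h)))\<^sup>2"
   if "k \<le> N" for k using that
  proof (induction k)
   case 0
   show ?case using Ux \<rho> by (intro exI[of _ x] exI[of _ Ux]) (simp add: U_def)
  next
   case (Suc k)
   then obtain z a where z: "usc_env u z = ereal a" "z \<in> cball (traj \<alpha> x (real k * h)) \<rho>"
    and le: "Ux - run \<alpha> x (real k * h) - real k * h * er \<le> a - c k * (norm (z - traj \<alpha> x (real k * h)))\<^sup>2" by auto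
   define y where "y = traj \<alpha> x (real k * h)"
   have kh: "0 \<le> real k * h" "real k * h \<le> S"
    using h Suc.prems mult_right_mono[of "real k" "real N" h] by auto
   have yY: "y \<in> Y" unfolding Y_def y_def using kh by auto
   have y: "norm y \<le> r" unfolding y_def r_def by (rule flow_bound'[OF kh order_refl])
   have ck': "cm \<le> c k" "c k \<le> c 0" "0 < c k" using ck[of k] Suc.prems cm0 by auto
   have "cm * \<rho>\<^sup>2 \<le> c k * \<rho>\<^sup>2" using ck' by (intro mult_right_mono) auto
   then have BuCk: "Bu < c k * \<rho>\<^sup>2" using BuC by linarith
   define \<beta> where "\<beta> = (\<lambda>s. \<alpha> (s + real k * h))"
   have \<beta>: "\<beta> \<in> ctrls" unfolding \<beta>_def by (rule ctrls_shift[OF \<alpha> kh(1)])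
   interpret s: adm M B L "FF \<beta>" "LL \<beta>" by (rule adm_ctrl[OF \<beta>])
   have t: "real (Suc k) * h = real k * h + h" by (simp add: algebra_simps)
   have tr: "traj \<beta> y h = traj \<alpha> x (real (Suc k) * h)"
    "run \<alpha> x (real (Suc k) * h) = run \<alpha> x (real k * h) + run \<beta> y h"
    using shift_props(2,3)[OF \<alpha> kh(1) less_imp_le[OF h(1)], of x, folded y_def \<beta>_def]
    unfolding t by (auto simp: add.commute)
   from sub_step[OF sub u0 \<beta> y less_imp_le[OF h(1)] h(2) \<rho>(1,2) \<rho>(3)[OF yY] Bu[OF yY] z[folded y_def] ck'(3) BuCk,
     folded R_def C_def, folded Lr_def, folded q_def]
   obtain z' a1 where z': "usc_env u z' = ereal a1" and nz: "norm (z' - y) \<le> sqrt (Bu / c k)"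
    and le2: "a - c k * (norm (z - y))\<^sup>2 \<le> a1 - c k / q * (norm (z' - traj \<beta> y h))\<^sup>2 + run \<beta> y h
     + h * Lr * sqrt (Bu / c k) + (c k * (2 * Lr * C + C\<^sup>2) + Lr * C) * h\<^sup>2" by blast
   have s1: "sqrt (Bu / c k) \<le> sqrt (Bu / cm)" using ck' cm0 Bu0 by (intro real_sqrt_le_mono divide_left_mono) auto
   then have 1: "h * Lr * sqrt (Bu / c k) \<le> h * Lr * sqrt (Bu / cm)" using h Lr0 by (intro mult_left_mono) auto
   have "c k * (2 * Lr * C + C\<^sup>2) + Lr * C \<le> D (c 0)"
    unfolding D_def using ck' Lr0 C0 by (intro add_right_mono mult_right_mono) auto
   then have 2: "(c k * (2 * Lr * C + C\<^sup>2) + Lr * C) * h\<^sup>2 \<le> D (c 0) * h\<^sup>2" by (intro mult_right_mono) auto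
   have 3: "h * Lr * sqrt (Bu / cm) + D (c 0) * h\<^sup>2 = h * er" by (simp add: er_def power2_eq_square algebra_simps)
   note cS = cS[of k, folded q_def]
   have "norm y \<le> rb M r 1 + 1" using y rb_ge[OF M_nonneg r0, of 1] by simp
   from s.step_estimates(1)[OF y less_imp_le[OF h(1)] h(2) this] have "norm (traj \<beta> y h - y) \<le> \<rho> / 2"
    using hC unfolding C_def by linarith
   then have "norm (z' - traj \<beta> y h) \<le> \<rho>"
    using nz s1 small\<rho> norm_triangle_ineq4[of "z' - y" "traj \<beta> y h - y"]
    by (simp del: real_sqrt_le_iff)
   then have "z' \<in> cball (traj \<alpha> x (real (Suc k) * h)) \<rho>" by (simp add: tr dist_norm norm_minus_commute)
   moreover have "Ux - run \<alpha> x (real (Suc k) * h) - real (Suc k) * h * er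
     \<le> a1 - c (Suc k) * (norm (z' - traj \<alpha> x (real (Suc k) * h)))\<^sup>2"
    unfolding t[unfolded t] cS tr(2) tr(1)[symmetric] using le[folded y_def] le2 1 2 3
    by (simp add: distrib_right)
   ultimately show ?case using z' by blast
  qed
  from step[OF order_refl] obtain z a where z: "usc_env u z = ereal a" "z \<in> cball xS \<rho>"
   and le: "Ux - run \<alpha> x S - S * er \<le> a - c N * (norm (z - xS))\<^sup>2" unfolding h(3) xS_def by auto
  have a: "a \<le> Bu" using Bu[OF xSY z(2)] z(1) by simp
  have Ux0: "0 \<le> Ux" using U0[of x] Ux by simp
  have cN: "cm \<le> c N" using ck by simp
  have "cm * (norm (z - xS))\<^sup>2 \<le> c N * (norm (z - xS))\<^sup>2" using cN by (intro mult_right_mono) auto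
  also have "\<dots> \<le> E" using le a Ux0 er \<eta> by (simp add: E_def)
  finally have zE: "cm * (norm (z - xS))\<^sup>2 \<le> E" .
  with E\<delta> have "cm * (norm (z - xS))\<^sup>2 < cm * \<delta>\<^sup>2" by linarith
  then have "(norm (z - xS))\<^sup>2 < \<delta>\<^sup>2" using cm0 by simp
  then have "norm (z - xS) < \<delta>" using \<delta> by (simp add: power2_less_imp_less)
  then have "a < US + \<eta>" using \<delta>(2)[of z] z(1) by (simp add: U_def dist_norm)
  moreover have "0 \<le> c N * (norm (z - xS))\<^sup>2" using cN cm0 by simp
  ultimately show ?thesis using le er by linarith
 qed
 note main = this
 have "Ux \<le> run \<alpha> x S + US"
 proof (rule field_le_epsilon)
  fix e :: real assume e: "0 < e"
  have "0 < min 1 (e / 2)" "min 1 (e / 2) \<le> 1" "2 * min 1 (e / 2) \<le> e" using e by auto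
  then show "Ux \<le> run \<alpha> x S + US + e" using main[of "min 1 (e / 2)"] by linarith
 qed
 then show ?thesis using Ux US by (simp add: U_def xS_def)
qed

end

section \<open>Continuous dependence and neighbourhoods of the target\<close>

lemma flow_rc_perturb:
 assumes "adm M B L F ell" "adm M B L G m" and S: "0 \<le> S" and x: "norm x \<le> r" "norm x' \<le> r"
  and close: "\<And>s z. 0 \<le> s ==> s \<le> S ==> norm z \<le> rb M r S ==> norm (F s z - G s z) \<le> \<epsilon>"
   "\<And>s z. 0 \<le> s ==> s \<le> S ==> norm z \<le> rb M r S ==> norm (ell s z - m s z) \<le> \<epsilon>" and \<epsilon>: "0 \<le> \<epsilon>"
 defines "R \<equiv> rb M r S"
 defines "D \<equiv> 2 * (norm (x - x') + \<epsilon> * S) * exp (2 * L R * S)"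
 shows "norm (flow F x S - flow G x' S) \<le> D" "\<bar>rc F ell x S - rc G m x' S\<bar> \<le> (L R * D + \<epsilon>) * S"
proof -
 interpret F: adm M B L F ell by fact
 interpret G: adm M B L G m by fact
 have L0: "0 \<le> L R" by (rule lfieldD(2)[OF F.F])
 have bd: "norm (flow F x t) \<le> R" "norm (flow G x' t) \<le> R" if "0 \<le> t" "t \<le> S" for t
  unfolding R_def using F.flow_bound'[OF that x(1)] G.flow_bound'[OF that x(2)] by auto
 have D: "norm (flow F x t - flow G x' t) \<le> D" if t: "0 \<le> t" "t \<le> S" for t
 proof -
  have "norm (flow F x t - flow G x' t) \<le> 2 * (norm (x - x') + \<epsilon> * S) * exp (2 * L R * t)"
   by (rule solon_perturb[OF F.flow_solon G.flow_solon F.F bd close(1)[OF _ _ bd(2)[unfolded R_def]] \<epsilon> t])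
  also have "\<dots> \<le> D" unfolding D_def using t L0 \<epsilon> S by (intro mult_left_mono) (auto intro: mult_left_mono)
  finally show ?thesis .
 qed
 show "norm (flow F x S - flow G x' S) \<le> D" using D S by simp
 have "norm (integral {0..S} (\<lambda>s. ell s (flow F x s) - m s (flow G x' s))) \<le> (L R * D + \<epsilon>) * (S - 0)"
 proof (rule integral_norm_le_const)
  show "(\<lambda>s. ell s (flow F x s) - m s (flow G x' s)) integrable_on {0..S}"
   by (intro HK_integrable_diff F.ell_integrable_HK G.ell_integrable_HK order_refl)
  fix s assume s: "0 \<le> s" "s \<le> S"
  have "L R * norm (flow F x s - flow G x' s) \<le> L R * D" using D[OF s] L0 by (intro mult_left_mono)
  then show "norm (ell s (flow F x s) - m s (flow G x' s)) \<le> L R * D + \<epsilon>"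
   using norm_triangle_ineq[of "ell s (flow F x s) - ell s (flow G x' s)" "ell s (flow G x' s) - m s (flow G x' s)"]
    lfieldD(4)[OF F.ell s(1) bd[OF s]] close(2)[OF s bd(2)[OF s, unfolded R_def]] by simp
 qed (rule S)
 moreover have "rc F ell x S - rc G m x' S = integral {0..S} (\<lambda>s. ell s (flow F x s) - m s (flow G x' s))"
  unfolding rc_def by (rule HK_integral_diff[symmetric]) (intro F.ell_integrable_HK G.ell_integrable_HK order_refl)+
 ultimately show "\<bar>rc F ell x S - rc G m x' S\<bar> \<le> (L R * D + \<epsilon>) * S" by simp
qed

lemma (in adm) rc_dependence:
 assumes "norm x \<le> r" "norm z \<le> r" "0 \<le> t"
 shows "\<bar>rc F ell z t - rc F ell x t\<bar> \<le> L (rb M r t) * (2 * norm (z - x) * exp (2 * L (rb M r t) * t)) * t"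
 using flow_rc_perturb(2)[OF adm_axioms adm_axioms assms(3,2,1), of 0] by simp

lemma (in adm) flow_rc_continuous:
 assumes "0 \<le> t"
 shows "isCont (\<lambda>z. flow F z t) x" "isCont (\<lambda>z. rc F ell z t) x"
proof -
 define r where "r = norm x + 1"
 define R where "R = rb M r t"
 have L0: "0 \<le> L R" by (rule lfieldD(2)[OF F])
 have b: "norm z \<le> r" if "z \<in> ball x 1" for z
  using that norm_triangle_ineq[of "z - x" x] by (simp add: r_def dist_norm norm_minus_commute)
 have "continuous_on (ball x 1) (\<lambda>z. flow F z t)"
  by (rule lipschitz_on_continuous_on[where L = "2 * exp (2 * L R * t)"], rule lipschitz_onI)
    (use flow_dependence[OF b b assms order_refl] in \<open>auto simp: R_def dist_norm ac_simps\<close>)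
 then show "isCont (\<lambda>z. flow F z t) x" by (simp add: continuous_on_eq_continuous_at)
 have "continuous_on (ball x 1) (\<lambda>z. rc F ell z t)"
  by (rule lipschitz_on_continuous_on[where L = "L R * (2 * exp (2 * L R * t)) * t"], rule lipschitz_onI)
    (use rc_dependence[OF b b assms] L0 assms in \<open>auto simp: R_def dist_norm ac_simps\<close>)
 then show "isCont (\<lambda>z. rc F ell z t) x" by (simp add: continuous_on_eq_continuous_at)
qed

text \<open>T may be unbounded, only its frontier is compact. A segment from a point outside Q to a
  nearly closest point of T meets the frontier, which has positive distance from the complement of
  Q.\<close>

lemma closed_subset_open_infdist:
 fixes T :: "'x::euclidean_space set"
 assumes T: "closed T" "T \<noteq> {}" "compact (frontier T)" and Q: "open Q" "T \<subseteq> Q"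
 obtains \<delta> where "0 < \<delta>" "\<And>z. infdist z T < \<delta> ==> z \<in> Q"
proof -
 have "frontier T \<inter> - Q = {}" using Q T by (auto simp: frontier_def)
 then obtain \<delta> where \<delta>: "0 < \<delta>" "\<And>x y. x \<in> frontier T ==> y \<in> - Q ==> \<delta> \<le> dist x y"
  using separate_compact_closed[OF T(3), of "- Q"] Q by blast
 have "z \<in> Q" if z: "infdist z T < \<delta>" for z
 proof (rule ccontr)
  assume nz: "z \<notin> Q"
  obtain x where x: "x \<in> T" "dist z x < \<delta>" using infdist_attains_inf[OF T(1,2)] z by metis
  have "closed_segment z x \<inter> frontier T \<noteq> {}" by (rule connected_Int_frontier) (use x nz Q in auto)
  then obtain w where w: "w \<in> closed_segment z x" "w \<in> frontier T" by blast
  have "dist w z \<le> dist z x" using dist_in_closed_segment[OF w(1)] by (simp add: dist_commute)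
  moreover have "\<delta> \<le> dist w z" using \<delta>(2)[OF w(2), of z] nz by simp
  ultimately show False using x by simp
 qed
 then show ?thesis using that \<delta> by blast
qed

lemma small_near_target:
 fixes T :: "'x::euclidean_space set" and u :: "'x \<Rightarrow> ereal"
 assumes T: "closed T" "T \<noteq> {}" "compact (frontier T)"
  and u: "\<And>x. x \<in> T ==> u x = 0" "\<And>x. x \<in> frontier T ==> (u \<longlongrightarrow> 0) (at x)" and e: "0 < e"
 obtains \<delta> where "0 < \<delta>" "\<And>z. infdist z T < \<delta> ==> u z < ereal e"
proof -
 have "T \<subseteq> interior {z. u z < ereal e}"
 proof
  fix x assume x: "x \<in> T"
  have ux: "u x < ereal e" using u(1)[OF x] e by simp
  have "\<forall>\<^sub>F z in nhds x. u z < ereal e"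
  proof (cases "x \<in> interior T")
   case True
   then have "\<forall>\<^sub>F z in nhds x. z \<in> interior T" by (intro eventually_nhds_in_open) auto
   then show ?thesis by (rule eventually_mono) (use u(1) interior_subset e in fastforce)
  next
   case False
   then have "x \<in> frontier T" using x T by (simp add: frontier_def)
   then have "\<forall>\<^sub>F z in at x. u z < ereal e" using order_tendstoD(2)[OF u(2)] e by auto
   then show ?thesis using ux by (simp add: eventually_nhds_conv_at)
  qed
  then show "x \<in> interior {z. u z < ereal e}" unfolding eventually_nhds interior_def by blast
 qed
 from closed_subset_open_infdist[OF T open_interior this] that interior_subset
 show ?thesis by (metis (no_types, lifting) in_mono mem_Collect_eq)
qed

lemma usc_env_eq:
 fixes u :: "'x::topological_space \<Rightarrow> ereal"
 assumes "\<And>x c. u x < c ==> \<forall>\<^sub>F z in nhds x. u z < c"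
 shows "usc_env u x = u x"
proof (rule antisym[OF _ usc_env_ge])
 show "usc_env u x \<le> u x"
 proof (rule dense_ge)
  fix c assume "u x < c"
  from assms[OF this] show "usc_env u x \<le> c"
   unfolding usc_env_def by (intro Limsup_bounded) (auto elim: eventually_mono)
 qed
qed

context csys
begin

lemma V_supersolution: "viscosity_supersolution Ham V"
proof (rule dpp_supersolution[OF V_nonneg])
 fix x and e :: real assume "V x < \<infinity>" "0 < e"
 then obtain \<alpha> where \<alpha>: "\<alpha> \<in> ctrls" "J \<alpha> x \<le> V x + ereal e" by (rule near_optimal)
 have "- (FF \<alpha> t z \<bullet> p) - LL \<alpha> t z \<le> Ham z p" if "0 \<le> t" for t z p
  using Ham_ge[OF ctrls_in[OF \<alpha>(1) that]] by (simp add: FF_def LL_def)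
 moreover have "ereal (run \<alpha> x h) + V (traj \<alpha> x h) \<le> V x + ereal e" if "0 \<le> h" for h
  using V_dpp_ge[OF \<alpha>(1) that, of x] \<alpha>(2) by (rule order_trans)
 ultimately show "\<exists>F ell. adm M B L F ell \<and> (\<forall>t\<ge>0. \<forall>z p. - (F t z \<bullet> p) - ell t z \<le> Ham z p) \<and>
    (\<forall>h\<ge>0. ereal (rc F ell x h) + V (flow F x h) \<le> V x + ereal e)" using adm_ctrl[OF \<alpha>(1)] by blast
qed

text \<open>With a positive Hamiltonian, \<phi> would drop along the constant maximizing control by
  more than the cost spent; the local maximum together with \<open>V_dpp_le\<close> forces the drop
  to be at most that cost. \<open>V\<close> itself is tested, because \<open>usc_env_V\<close> below
  shows that it equals its upper envelope.\<close>

lemma V_subsolution_test: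
 assumes C1: "C1_on \<Omega> \<phi> D" and \<Omega>: "open \<Omega>" "x \<in> \<Omega>" and fin: "V x < \<infinity>"
  and ev: "\<forall>\<^sub>F z in nhds x. V z - ereal (\<phi> z) \<le> V x - ereal (\<phi> x)"
 shows "Ham x (D x) \<le> 0"
proof (rule ccontr)
 assume neg: "\<not> Ham x (D x) \<le> 0"
 define p where "p = D x"
 obtain a where a: "a \<in> K" "Ham x p = - (f x a \<bullet> p) - l x a" using Ham_attained[of x p] by metis
 \<comment> \<open>The linearization of \<phi> and the freezing of the fields each lose at most k h,
   against a gain of 6 k h.\<close>
 define k where "k = Ham x p / 6"
 have k: "0 < k" "- (f x a \<bullet> p) - l x a = 6 * k" using neg a by (auto simp: k_def p_def)
 define r where "r = norm x"
 define R where "R = rb M r 1 + 1"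
 define C where "C = M * (1 + rb M r 1)"
 have r0: "0 \<le> r" by (simp add: r_def)
 have xR: "norm x \<le> rb M r 1 + 1" using rb_ge[OF M_nonneg r0, of 1] by (simp add: r_def)
 have C0: "0 \<le> C" unfolding C_def using M_nonneg rb_ge[OF M_nonneg r0, of 1] r0 by simp
 define \<eta> where "\<eta> = k / (C + 1)"
 have \<eta>: "0 < \<eta>" "\<eta> * C \<le> k" using k C0 by (auto simp: \<eta>_def field_simps)
 obtain d1 where d1: "0 < d1" "\<And>z z'. z \<in> ball x d1 ==> z' \<in> ball x d1 ==>
   \<bar>\<phi> z' - \<phi> z - p \<bullet> (z' - z)\<bar> \<le> \<eta> * norm (z' - z)"
  using C1_on_linearization[OF C1 \<Omega>(2,1) \<eta>(1)] unfolding p_def by metis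
 obtain d2 where d2: "0 < d2" "\<And>z. dist z x < d2 ==> V z - ereal (\<phi> z) \<le> V x - ereal (\<phi> x)"
  using ev unfolding eventually_nhds_metric by blast
 define d where "d = min d1 d2"
 have d: "0 < d" using d1 d2 by (simp add: d_def)
 define Q where "Q = (1 + norm p) * (L R * C) + 1"
 have Q: "1 \<le> Q" unfolding Q_def using L_nonneg C0 by simp
 define h where "h = min 1 (min (d / (2 * (C + 1))) (k / Q))"
 have h: "0 < h" "h \<le> 1" using d C0 Q k by (auto simp: h_def)
 have hd: "C * h < d"
 proof -
  have "(C + 1) * h \<le> (C + 1) * (d / (2 * (C + 1)))" using C0 by (intro mult_left_mono) (auto simp: h_def)
  also have "\<dots> = d / 2" using C0 by (simp add: field_simps)
  finally show ?thesis using h d by (simp add: algebra_simps)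
 qed
 have hQ: "(1 + norm p) * (L R * C) * h \<le> k"
 proof -
  have "Q * h \<le> Q * (k / Q)" using Q by (intro mult_left_mono) (auto simp: h_def)
  then have "Q * h \<le> k" using Q by simp
  then show ?thesis using h unfolding Q_def by (simp add: algebra_simps)
 qed
 define \<alpha> where "\<alpha> = (\<lambda>_::real. a)"
 have \<alpha>: "\<alpha> \<in> ctrls" unfolding \<alpha>_def by (rule const_ctrl[OF a(1)])
 interpret adm M B L "FF \<alpha>" "LL \<alpha>" by (rule adm_ctrl[OF \<alpha>])
 define y where "y = traj \<alpha> x h"
 have "norm x \<le> r" by (simp add: r_def)
 note st = step_estimates[OF this less_imp_le[OF h(1)] h(2) xR, folded R_def C_def y_def]
 have int: "integral {0..h} (\<lambda>s. FF \<alpha> s x) = h *\<^sub>R f x a" "integral {0..h} (\<lambda>s. LL \<alpha> s x) = h * l x a"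
  using h by (auto simp: FF_def LL_def \<alpha>_def)
 have yd: "norm (y - x) < d" using st(1) hd by linarith
 obtain v where v: "V x = ereal v" using fin V_nonneg[of x] by (cases "V x") auto
 have "V y - ereal (\<phi> y) \<le> V x - ereal (\<phi> x)" using d2(2)[of y] yd by (simp add: dist_norm d_def)
 then obtain w where w: "V y = ereal w" "w - \<phi> y \<le> v - \<phi> x" using V_nonneg[of y] v by (cases "V y") auto
 have "V x \<le> ereal (run \<alpha> x h) + V y" unfolding y_def using h by (intro V_dpp_le \<alpha>) auto
 then have m: "\<phi> x - \<phi> y \<le> run \<alpha> x h" using v w by simp
 have "\<eta> * norm (y - x) \<le> \<eta> * (C * h)" using st(1) \<eta> by (intro mult_left_mono) auto
 also have "\<dots> \<le> k * h" using mult_right_mono[OF \<eta>(2), of h] h by (simp add: algebra_simps)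
 finally have p1: "\<phi> y - \<phi> x \<le> p \<bullet> (y - x) + k * h"
  using d1(2)[of x y] yd d1(1) by (simp add: d_def dist_norm norm_minus_commute)
 define E where "E = L R * (C * h) * h"
 have E2: "(1 + norm p) * E \<le> k * h"
  using mult_right_mono[OF hQ, of h] h by (simp add: E_def algebra_simps)
 have "p \<bullet> (y - x) = h * (f x a \<bullet> p) + p \<bullet> (y - x - h *\<^sub>R f x a)" by (simp add: inner_diff_right inner_commute)
 moreover have "\<bar>p \<bullet> (y - x - h *\<^sub>R f x a)\<bar> \<le> norm p * E"
  using Cauchy_Schwarz_ineq2[of p "y - x - h *\<^sub>R f x a"] mult_left_mono[OF st(2), of "norm p"]
  unfolding E_def int by simp
 moreover have "\<bar>run \<alpha> x h - h * l x a\<bar> \<le> E" using st(3) unfolding E_def int by simp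
 moreover have "h * (f x a \<bullet> p) + h * l x a = - 6 * (k * h)"
  using k(2) by (metis (no_types, opaque_lifting) add.inverse_inverse diff_minus_eq_add distrib_left minus_diff_eq mult.commute mult.left_commute mult_minus_right)
 moreover have "(1 + norm p) * E = E + norm p * E" by (simp add: distrib_right)
 ultimately have "0 \<le> - 6 * (k * h) + (1 + norm p) * E + k * h" using m p1 by linarith
 then show False using E2 mult_pos_pos[OF k(1) h(1)] by linarith
qed

end

section \<open>The target and uniqueness\<close>

lemma isCont_nhds: "isCont q x ==> (q \<longlongrightarrow> q x) (nhds x)"
 by (simp add: tendsto_at_iff_tendsto_nhds isCont_def)

locale csys_target = csys K f l M B L
 for K :: "'c::euclidean_space set" and f :: "'x::euclidean_space \<Rightarrow> 'c \<Rightarrow> 'x" and l :: "'x \<Rightarrow> 'c \<Rightarrow> real"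
  and M :: real and B L :: "real \<Rightarrow> real" +
 fixes T :: "'x set"
 assumes T: "closed T" "T \<noteq> {}" "compact (frontier T)"
  and V_T: "x \<in> T ==> V x = 0" and V_frontier_T: "x \<in> frontier T ==> (V \<longlongrightarrow> 0) (at x)"
  and near_optimal_approach: "V x < \<infinity> ==> \<exists>\<epsilon>>0. \<forall>\<alpha>\<in>ctrls. J \<alpha> x \<le> V x + ereal \<epsilon> \<longrightarrow>
   Liminf at_top (\<lambda>t. ereal (infdist (traj \<alpha> x t) T)) = 0"
begin

text \<open>If the distance to T stayed at least \<delta> at all positive times, so would its lower
  limit. The time found is positive, as is needed for the positive horizon in
  \<open>subsolution_dpp\<close>.\<close>

lemma reach_near:
 assumes "V x < \<infinity>" "0 < e" "0 < \<delta>"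
 obtains \<alpha> t where "\<alpha> \<in> ctrls" "0 < t" "J \<alpha> x \<le> V x + ereal e" "infdist (traj \<alpha> x t) T < \<delta>"
proof -
 obtain \<epsilon> where \<epsilon>: "0 < \<epsilon>" "\<And>\<alpha>. \<alpha> \<in> ctrls ==> J \<alpha> x \<le> V x + ereal \<epsilon> ==>
   Liminf at_top (\<lambda>t. ereal (infdist (traj \<alpha> x t) T)) = 0"
  using near_optimal_approach[OF assms(1)] by blast
 obtain \<alpha> where \<alpha>: "\<alpha> \<in> ctrls" "J \<alpha> x \<le> V x + ereal (min e \<epsilon>)"
  using near_optimal[OF assms(1), of "min e \<epsilon>"] assms(2) \<epsilon>(1) by auto
 have "V x + ereal (min e \<epsilon>) \<le> V x + ereal \<epsilon>" "V x + ereal (min e \<epsilon>) \<le> V x + ereal e"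
  by (intro add_left_mono; simp)+
 then have J: "J \<alpha> x \<le> V x + ereal \<epsilon>" "J \<alpha> x \<le> V x + ereal e" using \<alpha>(2) order_trans by blast+
 have "\<exists>t>0. infdist (traj \<alpha> x t) T < \<delta>"
 proof (rule ccontr)
  assume "\<not> ?thesis"
  then have "\<forall>\<^sub>F t in at_top. ereal \<delta> \<le> ereal (infdist (traj \<alpha> x t) T)"
   by (intro eventually_mono[OF eventually_gt_at_top[of 0]]) (metis ereal_less_eq(3) not_less)
  from Liminf_bounded[OF this] \<epsilon>(2)[OF \<alpha>(1) J(1)] assms(3) show False by simp
 qed
 then show ?thesis using that \<alpha>(1) J(2) by blast
qed

text \<open>The same control is used from nearby points: its cost and endpoint depend continuously
  on the start, and the endpoint remains where \<open>V\<close> is small. Of the margin 3e, one part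
  each goes to almost optimality, the change of the cost, and the value at the endpoint.\<close>

lemma V_usc:
 assumes "V x < c"
 shows "\<forall>\<^sub>F z in nhds x. V z < c"
proof -
 have fin: "V x < \<infinity>" using assms less_le_trans by force
 then obtain v where v: "V x = ereal v" using V_nonneg[of x] by (cases "V x") auto
 obtain c' where c': "ereal v < c'" "c' < c" using dense assms v by metis
 then obtain w where w: "c' = ereal w" by (cases c') auto
 define e where "e = (w - v) / 3"
 have "3 * e = w - v" by (simp add: e_def)
 then have e: "0 < e" "w = v + 3 * e" using c'(1) w by auto
 obtain \<delta> where \<delta>: "0 < \<delta>" "\<And>z. infdist z T < \<delta> ==> V z < ereal e"
  using small_near_target[OF T, of V, OF V_T V_frontier_T e(1)] by metis
 obtain \<alpha> t where \<alpha>: "\<alpha> \<in> ctrls" "0 < t" "J \<alpha> x \<le> V x + ereal e" "infdist (traj \<alpha> x t) T < \<delta>"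
  using reach_near[OF fin e(1) \<delta>(1)] by metis
 interpret adm M B L "FF \<alpha>" "LL \<alpha>" by (rule adm_ctrl[OF \<alpha>(1)])
 have c1: "isCont (\<lambda>z. infdist (traj \<alpha> z t) T) x"
  by (intro continuous_infdist flow_rc_continuous less_imp_le[OF \<alpha>(2)])
 have c2: "isCont (\<lambda>z. run \<alpha> z t) x" by (intro flow_rc_continuous less_imp_le[OF \<alpha>(2)])
 have run: "run \<alpha> x t \<le> v + e" using order_trans[OF rc_le_pcost \<alpha>(3)] \<alpha>(2) v by simp
 have "\<forall>\<^sub>F z in nhds x. infdist (traj \<alpha> z t) T < \<delta>"
  using order_tendstoD(2)[OF isCont_nhds[OF c1] \<alpha>(4)] .
 moreover have "\<forall>\<^sub>F z in nhds x. run \<alpha> z t < v + 2 * e"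
  using order_tendstoD(2)[OF isCont_nhds[OF c2], of "v + 2 * e"] run e by simp
 ultimately show ?thesis
 proof eventually_elim
  case (elim z)
  have "V z \<le> ereal (run \<alpha> z t) + V (traj \<alpha> z t)" by (rule V_dpp_le[OF \<alpha>(1) less_imp_le[OF \<alpha>(2)]])
  also have "\<dots> \<le> ereal (run \<alpha> z t) + ereal e" by (intro add_left_mono less_imp_le \<delta>(2) elim)
  also have "\<dots> \<le> ereal w" using elim e by simp
  also have "\<dots> < c" using c' w by simp
  finally show ?case .
 qed
qed

lemma usc_env_V: "usc_env V = V" by (rule ext, rule usc_env_eq, rule V_usc)

lemma open_Dom_V: "open (Dom V)"
proof (rule open_subopen[THEN iffD2], rule ballI)
 fix x assume "x \<in> Dom V"
 then have "\<forall>\<^sub>F z in nhds x. V z < \<infinity>" by (intro V_usc) (simp add: Dom_def)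
 then show "\<exists>Q. open Q \<and> x \<in> Q \<and> Q \<subseteq> Dom V" unfolding eventually_nhds Dom_def by blast
qed

lemma V_continuous:
 assumes lsc: "\<And>x c. c < V x ==> \<forall>\<^sub>F z in nhds x. c < V z"
 shows "continuous_on UNIV V"
proof -
 have "isCont V x" for x
  unfolding isCont_def by (rule order_tendstoI) (use lsc V_usc in \<open>auto simp: eventually_nhds_conv_at\<close>)
 then show ?thesis by (simp add: continuous_at_imp_continuous_on)
qed

lemma V_target_pair:
 assumes lsc: "\<And>x c. c < V x ==> \<forall>\<^sub>F z in nhds x. c < V z"
 shows "(V, Dom V) \<in> target_solution_pairs Ham T"
proof -
 have "viscosity_subsolution Ham (Dom V) V" unfolding viscosity_subsolution_def usc_env_V
 proof (intro conjI ballI allI impI; (elim conjE)?)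
  show "locally_bounded_on (Dom V) V" unfolding locally_bounded_on_def
  proof
   fix x assume "x \<in> Dom V"
   then obtain v where v: "V x = ereal v" using V_nonneg[of x] by (cases "V x") (auto simp: Dom_def)
   have "\<forall>\<^sub>F z in nhds x. V z < ereal (v + 1)" using v by (intro V_usc) simp
   then have "\<forall>\<^sub>F z in nhds x. \<bar>V z\<bar> \<le> ereal (v + 1)" by (rule eventually_mono) (simp add: V_nonneg)
   then show "\<exists>B. \<forall>\<^sub>F z in nhds x. \<bar>V z\<bar> \<le> ereal B" by blast
  qed
  fix x \<phi> D assume "x \<in> Dom V" "C1_on (Dom V) \<phi> D"
   "\<forall>\<^sub>F z in nhds x. V z - ereal (\<phi> z) \<le> V x - ereal (\<phi> x)"
  then show "Ham x (D x) \<le> 0"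
   by (intro V_subsolution_test[of "Dom V" \<phi> D x] open_Dom_V) (auto simp: Dom_def)
 qed
 moreover have "(V \<longlongrightarrow> \<infinity>) (at x)" if "x \<in> frontier (Dom V)" for x
 proof -
  have "V x = \<infinity>" using that open_Dom_V by (auto simp: frontier_def interior_open Dom_def)
  then show ?thesis using V_continuous[OF lsc] by (metis UNIV_I continuous_on_def)
 qed
 ultimately show ?thesis unfolding target_solution_pairs_def solution_pairs_def
  using open_Dom_V V_nonneg V_supersolution V_T V_frontier_T by (auto simp: Dom_def)
qed

text \<open>The chain V \<le> Sig \<le> lsc_env u \<le> u gives the lower bound, and with local
  boundedness of u the inclusion of \<Omega> in the domain. For the rest, a near-optimal trajectory
  is followed until u is small, and \<open>subsolution_dpp\<close> transports this smallness back to
  the starting point.\<close>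

lemma V_unique:
 assumes VS: "\<And>x. V x \<le> Sig x" and pair: "(u, \<Omega>) \<in> target_solution_pairs Ham T"
 shows "\<Omega> = Dom V" "u = V"
proof -
 have \<Omega>: "open \<Omega>" "T \<subseteq> \<Omega>" and u0: "\<And>x. 0 \<le> u x" and sup: "viscosity_supersolution Ham u"
  and sub: "viscosity_subsolution Ham \<Omega> u" and bl: "\<And>x. x \<in> frontier \<Omega> ==> (u \<longlongrightarrow> \<infinity>) (at x)"
  and uT: "\<And>x. x \<in> T ==> u x = 0" "\<And>x. x \<in> frontier T ==> (u \<longlongrightarrow> 0) (at x)"
  using pair unfolding target_solution_pairs_def solution_pairs_def by auto
 have Vu: "V x \<le> u x" for x
  using VS[of x] Sig_le_supersolution[OF sup u0, of x] lsc_env_le[of u x] by (meson order_trans)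
 have lb: "locally_bounded_on \<Omega> u" using sub by (simp add: viscosity_subsolution_def)
 have sub1: "\<Omega> \<subseteq> Dom V"
 proof
  fix x assume "x \<in> \<Omega>"
  then have "u x < \<infinity>" using usc_env_locally_bounded[OF lb] usc_env_ge[of u x] le_less_trans by blast
  then show "x \<in> Dom V" using Vu[of x] by (auto simp: Dom_def intro: le_less_trans)
 qed
 obtain \<delta>1 where \<delta>1: "0 < \<delta>1" "\<And>z. infdist z T < \<delta>1 ==> z \<in> \<Omega>"
  using closed_subset_open_infdist[OF T \<Omega>] by metis
 have key: "x \<in> \<Omega> \<and> usc_env u x \<le> V x + ereal (2 * e)" if fin: "V x < \<infinity>" and e: "0 < e" for x e
 proof -
  obtain v where v: "V x = ereal v" using fin V_nonneg[of x] by (cases "V x") auto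
  obtain \<delta>2 where \<delta>2: "0 < \<delta>2" "\<And>z. infdist z T < \<delta>2 ==> u z < ereal e"
   using small_near_target[OF T uT e] by metis
  obtain \<alpha> t where \<alpha>: "\<alpha> \<in> ctrls" "0 < t" "J \<alpha> x \<le> V x + ereal e" "infdist (traj \<alpha> x t) T < min \<delta>1 \<delta>2"
   using reach_near[OF fin e, of "min \<delta>1 \<delta>2"] \<delta>1 \<delta>2 by auto
  interpret adm M B L "FF \<alpha>" "LL \<alpha>" by (rule adm_ctrl[OF \<alpha>(1)])
  define y where "y = traj \<alpha> x"
  have yt\<Omega>: "y t \<in> \<Omega>" using \<delta>1 \<alpha>(4) by (simp add: y_def)
  have uyt: "usc_env u (y t) \<le> ereal e"
  proof -
   have "isCont (\<lambda>z. infdist z T) (y t)" by (intro continuous_infdist continuous_ident)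
   then have "\<forall>\<^sub>F z in nhds (y t). infdist z T < \<delta>2"
    by (rule order_tendstoD(2)[OF isCont_nhds]) (use \<alpha>(4) in \<open>simp add: y_def\<close>)
   then have "\<forall>\<^sub>F z in nhds (y t). u z \<le> ereal e"
    by (rule eventually_mono) (use \<delta>2 in \<open>auto intro: less_imp_le\<close>)
   then show ?thesis unfolding usc_env_def by (rule Limsup_bounded)
  qed
  have run: "run \<alpha> x t \<le> v + e" using order_trans[OF rc_le_pcost \<alpha>(3)] \<alpha>(2) v by simp
  \<comment> \<open>Any final piece of the trajectory that lies in \<Omega> already admits the
    subsolution estimate, with a bound that does not depend on where it begins.\<close>
  have tail: "usc_env u (y s) \<le> ereal (v + 2 * e)"
   if s: "0 \<le> s" "s < t" and in\<Omega>: "\<And>r. s \<le> r ==> r \<le> t ==> y r \<in> \<Omega>" for s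
  proof -
   have sc: "(\<lambda>r. \<alpha> (r + s)) \<in> ctrls" by (rule ctrls_shift[OF \<alpha>(1) s(1)])
   have tr: "traj (\<lambda>r. \<alpha> (r + s)) (y s) r = y (r + s)" if "0 \<le> r" for r
    unfolding y_def by (rule shift_props(2)[OF \<alpha>(1) s(1) that])
   have "usc_env u (y s) \<le> ereal (run (\<lambda>r. \<alpha> (r + s)) (y s) (t - s)) + usc_env u (traj (\<lambda>r. \<alpha> (r + s)) (y s) (t - s))"
    by (rule subsolution_dpp[OF sub u0 \<Omega>(1) sc]) (use s in \<open>auto simp: tr intro!: in\<Omega>\<close>)
   also have "traj (\<lambda>r. \<alpha> (r + s)) (y s) (t - s) = y t" using s by (simp add: tr)
   also have "ereal (run (\<lambda>r. \<alpha> (r + s)) (y s) (t - s)) + usc_env u (y t) \<le> ereal (v + e) + ereal e"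
   proof (rule add_mono[OF _ uyt])
    have "run \<alpha> x (s + (t - s)) = run \<alpha> x s + run (\<lambda>r. \<alpha> (r + s)) (y s) (t - s)"
     unfolding y_def by (rule shift_props(3)[OF \<alpha>(1) s(1)]) (use s in simp)
    then show "ereal (run (\<lambda>r. \<alpha> (r + s)) (y s) (t - s)) \<le> ereal (v + e)"
     using run rc_nonneg[OF s(1), of x] by simp
   qed
   finally show ?thesis by (simp add: add.commute)
  qed
  have all: "y s \<in> \<Omega>" if "0 \<le> s" "s \<le> t" for s
  proof (rule ccontr)
   assume "y s \<notin> \<Omega>"
   define Z where "Z = {0..t} \<inter> y -` (- \<Omega>)"
   have "closed Z" unfolding Z_def y_def
    by (rule continuous_closed_preimage[OF flow_continuous]) (use \<Omega> in auto)
   moreover have "Z \<subseteq> {0..t}" by (auto simp: Z_def)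
   ultimately have Z: "compact Z" using compact_Int_closed[of "{0..t}" Z] by (simp add: Int_absorb1)
   have "s \<in> Z" using that \<open>y s \<notin> \<Omega>\<close> by (simp add: Z_def)
   \<comment> \<open>The last time outside \<Omega>. Just after it the trajectory is in \<Omega>, so
     it sits at a frontier point, where u tends to infinity although \<open>tail\<close> bounds
     u.\<close>
   then obtain s0 where s0: "s0 \<in> Z" "\<And>r. r \<in> Z ==> r \<le> s0" using compact_attains_sup[OF Z] by blast
   have s0t: "0 \<le> s0" "s0 < t" "y s0 \<notin> \<Omega>" using s0(1) yt\<Omega> by (auto simp: Z_def less_le)
   have after: "y r \<in> \<Omega>" if "s0 < r" "r \<le> t" for r
    using s0(2)[of r] that s0t(1) by (force simp: Z_def)
   have lim: "(y \<longlongrightarrow> y s0) (at s0 within {0..t})"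
    using flow_continuous[of t x] s0t unfolding continuous_on_def y_def by auto
   have lim: "(y \<longlongrightarrow> y s0) (at_right s0)"
    using s0t at_within_Icc_at_right[OF s0t(2)] tendsto_within_subset[OF lim, of "{s0..t}"] by auto
   have ev: "\<forall>\<^sub>F r in at_right s0. s0 < r \<and> r \<le> t"
    using s0t(2) by (auto simp: eventually_at_right_field intro!: exI[of _ t])
   have "y s0 \<in> closure \<Omega>" by (rule Lim_in_closed_set[OF closed_closure _ _ lim])
      (use after in \<open>auto intro!: eventually_mono[OF ev] subsetD[OF closure_subset]\<close>)
   then have "y s0 \<in> frontier \<Omega>" using s0t \<Omega> by (simp add: frontier_def interior_open)
   then have "(u \<longlongrightarrow> \<infinity>) (at (y s0))" by (rule bl)
   then have "\<forall>\<^sub>F z in at (y s0). ereal (v + 2 * e) < u z" by (rule order_tendstoD) simp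
   \<comment> \<open>The blow-up is a punctured limit. This suffices, since later points of the
     trajectory lie in \<Omega> and so differ from \<open>y s0\<close>.\<close>
   then have "\<forall>\<^sub>F z in nhds (y s0). z \<noteq> y s0 \<longrightarrow> ereal (v + 2 * e) < u z"
    by (simp add: eventually_at_filter)
   then have "\<forall>\<^sub>F r in at_right s0. y r \<noteq> y s0 \<longrightarrow> ereal (v + 2 * e) < u (y r)"
    using lim by (rule eventually_compose_filterlim)
   moreover have "\<forall>\<^sub>F r in at_right s0. r < t"
    using s0t(2) by (auto simp: eventually_at_right_field intro!: exI[of _ t])
   ultimately have "\<forall>\<^sub>F r in at_right s0. False" using ev
   proof eventually_elim
    case (elim r)
    then have "y r \<noteq> y s0" using after s0t by metis
    moreover have "usc_env u (y r) \<le> ereal (v + 2 * e)" by (rule tail) (use elim s0t after in auto)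
    ultimately show ?case using elim usc_env_ge[of u "y r"] by (metis leD order_trans)
   qed
   then show False by simp
  qed
  have y0: "y 0 = x" by (simp add: y_def)
  show ?thesis using all[of 0] tail[of 0] \<alpha>(2) all v y0 by simp
 qed
 have sub2: "Dom V \<subseteq> \<Omega>" using key[of _ 1] by (auto simp: Dom_def)
 show eq: "\<Omega> = Dom V" using sub1 sub2 by blast
 show "u = V"
 proof
  fix x
  show "u x = V x"
  proof (cases "V x < \<infinity>")
   case True
   have "usc_env u x \<le> V x"
   proof (rule ereal_le_epsilon2)
    fix e :: real assume "0 < e"
    then show "usc_env u x \<le> V x + ereal e" using key[OF True, of "e / 2"] by simp
   qed
   then show ?thesis using Vu[of x] usc_env_ge[of u x] by (meson order_antisym order_trans)
  next
   case False
   then show ?thesis using Vu[of x] by auto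
  qed
 qed
qed

end

section \<open>Shadowing\<close>

lemma diagonal_convergent_subseq:
 fixes g :: "nat \<Rightarrow> nat \<Rightarrow> 'a::euclidean_space"
 assumes bdd: "\<And>k. bounded (range (\<lambda>n. g n k))"
 obtains r :: "nat \<Rightarrow> nat" where "strict_mono r" "\<And>k. convergent (\<lambda>n. g (r n) k)"
proof -
 let ?P = "\<lambda>k s. convergent (\<lambda>n. g (s n) k)"
 interpret subseqs ?P
 proof
  fix k and s :: "nat \<Rightarrow> nat"
  have "bounded (range (\<lambda>n. g (s n) k))" by (rule bounded_subset[OF bdd[of k]]) auto
  from bounded_imp_convergent_subsequence[OF this]
  show "\<exists>r'. strict_mono r' \<and> convergent (\<lambda>n. g ((s \<circ> r') n) k)"
   by (auto simp: convergent_def o_def)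
 qed
 have "convergent (\<lambda>n. g (diagseq n) k)" for k
 proof -
  have "?P k (diagseq \<circ> ((+) (Suc k)))"
  proof (rule diagseq_holds)
   fix r s :: "nat \<Rightarrow> nat" and n assume "strict_mono r" "convergent (\<lambda>i. g (s i) n)"
   then show "convergent (\<lambda>i. g ((s \<circ> r) i) n)"
    using convergent_subseq_convergent[of "\<lambda>i. g (s i) n" r] by (simp add: o_def)
  qed
  then obtain l where "(\<lambda>n. g (diagseq (n + Suc k)) k) \<longlonglongrightarrow> l"
   by (auto simp: convergent_def o_def add.commute)
  then have "(\<lambda>n. g (diagseq n) k) \<longlonglongrightarrow> l" by (rule LIMSEQ_offset)
  then show ?thesis by (auto simp: convergent_def)
 qed
 then show ?thesis using that subseq_diagseq by blast
qed

lemma solon_reverse: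
 assumes y: "solon S F x y" and S: "0 \<le> S"
 shows "solon S (\<lambda>t z. - F (S - t) z) (y S) (\<lambda>t. y (S - t))" unfolding solon_def
proof (intro ballI conjI)
 fix t assume t: "t \<in> {0..S}"
 have i: "set_integrable lborel {S - t..S} (\<lambda>s. F s (y s))"
  by (rule set_integrable_subset[OF solonD(1)[OF y S order_refl]]) (use t in auto)
 have "set_integrable lborel {S - S..S - (S - t)} (\<lambda>s. F (S - s) (y (S - s)))"
  by (rule set_integrable_reflect[OF i])
 then have j: "set_integrable lborel {0..t} (\<lambda>s. F (S - s) (y (S - s)))" by simp
 then show "set_integrable lborel {0..t} (\<lambda>s. - F (S - s) (y (S - s)))"
  by (simp add: set_integrable_def)
 have "integral {0..t} (\<lambda>s. F (S - s) (y (S - s))) = integral {S - t..S} (\<lambda>s. F s (y s))"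
  using integral_reflect[OF i, of S] by simp
 also have "\<dots> = y S - y (S - t)" using solon_diff(1)[OF y, of "S - t" S] t by simp
 finally show "y (S - t) = y S + integral {0..t} (\<lambda>s. - F (S - s) (y (S - s)))" by simp
qed

context csys
begin

lemma traj_cong:
 assumes "\<And>t. 0 \<le> t ==> \<alpha> t = \<beta> t"
 shows "traj \<alpha> x = traj \<beta> x" "0 \<le> t ==> run \<alpha> x t = run \<beta> x t" "J \<alpha> x = J \<beta> x"
proof -
 show 1: "traj \<alpha> x = traj \<beta> x" by (rule flow_cong) (simp add: FF_def assms)
 show "run \<alpha> x t = run \<beta> x t" if "0 \<le> t"
  unfolding rc_def 1 by (rule HK_integral_cong) (simp add: LL_def assms)
 show "J \<alpha> x = J \<beta> x" by (rule pcost_cong) (auto simp: FF_def LL_def assms)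
qed

lemma csys_reverse: "csys K (\<lambda>x a. - f x a) l M B L"
proof
 show "continuous_on (UNIV \<times> K) (\<lambda>(x, a). - f x a)"
  using continuous_on_minus[OF f_cont] by (simp add: case_prod_unfold)
 show "norm (- f x a - - f y a) \<le> L R * norm (x - y)" if "a \<in> K" "norm x \<le> R" "norm y \<le> R" for a x y R
  using f_lip[OF that] by (simp add: norm_minus_commute)
qed (use K l_cont M_nonneg L_nonneg growth f_bound l_bound l_lip l_nonneg in auto)

text \<open>The trajectory run backwards solves the system with velocity -f and reversed control.
  Existence for that system makes the time-one map onto, and its dependence on initial values bounds
  the inverse.\<close>

lemma backward_flow:
 assumes \<alpha>: "\<alpha> \<in> ctrls"
 shows "\<exists>z. traj \<alpha> z 1 = \<zeta>"
  "norm (traj \<alpha> z 1) \<le> r ==> norm (traj \<alpha> z' 1) \<le> r ==>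
   norm (z - z') \<le> 2 * norm (traj \<alpha> z 1 - traj \<alpha> z' 1) * exp (2 * L (rb M r 1))"
proof -
 interpret rev: csys K "\<lambda>x a. - f x a" l M B L by (rule csys_reverse)
 \<comment> \<open>Beyond time 1 the reversed control is frozen at \<open>\<alpha> 0\<close>, a mere
   default value.\<close>
 define \<beta> where "\<beta> t = \<alpha> (max 0 (1 - t))" for t
 have "(\<lambda>t. \<alpha> (max 0 (1 - t))) \<in> borel \<rightarrow>\<^sub>M restrict_space borel K"
  by (rule measurable_compose[OF _ control_total[OF \<alpha>[unfolded ctrls_def]]]) simp
 then have \<beta>: "\<beta> \<in> ctrls" unfolding ctrls_def by (rule control_restrict) (simp add: \<beta>_def)
 then have \<beta>': "\<beta> \<in> rev.ctrls" by (simp add: ctrls_def rev.ctrls_def)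
 interpret A: adm M B L "FF \<alpha>" "LL \<alpha>" by (rule adm_ctrl[OF \<alpha>])
 interpret R: adm M B L "rev.FF \<beta>" "rev.LL \<beta>" by (rule rev.adm_ctrl[OF \<beta>'])
 have FFr: "rev.FF \<beta> t w = - FF \<alpha> (1 - t) w" if "0 \<le> t" "t \<le> 1" for t w
  using that by (simp add: rev.FF_def FF_def \<beta>_def)
 have bk: "rev.traj \<beta> (traj \<alpha> z 1) t = traj \<alpha> z (1 - t)" if "0 \<le> t" "t \<le> 1" for z t
 proof -
  have "solon 1 (\<lambda>t w. - FF \<alpha> (1 - t) w) (traj \<alpha> z 1) (\<lambda>t. traj \<alpha> z (1 - t))"
   by (rule solon_reverse[OF A.flow_solon]) simp
  then have "solon 1 (rev.FF \<beta>) (traj \<alpha> z 1) (\<lambda>t. traj \<alpha> z (1 - t))"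
   by (rule solon_cong[THEN iffD1, rotated -1]) (auto simp: FFr)
  from flow_eqI[OF R.F R.lg this that] show ?thesis .
 qed
 show "\<exists>z. traj \<alpha> z 1 = \<zeta>"
 proof
  let ?z = "rev.traj \<beta> \<zeta> 1"
  have "solon 1 (\<lambda>t w. - rev.FF \<beta> (1 - t) w) ?z (\<lambda>t. rev.traj \<beta> \<zeta> (1 - t))"
   by (rule solon_reverse[OF R.flow_solon]) simp
  then have "solon 1 (FF \<alpha>) ?z (\<lambda>t. rev.traj \<beta> \<zeta> (1 - t))"
   by (rule solon_cong[THEN iffD1, rotated -1]) (auto simp: FFr)
  from flow_eqI[OF A.F A.lg this, of 1] show "traj \<alpha> ?z 1 = \<zeta>" by simp
 qed
 assume "norm (traj \<alpha> z 1) \<le> r" "norm (traj \<alpha> z' 1) \<le> r"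
 from R.flow_dependence[OF this, of 1 1] bk[of 1 z] bk[of 1 z']
 show "norm (z - z') \<le> 2 * norm (traj \<alpha> z 1 - traj \<alpha> z' 1) * exp (2 * L (rb M r 1))" by simp
qed

text \<open>The k-th control is used on [k, k+1). The \<open>max 0\<close> makes each piece, for a
  fixed index, a measurable function on the whole line, as the countable case distinction in
  \<open>glue_ctrl\<close> requires.\<close>

definition glue :: "(nat \<Rightarrow> real \<Rightarrow> 'c) \<Rightarrow> real \<Rightarrow> 'c" where
 "glue \<sigma> t = \<sigma> (nat \<lfloor>t\<rfloor>) (max 0 (t - of_int \<lfloor>t\<rfloor>))"

lemma glue_ctrl:
 assumes "\<And>k. \<sigma> k \<in> ctrls"
 shows "glue \<sigma> \<in> ctrls" unfolding ctrls_def
proof (rule control_restrict)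
 have 1: "(\<lambda>t. \<sigma> (nat i) (max 0 (t - of_int i))) \<in> borel \<rightarrow>\<^sub>M restrict_space borel K" for i
  by (rule measurable_compose[OF _ control_total[OF assms[unfolded ctrls_def]]]) simp
 have 2: "(\<lambda>t::real. \<lfloor>t\<rfloor>) \<in> borel \<rightarrow>\<^sub>M count_space UNIV" by measurable
 show "(\<lambda>t. \<sigma> (nat \<lfloor>t\<rfloor>) (max 0 (t - of_int \<lfloor>t\<rfloor>))) \<in> borel \<rightarrow>\<^sub>M restrict_space borel K"
  using measurable_compose_countable[OF 1 2] .
qed (simp add: glue_def)

lemma glue_props:
 assumes \<sigma>: "\<And>k. \<sigma> k \<in> ctrls"
 shows "traj (glue \<sigma>) z (real (Suc k)) = traj (\<sigma> k) (traj (glue \<sigma>) z (real k)) 1"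
  and "run (glue \<sigma>) z (real (Suc k)) = run (glue \<sigma>) z (real k) + run (\<sigma> k) (traj (glue \<sigma>) z (real k)) 1"
proof -
 let ?g = "glue \<sigma>"
 note g = glue_ctrl[OF \<sigma>]
 define s where "s = (\<lambda>t. ?g (t + real k))"
 define s' where "s' = (\<lambda>t. ?g (t + real (Suc k)))"
 have sc: "s \<in> ctrls" "s' \<in> ctrls" unfolding s_def s'_def by (intro ctrls_shift g; simp)+
 have e: "s t = cat 1 (\<sigma> k) s' t" if "0 \<le> t" for t
 proof (cases "t < 1")
  case True
  then have "\<lfloor>t + real k\<rfloor> = int k" using that by linarith
  then show ?thesis using True that by (simp add: s_def cat_def glue_def)
 next
  case False
  then show ?thesis by (simp add: s_def s'_def cat_def)
 qed
 let ?y = "traj ?g z (real k)"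
 have a: "traj s ?y 1 = traj ?g z (1 + real k)"
  unfolding s_def using shift_props(2)[OF g, where ?t0.0 = "real k" and t = 1 and x = z] by simp
 have b: "run ?g z (real k + 1) = run ?g z (real k) + run s ?y 1"
  unfolding s_def using shift_props(3)[OF g, where ?t0.0 = "real k" and t = 1 and x = z] by simp
 have e1: "traj s ?y = traj (cat 1 (\<sigma> k) s') ?y" by (rule traj_cong(1)) (rule e)
 have e2: "run s ?y 1 = run (cat 1 (\<sigma> k) s') ?y 1" by (rule traj_cong(2)) (use e in auto)
 have c: "traj s ?y 1 = traj (\<sigma> k) ?y 1" "run s ?y 1 = run (\<sigma> k) ?y 1"
  using e1 e2 cat_props(1,2)[OF \<sigma>[of k] sc(2), where ?t0.0 = 1 and t = 1 and x = ?y] by auto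
 show "traj ?g z (real (Suc k)) = traj (\<sigma> k) ?y 1" using a c by (simp add: add.commute)
 show "run ?g z (real (Suc k)) = run ?g z (real k) + run (\<sigma> k) ?y 1" using b c by (simp add: add.commute)
qed

text \<open>Forward concatenation would amplify the mismatch at each integer time without end.
  Solving backward instead, one only needs tolerances \<rho>(k) so small that a point within
  \<rho>(k+1) of \<eta>(k+1) is pulled back to within \<rho>(k) of \<eta>(k). Starting points good
  up to time N accumulate at one that is good forever; the price is that it is only near
  \<eta>(0).\<close>

lemma shadowing:
 fixes \<eta> :: "nat \<Rightarrow> 'x" and \<gamma> A :: "nat \<Rightarrow> real"
 assumes app: "\<And>k \<delta>. 0 < \<delta> ==> \<exists>\<sigma>\<in>ctrls. \<exists>b. norm b \<le> A k \<and> norm (b - \<eta> k) \<le> \<delta> \<and>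
    norm (traj \<sigma> b 1) \<le> A (Suc k) \<and> norm (traj \<sigma> b 1 - \<eta> (Suc k)) \<le> \<delta> \<and> run \<sigma> b 1 \<le> \<gamma> k + \<delta>"
  and \<eta>A: "\<And>k. norm (\<eta> k) \<le> A k" and c: "\<And>N. (\<Sum>k<N. \<gamma> k) \<le> c" and \<epsilon>: "0 < \<epsilon>" "\<epsilon> \<le> 1"
 shows "\<exists>z. norm (z - \<eta> 0) \<le> \<epsilon> \<and> V z \<le> ereal (c + 4 * \<epsilon>)"
proof -
 \<comment> \<open>\<open>H k\<close> is a Lipschitz constant of the inverse time-one map on the
   k-th interval, \<open>G k\<close> (in the next line) one for the cost of that interval, enlarged
   by 1 to allow division.\<close>
 define H where "H k = 2 * exp (2 * L (rb M (A (Suc k) + 1) 1))" for k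
 define G where "G k = L (rb M (A k + 1) 1) * (2 * exp (2 * L (rb M (A k + 1) 1) * 1)) * 1 + 1" for k
 have H1: "1 \<le> H k" for k unfolding H_def
  using one_le_exp_iff[of "2 * L (rb M (A (Suc k) + 1) 1)"] L_nonneg[of "rb M (A (Suc k) + 1) 1"] by linarith
 have G1: "1 \<le> G k" for k unfolding G_def using L_nonneg by simp
 \<comment> \<open>A deviation of 2 \<theta>(k) at the start of the k-th interval changes its cost
   by at most \<epsilon>/2^k.\<close>
 define \<theta> where "\<theta> k = \<epsilon> * (1/2)^k / (2 * G k)" for k
 have \<theta>: "0 < \<theta> k" for k unfolding \<theta>_def using \<epsilon> G1[of k] by simp
 define \<rho> where "\<rho> = rec_nat (min \<epsilon> (\<theta> 0)) (\<lambda>k p. min (p / (4 * H k)) (\<theta> (Suc k)))"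
 have \<rho>0: "\<rho> 0 = min \<epsilon> (\<theta> 0)" and \<rho>S: "\<rho> (Suc k) = min (\<rho> k / (4 * H k)) (\<theta> (Suc k))" for k
  by (simp_all add: \<rho>_def)
 have \<rho>p: "0 < \<rho> k" for k
 proof (induction k)
  case (Suc k) then show ?case using H1[of k] \<theta> by (simp add: \<rho>S)
 qed (use \<epsilon> \<theta> in \<open>simp add: \<rho>0\<close>)
 have \<rho>\<theta>: "\<rho> k \<le> \<theta> k" for k by (cases k) (simp_all add: \<rho>0 \<rho>S)
 have \<rho>H: "H k * \<rho> (Suc k) \<le> \<rho> k / 4" for k
 proof -
  have "H k * \<rho> (Suc k) \<le> H k * (\<rho> k / (4 * H k))" using H1[of k] by (intro mult_left_mono) (auto simp: \<rho>S)
  then show ?thesis using H1[of k] by (simp add: field_simps)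
 qed
 have \<rho>dec: "\<rho> (Suc k) \<le> \<rho> k / 4" for k
  using mult_right_mono[OF H1[of k], of "\<rho> (Suc k)"] \<rho>H[of k] \<rho>p[of "Suc k"] by linarith
 have \<rho>1: "\<rho> k \<le> 1" for k
 proof (induction k)
  case (Suc k) then show ?case using \<rho>dec[of k] \<rho>p[of k] by linarith
 qed (use \<epsilon> in \<open>simp add: \<rho>0\<close>)
 define \<delta> where "\<delta> k = min (\<rho> (Suc k)) (\<epsilon> * (1/2)^k)" for k
 have \<delta>: "0 < \<delta> k" for k unfolding \<delta>_def using \<rho>p \<epsilon> by simp
 have "\<forall>k. \<exists>\<sigma> b. \<sigma> \<in> ctrls \<and> norm b \<le> A k \<and> norm (b - \<eta> k) \<le> \<delta> k \<and>
    norm (traj \<sigma> b 1) \<le> A (Suc k) \<and> norm (traj \<sigma> b 1 - \<eta> (Suc k)) \<le> \<delta> k \<and> run \<sigma> b 1 \<le> \<gamma> k + \<delta> k"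
  using app[OF \<delta>] by blast
 then obtain \<sigma> b where \<sigma>: "\<And>k. \<sigma> k \<in> ctrls" and bA: "\<And>k. norm (b k) \<le> A k"
  and b\<eta>: "\<And>k. norm (b k - \<eta> k) \<le> \<delta> k" and tA: "\<And>k. norm (traj (\<sigma> k) (b k) 1) \<le> A (Suc k)"
  and t\<eta>: "\<And>k. norm (traj (\<sigma> k) (b k) 1 - \<eta> (Suc k)) \<le> \<delta> k" and rb': "\<And>k. run (\<sigma> k) (b k) 1 \<le> \<gamma> k + \<delta> k"
  by metis
 define \<beta> where "\<beta> = glue \<sigma>"
 have \<beta>: "\<beta> \<in> ctrls" unfolding \<beta>_def by (rule glue_ctrl[OF \<sigma>])
 note gp = glue_props[where \<sigma> = \<sigma>, OF \<sigma>, folded \<beta>_def]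
 interpret \<beta>: adm M B L "FF \<beta>" "LL \<beta>" by (rule adm_ctrl[OF \<beta>])
 have bk: "\<exists>w. traj (\<sigma> k) w 1 = \<zeta> \<and> norm (w - \<eta> k) \<le> \<rho> k" if \<zeta>: "norm (\<zeta> - \<eta> (Suc k)) \<le> \<rho> (Suc k)" for \<zeta> k
 proof -
  obtain w where w: "traj (\<sigma> k) w 1 = \<zeta>" using backward_flow(1)[OF \<sigma>] by blast
  have n\<zeta>: "norm (traj (\<sigma> k) w 1) \<le> A (Suc k) + 1"
   using w \<zeta> \<eta>A[of "Suc k"] \<rho>1[of "Suc k"] norm_triangle_ineq[of "\<zeta> - \<eta> (Suc k)" "\<eta> (Suc k)"] by simp
  have "norm (w - b k) \<le> 2 * norm (traj (\<sigma> k) w 1 - traj (\<sigma> k) (b k) 1) * exp (2 * L (rb M (A (Suc k) + 1) 1))"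
   by (rule backward_flow(2)[OF \<sigma> n\<zeta>]) (use tA[of k] in simp)
  also have "\<dots> = H k * norm (\<zeta> - traj (\<sigma> k) (b k) 1)" by (simp add: w H_def)
  also have "norm (\<zeta> - traj (\<sigma> k) (b k) 1) \<le> \<rho> (Suc k) + \<rho> (Suc k)"
   using norm_triangle_ineq4[of "\<zeta> - \<eta> (Suc k)" "traj (\<sigma> k) (b k) 1 - \<eta> (Suc k)"] \<zeta> t\<eta>[of k] by (simp add: \<delta>_def)
  then have "H k * norm (\<zeta> - traj (\<sigma> k) (b k) 1) \<le> H k * (\<rho> (Suc k) + \<rho> (Suc k))"
   using H1[of k] by (intro mult_left_mono) auto
  also have "\<dots> \<le> \<rho> k / 2" using \<rho>H[of k] by (simp add: distrib_left)
  finally have "norm (w - b k) \<le> \<rho> k / 2" .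
  moreover have "norm (b k - \<eta> k) \<le> \<rho> k / 4" using b\<eta>[of k] \<rho>dec[of k] by (simp add: \<delta>_def)
  ultimately have "norm (w - \<eta> k) \<le> \<rho> k"
   using norm_triangle_ineq[of "w - b k" "b k - \<eta> k"] \<rho>p[of k] by simp
  then show ?thesis using w by blast
 qed
 have chain: "\<exists>z. norm (z - \<eta> 0) \<le> \<rho> 0 \<and> (\<forall>k\<le>N. norm (traj \<beta> z (real k) - \<eta> k) \<le> \<rho> k)" for N
 proof -
  \<comment> \<open>Induction on the number of intervals, with the first index arbitrary: the chain
    is extended at its beginning by one backward step.\<close>
  have "\<exists>w. norm (w 0 - \<eta> m) \<le> \<rho> m \<and> (\<forall>k<N'. w (Suc k) = traj (\<sigma> (m + k)) (w k) 1) \<and>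
    (\<forall>k\<le>N'. norm (w k - \<eta> (m + k)) \<le> \<rho> (m + k))" for m N'
  proof (induction N' arbitrary: m)
   case 0
   show ?case using \<rho>p[of m] by (intro exI[of _ "\<lambda>_. \<eta> m"]) auto
  next
   case (Suc N')
   from Suc[of "Suc m"] obtain w where w: "norm (w 0 - \<eta> (Suc m)) \<le> \<rho> (Suc m)"
    "\<And>k. k < N' ==> w (Suc k) = traj (\<sigma> (Suc m + k)) (w k) 1"
    "\<And>k. k \<le> N' ==> norm (w k - \<eta> (Suc m + k)) \<le> \<rho> (Suc m + k)" by blast
   from bk[OF w(1)] obtain w0 where w0: "traj (\<sigma> m) w0 1 = w 0" "norm (w0 - \<eta> m) \<le> \<rho> m" by blast
   define w' where "w' k = (case k of 0 \<Rightarrow> w0 | Suc j \<Rightarrow> w j)" for k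
   have "w' (Suc k) = traj (\<sigma> (m + k)) (w' k) 1" if "k < Suc N'" for k
    using that w0 w(2) by (cases k) (auto simp: w'_def)
   moreover have "norm (w' k - \<eta> (m + k)) \<le> \<rho> (m + k)" if "k \<le> Suc N'" for k
    using that w0 w(3) by (cases k) (auto simp: w'_def)
   ultimately show ?case using w0 by (intro exI[of _ w']) (auto simp: w'_def)
  qed
  from this[of 0 N] obtain w where w: "norm (w 0 - \<eta> 0) \<le> \<rho> 0" "\<And>k. k < N ==> w (Suc k) = traj (\<sigma> k) (w k) 1"
    "\<And>k. k \<le> N ==> norm (w k - \<eta> k) \<le> \<rho> k" by auto
  have "traj \<beta> (w 0) (real k) = w k" if "k \<le> N" for k using that
  proof (induction k)
   case (Suc k)
   then show ?case using w(2)[of k] gp(1)[of "w 0" k] by simp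
  qed simp
  then show ?thesis using w by (intro exI[of _ "w 0"]) auto
 qed
 then obtain z where z: "\<And>N. norm (z N - \<eta> 0) \<le> \<rho> 0" "\<And>N k. k \<le> N ==> norm (traj \<beta> (z N) (real k) - \<eta> k) \<le> \<rho> k"
  by metis
 have "seq_compact (cball (\<eta> 0) (\<rho> 0))" by (intro compact_imp_seq_compact compact_cball)
 moreover have "\<forall>N. z N \<in> cball (\<eta> 0) (\<rho> 0)" using z(1) by (simp add: dist_norm norm_minus_commute)
 ultimately obtain y s where ys: "y \<in> cball (\<eta> 0) (\<rho> 0)" "strict_mono s" "(z \<circ> s) \<longlonglongrightarrow> y"
  unfolding seq_compact_def by blast
 have near: "norm (traj \<beta> y (real k) - \<eta> k) \<le> \<rho> k" for k
 proof -
  have "isCont (\<lambda>z. traj \<beta> z (real k)) y" by (rule \<beta>.flow_rc_continuous) simp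
  then have "(\<lambda>i. traj \<beta> (z (s i)) (real k)) \<longlonglongrightarrow> traj \<beta> y (real k)"
   using ys(3) isCont_tendsto_compose by (fastforce simp: o_def)
  then have "(\<lambda>i. norm (traj \<beta> (z (s i)) (real k) - \<eta> k)) \<longlonglongrightarrow> norm (traj \<beta> y (real k) - \<eta> k)"
   by (intro tendsto_intros)
  then show ?thesis
   by (rule Lim_bounded[where M = k]) (use z(2) seq_suble[OF ys(2)] order_trans in blast)
 qed
 \<comment> \<open>One \<epsilon>/2^k comes from the deviation of the starting point, one from the
   tolerance of the approximating control; summed over k this is 4 \<epsilon>.\<close>
 have step: "run (\<sigma> k) (traj \<beta> y (real k)) 1 \<le> \<gamma> k + 2 * \<epsilon> * (1/2)^k" for k
 proof -
  interpret s: adm M B L "FF (\<sigma> k)" "LL (\<sigma> k)" by (rule adm_ctrl[OF \<sigma>])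
  let ?y = "traj \<beta> y (real k)"
  have ny: "norm ?y \<le> A k + 1"
   using near[of k] \<eta>A[of k] \<rho>1[of k] norm_triangle_ineq[of "?y - \<eta> k" "\<eta> k"] by simp
  have nb: "norm (b k) \<le> A k + 1" using bA[of k] by simp
  have "norm (?y - b k) \<le> \<rho> k + \<rho> k"
   using norm_triangle_ineq4[of "?y - \<eta> k" "b k - \<eta> k"] near[of k] b\<eta>[of k] \<rho>dec[of k] \<rho>p[of k] by (simp add: \<delta>_def)
  also have "\<dots> \<le> 2 * \<theta> k" using \<rho>\<theta>[of k] by simp
  finally have d: "norm (?y - b k) \<le> 2 * \<theta> k" .
  have "\<bar>run (\<sigma> k) ?y 1 - run (\<sigma> k) (b k) 1\<bar>
    \<le> L (rb M (A k + 1) 1) * (2 * norm (?y - b k) * exp (2 * L (rb M (A k + 1) 1) * 1)) * 1"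
   by (rule s.rc_dependence[OF nb ny]) simp
  also have "\<dots> = (G k - 1) * norm (?y - b k)" by (simp add: G_def)
  also have "\<dots> \<le> G k * (2 * \<theta> k)" using G1[of k] d by (intro mult_mono) auto
  also have "\<dots> = \<epsilon> * (1/2)^k" using G1[of k] by (simp add: \<theta>_def)
  finally have "run (\<sigma> k) ?y 1 \<le> run (\<sigma> k) (b k) 1 + \<epsilon> * (1/2)^k" by linarith
  moreover have "\<delta> k \<le> \<epsilon> * (1/2)^k" by (simp add: \<delta>_def)
  ultimately show ?thesis using rb'[of k] by linarith
 qed
 have total: "run \<beta> y (real N) \<le> (\<Sum>k<N. \<gamma> k) + 4 * \<epsilon> * (1 - (1/2)^N)" for N
 proof (induction N)
  case (Suc N)
  then show ?case using step[of N] gp(2)[of y N] by (simp add: algebra_simps)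
 qed simp
 have "run \<beta> y (real N) \<le> c + 4 * \<epsilon>" for N
 proof -
  have "4 * \<epsilon> * (1 - (1/2)^N) \<le> 4 * \<epsilon> * 1" using \<epsilon> by (intro mult_left_mono) auto
  then show ?thesis using total[of N] c[of N] by linarith
 qed
 then have "J \<beta> y \<le> ereal (c + 4 * \<epsilon>)" unfolding \<beta>.pcost_SUP by (intro SUP_least) simp
 then have "V y \<le> ereal (c + 4 * \<epsilon>)" using V_le_J[OF \<beta>, of y] by (rule order_trans[rotated])
 moreover have "norm (y - \<eta> 0) \<le> \<epsilon>" using ys(1) by (simp add: dist_norm norm_minus_commute \<rho>0)
 ultimately show ?thesis by blast
qed

end

context csys
begin

section \<open>Minimizing sequences for the supremum of the finite-horizon values\<close>

lemma INF_upto_witness: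
 assumes "(INF \<alpha>\<in>ctrls. pcost (FF \<alpha>) (LL \<alpha>) {0..t} x) < ereal c" "0 \<le> t"
 shows "\<exists>\<alpha>\<in>ctrls. run \<alpha> x t < c"
proof -
 obtain \<alpha> where \<alpha>: "\<alpha> \<in> ctrls" "pcost (FF \<alpha>) (LL \<alpha>) {0..t} x < ereal c"
  using assms(1) unfolding INF_less_iff by blast
 interpret adm M B L "FF \<alpha>" "LL \<alpha>" by (rule adm_ctrl[OF \<alpha>(1)])
 show ?thesis using \<alpha> pcost_upto[OF assms(2), of x] by auto
qed

lemma Sig_sequence:
 assumes "Sig x = ereal c"
 obtains \<alpha> where "\<And>n. \<alpha> n \<in> ctrls" "\<And>n. run (\<alpha> n) x (real (Suc n)) \<le> c + inverse (real (Suc n))"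
proof -
 have "\<exists>\<alpha>\<in>ctrls. run \<alpha> x (real (Suc n)) < c + inverse (real (Suc n))" for n
 proof (rule INF_upto_witness)
  have "(INF \<alpha>\<in>ctrls. pcost (FF \<alpha>) (LL \<alpha>) {0..real (Suc n)} x) \<le> Sig x"
   unfolding Sig_def by (rule SUP_upper) simp
  also have "\<dots> < ereal (c + inverse (real (Suc n)))" using assms by simp
  finally show "(INF \<alpha>\<in>ctrls. pcost (FF \<alpha>) (LL \<alpha>) {0..real (Suc n)} x) < ereal (c + inverse (real (Suc n)))" .
 qed simp
 then show ?thesis using that by (metis less_imp_le)
qed

lemma Sig_nonneg: "0 \<le> Sig x"
 unfolding Sig_def by (rule SUP_upper2[of 1]) (auto intro!: INF_greatest pcost_nonneg)

text \<open>Only the states at integer times and the costs of the unit intervals are passed to the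
  limit, for controls that are almost optimal on longer and longer horizons.
  \<open>shadowing\<close> realizes the limit data from points arbitrarily close to x, and lower
  semicontinuity returns to x itself.\<close>

lemma V_le_Sig_if_lsc:
 assumes lsc: "\<And>c. c < V x ==> \<forall>\<^sub>F z in nhds x. c < V z"
 shows "V x \<le> Sig x"
proof (cases "Sig x")
 case (real c)
 then obtain \<alpha> where \<alpha>: "\<And>n. \<alpha> n \<in> ctrls" "\<And>n. run (\<alpha> n) x (real (Suc n)) \<le> c + inverse (real (Suc n))"
  by (rule Sig_sequence) blast
 define A where "A k = rb M (norm x) (real k)" for k :: nat
 define g where "g n k = (traj (\<alpha> n) x (real k), run (\<alpha> n) x (real (Suc k)) - run (\<alpha> n) x (real k))" for n k
 have trA: "norm (traj (\<alpha> n) x (real k)) \<le> A k" for n k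
  unfolding A_def by (rule adm.flow_bound[OF adm_ctrl[OF \<alpha>(1)]]) auto
 have runB: "\<bar>run (\<alpha> n) x (real (Suc k)) - run (\<alpha> n) x (real k)\<bar> \<le> B (A (Suc k))" for n k
 proof -
  interpret adm M B L "FF (\<alpha> n)" "LL (\<alpha> n)" by (rule adm_ctrl[OF \<alpha>(1)])
  have "norm (integral {real k..real (Suc k)} (\<lambda>s. LL (\<alpha> n) s (traj (\<alpha> n) x s))) \<le> B (A (Suc k)) * (real (Suc k) - real k)"
  proof (rule integral_norm_le_const[OF ell_integrable_HK])
   fix s assume s: "real k \<le> s" "s \<le> real (Suc k)"
   have "norm (traj (\<alpha> n) x s) \<le> A (Suc k)" unfolding A_def by (rule flow_bound') (use s in auto)
   then show "norm (LL (\<alpha> n) s (traj (\<alpha> n) x s)) \<le> B (A (Suc k))"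
    using s by (intro lfieldD(3)[OF ell]) auto
  qed auto
  then show ?thesis using rc_diff[of "real k" "real (Suc k)" x] by simp
 qed
 have bg: "\<And>k. bounded (range (\<lambda>n. g n k))" unfolding bounded_iff
 proof (intro exI ballI)
  fix k z assume "z \<in> range (\<lambda>n. g n k)"
  then obtain n where z: "z = g n k" by auto
  show "norm z \<le> A k + B (A (Suc k))"
   unfolding z g_def using norm_Pair_le[of "traj (\<alpha> n) x (real k)" "run (\<alpha> n) x (real (Suc k)) - run (\<alpha> n) x (real k)"]
    trA[of n k] runB[of n k] by simp
 qed
 obtain r where r: "strict_mono r" "\<And>k. convergent (\<lambda>n. g (r n) k)"
  using diagonal_convergent_subseq[where g = g, OF bg] by metis
 then obtain G where G: "\<And>k. (\<lambda>n. g (r n) k) \<longlonglongrightarrow> G k" unfolding convergent_def by metis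
 define \<eta> where "\<eta> k = fst (G k)" for k
 define \<gamma> where "\<gamma> k = snd (G k)" for k
 have l\<eta>: "(\<lambda>n. traj (\<alpha> (r n)) x (real k)) \<longlonglongrightarrow> \<eta> k" for k
  using tendsto_fst[OF G[of k]] by (simp add: g_def \<eta>_def)
 have l\<gamma>: "(\<lambda>n. run (\<alpha> (r n)) x (real (Suc k)) - run (\<alpha> (r n)) x (real k)) \<longlonglongrightarrow> \<gamma> k" for k
  using tendsto_snd[OF G[of k]] by (simp add: g_def \<gamma>_def)
 have "traj (\<alpha> n) x 0 = x" for n by (rule adm.flow_0[OF adm_ctrl[OF \<alpha>(1)]])
 then have \<eta>0: "\<eta> 0 = x" using LIMSEQ_unique[OF l\<eta>[of 0]] by simp
 have \<eta>A: "norm (\<eta> k) \<le> A k" for k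
  by (rule LIMSEQ_le_const2[OF tendsto_norm[OF l\<eta>]]) (use trA in auto)
 have sum: "(\<Sum>k<N. \<gamma> k) \<le> c" for N
 proof (rule LIMSEQ_le)
  show "(\<lambda>n. \<Sum>k<N. run (\<alpha> (r n)) x (real (Suc k)) - run (\<alpha> (r n)) x (real k)) \<longlonglongrightarrow> (\<Sum>k<N. \<gamma> k)"
   by (intro tendsto_sum l\<gamma>)
  show "(\<lambda>n. c + inverse (real (Suc (r n)))) \<longlonglongrightarrow> c"
   using LIMSEQ_subseq_LIMSEQ[OF LIMSEQ_inverse_real_of_nat_add r(1)] by (simp add: o_def)
  have "(\<Sum>k<N. run (\<alpha> (r n)) x (real (Suc k)) - run (\<alpha> (r n)) x (real k)) \<le> c + inverse (real (Suc (r n)))"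
   if "N \<le> n" for n
  proof -
   interpret adm M B L "FF (\<alpha> (r n))" "LL (\<alpha> (r n))" by (rule adm_ctrl[OF \<alpha>(1)])
   have "(\<Sum>k<N. run (\<alpha> (r n)) x (real (Suc k)) - run (\<alpha> (r n)) x (real k)) = run (\<alpha> (r n)) x (real N)"
    using sum_lessThan_telescope[of "\<lambda>k. run (\<alpha> (r n)) x (real k)" N] by simp
   also have "\<dots> \<le> run (\<alpha> (r n)) x (real (Suc (r n)))"
    using that seq_suble[OF r(1), of n] by (intro rc_mono) auto
   finally show ?thesis using \<alpha>(2)[of "r n"] by linarith
  qed
  then show "\<exists>N0. \<forall>n\<ge>N0. (\<Sum>k<N. run (\<alpha> (r n)) x (real (Suc k)) - run (\<alpha> (r n)) x (real k))
    \<le> c + inverse (real (Suc (r n)))" by blast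
 qed
 \<comment> \<open>The required control is the piece on [k, k+1] of a late member of the
   sequence.\<close>
 have app: "\<exists>\<sigma>\<in>ctrls. \<exists>b. norm b \<le> A k \<and> norm (b - \<eta> k) \<le> \<delta> \<and>
    norm (traj \<sigma> b 1) \<le> A (Suc k) \<and> norm (traj \<sigma> b 1 - \<eta> (Suc k)) \<le> \<delta> \<and> run \<sigma> b 1 \<le> \<gamma> k + \<delta>"
  if \<delta>: "0 < \<delta>" for k \<delta>
 proof -
  have "\<forall>\<^sub>F n in sequentially. dist (traj (\<alpha> (r n)) x (real k)) (\<eta> k) < \<delta> \<and>
    dist (traj (\<alpha> (r n)) x (real (Suc k))) (\<eta> (Suc k)) < \<delta> \<and>
    dist (run (\<alpha> (r n)) x (real (Suc k)) - run (\<alpha> (r n)) x (real k)) (\<gamma> k) < \<delta>"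
   by (intro eventually_conj tendstoD[OF l\<eta> \<delta>] tendstoD[OF l\<gamma> \<delta>])
  then obtain n where n: "dist (traj (\<alpha> (r n)) x (real k)) (\<eta> k) < \<delta>"
    "dist (traj (\<alpha> (r n)) x (real (Suc k))) (\<eta> (Suc k)) < \<delta>"
    "dist (run (\<alpha> (r n)) x (real (Suc k)) - run (\<alpha> (r n)) x (real k)) (\<gamma> k) < \<delta>"
   by (auto dest: eventually_happens'[rotated])
  let ?a = "\<alpha> (r n)"
  define \<sigma> where "\<sigma> = (\<lambda>s. ?a (s + real k))"
  define b where "b = traj ?a x (real k)"
  have t: "traj \<sigma> b 1 = traj ?a x (real (Suc k))"
   unfolding \<sigma>_def b_def using shift_props(2)[OF \<alpha>(1), of "real k" 1 "r n" x]
   by (simp add: add.commute)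
  have rn: "run \<sigma> b 1 = run ?a x (real (Suc k)) - run ?a x (real k)"
   unfolding \<sigma>_def b_def using shift_props(3)[OF \<alpha>(1), of "real k" 1 "r n" x] by (simp add: add.commute)
  have "\<sigma> \<in> ctrls" unfolding \<sigma>_def by (rule ctrls_shift[OF \<alpha>(1)]) simp
  then show ?thesis
   using n trA[of "r n" k] trA[of "r n" "Suc k"] unfolding t[symmetric] rn[symmetric] b_def[symmetric]
   by (intro bexI[of _ \<sigma>] exI[of _ b]) (auto simp: dist_norm)
 qed
 show ?thesis
 proof (rule ccontr)
  assume "\<not> V x \<le> Sig x"
  then have "ereal c < V x" using real by simp
  then obtain c' where c': "ereal c < c'" "c' < V x" using dense by blast
  then obtain w where w: "c' = ereal w" by (cases c') auto
  from lsc[OF c'(2)] obtain d where d: "0 < d" "\<And>z. dist z x < d ==> c' < V z"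
   unfolding eventually_nhds_metric by blast
  \<comment> \<open>The quarter of w - c makes c + 4 \<epsilon> at most w, which lies below the
    values of V near x.\<close>
  define \<epsilon> where "\<epsilon> = min 1 (min (d / 2) ((w - c) / 4))"
  have \<epsilon>: "0 < \<epsilon>" "\<epsilon> \<le> 1" using d c' w by (auto simp: \<epsilon>_def)
  obtain z where z: "norm (z - x) \<le> \<epsilon>" "V z \<le> ereal (c + 4 * \<epsilon>)"
   using shadowing[of A \<eta> \<gamma>, OF app \<eta>A sum \<epsilon>] unfolding \<eta>0 by blast
  have "norm (z - x) < d" using z(1) d(1) by (simp add: \<epsilon>_def)
  then have "ereal w < V z" using d(2)[of z] w by (simp add: dist_norm)
  also have "V z \<le> ereal (c + 4 * \<epsilon>)" by (rule z(2))
  also have "\<dots> \<le> ereal w"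
  proof -
   have "\<epsilon> \<le> (w - c) / 4" unfolding \<epsilon>_def by (intro min.coboundedI2) simp
   then show ?thesis by simp
  qed
  finally show False by simp
 qed
next
 case MInf then show ?thesis using Sig_nonneg[of x] by simp
qed simp

end

section \<open>Relaxed controls\<close>

lemma topspace_weak_star: "topspace (weak_star K) \<subseteq> prob_measures K"
 unfolding weak_star_def topology_generated_by_topspace by auto

lemma openin_weak_star_Pow: "{U. openin (weak_star K) U} \<subseteq> Pow (prob_measures K)"
 using topspace_weak_star openin_subset by blast

lemma relaxed_control_in:
 assumes "\<mu> \<in> relaxed_controls K" "0 \<le> t"
 shows "\<mu> t \<in> prob_measures K"
 using measurable_space[OF assms(1)[unfolded relaxed_controls_def], of t] assms(2)
 by (simp add: space_restrict_space space_measure_of_conv)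

lemma integral_weak_star_measurable:
 fixes \<phi> :: "real^'m \<Rightarrow> real"
 assumes "continuous_on K \<phi>"
 shows "(\<lambda>\<mu>. \<integral>a. \<phi> a \<partial>\<mu>) \<in> borel_measurable (sigma (prob_measures K) {U. openin (weak_star K) U})"
proof (rule borel_measurableI)
 fix S :: "real set" assume S: "open S"
 have "openin (weak_star K) {\<mu> \<in> prob_measures K. (\<integral>a. \<phi> a \<partial>\<mu>) \<in> S}"
  unfolding weak_star_def by (rule topology_generated_by_Basis) (use S assms in auto)
 moreover have "(\<lambda>\<mu>. \<integral>a. \<phi> a \<partial>\<mu>) -` S \<inter> prob_measures K = {\<mu> \<in> prob_measures K. (\<integral>a. \<phi> a \<partial>\<mu>) \<in> S}"
  by auto
 ultimately show "(\<lambda>\<mu>. \<integral>a. \<phi> a \<partial>\<mu>) -` S \<inter> space (sigma (prob_measures K) {U. openin (weak_star K) U})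
   \<in> sets (sigma (prob_measures K) {U. openin (weak_star K) U})"
  by (simp add: space_measure_of_conv sets_measure_of[OF openin_weak_star_Pow])
qed

lemma prob_measures_integrable:
 fixes g :: "real^'m \<Rightarrow> 'y::euclidean_space"
 assumes \<mu>: "\<mu> \<in> prob_measures K" and K: "compact K" and g: "continuous_on K g"
 shows "integrable \<mu> g" "space \<mu> = K"
proof -
 have sets: "sets \<mu> = sets (restrict_space borel K)" and "prob_space \<mu>"
  using \<mu> by (auto simp: prob_measures_def)
 interpret prob_space \<mu> by fact
 show sp: "space \<mu> = K" using sets_eq_imp_space_eq[OF sets] by (simp add: space_restrict_space)
 have m: "g \<in> borel_measurable \<mu>"
  unfolding measurable_cong_sets[OF sets refl] by (rule borel_measurable_continuous_on_restrict[OF g])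
 have "bounded (g ` K)" by (intro compact_imp_bounded compact_continuous_image g K)
 then obtain b where "\<And>a. a \<in> K ==> norm (g a) \<le> b" unfolding bounded_iff by blast
 then show "integrable \<mu> g" by (intro integrable_const_bound[where B = b] m AE_I2) (simp add: sp)
qed

lemma prob_measures_integral_norm_le:
 fixes g :: "real^'m \<Rightarrow> 'y::euclidean_space"
 assumes \<mu>: "\<mu> \<in> prob_measures K" and K: "compact K" and g: "continuous_on K g"
  and b: "\<And>a. a \<in> K ==> norm (g a) \<le> b"
 shows "norm (\<integral>a. g a \<partial>\<mu>) \<le> b"
proof -
 interpret prob_space \<mu> using \<mu> by (auto simp: prob_measures_def)
 note i = prob_measures_integrable[OF \<mu> K g]
 have "norm (\<integral>a. g a \<partial>\<mu>) \<le> (\<integral>a. norm (g a) \<partial>\<mu>)" by (rule integral_norm_bound)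
 also have "\<dots> \<le> b" by (rule integral_le_const) (use i b in auto)
 finally show ?thesis .
qed

lemma prob_measures_integral_le:
 fixes g :: "real^'m \<Rightarrow> real"
 assumes \<mu>: "\<mu> \<in> prob_measures K" and K: "compact K" and g: "continuous_on K g"
 shows "(\<And>a. a \<in> K ==> g a \<le> b) ==> (\<integral>a. g a \<partial>\<mu>) \<le> b"
  and "(\<And>a. a \<in> K ==> b \<le> g a) ==> b \<le> (\<integral>a. g a \<partial>\<mu>)"
proof -
 interpret prob_space \<mu> using \<mu> by (auto simp: prob_measures_def)
 note i = prob_measures_integrable[OF \<mu> K g]
 show "(\<And>a. a \<in> K ==> g a \<le> b) ==> (\<integral>a. g a \<partial>\<mu>) \<le> b" by (rule integral_le_const) (use i in auto)
 show "(\<And>a. a \<in> K ==> b \<le> g a) ==> b \<le> (\<integral>a. g a \<partial>\<mu>)" by (rule integral_ge_const) (use i in auto)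
qed

text \<open>Weak-star measurability concerns integrals of real functions, so measurability in time
  is shown for each coordinate. The bounds pass to averages over a probability measure.\<close>

lemma lfield_relaxed:
 fixes g :: "'x::euclidean_space \<Rightarrow> real^'m \<Rightarrow> 'y::euclidean_space"
 assumes \<mu>: "\<mu> \<in> relaxed_controls K" and K: "compact K" and c: "\<And>x. continuous_on K (g x)"
  and b: "\<And>R a x. a \<in> K ==> norm x \<le> R ==> norm (g x a) \<le> B' R"
  and lip: "\<And>R a x y. a \<in> K ==> norm x \<le> R ==> norm y \<le> R ==> norm (g x a - g y a) \<le> L' R * norm (x - y)"
  and L0: "\<And>R. 0 \<le> L' R"
 shows "lfield B' L' (\<lambda>s z. \<integral>a. g z a \<partial>\<mu> s)" unfolding lfield_def
proof (intro conjI allI impI L0)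
 fix x
 have "(\<lambda>s. (\<integral>a. g x a \<partial>\<mu> s) \<bullet> i) \<in> borel_measurable (restrict_space borel {0..})" for i :: 'y
 proof -
  have ci: "continuous_on K (\<lambda>a. g x a \<bullet> i)" by (intro continuous_intros c)
  have "(\<lambda>s. \<integral>a. g x a \<bullet> i \<partial>\<mu> s) \<in> borel_measurable (restrict_space borel {0..})"
   by (rule measurable_compose[OF \<mu>[unfolded relaxed_controls_def] integral_weak_star_measurable[OF ci]])
  then show ?thesis
  proof (rule measurable_cong[THEN iffD1, rotated])
   fix s assume "s \<in> space (restrict_space borel {0::real..})"
   then have "\<mu> s \<in> prob_measures K" by (intro relaxed_control_in[OF \<mu>]) (simp add: space_restrict_space)
   from prob_measures_integrable(1)[OF this K c]
   show "(\<integral>a. g x a \<bullet> i \<partial>\<mu> s) = (\<integral>a. g x a \<partial>\<mu> s) \<bullet> i" by simp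
  qed
 qed
 then have "(\<lambda>s. \<integral>a. g x a \<partial>\<mu> s) \<in> borel_measurable (restrict_space borel {0..})"
  by (subst borel_measurable_euclidean_space) auto
 then show "set_borel_measurable borel {0..} (\<lambda>t. \<integral>a. g x a \<partial>\<mu> t)"
  unfolding set_borel_measurable_def by (subst (asm) borel_measurable_restrict_space_iff) auto
next
 fix R t :: real and x :: 'x assume "0 \<le> t" "norm x \<le> R"
 then show "norm (\<integral>a. g x a \<partial>\<mu> t) \<le> B' R"
  by (intro prob_measures_integral_norm_le[OF relaxed_control_in[OF \<mu>] K c]) (auto intro: b)
next
 fix R t :: real and x y :: 'x assume t: "0 \<le> t" and xy: "norm x \<le> R" "norm y \<le> R"
 note p = relaxed_control_in[OF \<mu> t]
 have "(\<integral>a. g x a \<partial>\<mu> t) - (\<integral>a. g y a \<partial>\<mu> t) = (\<integral>a. g x a - g y a \<partial>\<mu> t)"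
  using prob_measures_integrable(1)[OF p K c] by simp
 also have "norm \<dots> \<le> L' R * norm (x - y)"
  by (rule prob_measures_integral_norm_le[OF p K]) (auto intro!: continuous_intros c lip xy)
 finally show "norm ((\<integral>a. g x a \<partial>\<mu> t) - (\<integral>a. g y a \<partial>\<mu> t)) \<le> L' R * norm (x - y)" .
qed

lemma Dirac_continuous_map:
 fixes K :: "(real^'m) set"
 shows "continuous_map (top_of_set K) (weak_star K) (\<lambda>a. return (restrict_space borel K) a)"
 unfolding weak_star_def continuous_on_generated_topo_iff
proof (intro conjI allI impI)
 have in_p: "return (restrict_space borel K) a \<in> prob_measures K" if "a \<in> K" for a
  using that by (auto simp: prob_measures_def space_restrict_space intro!: prob_space_return)
 fix U :: "(real^'m) measure set"
 assume "U \<in> {{\<mu> \<in> prob_measures K. (\<integral>a. \<phi> a \<partial>\<mu>) \<in> U} |(\<phi> :: real^'m \<Rightarrow> real) U. continuous_on K \<phi> \<and> open U}"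
 then obtain \<phi> :: "real^'m \<Rightarrow> real" and Q where U: "U = {\<mu> \<in> prob_measures K. (\<integral>a. \<phi> a \<partial>\<mu>) \<in> Q}" and \<phi>: "continuous_on K \<phi>" "open Q"
  by blast
 have "(\<integral>b. \<phi> b \<partial>return (restrict_space borel K) a) = \<phi> a" if "a \<in> K" for a
  using that \<phi> by (intro integral_return) (auto simp: space_restrict_space intro: borel_measurable_continuous_on_restrict)
 then have "(\<lambda>a. return (restrict_space borel K) a) -` U \<inter> K = K \<inter> \<phi> -` Q"
  using in_p by (auto simp: U)
 then show "openin (top_of_set K) ((\<lambda>a. return (restrict_space borel K) a) -` U \<inter> topspace (top_of_set K))"
  using continuous_openin_preimage_gen[OF \<phi>] by simp
next
 show "(\<lambda>a. return (restrict_space borel K) a) ` topspace (top_of_set K)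
   \<subseteq> \<Union> {{\<mu> \<in> prob_measures K. (\<integral>a. \<phi> a \<partial>\<mu>) \<in> U} |(\<phi> :: real^'m \<Rightarrow> real) U. continuous_on K \<phi> \<and> open U}"
 proof clarify
  fix a assume "a \<in> topspace (top_of_set K)"
  \<comment> \<open>The test function 0 with the open set \<open>UNIV\<close> gives all of
    \<open>prob_measures K\<close>, so the generating family covers the image.\<close>
  then have "return (restrict_space borel K) a \<in> {\<mu> \<in> prob_measures K. (\<integral>a. (\<lambda>_. 0::real) a \<partial>\<mu>) \<in> UNIV}"
   by (auto simp: prob_measures_def space_restrict_space intro!: prob_space_return)
  then show "return (restrict_space borel K) a
    \<in> \<Union> {{\<mu> \<in> prob_measures K. (\<integral>a. \<phi> a \<partial>\<mu>) \<in> U} |(\<phi> :: real^'m \<Rightarrow> real) U. continuous_on K \<phi> \<and> open U}"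
   by (rule UnionI[rotated]) (use continuous_on_const open_UNIV in blast)
 qed
qed

lemma Dirac_relaxed_control:
 assumes \<alpha>: "\<alpha> \<in> restrict_space borel {0..} \<rightarrow>\<^sub>M restrict_space borel K"
 shows "(\<lambda>t. return (restrict_space borel K) (\<alpha> t)) \<in> relaxed_controls K"
 unfolding relaxed_controls_def
proof (rule measurable_compose[OF \<alpha>], rule measurable_measure_of[OF openin_weak_star_Pow])
 show "return (restrict_space borel K) \<in> space (restrict_space borel K) \<rightarrow> prob_measures K"
  by (auto simp: prob_measures_def space_restrict_space intro!: prob_space_return)
 fix U assume "U \<in> {U. openin (weak_star K) U}"
 then have "openin (top_of_set K) {a \<in> topspace (top_of_set K). return (restrict_space borel K) a \<in> U}"
  using openin_continuous_map_preimage[OF Dirac_continuous_map] by blast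
 then obtain Q where Q: "open Q" "{a \<in> K. return (restrict_space borel K) a \<in> U} = K \<inter> Q"
  unfolding openin_open by auto
 have "return (restrict_space borel K) -` U \<inter> space (restrict_space borel K) = K \<inter> Q"
  using Q(2) by (auto simp: space_restrict_space)
 then show "return (restrict_space borel K) -` U \<inter> space (restrict_space borel K) \<in> sets (restrict_space borel K)"
  using Q(1) by (auto simp: sets_restrict_space)
qed

locale csys_vec = csys K f l M B L
 for K :: "(real^'m) set" and f :: "'x::euclidean_space \<Rightarrow> real^'m \<Rightarrow> 'x" and l :: "'x \<Rightarrow> real^'m \<Rightarrow> real"
  and M :: real and B L :: "real \<Rightarrow> real"
begin

definition Frel :: "(real \<Rightarrow> (real^'m) measure) \<Rightarrow> real \<Rightarrow> 'x \<Rightarrow> 'x" where "Frel \<mu> = (\<lambda>s z. \<integral>a. f z a \<partial>\<mu> s)"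
definition Lrel :: "(real \<Rightarrow> (real^'m) measure) \<Rightarrow> real \<Rightarrow> 'x \<Rightarrow> real" where "Lrel \<mu> = (\<lambda>s z. \<integral>a. l z a \<partial>\<mu> s)"
definition Vrel :: "'x \<Rightarrow> ereal" where
 "Vrel x = (INF \<mu>\<in>relaxed_controls K. pcost (Frel \<mu>) (Lrel \<mu>) {0..} x)"

lemma adm_relaxed:
 assumes \<mu>: "\<mu> \<in> relaxed_controls K"
 shows "adm M B L (Frel \<mu>) (Lrel \<mu>)"
proof
 show "lfield B L (Frel \<mu>)"
  unfolding Frel_def by (rule lfield_relaxed[OF \<mu> K(1) f_cont_a f_bound f_lip L_nonneg])
 show "lfield B L (Lrel \<mu>)" unfolding Lrel_def
  by (rule lfield_relaxed[OF \<mu> K(1) l_cont_a]) (use l_bound l_nonneg l_lip L_nonneg in auto)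
 show "lin_growth M (Frel \<mu>)" unfolding lin_growth_def Frel_def
  by (intro conjI allI impI M_nonneg prob_measures_integral_norm_le[OF relaxed_control_in[OF \<mu>] K(1) f_cont_a] growth)
 show "0 \<le> Lrel \<mu> t x" if "0 \<le> t" for t x unfolding Lrel_def
  by (rule prob_measures_integral_le(2)[OF relaxed_control_in[OF \<mu> that] K(1) l_cont_a l_nonneg])
qed

lemma Ham_relaxed:
 assumes \<mu>: "\<mu> \<in> relaxed_controls K" and t: "0 \<le> t"
 shows "- (Frel \<mu> t z \<bullet> p) - Lrel \<mu> t z \<le> Ham z p"
proof -
 note P = relaxed_control_in[OF \<mu> t]
 have "- (Frel \<mu> t z \<bullet> p) - Lrel \<mu> t z = (\<integral>a. - (f z a \<bullet> p) - l z a \<partial>\<mu> t)"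
  unfolding Frel_def Lrel_def
  using prob_measures_integrable(1)[OF P K(1) f_cont_a, of z] prob_measures_integrable(1)[OF P K(1) l_cont_a, of z]
  by simp
 also have "\<dots> \<le> Ham z p"
  by (rule prob_measures_integral_le(1)[OF P K(1)]) (auto intro!: continuous_intros f_cont_a l_cont_a Ham_ge)
 finally show ?thesis .
qed

lemma Vrel_nonneg: "0 \<le> Vrel x" unfolding Vrel_def by (rule INF_greatest) (rule pcost_nonneg)

lemma Vrel_le: "\<mu> \<in> relaxed_controls K ==> Vrel x \<le> pcost (Frel \<mu>) (Lrel \<mu>) {0..} x"
 unfolding Vrel_def by (rule INF_lower)

text \<open>An average over controls never exceeds the maximum that defines \<open>Ham\<close>
  (\<open>Ham_relaxed\<close>), so relaxed fields satisfy the hypothesis of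
  \<open>dpp_supersolution\<close> with the original Hamiltonian.\<close>

lemma Vrel_supersolution: "viscosity_supersolution Ham Vrel"
proof (rule dpp_supersolution[OF Vrel_nonneg])
 fix x and e :: real assume fin: "Vrel x < \<infinity>" and e: "0 < e"
 have "Vrel x < Vrel x + ereal e" using fin e Vrel_nonneg[of x] by (cases "Vrel x") auto
 then obtain \<mu> where \<mu>: "\<mu> \<in> relaxed_controls K" "pcost (Frel \<mu>) (Lrel \<mu>) {0..} x < Vrel x + ereal e"
  unfolding Vrel_def INF_less_iff by blast
 interpret adm M B L "Frel \<mu>" "Lrel \<mu>" by (rule adm_relaxed[OF \<mu>(1)])
 have "ereal (rc (Frel \<mu>) (Lrel \<mu>) x h) + Vrel (flow (Frel \<mu>) x h) \<le> Vrel x + ereal e" if h: "0 \<le> h" for h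
 proof -
  have s: "(\<lambda>t. \<mu> (t + h)) \<in> relaxed_controls K"
   using \<mu>(1) h unfolding relaxed_controls_def by (rule control_shift)
  have "Vrel (flow (Frel \<mu>) x h) \<le> pcost (\<lambda>t. Frel \<mu> (t + h)) (\<lambda>t. Lrel \<mu> (t + h)) {0..} (flow (Frel \<mu>) x h)"
   using Vrel_le[OF s] by (simp add: Frel_def Lrel_def)
  then have "ereal (rc (Frel \<mu>) (Lrel \<mu>) x h) + Vrel (flow (Frel \<mu>) x h) \<le> pcost (Frel \<mu>) (Lrel \<mu>) {0..} x"
   unfolding pcost_split[OF h, of x] by (rule add_left_mono)
  then show ?thesis using \<mu>(2) by (meson less_imp_le order_trans)
 qed
 then show "\<exists>F ell. adm M B L F ell \<and> (\<forall>t\<ge>0. \<forall>z p. - (F t z \<bullet> p) - ell t z \<le> Ham z p) \<and>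
    (\<forall>h\<ge>0. ereal (rc F ell x h) + Vrel (flow F x h) \<le> Vrel x + ereal e)"
  using adm_relaxed[OF \<mu>(1)] Ham_relaxed[OF \<mu>(1)] by blast
qed

lemma Sig_le_Vrel: "Sig x \<le> Vrel x"
 using Sig_le_supersolution[OF Vrel_supersolution Vrel_nonneg, of x] lsc_env_le[of Vrel x] by (rule order_trans)

lemma Vrel_le_V: "Vrel x \<le> V x" unfolding V_def
proof (rule INF_greatest)
 fix \<alpha> assume \<alpha>: "\<alpha> \<in> ctrls"
 define \<mu> where "\<mu> t = return (restrict_space borel K) (\<alpha> t)" for t
 have \<mu>: "\<mu> \<in> relaxed_controls K"
  unfolding \<mu>_def by (rule Dirac_relaxed_control[OF \<alpha>[unfolded ctrls_def]])
 have "Frel \<mu> t = FF \<alpha> t" "Lrel \<mu> t = LL \<alpha> t" if "0 \<le> t" for t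
  unfolding Frel_def Lrel_def FF_def LL_def \<mu>_def
  by (intro ext integral_return; use ctrls_in[OF \<alpha> that] f_cont_a l_cont_a in
    \<open>auto simp: space_restrict_space intro: borel_measurable_continuous_on_restrict\<close>)+
 then have "pcost (Frel \<mu>) (Lrel \<mu>) {0..} x = J \<alpha> x" by (intro pcost_cong) auto
 then show "Vrel x \<le> J \<alpha> x" using Vrel_le[OF \<mu>, of x] by simp
qed

end

section \<open>Convex control systems\<close>

lemma closed_projection_compact:
 fixes C :: "'d::euclidean_space set" and Q :: "('z::metric_space \<times> 'd) set"
 assumes C: "compact C" and Q: "closed Q"
 shows "closed {z. \<exists>d\<in>C. (z, d) \<in> Q}" unfolding closed_sequential_limits
proof (intro allI impI, elim conjE)
 fix z :: "nat \<Rightarrow> 'z" and l assume "\<forall>n. z n \<in> {z. \<exists>d\<in>C. (z, d) \<in> Q}" and l: "z \<longlonglongrightarrow> l"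
 then obtain d where d: "\<And>n. d n \<in> C" "\<And>n. (z n, d n) \<in> Q" by simp metis
 from C obtain a s where s: "a \<in> C" "strict_mono s" "(d \<circ> s) \<longlonglongrightarrow> a"
  using d(1) unfolding compact_eq_seq_compact_metric seq_compact_def by metis
 have "(\<lambda>n. (z (s n), d (s n))) \<longlonglongrightarrow> (l, a)"
  using s(3) LIMSEQ_subseq_LIMSEQ[OF l s(2)] by (intro tendsto_Pair) (auto simp: o_def)
 then have "(l, a) \<in> Q" by (rule closed_sequentially[OF Q, rotated]) (use d in auto)
 then show "l \<in> {z. \<exists>d\<in>C. (z, d) \<in> Q}" using s(1) by auto
qed

text \<open>The selection is the lexicographic minimum with respect to the coordinates: the argument
  \<open>e\<close> records the coordinates that are fixed already.\<close>

lemma measurable_selection: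
 fixes C :: "'d::euclidean_space set" and \<Psi> :: "'z::euclidean_space \<Rightarrow> 'd \<Rightarrow> real"
 assumes C: "compact C" and \<Psi>: "continuous_on (UNIV \<times> C) (\<lambda>(z, d). \<Psi> z d)"
 shows "\<exists>s\<in>borel_measurable borel. \<forall>z. (\<exists>d\<in>C. \<Psi> z d \<le> 0) \<longrightarrow> s z \<in> C \<and> \<Psi> z (s z) \<le> 0"
proof -
 define Z where "Z = {z. \<exists>d\<in>C. \<Psi> z d \<le> 0}"
 have "\<exists>e\<in>borel_measurable borel. \<forall>z\<in>Z. \<exists>d\<in>C. \<Psi> z d \<le> 0 \<and> (\<forall>b\<in>S. d \<bullet> b = e z \<bullet> b)"
  if "finite S" "S \<subseteq> Basis" for S :: "'d set" using that
 proof (induction S rule: finite_induct)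
  case empty
  show ?case by (intro bexI[of _ "\<lambda>_. 0"]) (auto simp: Z_def)
 next
  case (insert b S)
  then obtain e where e: "e \<in> borel_measurable borel"
   and ex: "\<And>z. z \<in> Z ==> \<exists>d\<in>C. \<Psi> z d \<le> 0 \<and> (\<forall>b\<in>S. d \<bullet> b = e z \<bullet> b)" by auto
  define D where "D z = {d \<in> C. \<Psi> z d \<le> 0 \<and> (\<forall>b\<in>S. d \<bullet> b = e z \<bullet> b)}" for z
  have \<Psi>z: "continuous_on C (\<Psi> z)" for z
   by (rule continuous_on_compose2[OF \<Psi>, of _ "\<lambda>d. (z, d)", simplified]) (auto intro!: continuous_intros)
  have "compact (D z)" for z
  proof -
   have "D z = {d \<in> C. \<Psi> z d \<le> 0} \<inter> (\<Inter>b\<in>S. {d. d \<bullet> b = e z \<bullet> b})" by (auto simp: D_def)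
   moreover have "closed {d \<in> C. \<Psi> z d \<le> 0}"
    using continuous_closed_preimage[OF \<Psi>z compact_imp_closed[OF C], of "{..0}" z]
    by (simp add: Int_def vimage_def)
   moreover have "closed (\<Inter>b\<in>S. {d. d \<bullet> b = e z \<bullet> b})"
    by (intro closed_INT ballI closed_Collect_eq continuous_intros)
   ultimately have "closed (D z)" by auto
   then show ?thesis using compact_Int_closed[OF C, of "D z"] by (simp add: D_def Int_def conj_ac Int_absorb1 Collect_conj_eq[symmetric])
  qed
  note Dc = this
  define m where "m z = (if z \<in> Z then Inf ((\<lambda>d. d \<bullet> b) ` D z) else 0)" for z
  have att: "\<exists>d\<in>D z. d \<bullet> b = m z \<and> (\<forall>d'\<in>D z. m z \<le> d' \<bullet> b)" if z: "z \<in> Z" for z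
  proof -
   have "D z \<noteq> {}" using ex[OF z] by (auto simp: D_def)
   moreover have "continuous_on (D z) (\<lambda>d. d \<bullet> b)" by (intro continuous_intros)
   ultimately obtain d where d: "d \<in> D z" "\<And>d'. d' \<in> D z ==> d \<bullet> b \<le> d' \<bullet> b"
    using continuous_attains_inf[OF Dc] by blast
   then have "Inf ((\<lambda>d. d \<bullet> b) ` D z) = d \<bullet> b" by (intro cInf_eq_minimum) auto
   then show ?thesis using d z by (auto simp: m_def)
  qed
  have meas: "m \<in> borel_measurable borel"
  proof (rule borel_measurableI_le)
   fix c :: real
   \<comment> \<open>The coordinates fixed so far enter as an independent variable
     \<open>snd zw\<close> instead of \<open>e z\<close>. This makes the set closed although
     \<open>e\<close> is only Borel; \<open>e z\<close> is substituted after the projection.\<close>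
   define Q where "Q = {(zw, d). d \<in> C \<and> \<Psi> (fst zw) d \<le> 0 \<and> (\<forall>b\<in>S. d \<bullet> b = snd zw \<bullet> b) \<and> d \<bullet> b \<le> c}"
   define Q0 where "Q0 = {(z, d). d \<in> C \<and> \<Psi> z d \<le> 0}"
   have CC: "closed (UNIV \<times> C)" using C by (intro closed_Times compact_imp_closed) auto
   have Q0: "closed (Q0 :: ('z \<times> 'd) set)"
   proof -
    have "Q0 = (UNIV \<times> C) \<inter> (\<lambda>(z, d). \<Psi> z d) -` {..0}" by (auto simp: Q0_def)
    then show ?thesis using continuous_closed_preimage[OF \<Psi>, of "{..0}"] C
     by (simp add: closed_Times compact_imp_closed)
   qed
   have "Q = (\<lambda>p. (fst (fst p), snd p)) -` Q0 \<inter> (\<Inter>b\<in>S. {p. snd p \<bullet> b = snd (fst p) \<bullet> b}) \<inter> {p. snd p \<bullet> b \<le> c}"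
    by (auto simp: Q_def Q0_def)
   moreover have "closed ((\<lambda>p. (fst (fst p), snd p)) -` Q0 :: (('z \<times> 'd) \<times> 'd) set)"
    by (rule closed_vimage[OF Q0]) (intro continuous_intros)
   moreover have "closed (\<Inter>b\<in>S. {p :: ('z \<times> 'd) \<times> 'd. snd p \<bullet> b = snd (fst p) \<bullet> b})"
    by (intro closed_INT ballI closed_Collect_eq continuous_intros)
   moreover have "closed {p :: ('z \<times> 'd) \<times> 'd. snd p \<bullet> b \<le> c}"
    by (intro closed_Collect_le continuous_intros)
   ultimately have "closed Q" by (simp add: closed_Int)
   from closed_projection_compact[OF C this]
   have R: "{zw. \<exists>d\<in>C. (zw, d) \<in> Q} \<in> sets borel" by simp
   have R0: "Z \<in> sets borel"
    using closed_projection_compact[OF C Q0] by (simp add: Z_def Q0_def conj_commute cong: conj_cong)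
   have "(\<lambda>z. (z, e z)) \<in> borel \<rightarrow>\<^sub>M borel" using e by (intro borel_measurable_Pair) auto
   from measurable_sets[OF this R]
   have R1: "(\<lambda>z. (z, e z)) -` {zw. \<exists>d\<in>C. (zw, d) \<in> Q} \<in> sets borel" by simp
   have "{z \<in> space borel. m z \<le> c} = (Z \<inter> (\<lambda>z. (z, e z)) -` {zw. \<exists>d\<in>C. (zw, d) \<in> Q}) \<union> (if 0 \<le> c then - Z else {})"
   proof (intro set_eqI iffI)
    fix z assume "z \<in> {z \<in> space borel. m z \<le> c}"
    then have mz: "m z \<le> c" by simp
    show "z \<in> (Z \<inter> (\<lambda>z. (z, e z)) -` {zw. \<exists>d\<in>C. (zw, d) \<in> Q}) \<union> (if 0 \<le> c then - Z else {})"
    proof (cases "z \<in> Z")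
     case True
     from att[OF True] obtain d where "d \<in> D z" "d \<bullet> b = m z" by blast
     then show ?thesis using True mz by (auto simp: D_def Q_def)
    qed (use mz in \<open>auto simp: m_def\<close>)
   next
    fix z assume z: "z \<in> (Z \<inter> (\<lambda>z. (z, e z)) -` {zw. \<exists>d\<in>C. (zw, d) \<in> Q}) \<union> (if 0 \<le> c then - Z else {})"
    show "z \<in> {z \<in> space borel. m z \<le> c}"
    proof (cases "z \<in> Z")
     case True
     then obtain d where "d \<in> C" "((z, e z), d) \<in> Q" using z by (auto split: if_splits)
     then have "d \<in> D z" "d \<bullet> b \<le> c" by (auto simp: D_def Q_def)
     then show ?thesis using att[OF True] by force
    qed (use z in \<open>auto simp: m_def split: if_splits\<close>)
   qed
   then show "{z \<in> space borel. m z \<le> c} \<in> sets borel" using R0 R1 by auto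
  qed
  define e' where "e' z = e z + (m z - e z \<bullet> b) *\<^sub>R b" for z
  have bB: "b \<in> Basis" "S \<subseteq> Basis" "b \<notin> S" using insert by auto
  have e'b: "e' z \<bullet> b = m z" for z using bB by (simp add: e'_def inner_add_left)
  have e'S: "e' z \<bullet> b' = e z \<bullet> b'" if "b' \<in> S" for z b'
   using that bB inner_not_same_Basis[of b b'] by (auto simp: e'_def inner_add_left)
  have "e' \<in> borel_measurable borel" unfolding e'_def using e meas by simp
  moreover have "\<exists>d\<in>C. \<Psi> z d \<le> 0 \<and> (\<forall>b'\<in>insert b S. d \<bullet> b' = e' z \<bullet> b')" if "z \<in> Z" for z
   using att[OF that] e'b e'S by (auto simp: D_def)
  ultimately show ?case by blast
 qed
 from this[of Basis] obtain e where e: "e \<in> borel_measurable borel"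
  and ex: "\<And>z. z \<in> Z ==> \<exists>d\<in>C. \<Psi> z d \<le> 0 \<and> (\<forall>b\<in>Basis. d \<bullet> b = e z \<bullet> b)" by auto
 have "e z \<in> C \<and> \<Psi> z (e z) \<le> 0" if "z \<in> Z" for z using ex[OF that] euclidean_eqI by metis
 then show ?thesis using e by (auto simp: Z_def)
qed

text \<open>Only midpoints are needed for the parallelogram argument.\<close>

inductive_set fcomb :: "(nat \<Rightarrow> 'w \<Rightarrow> 'e::real_vector) \<Rightarrow> nat \<Rightarrow> ('w \<Rightarrow> 'e) set"
 for v :: "nat \<Rightarrow> 'w \<Rightarrow> 'e" and j :: nat where
 base: "j \<le> n ==> v n \<in> fcomb v j"
| mid: "u \<in> fcomb v j ==> w \<in> fcomb v j ==> (\<lambda>x. (1/2) *\<^sub>R (u x + w x)) \<in> fcomb v j"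

lemma fcomb_mono:
 assumes "u \<in> fcomb v j" "i \<le> j"
 shows "u \<in> fcomb v i" using assms(1) by induction (use assms(2) in \<open>auto intro: fcomb.intros\<close>)

lemma fcomb_scaled:
 assumes "u \<in> fcomb (\<lambda>n x. c x *\<^sub>R v n x) j"
 shows "\<exists>w\<in>fcomb v j. u = (\<lambda>x. c x *\<^sub>R w x)" using assms
proof induction
 case (base n)
 then show ?case by (intro bexI[of _ "v n"]) (auto intro: fcomb.base)
next
 case (mid u w)
 then obtain u' w' where "u' \<in> fcomb v j" "u = (\<lambda>x. c x *\<^sub>R u' x)" "w' \<in> fcomb v j" "w = (\<lambda>x. c x *\<^sub>R w' x)" by blast
 then show ?case
  by (intro bexI[of _ "\<lambda>x. (1/2) *\<^sub>R (u' x + w' x)"] fcomb.mid) (auto simp: algebra_simps)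
qed

lemma fcomb_measurable:
 fixes v :: "nat \<Rightarrow> 'w \<Rightarrow> 'e::euclidean_space"
 assumes "u \<in> fcomb v j" "\<And>n. v n \<in> borel_measurable N"
 shows "u \<in> borel_measurable N" using assms(1) by induction (use assms(2) in auto)

lemma fcomb_convex:
 assumes "u \<in> fcomb v j" "convex Q" "\<And>n. j \<le> n ==> v n x \<in> Q"
 shows "u x \<in> Q" using assms(1)
proof induction
 case (mid u w)
 then have "(1/2) *\<^sub>R u x + (1/2) *\<^sub>R w x \<in> Q" using assms(2) by (intro convexD) auto
 then show ?case by (simp add: scaleR_add_right)
qed (use assms(3) in auto)

section \<open>Almost everywhere convergence of forward combinations\<close>

lemma convex_near:
 fixes Q :: "'e::real_normed_vector set"
 assumes "convex Q"
 shows "convex {e. \<exists>q\<in>Q. norm (e - q) \<le> \<delta>}"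
proof (rule convexI)
 fix e e' and u v :: real
 assume uv: "0 \<le> u" "0 \<le> v" "u + v = 1"
  and "e \<in> {e. \<exists>q\<in>Q. norm (e - q) \<le> \<delta>}" "e' \<in> {e. \<exists>q\<in>Q. norm (e - q) \<le> \<delta>}"
 then obtain q q' where q: "q \<in> Q" "norm (e - q) \<le> \<delta>" "q' \<in> Q" "norm (e' - q') \<le> \<delta>" by blast
 have "norm (u *\<^sub>R (e - q) + v *\<^sub>R (e' - q')) \<le> \<delta>"
  using convexD[OF convex_cball[of 0 \<delta>], of "e - q" "e' - q'" u v] q uv by simp
 then have "norm (u *\<^sub>R e + v *\<^sub>R e' - (u *\<^sub>R q + v *\<^sub>R q')) \<le> \<delta>" by (simp add: algebra_simps)
 moreover have "u *\<^sub>R q + v *\<^sub>R q' \<in> Q" using convexD[OF assms q(1,3) uv] .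
 ultimately show "u *\<^sub>R e + v *\<^sub>R e' \<in> {e. \<exists>q\<in>Q. norm (e - q) \<le> \<delta>}" by blast
qed

lemma parallelogram:
 fixes a b :: "'e::real_inner"
 shows "(norm (a - b))\<^sup>2 = 2 * (norm a)\<^sup>2 + 2 * (norm b)\<^sup>2 - 4 * (norm ((1/2) *\<^sub>R (a + b)))\<^sup>2"
 unfolding power2_norm_eq_inner
 by (simp add: inner_add_left inner_add_right inner_diff_left inner_diff_right inner_commute field_simps)

text \<open>Take almost minimizers of the square norm over the combinations of tails. The infima
  increase and are bounded, hence converge; since the midpoint of the i-th and j-th choice is again
  a combination of the i-th tail, the parallelogram identity makes the choices Cauchy in L^2, hence
  in L^1, and a subsequence converges almost everywhere. Passing to it keeps the combinations
  forward.\<close>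

lemma forward_combinations_finite:
 fixes v :: "nat \<Rightarrow> 'w \<Rightarrow> 'e::euclidean_space"
 assumes fm: "finite_measure N" and v: "\<And>n. v n \<in> borel_measurable N" and b: "\<And>n x. norm (v n x) \<le> 1"
 shows "\<exists>w wl. (\<forall>j. w j \<in> fcomb v j) \<and> wl \<in> borel_measurable N \<and> (AE x in N. (\<lambda>j. w j x) \<longlonglongrightarrow> wl x)"
proof -
 interpret finite_measure N by fact
 have um: "u \<in> borel_measurable N" if "u \<in> fcomb v j" for u j by (rule fcomb_measurable[OF that v])
 have ub: "norm (u x) \<le> 1" if "u \<in> fcomb v j" for u j x
  using fcomb_convex[OF that convex_cball[of 0 1], of x] b by simp
 define E where "E u = (\<integral>x. (norm (u x))\<^sup>2 \<partial>N)" for u :: "'w \<Rightarrow> 'e"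
 have i2: "integrable N (\<lambda>x. (norm (u x))\<^sup>2)" if "u \<in> fcomb v j" for u j
  by (rule integrable_const_bound[where B = 1]) (use um[OF that] ub[OF that] in \<open>auto simp: power_le_one\<close>)
 have E0: "0 \<le> E u" for u unfolding E_def by simp
 have E1: "E u \<le> measure N (space N)" if "u \<in> fcomb v j" for u j
 proof -
  have "E u \<le> (\<integral>x. 1 \<partial>N)" unfolding E_def
   by (rule integral_mono[OF i2[OF that]]) (use ub[OF that] in \<open>auto simp: power_le_one\<close>)
  then show ?thesis by simp
 qed
 define d where "d j = Inf (E ` fcomb v j)" for j
 have bb: "bdd_below (E ` fcomb v j)" for j by (rule bdd_belowI2[where m = 0]) (rule E0)
 have ne: "fcomb v j \<noteq> {}" for j using fcomb.base[of j j v] by auto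
 have dle: "d j \<le> E u" if "u \<in> fcomb v j" for u j unfolding d_def by (rule cINF_lower[OF bb that])
 have dmono: "d i \<le> d j" if "i \<le> j" for i j unfolding d_def
  by (intro cInf_superset_mono bb image_mono subsetI fcomb_mono[OF _ that]) (use ne in auto)
 have dbd: "d j \<le> measure N (space N)" for j
  using dle[OF fcomb.base[of j j v]] E1[OF fcomb.base[of j j v]] by simp
 have "\<exists>u\<in>fcomb v j. E u < d j + inverse (real (Suc j))" for j
  unfolding d_def using cInf_lessD[of "E ` fcomb v j" "Inf (E ` fcomb v j) + inverse (real (Suc j))"] ne by auto
 then obtain w where w: "\<And>j. w j \<in> fcomb v j" "\<And>j. E (w j) < d j + inverse (real (Suc j))" by metis
 have d0: "0 \<le> d j" for j unfolding d_def by (rule cINF_greatest[OF ne E0])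
 have "convergent d"
 proof (rule Bseq_mono_convergent)
  show "Bseq d" by (rule BseqI'[of _ "measure N (space N)"]) (use dbd d0 in auto)
 qed (use dmono in blast)
 then have dC: "Cauchy d" by (rule convergent_Cauchy)
 have L2: "(\<integral>x. (norm (w i x - w j x))\<^sup>2 \<partial>N) \<le> 2 * (d j - d i) + 2 * inverse (real (Suc i)) + 2 * inverse (real (Suc j))"
  if "i \<le> j" for i j
 proof -
  let ?m = "\<lambda>x. (1/2) *\<^sub>R (w i x + w j x)"
  have m: "?m \<in> fcomb v i" by (intro fcomb.mid w fcomb_mono[OF w(1) that])
  have "(\<integral>x. (norm (w i x - w j x))\<^sup>2 \<partial>N) = (\<integral>x. 2 * (norm (w i x))\<^sup>2 + 2 * (norm (w j x))\<^sup>2 - 4 * (norm (?m x))\<^sup>2 \<partial>N)"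
   by (simp only: parallelogram)
  also have "\<dots> = 2 * E (w i) + 2 * E (w j) - 4 * E ?m"
   unfolding E_def using i2[OF w(1)[of i]] i2[OF w(1)[of j]] i2[OF m]
   by (subst Bochner_Integration.integral_diff) (auto intro!: Bochner_Integration.integrable_add)
  also have "\<dots> \<le> 2 * (d i + inverse (real (Suc i))) + 2 * (d j + inverse (real (Suc j))) - 4 * d i"
  proof -
   have "2 * a + 2 * b - 4 * c \<le> 2 * (x + p) + 2 * (y + q) - 4 * x"
    if "a < x + p" "b < y + q" "x \<le> c" for a b c x y p q :: real
   proof -
    have "2 * a < 2 * x + 2 * p" "2 * b < 2 * y + 2 * q" "4 * x \<le> 4 * c" using that by auto
    then show ?thesis by argo
   qed
   from this[OF w(2) w(2) dle[OF m]] show ?thesis .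
  qed
  finally show ?thesis by (simp add: algebra_simps)
 qed
 have wi: "integrable N (w j)" for j
  by (rule integrable_const_bound[where B = 1]) (use um[OF w(1)] ub[OF w(1)] in auto)
 have dint: "integrable N (\<lambda>x. (norm (w i x - w j x))\<^sup>2)" for i j
 proof -
  have "(norm (w i x - w j x))\<^sup>2 \<le> 2\<^sup>2" for x
   using norm_triangle_ineq4[of "w i x" "w j x"] ub[OF w(1), of i x] ub[OF w(1), of j x]
   by (intro power_mono) auto
  then show ?thesis by (intro integrable_const_bound[where B = "2\<^sup>2"] AE_I2)
     (use um[OF w(1)] in \<open>simp_all del: power2_less_eq_zero_iff\<close>)
 qed
 have L1: "\<exists>N0. \<forall>i\<ge>N0. \<forall>j\<ge>N0. (\<integral>x. norm (w i x - w j x) \<partial>N) < e" if e: "0 < e" for e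
 proof -
  \<comment> \<open>The bound a \<le> t + a^2/t turns smallness of squares into smallness of
    integrals on a finite measure space: t costs at most e/2 in total, and \<epsilon>/t is
    e/4.\<close>
  define t where "t = (e / 2) / (measure N (space N) + 1)"
  have t: "0 < t" "t * measure N (space N) < e / 2 + e / 2 - e / 4"
  proof -
   show "0 < t" using e by (auto simp: t_def intro!: divide_pos_pos add_nonneg_pos)
   have "t * measure N (space N) \<le> t * (measure N (space N) + 1)" using \<open>0 < t\<close> by (intro mult_left_mono) auto
   also have "\<dots> = e / 2"
   proof -
    have "measure N (space N) + 1 \<noteq> 0" using measure_nonneg[of N "space N"] by linarith
    then show ?thesis unfolding t_def by (rule nonzero_eq_divide_eq[THEN iffD1, OF _ refl])
   qed
   finally show "t * measure N (space N) < e / 2 + e / 2 - e / 4" using e by argo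
  qed
  define \<epsilon> where "\<epsilon> = e * t / 4"
  have \<epsilon>: "0 < \<epsilon>" using e t by (simp add: \<epsilon>_def)
  obtain N1 where N1: "\<And>i j. N1 \<le> i ==> N1 \<le> j ==> norm (d i - d j) < \<epsilon> / 8"
   using CauchyD[OF dC, of "\<epsilon> / 8"] \<epsilon> by auto
  obtain N2 where N2: "inverse (real (Suc N2)) < \<epsilon> / 8" using reals_Archimedean[of "\<epsilon> / 8"] \<epsilon> by auto
  have main: "(\<integral>x. norm (w i x - w j x) \<partial>N) < e" if ij: "max N1 N2 \<le> i" "i \<le> j" for i j
  proof -
   have "inverse (real (Suc i)) \<le> inverse (real (Suc N2))" "inverse (real (Suc j)) \<le> inverse (real (Suc N2))"
    using ij by (auto intro!: le_imp_inverse_le)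
   moreover have "d j - d i < \<epsilon> / 8"
    using N1[of j i] ij abs_ge_self[of "d j - d i"] by (simp only: real_norm_def) linarith
   ultimately have "2 * (d j - d i) < \<epsilon> / 4" "2 * inverse (real (Suc i)) < \<epsilon> / 4" "2 * inverse (real (Suc j)) < \<epsilon> / 4"
    using N2 by argo+
   then have s: "(\<integral>x. (norm (w i x - w j x))\<^sup>2 \<partial>N) < \<epsilon>" using L2[OF ij(2)] \<epsilon> by argo
   have "(\<integral>x. norm (w i x - w j x) \<partial>N) \<le> (\<integral>x. t + (norm (w i x - w j x))\<^sup>2 / t \<partial>N)"
   proof (rule integral_mono)
    fix x
    let ?a = "norm (w i x - w j x)"
    show "?a \<le> t + ?a\<^sup>2 / t"
    proof (cases "?a \<le> t")
     case True then show ?thesis using t(1) by (simp add: add_increasing2)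
    next
     case False
     then have "t * ?a \<le> ?a * ?a" by (intro mult_right_mono) auto
     then have "?a \<le> ?a\<^sup>2 / t" using t(1) by (simp add: le_divide_eq power2_eq_square mult.commute)
     then show ?thesis using t(1) by linarith
    qed
   qed (use wi dint in auto)
   also have "\<dots> = t * measure N (space N) + (\<integral>x. (norm (w i x - w j x))\<^sup>2 \<partial>N) / t"
    using dint by (subst Bochner_Integration.integral_add) auto
   also have "(\<integral>x. (norm (w i x - w j x))\<^sup>2 \<partial>N) / t \<le> \<epsilon> / t" using s t by (intro divide_right_mono) auto
   also have "\<epsilon> / t = e / 4" using t by (simp add: \<epsilon>_def)
   finally show ?thesis using t(2) by linarith
  qed
  show ?thesis
  proof (intro exI[of _ "max N1 N2"] allI impI)
   fix i j assume "max N1 N2 \<le> i" "max N1 N2 \<le> j"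
   then show "(\<integral>x. norm (w i x - w j x) \<partial>N) < e"
    using main[of i j] main[of j i] by (cases "i \<le> j") (auto simp: norm_minus_commute)
  qed
 qed
 obtain r where r: "strict_mono r" "AE x in N. Cauchy (\<lambda>i. w (r i) x)"
  using cauchy_L1_AE_cauchy_subseq[OF wi L1] by blast
 have "AE x in N. (\<lambda>i. w (r i) x) \<longlonglongrightarrow> lim (\<lambda>i. w (r i) x)"
  using r(2) by eventually_elim (simp add: Cauchy_convergent_iff convergent_LIMSEQ_iff)
 moreover have "(\<lambda>x. lim (\<lambda>i. w (r i) x)) \<in> borel_measurable N"
  by (rule borel_measurable_lim_metric) (rule um[OF w(1)])
 moreover have "w (r j) \<in> fcomb v j" for j by (rule fcomb_mono[OF w(1) seq_suble[OF r(1)]])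
 ultimately show ?thesis by (intro exI[of _ "\<lambda>i. w (r i)"]) blast
qed

text \<open>Reduction to the bounded case on a finite measure space: the weight \<open>c\<close>
  makes all functions bounded by 1 and commutes with combinations, and the Gaussian measure is
  finite with the same null sets as Lebesgue measure.\<close>

lemma forward_combinations:
 fixes v :: "nat \<Rightarrow> real \<Rightarrow> 'e::euclidean_space"
 assumes v: "\<And>n. v n \<in> borel_measurable borel" and b: "\<And>n x. norm (v n x) \<le> b x" and bm: "b \<in> borel_measurable borel"
 shows "\<exists>w wl. (\<forall>j. w j \<in> fcomb v j) \<and> wl \<in> borel_measurable borel \<and> (AE x in lborel. (\<lambda>j. w j x) \<longlonglongrightarrow> wl x)"
proof -
 define c where "c x = 1 / (1 + \<bar>b x\<bar>)" for x
 have c: "0 < c x" for x unfolding c_def by simp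
 have cm: "c \<in> borel_measurable borel" unfolding c_def using bm by simp
 define N where "N = density lborel std_normal_density"
 have "prob_space N" unfolding N_def by (rule prob_space_normal_density) simp
 then interpret prob_space N .
 have cv: "norm (c x *\<^sub>R v n x) \<le> 1" for n x
 proof -
  have "norm (v n x) \<le> 1 + \<bar>b x\<bar>" using b[of n x] by linarith
  then show ?thesis by (simp add: c_def divide_le_eq_1 add_pos_nonneg)
 qed
 have mN: "borel_measurable N = (borel_measurable borel :: (real \<Rightarrow> 'z::topological_space) set)"
  unfolding N_def by (rule measurable_cong_sets) auto
 obtain w wl where w: "\<And>j. w j \<in> fcomb (\<lambda>n x. c x *\<^sub>R v n x) j" and wl: "wl \<in> borel_measurable borel"
  and lim: "AE x in N. (\<lambda>j. w j x) \<longlonglongrightarrow> wl x"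
  using forward_combinations_finite[OF finite_measure_axioms, of "\<lambda>n x. c x *\<^sub>R v n x"] cv v cm
  unfolding mN by auto
 obtain u where u: "\<And>j. u j \<in> fcomb v j" "\<And>j. w j = (\<lambda>x. c x *\<^sub>R u j x)"
  using fcomb_scaled[OF w] by metis
 have "AE x in lborel. (\<lambda>j. w j x) \<longlonglongrightarrow> wl x"
  using lim unfolding N_def by (subst (asm) AE_density) (auto simp: normal_density_pos)
 then have "AE x in lborel. (\<lambda>j. u j x) \<longlonglongrightarrow> (1 / c x) *\<^sub>R wl x"
 proof eventually_elim
  case (elim x)
  then have "(\<lambda>j. (1 / c x) *\<^sub>R w j x) \<longlonglongrightarrow> (1 / c x) *\<^sub>R wl x" by (intro tendsto_intros)
  then show ?case using c[of x] by (simp add: u(2))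
 qed
 moreover have "(\<lambda>x. (1 / c x) *\<^sub>R wl x) \<in> borel_measurable borel" using cm wl by simp
 ultimately show ?thesis using u(1) by blast
qed

section \<open>Limits of trajectories\<close>

lemma continuous_on_atLeast:
 fixes y :: "real \<Rightarrow> 'a::topological_space"
 assumes "\<And>S. continuous_on {0..S} y"
 shows "continuous_on {0..} y" unfolding continuous_on_def
proof
 fix t :: real assume t: "t \<in> {0..}"
 have "(y \<longlongrightarrow> y t) (at t within {0..t + 1})"
  using assms[of "t + 1"] t unfolding continuous_on_def by auto
 moreover have "at t within {0..t + 1} = at t within {0..}"
  by (rule at_within_nhd[of _ "{..<t + 1}"]) auto
 ultimately show "(y \<longlongrightarrow> y t) (at t within {0..})" by simp
qed

lemma borel_measurable_max_0:
 fixes y :: "real \<Rightarrow> 'x::metric_space"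
 assumes "continuous_on {0..} y"
 shows "(\<lambda>t. y (max 0 t)) \<in> borel_measurable borel"
 by (intro borel_measurable_continuous_onI continuous_on_compose2[OF assms]) (auto intro!: continuous_intros)

lemma comp_measurable:
 fixes g :: "'x::euclidean_space \<Rightarrow> 'c::euclidean_space \<Rightarrow> 'z::euclidean_space"
 assumes g: "continuous_on (UNIV \<times> K) (\<lambda>(x, a). g x a)"
  and y: "y \<in> borel_measurable borel" and a: "a \<in> borel_measurable borel" "\<And>t. a t \<in> K"
 shows "(\<lambda>t::real. g (y t) (a t)) \<in> borel_measurable borel"
proof -
 have "(\<lambda>t. (y t, a t)) \<in> borel \<rightarrow>\<^sub>M restrict_space borel (UNIV \<times> K)"
  using borel_measurable_Pair[OF y a(1)] a(2) by (intro measurable_restrict_space2) auto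
 from measurable_compose[OF this borel_measurable_continuous_on_restrict[OF g]] show ?thesis by simp
qed

text \<open>The argument of Arzela and Ascoli: a diagonal sequence converges at the nonnegative
  rationals, and the common Lipschitz constant on bounded intervals extends convergence to all
  times.\<close>

lemma (in csys) limit_trajectory:
 assumes \<alpha>: "\<And>n. \<alpha> n \<in> ctrls" and xs: "xs \<longlonglongrightarrow> x"
 obtains s y where "strict_mono (s :: nat \<Rightarrow> nat)"
  "\<And>t. 0 \<le> t ==> (\<lambda>n. traj (\<alpha> (s n)) (xs (s n)) t) \<longlonglongrightarrow> y t" "y 0 = x" "continuous_on {0..} y"
proof -
 obtain r where r: "\<And>n. norm (xs n) \<le> r"
  using convergent_imp_Bseq[of xs] xs unfolding Bseq_def convergent_def by metis
 have r0: "0 \<le> r" using r[of 0] norm_ge_zero order_trans by blast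
 define yn where "yn n = traj (\<alpha> n) (xs n)" for n
 have lip: "norm (yn n t - yn n t') \<le> M * (1 + rb M r S) * \<bar>t - t'\<bar>"
  if "0 \<le> t" "t \<le> S" "0 \<le> t'" "t' \<le> S" for n t t' S
 proof -
  interpret adm M B L "FF (\<alpha> n)" "LL (\<alpha> n)" by (rule adm_ctrl[OF \<alpha>])
  show ?thesis using flow_lipschitz[of t t' S "xs n" r] flow_lipschitz[of t' t S "xs n" r] that r
   by (cases "t \<le> t'") (auto simp: yn_def norm_minus_commute)
 qed
 \<comment> \<open>Enumerates the nonnegative rationals; negative ones are sent to 0.\<close>
 define q where "q k = max 0 (real_of_rat (from_nat k))" for k :: nat
 have q0: "0 \<le> q k" for k by (simp add: q_def)
 have bg: "bounded (range (\<lambda>n. yn n (q k)))" for k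
 proof -
  have "norm (yn n (q k)) \<le> rb M r (q k)" for n
   unfolding yn_def by (rule adm.flow_bound[OF adm_ctrl[OF \<alpha>] q0 r])
  then show ?thesis unfolding bounded_iff by (intro exI[of _ "rb M r (q k)"]) auto
 qed
 obtain s :: "nat \<Rightarrow> nat" where s: "strict_mono s" "\<And>k. convergent (\<lambda>n. yn (s n) (q k))"
  using diagonal_convergent_subseq[where g = "\<lambda>n k. yn n (q k)", OF bg] by metis
 have conv: "convergent (\<lambda>n. yn (s n) t)" if t: "0 \<le> t" for t
 proof -
  define \<Lambda> where "\<Lambda> = M * (1 + rb M r (t + 1))"
  have \<Lambda>: "0 \<le> \<Lambda>" unfolding \<Lambda>_def using M_nonneg rb_ge[OF M_nonneg r0, of "t + 1"] r0 t by simp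
  have "Cauchy (\<lambda>n. yn (s n) t)"
  proof (rule CauchyI)
   fix e :: real assume e: "0 < e"
   define d where "d = min 1 (e / (3 * (\<Lambda> + 1)))"
   have d: "0 < d" "d \<le> 1" using e \<Lambda> by (auto simp: d_def)
   have \<Lambda>d: "\<Lambda> * d \<le> e / 3"
   proof -
    have "\<Lambda> * d \<le> (\<Lambda> + 1) * (e / (3 * (\<Lambda> + 1)))" using \<Lambda> e by (intro mult_mono) (auto simp: d_def)
    also have "\<dots> = e / 3" using \<Lambda> by (simp add: divide_simps)
    finally show ?thesis .
   qed
   obtain \<rho> where \<rho>: "t < real_of_rat \<rho>" "real_of_rat \<rho> < t + d" using of_rat_dense[of t "t + d"] d by auto
   define k where "k = to_nat \<rho>"
   have qk: "q k = real_of_rat \<rho>" using \<rho> t by (simp add: q_def k_def)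
   have near: "norm (yn n t - yn n (q k)) \<le> e / 3" for n
   proof -
    have "norm (yn n t - yn n (q k)) \<le> \<Lambda> * \<bar>t - q k\<bar>"
     unfolding \<Lambda>_def qk by (rule lip) (use t \<rho> d in linarith)+
    also have "\<dots> \<le> \<Lambda> * d" using \<rho> qk \<Lambda> by (intro mult_left_mono) auto
    finally show ?thesis using \<Lambda>d by simp
   qed
   have "Cauchy (\<lambda>n. yn (s n) (q k))" using s(2) by (rule convergent_Cauchy)
   then obtain N where N: "\<And>m n. N \<le> m ==> N \<le> n ==> norm (yn (s m) (q k) - yn (s n) (q k)) < e / 3"
    using CauchyD[of "\<lambda>n. yn (s n) (q k)" "e / 3"] e by auto
   have "norm (yn (s m) t - yn (s n) t) < e" if "N \<le> m" "N \<le> n" for m n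
   proof -
    have "yn (s m) t - yn (s n) t = (yn (s m) t - yn (s m) (q k)) + (yn (s m) (q k) - yn (s n) (q k)) - (yn (s n) t - yn (s n) (q k))"
     by simp
    also have "norm \<dots> \<le> norm (yn (s m) t - yn (s m) (q k)) + norm (yn (s m) (q k) - yn (s n) (q k)) + norm (yn (s n) t - yn (s n) (q k))"
     by (meson add_mono norm_triangle_ineq norm_triangle_ineq4 order_refl order_trans)
    also have "\<dots> < e" using near[of "s m"] near[of "s n"] N[OF that] by linarith
    finally show ?thesis .
   qed
   then show "\<exists>N. \<forall>m\<ge>N. \<forall>n\<ge>N. norm (yn (s m) t - yn (s n) t) < e" by blast
  qed
  then show ?thesis by (simp add: Cauchy_convergent_iff)
 qed
 define y where "y t = lim (\<lambda>n. yn (s n) t)" for t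
 have y: "(\<lambda>n. yn (s n) t) \<longlonglongrightarrow> y t" if "0 \<le> t" for t
  unfolding y_def using conv[OF that] by (simp add: convergent_LIMSEQ_iff)
 have "yn n 0 = xs n" for n unfolding yn_def by (rule adm.flow_0[OF adm_ctrl[OF \<alpha>]])
 then have y0: "y 0 = x"
  using LIMSEQ_unique[OF y[of 0] ] LIMSEQ_subseq_LIMSEQ[OF xs s(1)] by (simp add: o_def)
 have ylip: "norm (y t - y t') \<le> M * (1 + rb M r S) * \<bar>t - t'\<bar>"
  if "0 \<le> t" "t \<le> S" "0 \<le> t'" "t' \<le> S" for t t' S
  by (rule LIMSEQ_le_const2[OF tendsto_norm[OF tendsto_diff[OF y y]]]) (use lip that in auto)
 have "continuous_on {0..S} y" for S
 proof (rule lipschitz_on_continuous_on[OF lipschitz_onI])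
  show "dist (y t) (y t') \<le> \<bar>M * (1 + rb M r S)\<bar> * dist t t'" if "t \<in> {0..S}" "t' \<in> {0..S}" for t t'
   using order_trans[OF ylip[of t S t'] mult_right_mono[OF abs_ge_self abs_ge_zero]] that
   by (simp add: dist_norm)
 qed simp
 then have "continuous_on {0..} y" by (rule continuous_on_atLeast)
 then show ?thesis using that[OF s(1), of y] y y0 unfolding yn_def by blast
qed

lemma fcomb_set_integral:
 fixes v :: "nat \<Rightarrow> real \<Rightarrow> 'e::euclidean_space"
 assumes "u \<in> fcomb v j" "\<And>n. set_integrable lborel S (v n)" "convex Q"
  "\<And>n. j \<le> n ==> (LINT t:S|lborel. v n t) \<in> Q"
 shows "set_integrable lborel S u \<and> (LINT t:S|lborel. u t) \<in> Q" using assms(1)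
proof induction
 case (mid u w)
 then have i: "set_integrable lborel S u" "set_integrable lborel S w" by auto
 then have "(LINT t:S|lborel. (1/2) *\<^sub>R (u t + w t)) = (1/2) *\<^sub>R (LINT t:S|lborel. u t) + (1/2) *\<^sub>R (LINT t:S|lborel. w t)"
  by (simp add: scaleR_add_right)
 also have "\<dots> \<in> Q" using mid by (intro convexD[OF assms(3)]) auto
 finally show ?case using i by simp
qed (use assms in auto)

text \<open>Two control sets: K generates the approximating trajectories, C with the data
  \<open>e\<close> and \<open>m\<close> realizes their limits. The vector \<open>e\<close> may carry
  more than the velocity, which \<open>P\<close> extracts; for unbounded controls it also records
  the time component. For compact A one takes C = K, e = f and the identity for \<open>P\<close>.
  Convexity is asked only off \<open>Tg\<close>, hence conclusions hold only until \<open>Tg\<close>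
  is reached.\<close>

locale csys_convex = csys K f l M B L
 for K :: "'c::euclidean_space set" and f :: "'x::euclidean_space \<Rightarrow> 'c \<Rightarrow> 'x" and l :: "'x \<Rightarrow> 'c \<Rightarrow> real"
  and M :: real and B L :: "real \<Rightarrow> real" +
 fixes C :: "'d::euclidean_space set" and e :: "'x \<Rightarrow> 'd \<Rightarrow> 'e::euclidean_space" and m :: "'x \<Rightarrow> 'd \<Rightarrow> real"
  and eK :: "'x \<Rightarrow> 'c \<Rightarrow> 'e" and P :: "'e \<Rightarrow> 'x" and Tg :: "'x set"
 assumes C: "compact C" "C \<noteq> {}"
  and e_cont: "continuous_on (UNIV \<times> C) (\<lambda>(x, d). e x d)"
  and m_cont: "continuous_on (UNIV \<times> C) (\<lambda>(x, d). m x d)"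
  and m_nonneg: "d \<in> C ==> 0 \<le> m x d"
  and eK_cont: "continuous_on (UNIV \<times> K) (\<lambda>(x, a). eK x a)"
  and P: "bounded_linear P" and P_eK: "a \<in> K ==> P (eK x a) = f x a"
  and conv: "x \<notin> Tg ==> convex {(\<epsilon>, \<gamma>). \<exists>d\<in>C. \<epsilon> = e x d \<and> m x d \<le> \<gamma>}"
  and embed: "x \<notin> Tg ==> a \<in> K ==> \<exists>d\<in>C. eK x a = e x d \<and> m x d \<le> l x a"
begin

definition epi :: "'x \<Rightarrow> ('e \<times> real) set" where
 "epi x = {(\<epsilon>, \<gamma>). \<exists>d\<in>C. \<epsilon> = e x d \<and> m x d \<le> \<gamma>}"

lemma continuous_on_snd_section:
 assumes "continuous_on (UNIV \<times> D) (\<lambda>(x, d). h x d)"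
 shows "continuous_on D (h x)"
 by (rule continuous_on_compose2[OF assms, of _ "\<lambda>d. (x, d)", simplified]) (auto intro!: continuous_intros)

lemma epi_closed: "closed (epi x)"
proof -
 have cC: "closed (UNIV \<times> C)" using C by (intro closed_Times compact_imp_closed) auto
 let ?h = "\<lambda>p :: ('e \<times> real) \<times> 'd. norm (e x (snd p) - fst (fst p)) + max 0 (m x (snd p) - snd (fst p))"
 have c1: "continuous_on (UNIV \<times> C) (\<lambda>p :: ('e \<times> real) \<times> 'd. e x (snd p))"
  by (rule continuous_on_compose2[OF continuous_on_snd_section[OF e_cont]]) (auto intro!: continuous_intros)
 have c2: "continuous_on (UNIV \<times> C) (\<lambda>p :: ('e \<times> real) \<times> 'd. m x (snd p))"
  by (rule continuous_on_compose2[OF continuous_on_snd_section[OF m_cont]]) (auto intro!: continuous_intros)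
 have "continuous_on (UNIV \<times> C) ?h" by (intro continuous_intros c1 c2)
 from continuous_closed_preimage[OF this cC, of "{..0}"]
 have "closed ((UNIV \<times> C) \<inter> ?h -` {..0})" by simp
 from closed_projection_compact[OF C(1) this]
 have "closed {z. \<exists>d\<in>C. (z, d) \<in> (UNIV \<times> C) \<inter> ?h -` {..0}}" .
 moreover have "{z. \<exists>d\<in>C. (z, d) \<in> (UNIV \<times> C) \<inter> ?h -` {..0}} = epi x"
 proof -
  have eq: "norm (e x d - \<epsilon>) + max 0 (m x d - \<gamma>) \<le> 0 \<longleftrightarrow> \<epsilon> = e x d \<and> m x d \<le> \<gamma>" for d \<epsilon> \<gamma>
  proof
   assume a: "norm (e x d - \<epsilon>) + max 0 (m x d - \<gamma>) \<le> 0"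
   then have "norm (e x d - \<epsilon>) \<le> 0" "max 0 (m x d - \<gamma>) \<le> 0"
    using norm_ge_zero[of "e x d - \<epsilon>"] max.cobounded1[of 0 "m x d - \<gamma>"] by linarith+
   then show "\<epsilon> = e x d \<and> m x d \<le> \<gamma>" by auto
  qed auto
  show ?thesis unfolding epi_def using eq by auto
 qed
 ultimately show ?thesis by simp
qed

text \<open>Velocities and costs converge only weakly, so they are replaced by forward combinations
  that converge almost everywhere. These stay near the convex sets \<open>epi (y t)\<close>, so the
  limit belongs to them and a selection turns it into a control. The integral identities survive
  because they are closed convex conditions.\<close>

lemma closure_control:
 assumes \<alpha>: "\<And>n. \<alpha> n \<in> ctrls" and xs: "xs \<longlonglongrightarrow> x"
  and cn: "\<And>n. run (\<alpha> n) (xs n) (real n) \<le> c n" and c: "c \<longlonglongrightarrow> cl"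
 shows "\<exists>y d. y 0 = x \<and> continuous_on {0..} y \<and> d \<in> borel_measurable borel \<and> (\<forall>s. d s \<in> C) \<and>
  (\<forall>t\<ge>0. (\<forall>s. 0 \<le> s \<longrightarrow> s < t \<longrightarrow> y s \<notin> Tg) \<longrightarrow>
    solon t (\<lambda>s z. P (e z (d s))) x y \<and> set_integrable lborel {0..t} (\<lambda>s. m (y s) (d s)) \<and>
    integral {0..t} (\<lambda>s. m (y s) (d s)) \<le> cl)"
proof -
 obtain s y where s: "strict_mono s" and yl: "\<And>t. 0 \<le> t ==> (\<lambda>n. traj (\<alpha> (s n)) (xs (s n)) t) \<longlonglongrightarrow> y t"
  and y0: "y 0 = x" and yc: "continuous_on {0..} y"
  by (rule limit_trajectory[where \<alpha> = \<alpha> and xs = xs, OF \<alpha> xs]) (rule that)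
 define a where "a n = \<alpha> (s n)" for n
 define yn where "yn n = traj (a n) (xs (s n))" for n
 have a: "a n \<in> ctrls" for n unfolding a_def by (rule \<alpha>)
 have ynl: "(\<lambda>n. yn n t) \<longlonglongrightarrow> y t" if "0 \<le> t" for t using yl[OF that] by (simp add: yn_def a_def)
 obtain r where r: "\<And>n. norm (xs n) \<le> r"
  using convergent_imp_Bseq[of xs] xs unfolding Bseq_def convergent_def by metis
 define g where "g x a = (eK x a, l x a)" for x a
 have gc: "continuous_on (UNIV \<times> K) (\<lambda>(x, a). g x a)" unfolding g_def case_prod_unfold
  using eK_cont l_cont unfolding case_prod_unfold by (intro continuous_on_Pair)
 \<comment> \<open>The value 0 before time 0 makes these Borel functions on the whole line.\<close>
 define v where "v n t = (if t < 0 then 0 else g (yn n t) (a n t))" for n t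
 have ynb: "norm (yn n t) \<le> rb M r S" if "0 \<le> t" "t \<le> S" for n t S
  unfolding yn_def by (rule adm.flow_bound'[OF adm_ctrl[OF a] that r])
 have "\<exists>b. \<forall>x a. norm x \<le> R \<longrightarrow> a \<in> K \<longrightarrow> norm (g x a) \<le> b" for R
 proof -
  have "compact ((\<lambda>(x, a). g x a) ` (cball 0 R \<times> K))"
   by (intro compact_continuous_image continuous_on_subset[OF gc] compact_Times K) auto
  from compact_imp_bounded[OF this] obtain b where "\<forall>z\<in>(\<lambda>(x, a). g x a) ` (cball 0 R \<times> K). norm z \<le> b"
   unfolding bounded_iff by blast
  then show ?thesis by (intro exI[of _ b]) force
 qed
 then obtain bd where bd: "\<And>R x a. norm x \<le> R ==> a \<in> K ==> norm (g x a) \<le> bd R" by metis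
 have vb: "norm (v n t) \<le> \<bar>bd (rb M r S)\<bar>" if "t \<le> S" for n t S
 proof (cases "t < 0")
  case False
  then show ?thesis
   using order_trans[OF bd[OF ynb[of t S n] ctrls_in[OF a[of n], of t]] abs_ge_self] that by (simp add: v_def)
 qed (simp add: v_def)
 have vm: "v n \<in> borel_measurable borel" for n
 proof -
  interpret adm M B L "FF (a n)" "LL (a n)" by (rule adm_ctrl[OF a])
  have c0: "continuous_on {0..} (yn n)"
   by (rule continuous_on_atLeast) (simp add: yn_def flow_continuous)
  have "(\<lambda>t. a n (max 0 t)) \<in> borel \<rightarrow>\<^sub>M restrict_space borel K"
   using control_total[OF a[of n, unfolded ctrls_def]] .
  then have am: "(\<lambda>t. a n (max 0 t)) \<in> borel_measurable borel" by (rule measurable_restrict_space2_iff[THEN iffD1, THEN conjunct1])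
  have "(\<lambda>t. g (yn n (max 0 t)) (a n (max 0 t))) \<in> borel_measurable borel"
   by (rule comp_measurable[OF gc borel_measurable_max_0[OF c0] am]) (use ctrls_in[OF a] in simp)
  then have "(\<lambda>t. if t < 0 then 0 else g (yn n (max 0 t)) (a n (max 0 t))) \<in> borel_measurable borel"
   by (intro measurable_If) auto
  then show ?thesis by (rule measurable_cong[THEN iffD1, rotated]) (auto simp: v_def)
 qed
 \<comment> \<open>One Borel majorant for all n: the radius is taken at the integer above t, where
   it bounds all trajectories up to t.\<close>
 define b where "b t = \<bar>bd (rb M r (real (nat \<lceil>t\<rceil>)))\<bar>" for t :: real
 have bm: "b \<in> borel_measurable borel"
 proof -
  have "(\<lambda>t::real. nat \<lceil>t\<rceil>) \<in> borel \<rightarrow>\<^sub>M count_space UNIV" by measurable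
  then show ?thesis unfolding b_def by (rule measurable_compose) simp
 qed
 have "norm (v n t) \<le> b t" for n t unfolding b_def by (rule vb) linarith
 from forward_combinations[where v = v, OF vm this bm] obtain w wl where w: "\<And>j. w j \<in> fcomb v j"
  and wlm: "wl \<in> borel_measurable borel" and wl: "AE t in lborel. (\<lambda>j. w j t) \<longlonglongrightarrow> wl t" by blast
 have in_epi: "wl t \<in> epi (y t)" if lim: "(\<lambda>j. w j t) \<longlonglongrightarrow> wl t" and t: "0 \<le> t" and nT: "y t \<notin> Tg" for t
 proof -
  have "wl t \<in> closure (epi (y t))" unfolding closure_approachable
  \<comment> \<open>For large n the pairs \<open>v n t\<close> are within \<delta>/2 of the convex
    set \<open>epi (y t)\<close>, by uniform continuity of the data; the points with this property
    form a convex set, which therefore contains the combinations.\<close>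
  proof (intro allI impI)
   fix \<delta> :: real assume \<delta>: "0 < \<delta>"
   define R where "R = rb M r t"
   have yR: "norm (y t) \<le> R"
    by (rule LIMSEQ_le_const2[OF tendsto_norm[OF ynl[OF t]]]) (use ynb[OF t order_refl] in \<open>auto simp: R_def\<close>)
   have "uniformly_continuous_on (cball 0 R \<times> K) (\<lambda>(x, a). g x a)"
    by (intro compact_uniformly_continuous continuous_on_subset[OF gc] compact_Times K) auto
   then obtain \<eta> where \<eta>: "0 < \<eta>" "\<And>p q. p \<in> cball 0 R \<times> K ==> q \<in> cball 0 R \<times> K ==> dist q p < \<eta> ==>
     dist ((\<lambda>(x, a). g x a) q) ((\<lambda>(x, a). g x a) p) < \<delta> / 2"
    unfolding uniformly_continuous_on_def using half_gt_zero[OF \<delta>] by metis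
   obtain j0 where j0: "\<And>n. j0 \<le> n ==> dist (yn n t) (y t) < \<eta>"
    using tendstoD[OF ynl[OF t] \<eta>(1)] unfolding eventually_sequentially by blast
   have vnear: "v n t \<in> {z. \<exists>q\<in>epi (y t). norm (z - q) \<le> \<delta> / 2}" if n: "j0 \<le> n" for n
   proof -
    have an: "a n t \<in> K" by (rule ctrls_in[OF a t])
    have "g (y t) (a n t) \<in> epi (y t)" using embed[OF nT an] by (auto simp: epi_def g_def)
    moreover have "dist (g (yn n t) (a n t)) (g (y t) (a n t)) < \<delta> / 2"
     using \<eta>(2)[of "(y t, a n t)" "(yn n t, a n t)"] an yR ynb[OF t order_refl, of n] j0[OF n]
     by (auto simp: R_def dist_Pair_Pair)
    ultimately show ?thesis using t by (auto simp: v_def dist_norm intro!: bexI[of _ "g (y t) (a n t)"])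
   qed
   obtain j1 where j1: "\<And>j. j1 \<le> j ==> dist (w j t) (wl t) < \<delta> / 2"
    using tendstoD[OF lim half_gt_zero[OF \<delta>]] unfolding eventually_sequentially by blast
   define j where "j = max j0 j1"
   have "w j t \<in> {z. \<exists>q\<in>epi (y t). norm (z - q) \<le> \<delta> / 2}"
    by (rule fcomb_convex[OF w convex_near]) (use conv[OF nT] vnear in \<open>auto simp: epi_def j_def\<close>)
   then obtain q where q: "q \<in> epi (y t)" "norm (w j t - q) \<le> \<delta> / 2" by blast
   have "dist q (wl t) \<le> dist (w j t) q + dist (w j t) (wl t)" by (rule dist_triangle3)
   also have "\<dots> < \<delta>" using q(2) j1[of j] by (simp add: dist_norm j_def)
   finally show "\<exists>q\<in>epi (y t). dist q (wl t) < \<delta>" using q(1) by blast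
  qed
  then show ?thesis using epi_closed closure_closed by blast
 qed
 \<comment> \<open>Encodes the equation for \<open>e\<close> and the inequality for \<open>m\<close>
   in a single inequality, the form that \<open>measurable_selection\<close> accepts.\<close>
 define \<Psi> where "\<Psi> z d = norm (e (fst z) d - fst (snd z)) + max 0 (m (fst z) d - snd (snd z))" for z :: "'x \<times> 'e \<times> real" and d
 have \<Psi>c: "continuous_on (UNIV \<times> C) (\<lambda>(z, d). \<Psi> z d)"
 proof -
  have p: "continuous_on (UNIV \<times> C) (\<lambda>p :: ('x \<times> 'e \<times> real) \<times> 'd. (fst (fst p), snd p))" by (intro continuous_intros)
  have im: "(\<lambda>p :: ('x \<times> 'e \<times> real) \<times> 'd. (fst (fst p), snd p)) ` (UNIV \<times> C) \<subseteq> UNIV \<times> C" by auto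
  have "continuous_on (UNIV \<times> C) (\<lambda>p :: ('x \<times> 'e \<times> real) \<times> 'd. e (fst (fst p)) (snd p))"
   using continuous_on_compose2[OF e_cont p im] by simp
  moreover have "continuous_on (UNIV \<times> C) (\<lambda>p :: ('x \<times> 'e \<times> real) \<times> 'd. m (fst (fst p)) (snd p))"
   using continuous_on_compose2[OF m_cont p im] by simp
  ultimately show ?thesis unfolding \<Psi>_def case_prod_unfold by (intro continuous_intros)
 qed
 obtain sel where selm: "sel \<in> borel_measurable borel"
  and sel: "\<And>z. \<exists>d\<in>C. \<Psi> z d \<le> 0 ==> sel z \<in> C \<and> \<Psi> z (sel z) \<le> 0"
  using measurable_selection[OF C(1) \<Psi>c] by blast
 have \<Psi>0: "e z d = fst p \<and> m z d \<le> snd p" if "\<Psi> (z, p) d \<le> 0" for z p d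
 proof -
  have "norm (e z d - fst p) \<le> 0" "max 0 (m z d - snd p) \<le> 0"
   using that norm_ge_zero[of "e z d - fst p"] max.cobounded1[of 0 "m z d - snd p"]
   unfolding \<Psi>_def fst_conv snd_conv by linarith+
  then show ?thesis by simp
 qed
 obtain c0 where c0: "c0 \<in> C" using C(2) by blast
 define \<zeta> where "\<zeta> t = (y (max 0 t), wl t)" for t
 define d where "d t = (if sel (\<zeta> t) \<in> C then sel (\<zeta> t) else c0)" for t
 have dC: "d t \<in> C" for t using c0 by (simp add: d_def)
 have ym: "(\<lambda>t. y (max 0 t)) \<in> borel_measurable borel" by (rule borel_measurable_max_0[OF yc])
 have "\<zeta> \<in> borel_measurable borel" unfolding \<zeta>_def using ym wlm by (intro borel_measurable_Pair)
 then have sm: "(\<lambda>t. sel (\<zeta> t)) \<in> borel_measurable borel" by (rule measurable_compose[OF _ selm])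
 have dm: "d \<in> borel_measurable borel" unfolding d_def
 proof (intro measurable_If sm)
  show "{x \<in> space borel. sel (\<zeta> x) \<in> C} \<in> sets borel"
   using measurable_sets[OF sm, of C] C(1) by (simp add: compact_imp_closed vimage_def)
 qed simp
 have dprop: "e (y t) (d t) = fst (wl t) \<and> m (y t) (d t) \<le> snd (wl t)"
  if lim: "(\<lambda>j. w j t) \<longlonglongrightarrow> wl t" and t: "0 \<le> t" and nT: "y t \<notin> Tg" for t
 proof -
  obtain d' where d': "d' \<in> C" "fst (wl t) = e (y t) d'" "m (y t) d' \<le> snd (wl t)"
   using in_epi[OF lim t nT] by (cases "wl t") (auto simp: epi_def)
  then have "\<Psi> (\<zeta> t) d' \<le> 0" using t by (simp add: \<Psi>_def \<zeta>_def)
  then have "sel (\<zeta> t) \<in> C \<and> \<Psi> (\<zeta> t) (sel (\<zeta> t)) \<le> 0" using sel d' by blast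
  then have "\<Psi> (y t, wl t) (d t) \<le> 0" using t by (simp add: d_def \<zeta>_def)
  then show ?thesis by (rule \<Psi>0)
 qed
 have wsnd: "0 \<le> snd (w j t)" for j t
 proof -
  have "w j t \<in> {p. 0 \<le> snd p}"
  proof (rule fcomb_convex[OF w])
   show "convex {p :: 'e \<times> real. 0 \<le> snd p}" by (auto simp: convex_def)
   show "v n t \<in> {p. 0 \<le> snd p}" for n using l_nonneg ctrls_in[OF a] by (auto simp: v_def g_def)
  qed
  then show ?thesis by simp
 qed
 have wlsnd: "0 \<le> snd (wl t)" if lim: "(\<lambda>j. w j t) \<longlonglongrightarrow> wl t" for t
  by (rule LIMSEQ_le_const[OF tendsto_snd[OF lim]]) (use wsnd in auto)
 have vint: "set_integrable lborel {0..S} (v n)" for n S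
  by (rule bounded_set_integrable[where B = "\<bar>bd (rb M r S)\<bar>"])
    (use vm vb in \<open>auto simp: set_borel_measurable_def\<close>)
 have wb: "norm (w j t) \<le> \<bar>bd (rb M r S)\<bar>" if "t \<le> S" for j t S
 proof -
  have "w j t \<in> cball 0 \<bar>bd (rb M r S)\<bar>"
   by (rule fcomb_convex[OF w convex_cball]) (use vb[OF that] in simp)
  then show ?thesis by simp
 qed
 have lim_int: "set_integrable lborel {0..S} wl"
  "(\<lambda>j. LINT t:{0..S}|lborel. w j t) \<longlonglongrightarrow> (LINT t:{0..S}|lborel. wl t)" for S
 proof -
  let ?b = "\<lambda>t. indicator {0..S} t *\<^sub>R \<bar>bd (rb M r S)\<bar>"
  have bi: "integrable lborel ?b"
   using borel_integrable_atLeastAtMost'[of 0 S "\<lambda>_. \<bar>bd (rb M r S)\<bar>"] by (simp add: set_integrable_def)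
  have m1: "(\<lambda>t. indicator {0..S} t *\<^sub>R wl t) \<in> borel_measurable lborel" using wlm by simp
  have m2: "(\<lambda>t. indicator {0..S} t *\<^sub>R w j t) \<in> borel_measurable lborel" for j
   using fcomb_measurable[OF w vm] by simp
  have l: "AE t in lborel. (\<lambda>j. indicator {0..S} t *\<^sub>R w j t) \<longlonglongrightarrow> indicator {0..S} t *\<^sub>R wl t"
   using wl by eventually_elim (intro tendsto_intros)
  have b: "AE t in lborel. norm (indicator {0..S} t *\<^sub>R w j t) \<le> ?b t" for j
   by (intro AE_I2) (use wb in \<open>auto split: split_indicator\<close>)
  show "set_integrable lborel {0..S} wl"
   unfolding set_integrable_def by (rule integrable_dominated_convergence[OF m1 m2 bi l b])
  show "(\<lambda>j. LINT t:{0..S}|lborel. w j t) \<longlonglongrightarrow> (LINT t:{0..S}|lborel. wl t)"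
   unfolding set_lebesgue_integral_def by (rule integral_dominated_convergence[OF m1 m2 bi l b])
 qed
 \<comment> \<open>Transfers conditions from \<open>v n\<close> to the limit. It is applied with
   preimages of balls, for the velocity, and with half-spaces, for the cost.\<close>
 have lim_in: "(LINT t:{0..S}|lborel. wl t) \<in> Q"
  if Q: "convex Q" "closed Q" and ev: "\<forall>\<^sub>F n in sequentially. (LINT t:{0..S}|lborel. v n t) \<in> Q" for Q S
 proof -
  obtain j0 where j0: "\<And>n. j0 \<le> n ==> (LINT t:{0..S}|lborel. v n t) \<in> Q" using ev unfolding eventually_sequentially by blast
  have "(LINT t:{0..S}|lborel. w j t) \<in> Q" if "j0 \<le> j" for j
   by (rule fcomb_set_integral[OF w vint Q(1), THEN conjunct2]) (use j0 that in auto)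
  then show ?thesis
   by (intro Lim_in_closed_set[OF Q(2) _ _ lim_int(2)]) (auto simp: eventually_sequentially)
 qed
 have LINTv: "(LINT t:{0..S}|lborel. v n t) = (integral {0..S} (\<lambda>t. fst (v n t)), run (a n) (xs (s n)) S)"
  "P (integral {0..S} (\<lambda>t. fst (v n t))) = yn n S - xs (s n)" if S: "0 \<le> S" for n S
 proof -
  interpret adm M B L "FF (a n)" "LL (a n)" by (rule adm_ctrl[OF a])
  note vi = set_integrable_imp_HK[OF vint[of S n]]
  have f: "fst (LINT t:{0..S}|lborel. v n t) = integral {0..S} (\<lambda>t. fst (v n t))"
   using integral_linear[OF vi(1) bounded_linear_fst] vi(2) by (simp add: o_def)
  have "snd (LINT t:{0..S}|lborel. v n t) = integral {0..S} (\<lambda>t. snd (v n t))"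
   using integral_linear[OF vi(1) bounded_linear_snd] vi(2) by (simp add: o_def)
  also have "\<dots> = run (a n) (xs (s n)) S"
   unfolding rc_def by (rule HK_integral_cong) (auto simp: v_def g_def LL_def yn_def)
  finally show "(LINT t:{0..S}|lborel. v n t) = (integral {0..S} (\<lambda>t. fst (v n t)), run (a n) (xs (s n)) S)"
   using f by (simp add: prod_eq_iff)
  have "(\<lambda>t. fst (v n t)) integrable_on {0..S}"
   using integrable_linear[OF vi(1) bounded_linear_fst] by (simp add: o_def)
  from integral_linear[OF this P]
  have "P (integral {0..S} (\<lambda>t. fst (v n t))) = integral {0..S} (\<lambda>t. P (fst (v n t)))" by (simp add: o_def)
  also have "\<dots> = integral {0..S} (\<lambda>t. FF (a n) t (yn n t))"
   by (rule HK_integral_cong) (auto simp: v_def g_def FF_def P_eK ctrls_in[OF a])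
  also have "\<dots> = yn n S - xs (s n)"
   using solon_diff(1)[OF flow_solon[of S "xs (s n)"], of 0 S] S by (simp add: yn_def)
  finally show "P (integral {0..S} (\<lambda>t. fst (v n t))) = yn n S - xs (s n)" .
 qed
 have xsl: "(\<lambda>n. xs (s n)) \<longlonglongrightarrow> x" using LIMSEQ_subseq_LIMSEQ[OF xs s] by (simp add: o_def)
 have vel: "P (fst (LINT t:{0..S}|lborel. wl t)) = y S - x" if S: "0 \<le> S" for S
 proof -
  have "dist (P (fst (LINT t:{0..S}|lborel. wl t))) (y S - x) \<le> \<delta>" if \<delta>: "0 < \<delta>" for \<delta>
  proof -
   let ?Q = "(\<lambda>p :: 'e \<times> real. P (fst p)) -` cball (y S - x) \<delta>"
   have bl: "bounded_linear (\<lambda>p :: 'e \<times> real. P (fst p))"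
    using bounded_linear_compose[OF P bounded_linear_fst] .
   have "convex ?Q" by (intro convex_linear_vimage bounded_linear.linear[OF bl] convex_cball)
   moreover have "closed ?Q" by (intro closed_vimage closed_cball bounded_linear.continuous_on[OF bl] continuous_on_id)
   moreover have "(\<lambda>n. yn n S - xs (s n)) \<longlonglongrightarrow> y S - x" by (intro tendsto_diff ynl S xsl)
   from tendstoD[OF this \<delta>] have "\<forall>\<^sub>F n in sequentially. (LINT t:{0..S}|lborel. v n t) \<in> ?Q"
    by eventually_elim (simp add: LINTv[OF S] dist_commute)
   ultimately have "(LINT t:{0..S}|lborel. wl t) \<in> ?Q" by (rule lim_in)
   then show ?thesis by (simp add: dist_commute)
  qed
  then have "dist (P (fst (LINT t:{0..S}|lborel. wl t))) (y S - x) \<le> 0" by (rule field_le_epsilon[of _ 0, simplified])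
  then show ?thesis by simp
 qed
 have costN: "snd (LINT t:{0..real N}|lborel. wl t) \<le> cl" for N
 proof (rule field_le_epsilon)
  fix \<delta> :: real assume \<delta>: "0 < \<delta>"
  let ?Q = "{p :: 'e \<times> real. snd p \<le> cl + \<delta>}"
  have "convex ?Q"
  proof (rule convexI)
   fix p q :: "'e \<times> real" and u v :: real assume "p \<in> ?Q" "q \<in> ?Q" "0 \<le> u" "0 \<le> v" "u + v = 1"
   then show "u *\<^sub>R p + v *\<^sub>R q \<in> ?Q" using convex_bound_le[of "snd p" "cl + \<delta>" "snd q" u v] by simp
  qed
  moreover have "closed ?Q" by (intro closed_Collect_le continuous_intros)
  moreover have "\<forall>\<^sub>F n in sequentially. (LINT t:{0..real N}|lborel. v n t) \<in> ?Q"
  proof -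
   have "(\<lambda>n. c (s n)) \<longlonglongrightarrow> cl" using LIMSEQ_subseq_LIMSEQ[OF c s] by (simp add: o_def)
   then have "\<forall>\<^sub>F n in sequentially. c (s n) < cl + \<delta>" by (rule order_tendstoD) (use \<delta> in simp)
   then show ?thesis using eventually_ge_at_top[of N]
   proof eventually_elim
    case (elim n)
    interpret adm M B L "FF (a n)" "LL (a n)" by (rule adm_ctrl[OF a])
    \<comment> \<open>The cost bound is known up to time n only, so for horizon N one waits until n
      \<ge> N and uses monotonicity of the running cost.\<close>
    have "run (a n) (xs (s n)) (real N) \<le> run (a n) (xs (s n)) (real (s n))"
     using elim(2) seq_suble[OF s, of n] by (intro rc_mono) auto
    then show ?case using cn[of "s n"] elim(1) by (simp add: LINTv(1) a_def)
   qed
  qed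
  ultimately have "(LINT t:{0..real N}|lborel. wl t) \<in> ?Q" by (rule lim_in)
  then show "snd (LINT t:{0..real N}|lborel. wl t) \<le> cl + \<delta>" by simp
 qed
 have Pm: "(\<lambda>t. P (e (y (max 0 t)) (d t))) \<in> borel_measurable borel"
  using measurable_compose[OF comp_measurable[OF e_cont ym dm dC]
   borel_measurable_continuous_onI[OF bounded_linear.continuous_on[OF P continuous_on_id]]] .
 have mm: "(\<lambda>t. m (y (max 0 t)) (d t)) \<in> borel_measurable borel" by (rule comp_measurable[OF m_cont ym dm dC])
 have final: "set_integrable lborel {0..t} (\<lambda>s. P (e (y s) (d s)))"
  "y t = x + integral {0..t} (\<lambda>s. P (e (y s) (d s)))"
  "set_integrable lborel {0..t} (\<lambda>s. m (y s) (d s))"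
  "integral {0..t} (\<lambda>s. m (y s) (d s)) \<le> cl"
  if t: "0 \<le> t" and nT: "\<And>s. 0 \<le> s ==> s < t ==> y s \<notin> Tg" for t
 proof -
  \<comment> \<open>The trajectory is assumed to avoid \<open>Tg\<close> only before t, since it may
    enter \<open>Tg\<close> at t; the single time t is discarded as a null set.\<close>
  have "AE s in lborel. s \<noteq> t" by (rule AE_lborel_singleton)
  then have ae: "AE s in lborel. s \<in> {0..t} \<longrightarrow> e (y s) (d s) = fst (wl s) \<and> m (y s) (d s) \<le> snd (wl s) \<and> 0 \<le> snd (wl s)"
   using wl
  proof eventually_elim
   case (elim s)
   then show ?case using dprop[OF elim(2)] wlsnd[OF elim(2)] nT by auto
  qed
  have Pf: "set_integrable lborel {0..t} (\<lambda>s. P (fst (wl s)))"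
   using integrable_bounded_linear[OF bounded_linear_compose[OF P bounded_linear_fst] lim_int(1)[of t, unfolded set_integrable_def]]
   unfolding set_integrable_def by (simp add: linear_simps(5)[OF P] o_def)
  have eqP: "AE s in lborel. indicator {0..t} s *\<^sub>R P (fst (wl s)) = indicator {0..t} s *\<^sub>R P (e (y s) (d s))"
   using ae by eventually_elim (auto split: split_indicator)
  have mP: "(\<lambda>s. indicator {0..t} s *\<^sub>R P (e (y s) (d s))) \<in> borel_measurable lborel"
  proof -
   have "(\<lambda>s. indicator {0..t} s *\<^sub>R P (e (y (max 0 s)) (d s))) \<in> borel_measurable lborel" using Pm by simp
   then show ?thesis by (rule measurable_cong[THEN iffD1, rotated]) (auto split: split_indicator)
  qed
  have mS: "(\<lambda>s. indicator {0..t} s *\<^sub>R m (y s) (d s)) \<in> borel_measurable lborel"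
  proof -
   have "(\<lambda>s. indicator {0..t} s *\<^sub>R m (y (max 0 s)) (d s)) \<in> borel_measurable lborel" using mm by simp
   then show ?thesis by (rule measurable_cong[THEN iffD1, rotated]) (auto split: split_indicator)
  qed
  show i1: "set_integrable lborel {0..t} (\<lambda>s. P (e (y s) (d s)))"
   unfolding set_integrable_def by (rule integrable_cong_AE_imp[OF Pf[unfolded set_integrable_def] mP eqP])
  have "integral {0..t} (\<lambda>s. P (e (y s) (d s))) = (LINT s:{0..t}|lborel. P (e (y s) (d s)))"
   using set_integrable_imp_HK(2)[OF i1] by simp
  also have "\<dots> = (LINT s:{0..t}|lborel. P (fst (wl s)))" unfolding set_lebesgue_integral_def
   by (rule integral_cong_AE[OF borel_measurable_integrable[OF Pf[unfolded set_integrable_def]] mP eqP, symmetric])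
  also have "\<dots> = P (fst (LINT s:{0..t}|lborel. wl s))"
  proof -
   have "(LINT s:{0..t}|lborel. P (fst (wl s))) = integral {0..t} (\<lambda>s. P (fst (wl s)))"
    by (rule set_integrable_imp_HK(2)[OF Pf])
   also have "\<dots> = P (fst (integral {0..t} wl))"
    using integral_linear[OF set_integrable_imp_HK(1)[OF lim_int(1)[of t]] bounded_linear_compose[OF P bounded_linear_fst]]
    by (simp add: o_def)
   finally show ?thesis using set_integrable_imp_HK(2)[OF lim_int(1)[of t]] by simp
  qed
  also have "\<dots> = y t - x" by (rule vel[OF t])
  finally show "y t = x + integral {0..t} (\<lambda>s. P (e (y s) (d s)))" by simp
  have Sf: "set_integrable lborel {0..S} (\<lambda>s. snd (wl s))" for S
   using integrable_bounded_linear[OF bounded_linear_snd lim_int(1)[of S, unfolded set_integrable_def]]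
   unfolding set_integrable_def by simp
  show i2: "set_integrable lborel {0..t} (\<lambda>s. m (y s) (d s))" unfolding set_integrable_def
   by (rule Bochner_Integration.integrable_bound[OF Sf[of t, unfolded set_integrable_def] mS])
     (use ae m_nonneg[OF dC] in \<open>auto elim!: eventually_mono split: split_indicator\<close>)
  obtain N where N: "t \<le> real N" using real_arch_simple by blast
  have "integral {0..t} (\<lambda>s. m (y s) (d s)) = (LINT s:{0..t}|lborel. m (y s) (d s))"
   using set_integrable_imp_HK(2)[OF i2] by simp
  also have "\<dots> \<le> (LINT s:{0..real N}|lborel. snd (wl s))" unfolding set_lebesgue_integral_def
  proof (rule integral_mono_AE)
   show "AE s in lborel. indicator {0..t} s *\<^sub>R m (y s) (d s) \<le> indicator {0..real N} s *\<^sub>R snd (wl s)"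
    using ae wl by eventually_elim (use N wlsnd in \<open>auto split: split_indicator\<close>)
  qed (use i2 Sf[of "real N"] in \<open>auto simp: set_integrable_def\<close>)
  also have "\<dots> = snd (LINT s:{0..real N}|lborel. wl s)"
  proof -
   have "(LINT s:{0..real N}|lborel. snd (wl s)) = integral {0..real N} (\<lambda>s. snd (wl s))"
    by (rule set_integrable_imp_HK(2)[OF Sf])
   also have "\<dots> = snd (integral {0..real N} wl)"
    using integral_linear[OF set_integrable_imp_HK(1)[OF lim_int(1)[of "real N"]] bounded_linear_snd]
    by (simp add: o_def)
   finally show ?thesis using set_integrable_imp_HK(2)[OF lim_int(1)[of "real N"]] by simp
  qed
  also have "\<dots> \<le> cl" by (rule costN)
  finally show "integral {0..t} (\<lambda>s. m (y s) (d s)) \<le> cl" .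
 qed
 have "solon t (\<lambda>s z. P (e z (d s))) x y" if t: "0 \<le> t" and nT: "\<And>s. 0 \<le> s ==> s < t ==> y s \<notin> Tg" for t
  unfolding solon_def using final(1,2) nT by auto
 then show ?thesis using y0 yc dm dC final(3,4) by (intro exI[of _ y] exI[of _ d]) auto
qed

end

context csys
begin

section \<open>Consequences of closedness under limits\<close>

lemma Sig_le_V: "Sig x \<le> V x" unfolding Sig_def
proof (rule SUP_least)
 fix t :: real assume "t \<in> {0<..}"
 show "(INF \<alpha>\<in>ctrls. pcost (FF \<alpha>) (LL \<alpha>) {0..t} x) \<le> V x" unfolding V_def
 proof (rule INF_mono)
  fix \<alpha> assume \<alpha>: "\<alpha> \<in> ctrls"
  have "pcost (FF \<alpha>) (LL \<alpha>) {0..t} x \<le> J \<alpha> x" unfolding pcost_def less_eq_ennreal.rep_eq[symmetric]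
   by (intro nn_integral_mono) (auto split: split_indicator)
  with \<alpha> show "\<exists>\<beta>\<in>ctrls. pcost (FF \<beta>) (LL \<beta>) {0..t} x \<le> J \<alpha> x" by blast
 qed
qed

text \<open>The hypothesis says that limits of controls with bounded cost over growing horizons are
  realized. Here it is used with a constant sequence of starting points; the next lemma uses
  converging ones to obtain lower semicontinuity.\<close>

lemma V_le_Sig_if_closure:
 assumes key: "\<And>\<alpha> xs c cl. (\<And>n. \<alpha> n \<in> ctrls) ==> xs \<longlonglongrightarrow> x ==>
   (\<And>n. run (\<alpha> n) (xs n) (real n) \<le> c n) ==> c \<longlonglongrightarrow> cl ==> V x \<le> ereal cl"
 shows "V x \<le> Sig x"
proof (cases "Sig x")
 case (real c)
 then obtain \<alpha> where \<alpha>: "\<And>n. \<alpha> n \<in> ctrls" "\<And>n. run (\<alpha> n) x (real (Suc n)) \<le> c + inverse (real (Suc n))"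
  by (rule Sig_sequence) blast
 have "V x \<le> ereal c"
 proof (rule key[of \<alpha> "\<lambda>_. x" "\<lambda>n. c + inverse (real (Suc n))"])
  fix n
  interpret adm M B L "FF (\<alpha> n)" "LL (\<alpha> n)" by (rule adm_ctrl[OF \<alpha>(1)])
  show "run (\<alpha> n) x (real n) \<le> c + inverse (real (Suc n))"
   using rc_mono[of "real n" "real (Suc n)" x] \<alpha>(2)[of n] by simp
 next
  show "(\<lambda>n. c + inverse (real (Suc n))) \<longlonglongrightarrow> c" by (rule LIMSEQ_inverse_real_of_nat_add)
 qed (auto intro: \<alpha>)
 then show ?thesis using real by simp
next
 case MInf then show ?thesis using Sig_nonneg[of x] by simp
qed simp

lemma V_lsc_if_closure:
 assumes key: "\<And>\<alpha> xs c cl. (\<And>n. \<alpha> n \<in> ctrls) ==> xs \<longlonglongrightarrow> x ==>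
   (\<And>n. run (\<alpha> n) (xs n) (real n) \<le> c n) ==> c \<longlonglongrightarrow> cl ==> V x \<le> ereal cl"
  and c: "c < V x"
 shows "\<forall>\<^sub>F z in nhds x. c < V z"
proof (rule ccontr)
 assume n: "\<not> ?thesis"
 have "\<exists>z. dist z x < d \<and> V z \<le> c" if "0 < d" for d
  using n that unfolding eventually_nhds_metric by (meson not_le)
 then have "\<exists>z. dist z x < inverse (real (Suc n)) \<and> V z \<le> c" for n by simp
 then obtain z where z: "\<And>n. dist (z n) x < inverse (real (Suc n))" "\<And>n. V (z n) \<le> c" by metis
 have "0 \<le> c" using V_nonneg[of "z 0"] z(2)[of 0] by (rule order_trans)
 then obtain w where w: "c = ereal w" using c by (cases c) auto
 have "\<exists>\<alpha>. \<alpha> \<in> ctrls \<and> J \<alpha> (z n) \<le> V (z n) + ereal (inverse (real (Suc n)))" for n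
 proof -
  have "V (z n) < \<infinity>" using z(2)[of n] w by (cases "V (z n)") auto
  then show ?thesis by (rule near_optimal[of "z n" "inverse (real (Suc n))"]) auto
 qed
 then obtain \<alpha> where \<alpha>: "\<And>n. \<alpha> n \<in> ctrls" "\<And>n. J (\<alpha> n) (z n) \<le> V (z n) + ereal (inverse (real (Suc n)))" by metis
 have "V x \<le> ereal w"
 proof (rule key[of \<alpha> z "\<lambda>n. w + inverse (real (Suc n))"])
  have "(\<lambda>n. dist (z n) x) \<longlonglongrightarrow> 0"
  proof (rule tendsto_sandwich)
   show "\<forall>\<^sub>F n in sequentially. 0 \<le> dist (z n) x" by simp
   show "\<forall>\<^sub>F n in sequentially. dist (z n) x \<le> inverse (real (Suc n))"
    using z(1) by (intro always_eventually allI less_imp_le)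
  qed (rule tendsto_const LIMSEQ_inverse_real_of_nat)+
  then show "z \<longlonglongrightarrow> x" by (rule tendsto_dist_iff[THEN iffD2])
  fix n
  interpret adm M B L "FF (\<alpha> n)" "LL (\<alpha> n)" by (rule adm_ctrl[OF \<alpha>(1)])
  have "ereal (run (\<alpha> n) (z n) (real n)) \<le> J (\<alpha> n) (z n)" by (rule rc_le_pcost) simp
  also have "\<dots> \<le> V (z n) + ereal (inverse (real (Suc n)))" by (rule \<alpha>)
  also have "\<dots> \<le> ereal w + ereal (inverse (real (Suc n)))" using z(2)[of n] w by (intro add_right_mono) simp
  finally show "run (\<alpha> n) (z n) (real n) \<le> w + inverse (real (Suc n))" by simp
 next
  show "(\<lambda>n. w + inverse (real (Suc n))) \<longlonglongrightarrow> w" by (rule LIMSEQ_inverse_real_of_nat_add)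
 qed (rule \<alpha>)
 then show False using c w by simp
qed

text \<open>The case of \<open>closure_control\<close> in which the limit control again takes values
  in K and the exceptional set is empty, so that the limit trajectory is controlled for all
  times.\<close>

lemma closure_if_convex:
 assumes conv: "\<And>x. convex {(v, \<gamma>). \<exists>a\<in>K. v = f x a \<and> l x a \<le> \<gamma>}"
  and \<alpha>: "\<And>n. \<alpha> n \<in> ctrls" and xs: "xs \<longlonglongrightarrow> x"
  and cn: "\<And>n. run (\<alpha> n) (xs n) (real n) \<le> c n" and c: "c \<longlonglongrightarrow> cl"
 shows "V x \<le> ereal cl"
proof -
 interpret cc: csys_convex K f l M B L K f l f "\<lambda>v. v" "{}"
 proof unfold_locales
  fix x a assume "a \<in> K"
  then show "\<exists>d\<in>K. f x a = f x d \<and> l x d \<le> l x a" by blast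
 next
  show "\<exists>K. \<forall>x::'x. norm x \<le> norm x * K" by (rule exI[of _ 1]) simp
  show "convex {(\<epsilon>, \<gamma>). \<exists>d\<in>K. \<epsilon> = f x d \<and> l x d \<le> \<gamma>}" for x by (rule conv)
 qed (rule K f_cont l_cont refl | erule l_nonneg)+
 obtain y d where y: "y 0 = x" and d: "d \<in> borel_measurable borel" "\<And>s. d s \<in> K"
  and sol: "\<And>t. 0 \<le> t ==> solon t (\<lambda>s z. f z (d s)) x y \<and>
    set_integrable lborel {0..t} (\<lambda>s. l (y s) (d s)) \<and> integral {0..t} (\<lambda>s. l (y s) (d s)) \<le> cl"
  using cc.closure_control[where \<alpha> = \<alpha> and xs = xs and c = c, OF \<alpha> xs cn c] by auto
 have dc: "d \<in> ctrls" unfolding ctrls_def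
  by (intro measurable_restrict_space1 measurable_restrict_space2) (use d in auto)
 interpret adm M B L "FF d" "LL d" by (rule adm_ctrl[OF dc])
 have tr: "traj d x t = y t" if "0 \<le> t" for t
  using sol[OF that] by (intro flow_eqI[OF F lg _ that order_refl]) (simp add: FF_def)
 have "run d x t \<le> cl" if "0 \<le> t" for t
 proof -
  have "run d x t = integral {0..t} (\<lambda>s. l (y s) (d s))"
   unfolding rc_def LL_def by (rule HK_integral_cong) (simp add: tr)
  then show ?thesis using sol[OF that] by simp
 qed
 then have "J d x \<le> ereal cl" by (simp add: pcost_le_iff)
 then show ?thesis using V_le_J[OF dc, of x] by (rule order_trans[rotated])
qed

end

lemma lsc_if_continuous_on_Dom:
 fixes V :: "'x::metric_space \<Rightarrow> ereal"
 assumes o: "open (Dom V)" and c: "continuous_on (Dom V) V"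
  and fr: "\<And>x. x \<in> frontier (Dom V) ==> (V \<longlongrightarrow> \<infinity>) (at x)" and lt: "b < V x"
 shows "\<forall>\<^sub>F z in nhds x. b < V z"
proof (cases "x \<in> Dom V")
 case True
 then have "isCont V x" using c o by (simp add: continuous_on_eq_continuous_at)
 then have "\<forall>\<^sub>F z in at x. b < V z" unfolding isCont_def by (rule order_tendstoD) (rule lt)
 then show ?thesis using lt by (simp add: eventually_nhds_conv_at)
next
 case False
 show ?thesis
 proof (cases "x \<in> frontier (Dom V)")
  case True
  have "\<forall>\<^sub>F z in at x. b < V z"
   by (rule order_tendstoD(1)[OF fr[OF True]]) (use lt in \<open>cases b; simp\<close>)
  then show ?thesis using lt by (simp add: eventually_nhds_conv_at)
 next
  case nf: False
  then have "x \<in> - closure (Dom V)" using False o by (auto simp: frontier_def interior_open)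
  then have "\<forall>\<^sub>F z in nhds x. z \<in> - closure (Dom V)" by (intro eventually_nhds_in_open) auto
  then show ?thesis
  proof eventually_elim
   case (elim z)
   then have "z \<notin> Dom V" using closure_subset by blast
   then have "V z = \<infinity>" by (simp add: Dom_def)
   then show ?case using lt by (cases b) auto
  qed
 qed
qed

locale csys_vec_target = csys_vec K f l M B L + csys_target K f l M B L T
 for K :: "(real^'m) set" and f :: "'x::euclidean_space \<Rightarrow> real^'m \<Rightarrow> 'x" and l :: "'x \<Rightarrow> real^'m \<Rightarrow> real"
  and M :: real and B L :: "real \<Rightarrow> real" and T
begin

abbreviation "unique_solution \<equiv>
 V = Vrel \<and> V = Sig \<and> (V, Dom V) \<in> target_solution_pairs Ham T \<and>
 (\<forall>u \<Omega>. (u, \<Omega>) \<in> target_solution_pairs Ham T \<longrightarrow> \<Omega> = Dom V \<and> u = V) \<and> continuous_on UNIV V"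

text \<open>The chain V \<le> Sig \<le> Vrel \<le> V identifies the three functions.\<close>

lemma unique_solution_if_lsc:
 assumes lsc: "\<And>x c. c < V x ==> \<forall>\<^sub>F z in nhds x. c < V z" and VS: "\<And>x. V x \<le> Sig x"
 shows unique_solution
proof (intro conjI allI impI)
 show "V = Vrel" "V = Sig"
  using VS Sig_le_V Sig_le_Vrel Vrel_le_V by (auto intro!: ext order_antisym intro: order_trans)
 show "(V, Dom V) \<in> target_solution_pairs Ham T" by (rule V_target_pair[OF lsc])
 show "\<Omega> = Dom V" "u = V" if "(u, \<Omega>) \<in> target_solution_pairs Ham T" for u \<Omega>
  using V_unique[OF VS that] by blast+
 show "continuous_on UNIV V" by (rule V_continuous[OF lsc])
qed

lemma unique_solution_if_continuous:
 assumes "continuous_on (Dom V) V" "\<And>x. x \<in> frontier (Dom V) ==> (V \<longlongrightarrow> \<infinity>) (at x)"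
 shows unique_solution
proof -
 have lsc: "\<forall>\<^sub>F z in nhds x. c < V z" if "c < V x" for x c
  using lsc_if_continuous_on_Dom[OF open_Dom_V assms that] .
 have VS: "V x \<le> Sig x" for x by (rule V_le_Sig_if_lsc) (rule lsc)
 from unique_solution_if_lsc[OF lsc VS] show ?thesis .
qed

lemma unique_solution_if_closure:
 assumes key: "\<And>x \<alpha> xs c cl. (\<And>n. \<alpha> n \<in> ctrls) ==> xs \<longlonglongrightarrow> x ==>
   (\<And>n. run (\<alpha> n) (xs n) (real n) \<le> c n) ==> c \<longlonglongrightarrow> cl ==> V x \<le> ereal cl"
 shows unique_solution
proof -
 have lsc: "\<forall>\<^sub>F z in nhds x. c < V z" if "c < V x" for x c
  by (rule V_lsc_if_closure[OF _ that]) (rule key)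
 have VS: "V x \<le> Sig x" for x by (rule V_le_Sig_if_closure) (rule key)
 from unique_solution_if_lsc[OF lsc VS] show ?thesis .
qed

end

section \<open>Time change\<close>

text \<open>The speed \<rho> may vanish, even on intervals, since controls in the box of the
  extended problem may be 0. The infinite total integral makes the new time run through the whole
  half line.\<close>

locale time_change =
 fixes \<rho> :: "real \<Rightarrow> real"
 assumes \<rho>_measurable: "\<rho> \<in> borel_measurable borel" and \<rho>_nonneg: "0 \<le> \<rho> t"
  and \<rho>_integrable: "set_integrable lborel {0..t} \<rho>"
  and \<rho>_infinite: "\<exists>t\<ge>0. s \<le> integral {0..t} \<rho>"
begin

definition \<Theta> :: "real \<Rightarrow> real" where "\<Theta> t = integral {0..t} \<rho>"

lemma \<rho>_integrable_on: "\<rho> integrable_on {a..b}" if "0 \<le> a"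
 by (rule integrable_on_subinterval[OF set_integrable_imp_HK(1)[OF \<rho>_integrable[of b]]]) (use that in auto)

lemma \<Theta>_nonpos: "t \<le> 0 ==> \<Theta> t = 0" by (cases "t = 0") (auto simp: \<Theta>_def)

lemma \<Theta>_0 [simp]: "\<Theta> 0 = 0" by (simp add: \<Theta>_nonpos)

lemma \<Theta>_diff: "0 \<le> s ==> s \<le> t ==> \<Theta> t - \<Theta> s = integral {s..t} \<rho>"
 using Henstock_Kurzweil_Integration.integral_combine[of 0 s t \<rho>] \<rho>_integrable_on[of 0 t]
 by (simp add: \<Theta>_def algebra_simps)

lemma \<Theta>_nonneg: "0 \<le> \<Theta> t"
 unfolding \<Theta>_def by (rule integral_nonneg[OF \<rho>_integrable_on]) (auto intro: \<rho>_nonneg)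

lemma \<Theta>_mono: "s \<le> t ==> \<Theta> s \<le> \<Theta> t"
proof (cases "0 \<le> s")
 case True
 moreover assume "s \<le> t"
 ultimately show ?thesis
  using \<Theta>_diff[of s t] integral_nonneg[OF \<rho>_integrable_on[of s t]] \<rho>_nonneg by force
next
 case False
 then show ?thesis using \<Theta>_nonpos[of s] \<Theta>_nonneg[of t] by simp
qed

lemma \<Theta>_continuous: "continuous_on S \<Theta>"
proof -
 have "continuous_on {0..} \<Theta>" by (rule continuous_on_atLeast)
    (simp add: \<Theta>_def[abs_def] indefinite_integral_continuous_1 \<rho>_integrable_on)
 then have "continuous_on UNIV (\<lambda>t. \<Theta> (max 0 t))"
  by (rule continuous_on_compose2) (auto intro!: continuous_intros)
 moreover have "\<Theta> (max 0 t) = \<Theta> t" for t by (cases "0 \<le> t") (auto simp: \<Theta>_nonpos max_def)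
 ultimately show ?thesis using continuous_on_subset by fastforce
qed

lemma \<Theta>_measurable [measurable]: "\<Theta> \<in> borel_measurable borel"
 by (rule borel_measurable_continuous_onI[OF \<Theta>_continuous])

lemma \<Theta>_unbounded: "\<exists>t\<ge>0. s \<le> \<Theta> t" using \<rho>_infinite unfolding \<Theta>_def .

lemma nn_integral_\<rho>: "0 \<le> b ==> (\<integral>\<^sup>+ s. ennreal (indicator {0..b} s *\<^sub>R \<rho> s) \<partial>lborel) = ennreal (\<Theta> b)"
 using \<rho>_integrable[of b] \<rho>_nonneg set_integrable_imp_HK(2)[OF \<rho>_integrable[of b]]
 unfolding set_integrable_def
 by (subst nn_integral_eq_integral) (auto simp: \<Theta>_def set_lebesgue_integral_def)

lemma sublevel:
 assumes "0 \<le> S" "0 \<le> a"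
 obtains b where "0 \<le> b" "b \<le> S" "{t \<in> {0..S}. \<Theta> t \<le> a} = {0..b}" "\<Theta> b = min a (\<Theta> S)"
proof -
 have "compact ({0..S} \<inter> {t. \<Theta> t \<le> a})"
  by (intro compact_Int_closed closed_Collect_le \<Theta>_continuous continuous_on_const) simp
 moreover have "0 \<in> {0..S} \<inter> {t. \<Theta> t \<le> a}" using assms by simp
 ultimately obtain b where b: "b \<in> {0..S} \<inter> {t. \<Theta> t \<le> a}" "\<And>t. t \<in> {0..S} \<inter> {t. \<Theta> t \<le> a} ==> t \<le> b"
  using compact_attains_sup[of "{0..S} \<inter> {t. \<Theta> t \<le> a}"] by (metis empty_iff)
 have eq: "{t \<in> {0..S}. \<Theta> t \<le> a} = {0..b}"
 proof (intro set_eqI iffI)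
  fix t assume "t \<in> {0..b}"
  then show "t \<in> {t \<in> {0..S}. \<Theta> t \<le> a}" using b(1) \<Theta>_mono[of t b] by auto
 next
  fix t assume "t \<in> {t \<in> {0..S}. \<Theta> t \<le> a}"
  then show "t \<in> {0..b}" using b(2)[of t] by auto
 qed
 have "\<Theta> b = min a (\<Theta> S)"
 proof (rule antisym)
  show "\<Theta> b \<le> min a (\<Theta> S)" using b \<Theta>_mono[of b S] by auto
  show "min a (\<Theta> S) \<le> \<Theta> b"
  proof (cases "a \<le> \<Theta> S")
   case True
   then obtain t where "0 \<le> t" "t \<le> S" "\<Theta> t = a" using IVT'[of \<Theta> 0 a S] assms \<Theta>_continuous by auto
   then have "t \<le> b" using b(2)[of t] by simp
   from \<Theta>_mono[OF this] show ?thesis using \<open>\<Theta> t = a\<close> by simp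
  next
   case False
   then have "S \<le> b" using b(2)[of S] assms by simp
   from \<Theta>_mono[OF this] show ?thesis by simp
  qed
 qed
 then show ?thesis using that[of b] b eq by auto
qed

text \<open>The substitution rule as an identity of measures: \<Theta> carries \<rho>(s) ds on [0,S]
  to Lebesgue measure on [0, \<Theta>(S)]. Both sides are finite and have the same distribution
  function, computed from the sublevel sets of \<Theta>, so neither derivatives nor injectivity of
  \<Theta> enter.\<close>

lemma pushforward:
 assumes S: "0 \<le> S"
 shows "distr (density lborel (\<lambda>s. ennreal (indicator {0..S} s *\<^sub>R \<rho> s))) borel \<Theta>
  = density lborel (\<lambda>s. ennreal (indicator {0..\<Theta> S} s))" (is "?M = ?N")
proof (rule cdf_unique')
 let ?D = "density lborel (\<lambda>s. ennreal (indicator {0..S} s *\<^sub>R \<rho> s))"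
 have \<rho>m: "(\<lambda>s. ennreal (indicator {0..S} s *\<^sub>R \<rho> s)) \<in> borel_measurable lborel"
  using \<rho>_measurable by simp
 have M: "emeasure ?M {..a} = ennreal (if a < 0 then 0 else min a (\<Theta> S))" for a
 proof -
  have "emeasure ?M {..a} = emeasure ?D (\<Theta> -` {..a})" by (subst emeasure_distr) auto
  also have "\<dots> = (\<integral>\<^sup>+ s. ennreal (indicator {0..S} s *\<^sub>R \<rho> s) * indicator (\<Theta> -` {..a}) s \<partial>lborel)"
   using measurable_sets[OF \<Theta>_measurable, of "{..a}"] by (subst emeasure_density[OF \<rho>m]) auto
  also have "\<dots> = ennreal (if a < 0 then 0 else min a (\<Theta> S))"
  proof (cases "a < 0")
   case True
   have "(\<Theta> s \<le> a) = False" for s using True \<Theta>_nonneg[of s] by (simp add: not_le)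
   then show ?thesis using True by (simp add: indicator_def)
  next
   case False
   then obtain b where b: "0 \<le> b" "b \<le> S" "{t \<in> {0..S}. \<Theta> t \<le> a} = {0..b}" "\<Theta> b = min a (\<Theta> S)"
    using sublevel[OF S, of a] by auto
   have "ennreal (indicator {0..S} s *\<^sub>R \<rho> s) * indicator (\<Theta> -` {..a}) s = ennreal (indicator {0..b} s *\<^sub>R \<rho> s)" for s
    using b(3) by (auto split: split_indicator simp: set_eq_iff)
   then show ?thesis using nn_integral_\<rho>[OF b(1)] b(4) False by simp
  qed
  finally show ?thesis .
 qed
 have N: "emeasure ?N {..a} = ennreal (if a < 0 then 0 else min a (\<Theta> S))" for a
 proof -
  have "emeasure ?N {..a} = (\<integral>\<^sup>+ s. ennreal (indicator {0..\<Theta> S} s) * indicator {..a} s \<partial>lborel)"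
   by (subst emeasure_density) auto
  also have "\<dots> = (\<integral>\<^sup>+ s. indicator {0..min a (\<Theta> S)} s \<partial>lborel)"
   by (intro nn_integral_cong) (auto split: split_indicator)
  also have "\<dots> = ennreal (if a < 0 then 0 else min a (\<Theta> S))"
   using \<Theta>_nonneg[of S] by (auto simp: min_def)
  finally show ?thesis .
 qed
 have MS: "emeasure ?M UNIV = ennreal (\<Theta> S)"
 proof -
  have "emeasure ?M UNIV = emeasure ?D UNIV" by (subst emeasure_distr) auto
  also have "\<dots> = (\<integral>\<^sup>+ s. ennreal (indicator {0..S} s *\<^sub>R \<rho> s) \<partial>lborel)"
   by (subst emeasure_density[OF \<rho>m]) auto
  also have "\<dots> = ennreal (\<Theta> S)" by (rule nn_integral_\<rho>[OF S])
  finally show ?thesis .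
 qed
 have NS: "emeasure ?N UNIV = ennreal (\<Theta> S)"
 proof -
  have "emeasure ?N UNIV = (\<integral>\<^sup>+ s. ennreal (indicator {0..\<Theta> S} s) * indicator UNIV s \<partial>lborel)"
   by (subst emeasure_density) auto
  also have "\<dots> = (\<integral>\<^sup>+ s. indicator {0..\<Theta> S} s \<partial>lborel)"
   by (intro nn_integral_cong) (auto split: split_indicator)
  finally have "emeasure ?N UNIV = (\<integral>\<^sup>+ s. indicator {0..\<Theta> S} s \<partial>lborel)" .
  then show ?thesis using \<Theta>_nonneg[of S] by simp
 qed
 have "space ?M = UNIV" by simp
 then have "emeasure ?M (space ?M) \<noteq> \<infinity>" by (simp only: MS) simp
 then show "finite_borel_measure ?M"
  by (intro finite_borel_measure.intro finite_measureI finite_borel_measure_axioms.intro) simp_all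
 have "space ?N = UNIV" by simp
 then have "emeasure ?N (space ?N) \<noteq> \<infinity>" by (simp only: NS) simp
 then show "finite_borel_measure ?N"
  by (intro finite_borel_measure.intro finite_measureI finite_borel_measure_axioms.intro) simp_all
 show "cdf ?M = cdf ?N" by (rule ext) (simp only: cdf_def measure_def M N)
qed

lemma integral_change:
 fixes \<phi> :: "real \<Rightarrow> 'x::euclidean_space"
 assumes S: "0 \<le> S" and \<phi>: "\<phi> \<in> borel_measurable borel"
 shows "set_integrable lborel {0..\<Theta> S} \<phi> \<longleftrightarrow> set_integrable lborel {0..S} (\<lambda>r. \<rho> r *\<^sub>R \<phi> (\<Theta> r))"
  and "(LINT s:{0..\<Theta> S}|lborel. \<phi> s) = (LINT r:{0..S}|lborel. \<rho> r *\<^sub>R \<phi> (\<Theta> r))"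
proof -
 let ?D = "density lborel (\<lambda>s. ennreal (indicator {0..S} s *\<^sub>R \<rho> s))"
 have g: "AE s in lborel. 0 \<le> indicator {0..S} s *\<^sub>R \<rho> s" using \<rho>_nonneg by auto
 have gm: "(\<lambda>s. indicator {0..S} s *\<^sub>R \<rho> s) \<in> borel_measurable lborel" using \<rho>_measurable by simp
 have \<phi>\<Theta>: "(\<lambda>r. \<phi> (\<Theta> r)) \<in> borel_measurable borel" using \<phi> by measurable
 have "set_integrable lborel {0..\<Theta> S} \<phi> \<longleftrightarrow> integrable (density lborel (\<lambda>s. ennreal (indicator {0..\<Theta> S} s))) \<phi>"
  unfolding set_integrable_def using \<phi> by (subst integrable_density) auto
 also have "\<dots> \<longleftrightarrow> integrable ?D (\<lambda>r. \<phi> (\<Theta> r))"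
  unfolding pushforward[OF S, symmetric] using \<phi> by (subst integrable_distr_eq) auto
 also have "\<dots> \<longleftrightarrow> set_integrable lborel {0..S} (\<lambda>r. \<rho> r *\<^sub>R \<phi> (\<Theta> r))"
  unfolding set_integrable_def using \<phi>\<Theta> by (subst integrable_density[OF _ gm g]) auto
 finally show "set_integrable lborel {0..\<Theta> S} \<phi> \<longleftrightarrow> set_integrable lborel {0..S} (\<lambda>r. \<rho> r *\<^sub>R \<phi> (\<Theta> r))" .
 have "(LINT s:{0..\<Theta> S}|lborel. \<phi> s) = (LINT s|density lborel (\<lambda>s. ennreal (indicator {0..\<Theta> S} s)). \<phi> s)"
  unfolding set_lebesgue_integral_def using \<phi> by (subst integral_density) auto
 also have "\<dots> = (LINT r|?D. \<phi> (\<Theta> r))"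
  unfolding pushforward[OF S, symmetric] using \<phi> by (subst integral_distr) auto
 also have "\<dots> = (LINT r:{0..S}|lborel. \<rho> r *\<^sub>R \<phi> (\<Theta> r))"
  unfolding set_lebesgue_integral_def using \<phi>\<Theta> by (subst integral_density[OF _ gm g]) auto
 finally show "(LINT s:{0..\<Theta> S}|lborel. \<phi> s) = (LINT r:{0..S}|lborel. \<rho> r *\<^sub>R \<phi> (\<Theta> r))" .
qed

text \<open>The leftmost preimage, as \<Theta> may be flat. It is a right inverse of \<Theta> on
  nonnegative times, and it is monotone, hence Borel.\<close>

definition \<tau> :: "real \<Rightarrow> real" where "\<tau> s = Inf {t. 0 \<le> t \<and> s \<le> \<Theta> t}"

lemma \<tau>_attained: "0 \<le> \<tau> s \<and> s \<le> \<Theta> (\<tau> s)" and \<tau>_least: "0 \<le> t ==> s \<le> \<Theta> t ==> \<tau> s \<le> t"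
proof -
 have ne: "{t. 0 \<le> t \<and> s \<le> \<Theta> t} \<noteq> {}" using \<Theta>_unbounded[of s] by auto
 have bb: "bdd_below {t. 0 \<le> t \<and> s \<le> \<Theta> t}" by (rule bdd_belowI[of _ 0]) auto
 have "closed ({0..} \<inter> {t. s \<le> \<Theta> t})"
  by (intro closed_Int closed_Collect_le \<Theta>_continuous continuous_on_const) simp
 moreover have "{0..} \<inter> {t. s \<le> \<Theta> t} = {t. 0 \<le> t \<and> s \<le> \<Theta> t}" by auto
 ultimately have "Inf {t. 0 \<le> t \<and> s \<le> \<Theta> t} \<in> {t. 0 \<le> t \<and> s \<le> \<Theta> t}"
  using closed_contains_Inf[OF ne bb] by simp
 then show "0 \<le> \<tau> s \<and> s \<le> \<Theta> (\<tau> s)" by (simp add: \<tau>_def)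
 show "0 \<le> t ==> s \<le> \<Theta> t ==> \<tau> s \<le> t" unfolding \<tau>_def by (rule cInf_lower[OF _ bb]) simp
qed

lemma \<tau>_nonneg: "0 \<le> \<tau> s" using \<tau>_attained by blast

lemma \<Theta>_\<tau>: "0 \<le> s ==> \<Theta> (\<tau> s) = s"
proof -
 assume s: "0 \<le> s"
 obtain t where t: "0 \<le> t" "t \<le> \<tau> s" "\<Theta> t = s"
  using IVT'[of \<Theta> 0 s "\<tau> s"] s \<tau>_attained[of s] \<Theta>_continuous by auto
 then have "\<tau> s = t" using \<tau>_least[of t s] by simp
 then show ?thesis using t by simp
qed

lemma \<tau>_\<Theta>_le: "0 \<le> t ==> \<tau> (\<Theta> t) \<le> t" by (rule \<tau>_least) auto

lemma \<tau>_mono: "s \<le> s' ==> \<tau> s \<le> \<tau> s'" using \<tau>_least[of "\<tau> s'" s] \<tau>_attained[of s'] by simp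

lemma \<tau>_measurable [measurable]: "\<tau> \<in> borel_measurable borel"
 by (rule borel_measurable_mono) (simp add: mono_def \<tau>_mono)

text \<open>Where \<open>\<tau> \<circ> \<Theta>\<close> is not the identity, \<open>\<Theta>\<close> is constant on an interval, and there
  \<open>\<rho>\<close> vanishes almost everywhere.\<close>

lemma \<tau>_\<Theta>_AE: "AE t in lborel. 0 \<le> t \<longrightarrow> \<tau> (\<Theta> t) = t \<or> \<rho> t = 0"
proof -
 have flat: "AE t in lborel. real_of_rat r \<le> t \<longrightarrow> \<Theta> t = \<Theta> (real_of_rat r) \<longrightarrow> \<rho> t = 0" if r: "0 \<le> real_of_rat r" for r
 proof -
  let ?r = "real_of_rat r"
  obtain T where T: "0 \<le> T" "\<Theta> ?r + 1 \<le> \<Theta> T" using \<Theta>_unbounded by blast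
  have "?r \<le> T" using \<Theta>_mono[of T ?r] T by linarith
  have T0: "0 \<le> \<Theta> ?r" by (rule \<Theta>_nonneg)
  obtain b where b: "0 \<le> b" "b \<le> T" "{t \<in> {0..T}. \<Theta> t \<le> \<Theta> ?r} = {0..b}" "\<Theta> b = min (\<Theta> ?r) (\<Theta> T)"
   using sublevel[OF T(1) T0] by metis
  have \<Theta>b: "\<Theta> b = \<Theta> ?r" using b(4) T by simp
  have "?r \<in> {t \<in> {0..T}. \<Theta> t \<le> \<Theta> ?r}" using r \<open>?r \<le> T\<close> by simp
  then have "?r \<in> {0..b}" unfolding b(3) .
  then have rb: "?r \<le> b" by simp
  have si: "set_integrable lborel {?r..b} \<rho>" by (rule set_integrable_subset[OF \<rho>_integrable[of b]]) (use r in auto)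
  have "(LINT t:{?r..b}|lborel. \<rho> t) = 0"
   using set_integrable_imp_HK(2)[OF si] \<Theta>_diff[OF r rb] \<Theta>b by simp
  then have "AE t in lborel. indicator {?r..b} t *\<^sub>R \<rho> t = 0" unfolding set_lebesgue_integral_def
   using integral_nonneg_eq_0_iff_AE[OF si[unfolded set_integrable_def]] \<rho>_nonneg by auto
  then show ?thesis
  proof eventually_elim
   case (elim t)
   show ?case
   proof (intro impI)
    assume t: "?r \<le> t" "\<Theta> t = \<Theta> ?r"
    have "t \<le> T" using \<Theta>_mono[of T t] t T by linarith
    moreover have "0 \<le> t" using t(1) r by (rule order_trans[rotated])
    ultimately have "t \<in> {t \<in> {0..T}. \<Theta> t \<le> \<Theta> ?r}" using t by simp
    then have "t \<in> {0..b}" unfolding b(3) .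
    then have "t \<in> {?r..b}" using t by simp
    then show "\<rho> t = 0" using elim by simp
   qed
  qed
 qed
 \<comment> \<open>Rational points detect all flat intervals: if \<open>\<tau> (\<Theta> t)\<close>
   is less than t, a rational lies between them and \<Theta> takes the same value there. So
   countably many null sets suffice.\<close>
 have "AE t in lborel. \<forall>r. 0 \<le> real_of_rat r \<longrightarrow> real_of_rat r \<le> t \<longrightarrow> \<Theta> t = \<Theta> (real_of_rat r) \<longrightarrow> \<rho> t = 0"
  unfolding AE_all_countable
 proof
  fix r show "AE t in lborel. 0 \<le> real_of_rat r \<longrightarrow> real_of_rat r \<le> t \<longrightarrow> \<Theta> t = \<Theta> (real_of_rat r) \<longrightarrow> \<rho> t = 0"
   by (cases "0 \<le> real_of_rat r") (use flat in auto)
 qed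
 then show ?thesis
 proof eventually_elim
  case (elim t)
  show ?case
  proof (intro impI disjCI)
   assume t: "0 \<le> t" and n: "\<rho> t \<noteq> 0"
   show "\<tau> (\<Theta> t) = t"
   proof (rule ccontr)
    assume "\<tau> (\<Theta> t) \<noteq> t"
    then have "\<tau> (\<Theta> t) < t" using \<tau>_\<Theta>_le[OF t] by simp
    then obtain r where r: "\<tau> (\<Theta> t) < real_of_rat r" "real_of_rat r < t" using of_rat_dense by blast
    have "\<Theta> (real_of_rat r) = \<Theta> t"
     using \<Theta>_mono[of "\<tau> (\<Theta> t)" "real_of_rat r"] \<Theta>_mono[of "real_of_rat r" t] r \<Theta>_\<tau>[OF \<Theta>_nonneg, of t] by simp
    moreover have "0 \<le> real_of_rat r" using r \<tau>_nonneg[of "\<Theta> t"] by linarith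
    ultimately show False using elim r n by force
   qed
  qed
 qed
qed

text \<open>Substitution s = \<Theta>(r) in the integral equation of \<eta>. The relation between
  the fields is needed almost everywhere only, which allows for the flat parts of \<Theta>.\<close>

lemma solon_forward:
 assumes \<eta>: "solon (\<Theta> t) F2 x \<eta>" and t: "0 \<le> t"
  and F1m: "set_borel_measurable borel {0..t} (\<lambda>r. F1 r (\<eta> (\<Theta> r)))"
  and eq: "AE r in lborel. 0 \<le> r \<longrightarrow> r \<le> t \<longrightarrow> F1 r (\<eta> (\<Theta> r)) = \<rho> r *\<^sub>R F2 (\<Theta> r) (\<eta> (\<Theta> r))"
 shows "solon t F1 x (\<lambda>r. \<eta> (\<Theta> r))" unfolding solon_def
proof (intro ballI)
 fix u assume u: "u \<in> {0..t}"
 \<comment> \<open>Cut off outside the interval to obtain a function that is Borel on the whole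
   line, as \<open>integral_change\<close> requires.\<close>
 define \<phi> where "\<phi> s = indicator {0..\<Theta> t} s *\<^sub>R F2 s (\<eta> s)" for s
 have i0: "set_integrable lborel {0..\<Theta> t} (\<lambda>s. F2 s (\<eta> s))"
  using solonD(1)[OF \<eta> \<Theta>_nonneg order_refl] .
 then have \<phi>m: "\<phi> \<in> borel_measurable borel"
  unfolding \<phi>_def set_integrable_def using borel_measurable_integrable by fastforce
 have le: "\<Theta> u \<le> \<Theta> t" using u by (intro \<Theta>_mono) simp
 have i1: "set_integrable lborel {0..\<Theta> u} (\<lambda>s. F2 s (\<eta> s))"
  by (rule set_integrable_subset[OF i0]) (use le in auto)
 have e1: "set_integrable lborel {0..\<Theta> u} \<phi> = set_integrable lborel {0..\<Theta> u} (\<lambda>s. F2 s (\<eta> s))"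
  by (rule set_integrable_cong) (use le in \<open>auto simp: \<phi>_def\<close>)
 have e2: "(LINT s:{0..\<Theta> u}|lborel. \<phi> s) = (LINT s:{0..\<Theta> u}|lborel. F2 s (\<eta> s))"
  by (rule set_lebesgue_integral_cong) (use le in \<open>auto simp: \<phi>_def\<close>)
 have u0: "0 \<le> u" using u by simp
 have j: "set_integrable lborel {0..u} (\<lambda>r. \<rho> r *\<^sub>R \<phi> (\<Theta> r))"
  using integral_change(1)[OF u0 \<phi>m] e1 i1 by simp
 have ae: "AE r in lborel. indicator {0..u} r *\<^sub>R (\<rho> r *\<^sub>R \<phi> (\<Theta> r)) = indicator {0..u} r *\<^sub>R F1 r (\<eta> (\<Theta> r))"
  using eq
 proof eventually_elim
  case (elim r)
  show ?case
  proof (cases "r \<in> {0..u}")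
   case True
   then have "\<Theta> r \<in> {0..\<Theta> t}" using u \<Theta>_nonneg \<Theta>_mono by auto
   then show ?thesis using elim True u by (simp add: \<phi>_def)
  qed simp
 qed
 have m1: "(\<lambda>r. indicator {0..u} r *\<^sub>R F1 r (\<eta> (\<Theta> r))) \<in> borel_measurable lborel"
  using set_borel_measurable_sub[OF F1m, of "{0..u}"] u by (simp add: set_borel_measurable_def)
 have k: "set_integrable lborel {0..u} (\<lambda>r. F1 r (\<eta> (\<Theta> r)))"
  unfolding set_integrable_def by (rule integrable_cong_AE_imp[OF j[unfolded set_integrable_def] m1 ae])
 have "(LINT r:{0..u}|lborel. \<rho> r *\<^sub>R \<phi> (\<Theta> r)) = (LINT r:{0..u}|lborel. F1 r (\<eta> (\<Theta> r)))"
  unfolding set_lebesgue_integral_def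
  by (rule integral_cong_AE[OF borel_measurable_integrable[OF j[unfolded set_integrable_def]] m1 ae])
 then have "integral {0..\<Theta> u} (\<lambda>s. F2 s (\<eta> s)) = integral {0..u} (\<lambda>r. F1 r (\<eta> (\<Theta> r)))"
  using integral_change(2)[OF u0 \<phi>m] e2 set_integrable_imp_HK(2)[OF i1] set_integrable_imp_HK(2)[OF k] by simp
 then show "set_integrable lborel {0..u} (\<lambda>r. F1 r (\<eta> (\<Theta> r))) \<and>
   \<eta> (\<Theta> u) = x + integral {0..u} (\<lambda>r. F1 r (\<eta> (\<Theta> r)))" using k solonD(2)[OF \<eta> \<Theta>_nonneg le] by simp
qed

text \<open>At almost every r either \<tau>(\<Theta>(r)) = r, and the two fields correspond, or
  \<rho>(r) = 0, and then both sides vanish (\<open>\<tau>_\<Theta>_AE\<close>).\<close>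

lemma solon_backward:
 assumes \<xi>: "\<And>S. solon S F1 x \<xi>"
  and F2m: "(\<lambda>s. F2 s (\<xi> (\<tau> s))) \<in> borel_measurable borel"
  and eq: "\<And>r. 0 \<le> r ==> \<tau> (\<Theta> r) = r ==> F1 r (\<xi> r) = \<rho> r *\<^sub>R F2 (\<Theta> r) (\<xi> r)"
  and eq0: "\<And>r. 0 \<le> r ==> \<rho> r = 0 ==> F1 r (\<xi> r) = 0"
 shows "solon S F2 x (\<lambda>s. \<xi> (\<tau> s))" unfolding solon_def
proof (intro ballI)
 fix s assume s: "s \<in> {0..S}"
 define u where "u = \<tau> s"
 have u: "0 \<le> u" "\<Theta> u = s" unfolding u_def using \<tau>_nonneg \<Theta>_\<tau> s by auto
 have i: "set_integrable lborel {0..u} (\<lambda>r. F1 r (\<xi> r))" using solonD(1)[OF \<xi>[of u] u(1) order_refl] .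
 have ae: "AE r in lborel. indicator {0..u} r *\<^sub>R F1 r (\<xi> r) = indicator {0..u} r *\<^sub>R (\<rho> r *\<^sub>R F2 (\<Theta> r) (\<xi> (\<tau> (\<Theta> r))))"
  using \<tau>_\<Theta>_AE by eventually_elim (auto split: split_indicator simp: eq eq0)
 have m: "(\<lambda>r. indicator {0..u} r *\<^sub>R (\<rho> r *\<^sub>R F2 (\<Theta> r) (\<xi> (\<tau> (\<Theta> r))))) \<in> borel_measurable lborel"
  using measurable_compose[OF \<Theta>_measurable F2m] \<rho>_measurable by simp
 have j: "set_integrable lborel {0..u} (\<lambda>r. \<rho> r *\<^sub>R F2 (\<Theta> r) (\<xi> (\<tau> (\<Theta> r))))"
  unfolding set_integrable_def by (rule integrable_cong_AE_imp[OF i[unfolded set_integrable_def] m ae])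
 have k: "set_integrable lborel {0..s} (\<lambda>s. F2 s (\<xi> (\<tau> s)))"
  using integral_change(1)[OF u(1) F2m] j u(2) by simp
 have "(LINT r:{0..u}|lborel. F1 r (\<xi> r)) = (LINT r:{0..u}|lborel. \<rho> r *\<^sub>R F2 (\<Theta> r) (\<xi> (\<tau> (\<Theta> r))))"
  unfolding set_lebesgue_integral_def
  by (rule integral_cong_AE[OF borel_measurable_integrable[OF i[unfolded set_integrable_def]] m ae])
 then have "integral {0..u} (\<lambda>r. F1 r (\<xi> r)) = integral {0..s} (\<lambda>s. F2 s (\<xi> (\<tau> s)))"
  using integral_change(2)[OF u(1) F2m] set_integrable_imp_HK(2)[OF i] set_integrable_imp_HK(2)[OF k] u(2) by simp
 then show "set_integrable lborel {0..s} (\<lambda>s. F2 s (\<xi> (\<tau> s))) \<and>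
   \<xi> (\<tau> s) = x + integral {0..s} (\<lambda>s. F2 s (\<xi> (\<tau> s)))"
  using k solonD(2)[OF \<xi>[of u] u(1) order_refl] by (simp add: u_def)
qed

end

section \<open>Unbounded controls\<close>

lemma ext_fun_pos: "0 < w0 ==> ext_fun q \<Phi> \<Phi>_inf x (w0, w) = w0 ^ q *\<^sub>R \<Phi> x (w /\<^sub>R w0)"
 and ext_fun_0: "ext_fun q \<Phi> \<Phi>_inf x (0, w) = \<Phi>_inf x w" by (auto simp: ext_fun_def)

text \<open>Only points with vanishing first component are delicate. There uniform convergence to
  the recession function on a compact neighbourhood takes one e/2, and continuity of the recession
  function the other.\<close>

lemma ext_fun_continuous:
 fixes \<Phi> \<Phi>_inf :: "real^'n \<Rightarrow> real^'m \<Rightarrow> 'b::real_normed_vector"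
 assumes A: "closed A" "convex_cone A"
  and c: "continuous_on (UNIV \<times> A) (\<lambda>(x, a). \<Phi> x a)" and r: "recession A q \<Phi> \<Phi>_inf"
 shows "continuous_on (UNIV \<times> ({0..} \<times> A)) (\<lambda>(x, w). ext_fun q \<Phi> \<Phi>_inf x w)"
 unfolding continuous_on_def
proof
 fix z :: "(real^'n) \<times> (real \<times> (real^'m))" assume z: "z \<in> UNIV \<times> ({0..} \<times> A)"
 let ?S = "UNIV \<times> ({0..} \<times> A) :: ((real^'n) \<times> (real \<times> (real^'m))) set"
 let ?F = "at z within ?S"
 let ?E = "\<lambda>z::(real^'n) \<times> (real \<times> (real^'m)). ext_fun q \<Phi> \<Phi>_inf (fst z) (fst (snd z), snd (snd z))"
 have scale: "t *\<^sub>R a \<in> A" if "0 \<le> t" "a \<in> A" for t a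
  using A(2) that by (simp add: convex_cone_scaleR)
 have idt: "(fst \<longlongrightarrow> fst z) ?F" "((\<lambda>z. fst (snd z)) \<longlongrightarrow> fst (snd z)) ?F" "((\<lambda>z. snd (snd z)) \<longlongrightarrow> snd (snd z)) ?F"
  by (intro tendsto_intros tendsto_ident_at)+
 have inS: "\<forall>\<^sub>F y in ?F. y \<in> ?S" by (rule eventually_at_topological[THEN iffD2]) auto
 have "(?E \<longlongrightarrow> ?E z) ?F"
 proof (cases "0 < fst (snd z)")
  case True
  have pos: "\<forall>\<^sub>F y in ?F. 0 < fst (snd y)" by (rule order_tendstoD(1)[OF idt(2) True])
  have "((\<lambda>y. (fst y, snd (snd y) /\<^sub>R fst (snd y))) \<longlongrightarrow> (fst z, snd (snd z) /\<^sub>R fst (snd z))) ?F"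
   using True by (intro tendsto_intros idt) simp
  then have "((\<lambda>y. (\<lambda>(x, a). \<Phi> x a) (fst y, snd (snd y) /\<^sub>R fst (snd y))) \<longlongrightarrow> (\<lambda>(x, a). \<Phi> x a) (fst z, snd (snd z) /\<^sub>R fst (snd z))) ?F"
  proof (rule continuous_on_tendsto_compose[OF c])
   show "(fst z, snd (snd z) /\<^sub>R fst (snd z)) \<in> UNIV \<times> A" using z scale True by auto
   show "\<forall>\<^sub>F y in ?F. (fst y, snd (snd y) /\<^sub>R fst (snd y)) \<in> UNIV \<times> A"
    using inS by eventually_elim (auto intro!: scale)
  qed
  then have "((\<lambda>y. fst (snd y) ^ q *\<^sub>R \<Phi> (fst y) (snd (snd y) /\<^sub>R fst (snd y))) \<longlongrightarrow> ?E z) ?F"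
   unfolding ext_fun_pos[OF True] prod.case by (intro tendsto_intros idt)
  then show ?thesis
   by (rule Lim_transform_eventually) (use pos in eventually_elim, simp only: ext_fun_pos)
 next
  case False
  then have z0: "fst (snd z) = 0" using z by auto
  let ?x = "fst z" and ?w = "snd (snd z)"
  have wA: "?w \<in> A" using z by auto
  define N where "N = cball ?x 1 \<times> (cball ?w 1 \<inter> A)"
  have "compact N" unfolding N_def by (intro compact_Times compact_Int_closed A) auto
  then have ul: "uniform_limit N (\<lambda>\<rho> (x, a). \<rho> ^ q *\<^sub>R \<Phi> x (a /\<^sub>R \<rho>)) (\<lambda>(x, a). \<Phi>_inf x a) (at_right 0)"
   and ci: "continuous_on (UNIV \<times> A) (\<lambda>(x, a). \<Phi>_inf x a)"
   using r unfolding recession_def N_def by auto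
  have "\<forall>\<^sub>F y in ?F. snd (snd y) \<in> A" using inS by eventually_elim auto
  then have lim: "((\<lambda>y. \<Phi>_inf (fst y) (snd (snd y))) \<longlongrightarrow> \<Phi>_inf ?x ?w) ?F"
   using continuous_on_tendsto_compose[OF ci tendsto_Pair[OF idt(1) idt(3)]] wA by simp
  show ?thesis unfolding tendsto_iff
  proof (intro allI impI)
   fix e :: real assume e: "0 < e"
   then have "\<forall>\<^sub>F \<rho> in at_right 0. \<forall>k\<in>N. dist ((\<lambda>(x, a). \<rho> ^ q *\<^sub>R \<Phi> x (a /\<^sub>R \<rho>)) k) ((\<lambda>(x, a). \<Phi>_inf x a) k) < e / 2"
    using uniform_limitD[OF ul half_gt_zero] by blast
   then obtain b :: real where b: "0 < b" "\<And>\<rho> k. 0 < \<rho> ==> \<rho> < b ==> k \<in> N ==>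
     dist ((\<lambda>(x, a). \<rho> ^ q *\<^sub>R \<Phi> x (a /\<^sub>R \<rho>)) k) ((\<lambda>(x, a). \<Phi>_inf x a) k) < e / 2"
    unfolding eventually_at_right_field by blast
   have 1: "\<forall>\<^sub>F y in ?F. fst (snd y) < b" by (rule order_tendstoD(2)[OF idt(2)]) (use z0 b in simp)
   have 2: "\<forall>\<^sub>F y in ?F. dist (fst y) ?x < 1" "\<forall>\<^sub>F y in ?F. dist (snd (snd y)) ?w < 1"
    "\<forall>\<^sub>F y in ?F. dist (\<Phi>_inf (fst y) (snd (snd y))) (\<Phi>_inf ?x ?w) < e / 2"
    by (rule tendstoD[OF idt(1) zero_less_one] tendstoD[OF idt(3) zero_less_one] tendstoD[OF lim half_gt_zero[OF e]])+
   show "\<forall>\<^sub>F y in ?F. dist (?E y) (?E z) < e" using inS 1 2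
   proof eventually_elim
    case (elim y)
    have yN: "(fst y, snd (snd y)) \<in> N" using elim by (auto simp: N_def dist_commute)
    show ?case
    proof (cases "fst (snd y) = 0")
     case True
     then show ?thesis using elim(5) e unfolding z0 True ext_fun_0 by linarith
    next
     case False
     then have "0 < fst (snd y)" using elim(1) by auto
     then have "dist (?E y) (\<Phi>_inf (fst y) (snd (snd y))) < e / 2"
      using b(2)[OF _ elim(2) yN] by (simp only: ext_fun_pos prod.case)
     then have "dist (?E y) (\<Phi>_inf ?x ?w) < e"
      using elim(5) dist_triangle[of "?E y" "\<Phi>_inf ?x ?w" "\<Phi>_inf (fst y) (snd (snd y))"] by linarith
     then show ?thesis by (simp only: z0 ext_fun_0)
    qed
   qed
  qed
 qed
 then show "((\<lambda>(x, w). ext_fun q \<Phi> \<Phi>_inf x w) \<longlongrightarrow> (case z of (x, w) \<Rightarrow> ext_fun q \<Phi> \<Phi>_inf x w)) ?F"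
  by (simp add: case_prod_unfold)
qed

text \<open>Closed conditions on \<open>ext_fun\<close> need only be checked for a positive first component.\<close>

lemma ext_fun_limit:
 fixes \<Phi> \<Phi>_inf :: "real^'n \<Rightarrow> real^'m \<Rightarrow> 'b::real_normed_vector"
 assumes A: "closed A" "convex_cone A"
  and c: "continuous_on (UNIV \<times> A) (\<lambda>(x, a). \<Phi> x a)" and r: "recession A q \<Phi> \<Phi>_inf"
  and w: "0 \<le> w0" "w \<in> A"
 shows "(\<lambda>n. ext_fun q \<Phi> \<Phi>_inf x (w0 + inverse (real (Suc n)), w)) \<longlonglongrightarrow> ext_fun q \<Phi> \<Phi>_inf x (w0, w)"
proof -
 have "(\<lambda>n. (x, (w0 + inverse (real (Suc n)), w))) \<longlonglongrightarrow> (x, (w0, w))"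
  by (intro tendsto_Pair tendsto_const LIMSEQ_inverse_real_of_nat_add)
 then have "(\<lambda>n. (\<lambda>(x, w). ext_fun q \<Phi> \<Phi>_inf x w) (x, (w0 + inverse (real (Suc n)), w))) \<longlonglongrightarrow>
   (\<lambda>(x, w). ext_fun q \<Phi> \<Phi>_inf x w) (x, (w0, w))"
  by (intro continuous_on_tendsto_compose[OF ext_fun_continuous[OF A c r]]) (use w in auto)
 then show ?thesis by simp
qed

text \<open>For positive first component the homogeneity of degree q is immediate from the formula;
  continuity carries it to first component 0.\<close>

lemma ext_fun_scale:
 fixes \<Phi> \<Phi>_inf :: "real^'n \<Rightarrow> real^'m \<Rightarrow> 'b::real_normed_vector"
 assumes A: "closed A" "convex_cone A"
  and c: "continuous_on (UNIV \<times> A) (\<lambda>(x, a). \<Phi> x a)" and r: "recession A q \<Phi> \<Phi>_inf"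
  and w: "0 \<le> w0" "w \<in> A" and t: "0 < t"
 shows "ext_fun q \<Phi> \<Phi>_inf x (t * w0, t *\<^sub>R w) = t ^ q *\<^sub>R ext_fun q \<Phi> \<Phi>_inf x (w0, w)"
proof -
 have tw: "t *\<^sub>R w \<in> A" using A(2) w t by (simp add: convex_cone_scaleR)
 let ?E = "\<lambda>z. (\<lambda>(x, w). ext_fun q \<Phi> \<Phi>_inf x w) (x, z)"
 have "(\<lambda>n. (x, (t * (w0 + inverse (real (Suc n))), t *\<^sub>R w))) \<longlonglongrightarrow> (x, (t * (w0 + 0), t *\<^sub>R w))"
  by (intro tendsto_intros LIMSEQ_inverse_real_of_nat)
 then have "(\<lambda>n. ?E (t * (w0 + inverse (real (Suc n))), t *\<^sub>R w)) \<longlonglongrightarrow> ?E (t * (w0 + 0), t *\<^sub>R w)"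
  by (rule continuous_on_tendsto_compose[OF ext_fun_continuous[OF A c r]]) (use w tw t in auto)
 moreover have "?E (t * (w0 + inverse (real (Suc n))), t *\<^sub>R w)
   = t ^ q *\<^sub>R ext_fun q \<Phi> \<Phi>_inf x (w0 + inverse (real (Suc n)), w)" for n
 proof -
  have p: "0 < w0 + inverse (real (Suc n))" using w(1) by (intro add_nonneg_pos) auto
  with t have p': "0 < t * (w0 + inverse (real (Suc n)))" by simp
  have "(t *\<^sub>R w) /\<^sub>R (t * u) = w /\<^sub>R u" for u using t by simp
  then show ?thesis
   unfolding prod.case ext_fun_pos[OF p] ext_fun_pos[OF p'] by (simp only: power_mult_distrib scaleR_scaleR)
 qed
 ultimately have "(\<lambda>n. t ^ q *\<^sub>R ext_fun q \<Phi> \<Phi>_inf x (w0 + inverse (real (Suc n)), w)) \<longlonglongrightarrow> ext_fun q \<Phi> \<Phi>_inf x (t * w0, t *\<^sub>R w)"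
  by simp
 then show ?thesis
  by (rule LIMSEQ_unique) (intro tendsto_scaleR tendsto_const ext_fun_limit[OF A c r w])
qed

text \<open>The structural bounds in uniform shape: the power p is replaced by q, the constants are
  defined for all radii, and the modulus of continuity of the cost is merged into
  \<open>L\<close>.\<close>

locale data_bounds =
 fixes A :: "(real^'m) set" and f :: "real^'n \<Rightarrow> real^'m \<Rightarrow> real^'n" and l :: "real^'n \<Rightarrow> real^'m \<Rightarrow> real"
  and q :: nat and M :: real and B L :: "real \<Rightarrow> real"
 assumes M_nonneg: "0 \<le> M" and L_nonneg: "0 \<le> L R"
  and growth: "a \<in> A ==> norm (f x a) \<le> M * (1 + norm a ^ q) * (1 + norm x)"
  and f_bound: "a \<in> A ==> norm x \<le> R ==> norm (f x a) \<le> B R * (1 + norm a ^ q)"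
  and l_bound: "a \<in> A ==> norm x \<le> R ==> l x a \<le> B R * (1 + norm a ^ q)"
  and f_lip: "a \<in> A ==> norm x \<le> R ==> norm y \<le> R ==>
   norm (f x a - f y a) \<le> L R * (1 + norm a ^ q) * norm (x - y)"
  and l_lip: "a \<in> A ==> norm x \<le> R ==> norm y \<le> R ==>
   \<bar>l x a - l y a\<bar> \<le> L R * (1 + norm a ^ q) * norm (x - y)"
  and cost_nonneg: "a \<in> A ==> 0 \<le> l x a"

locale cone_system = data_bounds A f l q M B L
 for A :: "(real^'m) set" and f f_inf :: "real^'n \<Rightarrow> real^'m \<Rightarrow> real^'n"
  and l l_inf :: "real^'n \<Rightarrow> real^'m \<Rightarrow> real" and q :: nat
  and M :: real and B L :: "real \<Rightarrow> real" and C1 C2 :: real +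
 assumes A: "closed A" "convex_cone A" "\<not> bounded A"
  and f_cont: "continuous_on (UNIV \<times> A) (\<lambda>(x, a). f x a)"
  and l_cont: "continuous_on (UNIV \<times> A) (\<lambda>(x, a). l x a)"
  and q: "0 < q" and C1: "0 \<le> C1" and C2: "0 < C2"
  and coercive: "a \<in> A ==> C2 * norm a ^ q - C1 \<le> l x a"
  and f_rec: "recession A q f f_inf" and l_rec: "recession A q l l_inf"
begin

abbreviation "fe \<equiv> ext_fun q f f_inf"
abbreviation "le \<equiv> ext_fun q l l_inf"

section \<open>The extended system as a compact control system\<close>

lemma A_0: "0 \<in> A" using A(2) convex_cone_contains_0 by blast

lemma A_scale: "0 \<le> t ==> a \<in> A ==> t *\<^sub>R a \<in> A" using A(2) by (simp add: convex_cone_scaleR)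

lemmas fe_cont = ext_fun_continuous[OF A(1,2) f_cont f_rec]
lemmas le_cont = ext_fun_continuous[OF A(1,2) l_cont l_rec]
lemmas fe_limit = ext_fun_limit[OF A(1,2) f_cont f_rec]
lemmas le_limit = ext_fun_limit[OF A(1,2) l_cont l_rec]
lemmas fe_scale = ext_fun_scale[OF A(1,2) f_cont f_rec]
lemmas le_scale = ext_fun_scale[OF A(1,2) l_cont l_rec]

lemma homogenize:
 assumes "0 < w0" "w \<in> A"
 shows "w /\<^sub>R w0 \<in> A" "w0 ^ q * norm (w /\<^sub>R w0) ^ q = norm w ^ q"
  "X \<le> c * (1 + norm (w /\<^sub>R w0) ^ q) ==> w0 ^ q * X \<le> c * (w0 ^ q + norm w ^ q)"
proof -
 show "w /\<^sub>R w0 \<in> A" using A_scale assms by simp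
 have "norm (w /\<^sub>R w0) = norm w / w0" using assms by (simp add: divide_inverse mult.commute)
 then show e: "w0 ^ q * norm (w /\<^sub>R w0) ^ q = norm w ^ q" using assms by (simp add: power_divide)
 assume "X \<le> c * (1 + norm (w /\<^sub>R w0) ^ q)"
 then have "w0 ^ q * X \<le> w0 ^ q * (c * (1 + norm (w /\<^sub>R w0) ^ q))" by (rule mult_left_mono) (use assms in simp)
 also have "\<dots> = c * (w0 ^ q + w0 ^ q * norm (w /\<^sub>R w0) ^ q)" by (simp only: algebra_simps mult_1_right)
 finally show "w0 ^ q * X \<le> c * (w0 ^ q + norm w ^ q)" unfolding e .
qed

text \<open>Homogeneity turns the factor 1 + |a|^q of the data into w0^q + |w|^q, which is bounded
  on the box and equals 1 on \<open>ext_set A q\<close>. The limit towards w0 = 0 preserves the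
  inequalities.\<close>

lemma ext_estimates:
 assumes w: "0 \<le> w0" "w \<in> A"
 shows fe_growth: "norm (fe x (w0, w)) \<le> M * (w0 ^ q + norm w ^ q) * (1 + norm x)"
  and fe_bound: "norm x \<le> R ==> norm (fe x (w0, w)) \<le> B R * (w0 ^ q + norm w ^ q)"
  and le_bound: "norm x \<le> R ==> le x (w0, w) \<le> B R * (w0 ^ q + norm w ^ q)"
  and fe_lip: "norm x \<le> R ==> norm y \<le> R ==>
   norm (fe x (w0, w) - fe y (w0, w)) \<le> L R * (w0 ^ q + norm w ^ q) * norm (x - y)"
  and le_lip: "norm x \<le> R ==> norm y \<le> R ==>
   \<bar>le x (w0, w) - le y (w0, w)\<bar> \<le> L R * (w0 ^ q + norm w ^ q) * norm (x - y)"
  and le_nonneg: "0 \<le> le x (w0, w)"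
  and le_coercive: "C2 * norm w ^ q - C1 * w0 ^ q \<le> le x (w0, w)"
proof -
 have pos: "norm (fe x (w0, w)) \<le> M * (1 + norm x) * (w0 ^ q + norm w ^ q)"
  "norm x \<le> R ==> norm (fe x (w0, w)) \<le> B R * (w0 ^ q + norm w ^ q)"
  "norm x \<le> R ==> le x (w0, w) \<le> B R * (w0 ^ q + norm w ^ q)"
  "norm x \<le> R ==> norm y \<le> R ==> norm (fe x (w0, w) - fe y (w0, w)) \<le> L R * norm (x - y) * (w0 ^ q + norm w ^ q)"
  "norm x \<le> R ==> norm y \<le> R ==> \<bar>le x (w0, w) - le y (w0, w)\<bar> \<le> L R * norm (x - y) * (w0 ^ q + norm w ^ q)"
  "0 \<le> le x (w0, w)" "C2 * norm w ^ q - C1 * w0 ^ q \<le> le x (w0, w)"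
  if w0: "0 < w0" for w0 x y R
 proof -
  note h = homogenize[OF w0 w(2)]
  have e: "norm (fe x (w0, w)) = w0 ^ q * norm (f x (w /\<^sub>R w0))" "le x (w0, w) = w0 ^ q * l x (w /\<^sub>R w0)"
   "norm (fe x (w0, w) - fe y (w0, w)) = w0 ^ q * norm (f x (w /\<^sub>R w0) - f y (w /\<^sub>R w0))"
   "\<bar>le x (w0, w) - le y (w0, w)\<bar> = w0 ^ q * \<bar>l x (w /\<^sub>R w0) - l y (w /\<^sub>R w0)\<bar>"
   using w0 by (simp_all add: ext_fun_pos abs_mult flip: scaleR_diff_right right_diff_distrib)
  show "norm (fe x (w0, w)) \<le> M * (1 + norm x) * (w0 ^ q + norm w ^ q)"
   unfolding e(1) by (rule h(3)) (use growth[OF h(1), of x] in \<open>simp only: ac_simps\<close>)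
  show "norm x \<le> R ==> norm (fe x (w0, w)) \<le> B R * (w0 ^ q + norm w ^ q)"
   unfolding e(1) by (rule h(3)[OF f_bound[OF h(1)]])
  show "norm x \<le> R ==> le x (w0, w) \<le> B R * (w0 ^ q + norm w ^ q)"
   unfolding e(2) by (rule h(3)[OF l_bound[OF h(1)]])
  show "norm (fe x (w0, w) - fe y (w0, w)) \<le> L R * norm (x - y) * (w0 ^ q + norm w ^ q)" if "norm x \<le> R" "norm y \<le> R"
   unfolding e(3) by (rule h(3)) (use f_lip[OF h(1) that] in \<open>simp only: ac_simps\<close>)
  show "\<bar>le x (w0, w) - le y (w0, w)\<bar> \<le> L R * norm (x - y) * (w0 ^ q + norm w ^ q)" if "norm x \<le> R" "norm y \<le> R"
   unfolding e(4) by (rule h(3)) (use l_lip[OF h(1) that] in \<open>simp only: ac_simps\<close>)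
  show "0 \<le> le x (w0, w)" using w0 cost_nonneg[OF h(1)] by (simp add: ext_fun_pos)
  have "w0 ^ q * (C2 * norm (w /\<^sub>R w0) ^ q - C1) \<le> le x (w0, w)"
   unfolding e(2) using w0 by (intro mult_left_mono coercive h(1)) simp
  moreover have "w0 ^ q * (C2 * norm (w /\<^sub>R w0) ^ q - C1) = C2 * (w0 ^ q * norm (w /\<^sub>R w0) ^ q) - C1 * w0 ^ q"
   by (simp add: algebra_simps)
  ultimately show "C2 * norm w ^ q - C1 * w0 ^ q \<le> le x (w0, w)" unfolding h(2) by (simp only:)
 qed
 define s where "s n = w0 + inverse (real (Suc n))" for n
 have sp: "0 < s n" for n unfolding s_def using w(1) by (intro add_nonneg_pos) auto
 have sl: "s \<longlonglongrightarrow> w0" unfolding s_def by (rule LIMSEQ_inverse_real_of_nat_add)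
 have fl: "(\<lambda>n. fe z (s n, w)) \<longlonglongrightarrow> fe z (w0, w)" and ll: "(\<lambda>n. le z (s n, w)) \<longlonglongrightarrow> le z (w0, w)" for z
  unfolding s_def by (rule fe_limit[OF w] le_limit[OF w])+
 have lim: "(\<lambda>n. c * (s n ^ q + norm w ^ q)) \<longlonglongrightarrow> c * (w0 ^ q + norm w ^ q)" for c
  by (intro tendsto_intros sl)
 have lim': "(\<lambda>n. C2 * norm w ^ q - C1 * s n ^ q) \<longlonglongrightarrow> C2 * norm w ^ q - C1 * w0 ^ q"
  by (intro tendsto_intros sl)
 note pos = pos[OF sp]
 have "norm (fe x (w0, w)) \<le> M * (1 + norm x) * (w0 ^ q + norm w ^ q)"
  by (rule LIMSEQ_le[OF tendsto_norm[OF fl] lim]) (use pos(1) in blast)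
 then show "norm (fe x (w0, w)) \<le> M * (w0 ^ q + norm w ^ q) * (1 + norm x)" by (simp only: ac_simps)
 show "norm (fe x (w0, w)) \<le> B R * (w0 ^ q + norm w ^ q)" if "norm x \<le> R"
  by (rule LIMSEQ_le[OF tendsto_norm[OF fl] lim]) (use pos(2)[OF that] in blast)
 show "le x (w0, w) \<le> B R * (w0 ^ q + norm w ^ q)" if "norm x \<le> R"
  by (rule LIMSEQ_le[OF ll lim]) (use pos(3)[OF that] in blast)
 have "norm (fe x (w0, w) - fe y (w0, w)) \<le> L R * norm (x - y) * (w0 ^ q + norm w ^ q)" if "norm x \<le> R" "norm y \<le> R"
  by (rule LIMSEQ_le[OF tendsto_norm[OF tendsto_diff[OF fl fl]] lim]) (use pos(4)[OF that] in blast)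
 then show "norm (fe x (w0, w) - fe y (w0, w)) \<le> L R * (w0 ^ q + norm w ^ q) * norm (x - y)" if "norm x \<le> R" "norm y \<le> R"
  using that by (simp only: ac_simps)
 have "\<bar>le x (w0, w) - le y (w0, w)\<bar> \<le> L R * norm (x - y) * (w0 ^ q + norm w ^ q)" if "norm x \<le> R" "norm y \<le> R"
  by (rule LIMSEQ_le[OF tendsto_rabs[OF tendsto_diff[OF ll ll]] lim]) (use pos(5)[OF that] in blast)
 then show "\<bar>le x (w0, w) - le y (w0, w)\<bar> \<le> L R * (w0 ^ q + norm w ^ q) * norm (x - y)" if "norm x \<le> R" "norm y \<le> R"
  using that by (simp only: ac_simps)
 show "0 \<le> le x (w0, w)" by (rule LIMSEQ_le[OF tendsto_const ll]) (use pos(6) in blast)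
 show "C2 * norm w ^ q - C1 * w0 ^ q \<le> le x (w0, w)"
  by (rule LIMSEQ_le[OF lim' ll]) (use pos(7) in blast)
qed

text \<open>\<open>Bx\<close> is the box of the convexity condition, where w0^q + |w|^q is not
  normalized. \<open>K'\<close> with \<open>\<sigma>\<close> parametrizes the normalized controls by
  their second component alone (\<open>\<sigma>_image\<close>), as in the relaxed problem.\<close>

definition Bx :: "(real \<times> (real^'m)) set" where "Bx = {0..1} \<times> (cball 0 1 \<inter> A)"
definition K' :: "(real^'m) set" where "K' = cball 0 1 \<inter> A"
definition \<sigma> :: "real^'m \<Rightarrow> real \<times> (real^'m)" where "\<sigma> w = (root q (1 - norm w ^ q), w)"
definition f' :: "real^'n \<Rightarrow> real^'m \<Rightarrow> real^'n" where "f' x w = fe x (\<sigma> w)"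
definition l' :: "real^'n \<Rightarrow> real^'m \<Rightarrow> real" where "l' x w = le x (\<sigma> w)"

lemma K'_norm: "w \<in> K' ==> norm w ^ q \<le> 1" by (auto simp: K'_def power_le_one)

lemma \<sigma>_in: "w \<in> K' ==> \<sigma> w \<in> ext_set A q" "w \<in> K' ==> \<sigma> w \<in> Bx" using K'_norm[of w] q
 by (auto simp: \<sigma>_def ext_set_def Bx_def K'_def real_root_ge_zero)

lemma \<sigma>_snd: "w \<in> ext_set A q ==> snd w \<in> K' \<and> \<sigma> (snd w) = w"
proof -
 assume "w \<in> ext_set A q"
 then obtain w0 v where w: "w = (w0, v)" "0 \<le> w0" "v \<in> A" "w0 ^ q + norm v ^ q = 1"
  by (auto simp: ext_set_def)
 have "norm v ^ q \<le> 1" using w(4) zero_le_power[OF w(2), of q] by linarith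
 then have "norm v \<le> 1" using q by (simp add: power_le_one_iff)
 moreover have "root q (1 - norm v ^ q) = w0" using w(2,4) q by (intro real_root_pos_unique) auto
 ultimately show ?thesis using w by (simp add: K'_def \<sigma>_def)
qed

lemma \<sigma>_image: "\<sigma> ` K' = ext_set A q" using \<sigma>_in(1) \<sigma>_snd by (auto simp: image_iff) metis

lemma Bx_sum: "(w0, w) \<in> Bx ==> 0 \<le> w0 ^ q + norm w ^ q \<and> w0 ^ q + norm w ^ q \<le> 2 \<and> 0 \<le> w0 \<and> w \<in> A"
 unfolding Bx_def using power_le_one[of w0 q] power_le_one[of "norm w" q] by (auto simp: add_nonneg_nonneg)

lemma B_nonneg: "0 \<le> R ==> 0 \<le> B R"
 using f_bound[OF A_0, of 0 R] q order_trans[OF norm_ge_zero[of "f 0 0"], of "B R"] by (simp add: zero_power)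

lemma csys_box: "csys Bx fe le (2 * M) (\<lambda>R. 2 * B R) (\<lambda>R. 2 * L R)"
proof
 show "compact Bx" unfolding Bx_def by (intro compact_Times compact_Int_closed A) auto
 have "(0, 0) \<in> Bx" using A_0 by (simp add: Bx_def)
 then show "Bx \<noteq> {}" by blast
 have sub: "UNIV \<times> Bx \<subseteq> UNIV \<times> ({0..} \<times> A)" by (auto simp: Bx_def)
 show "continuous_on (UNIV \<times> Bx) (\<lambda>(x, a). fe x a)" by (rule continuous_on_subset[OF fe_cont sub])
 show "continuous_on (UNIV \<times> Bx) (\<lambda>(x, a). le x a)" by (rule continuous_on_subset[OF le_cont sub])
 show "0 \<le> 2 * M" using M_nonneg by simp
 show "0 \<le> 2 * L R" for R using L_nonneg by simp
 fix a assume a: "a \<in> Bx"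
 obtain w0 w where aw: "a = (w0, w)" by (cases a)
 note s = Bx_sum[of w0 w, OF a[unfolded aw]]
 have m2: "c * (w0 ^ q + norm w ^ q) \<le> 2 * c" if "0 \<le> c" for c
  using mult_left_mono[of "w0 ^ q + norm w ^ q" 2 c] s that by (simp add: mult.commute)
 show "norm (fe x a) \<le> 2 * M * (1 + norm x)" for x
 proof -
  have "norm (fe x a) \<le> (M * (1 + norm x)) * (w0 ^ q + norm w ^ q)"
   using fe_growth[of w0 w x] s unfolding aw by (simp only: ac_simps)
  also have "\<dots> \<le> 2 * (M * (1 + norm x))" by (rule m2) (use M_nonneg in simp)
  finally show ?thesis by simp
 qed
 show "norm (fe x a) \<le> 2 * B R" if "norm x \<le> R" for x R
  using fe_bound[of w0 w x R] s m2[of "B R"] B_nonneg[of R] that norm_ge_zero[of x] unfolding aw by linarith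
 show "le x a \<le> 2 * B R" if "norm x \<le> R" for x R
  using le_bound[of w0 w x R] s m2[of "B R"] B_nonneg[of R] that norm_ge_zero[of x] unfolding aw by linarith
 show "norm (fe x a - fe y a) \<le> 2 * L R * norm (x - y)" if "norm x \<le> R" "norm y \<le> R" for x y R
  using fe_lip[of w0 w x R y] s that mult_right_mono[OF m2[OF L_nonneg[of R]], of "norm (x - y)"] unfolding aw
  by (simp add: mult.commute)
 show "\<bar>le x a - le y a\<bar> \<le> 2 * L R * norm (x - y)" if "norm x \<le> R" "norm y \<le> R" for x y R
  using le_lip[of w0 w x R y] s that mult_right_mono[OF m2[OF L_nonneg[of R]], of "norm (x - y)"] unfolding aw
  by (simp add: mult.commute)
 show "0 \<le> le x a" for x using le_nonneg[of w0 w x] s unfolding aw by simp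
qed

sublocale bx: csys Bx fe le "2 * M" "\<lambda>R. 2 * B R" "\<lambda>R. 2 * L R" by (rule csys_box)

lemma \<sigma>_cont: "continuous_on S \<sigma>" unfolding \<sigma>_def[abs_def] by (intro continuous_intros)

lemma csys_ball: "csys K' f' l' (2 * M) (\<lambda>R. 2 * B R) (\<lambda>R. 2 * L R)"
proof
 show "compact K'" unfolding K'_def by (intro compact_Int_closed A) auto
 have "0 \<in> K'" using A_0 by (simp add: K'_def)
 then show "K' \<noteq> {}" by blast
 have c: "continuous_on (UNIV \<times> K') (\<lambda>z. (fst z, \<sigma> (snd z)))"
  by (intro continuous_intros continuous_on_compose2[OF \<sigma>_cont[of UNIV]]) auto
 have sub: "(\<lambda>z. (fst z, \<sigma> (snd z))) ` (UNIV \<times> K') \<subseteq> UNIV \<times> Bx" using \<sigma>_in(2) by auto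
 show "continuous_on (UNIV \<times> K') (\<lambda>(x, a). f' x a)"
  using continuous_on_compose2[OF bx.f_cont c sub] by (simp add: f'_def case_prod_unfold)
 show "continuous_on (UNIV \<times> K') (\<lambda>(x, a). l' x a)"
  using continuous_on_compose2[OF bx.l_cont c sub] by (simp add: l'_def case_prod_unfold)
qed (auto simp: f'_def l'_def dest!: \<sigma>_in(2)
  intro: M_nonneg L_nonneg bx.growth bx.f_bound bx.l_bound bx.f_lip bx.l_lip bx.l_nonneg)

sublocale csys_vec K' f' l' "2 * M" "\<lambda>R. 2 * B R" "\<lambda>R. 2 * L R"
 unfolding csys_vec_def by (rule csys_ball)

end

context cone_system
begin

section \<open>Original and extended controls\<close>

lemma not_compact_A: "\<not> compact A" using A(3) compact_imp_bounded by blast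

lemma f'_pos: "norm w < 1 ==> f' x w = (1 - norm w ^ q) *\<^sub>R f x (w /\<^sub>R root q (1 - norm w ^ q))"
 and l'_pos: "norm w < 1 ==> l' x w = (1 - norm w ^ q) * l x (w /\<^sub>R root q (1 - norm w ^ q))"
proof -
 assume w: "norm w < 1"
 have "norm w ^ q < 1" using w q by (simp add: power_less_one_iff)
 then have r: "0 < root q (1 - norm w ^ q)" "root q (1 - norm w ^ q) ^ q = 1 - norm w ^ q"
  using q by (auto simp: real_root_gt_zero)
 show "f' x w = (1 - norm w ^ q) *\<^sub>R f x (w /\<^sub>R root q (1 - norm w ^ q))"
  "l' x w = (1 - norm w ^ q) * l x (w /\<^sub>R root q (1 - norm w ^ q))"
  unfolding f'_def l'_def \<sigma>_def ext_fun_pos[OF r(1)] r(2) by simp_all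
qed

text \<open>The inverse of \<open>w \<mapsto> w / w\<^sub>0\<close>, where \<open>\<sigma> w = (w\<^sub>0, w)\<close>.\<close>

definition proj :: "real^'m \<Rightarrow> real^'m" where "proj a = a /\<^sub>R root q (1 + norm a ^ q)"

lemma proj:
 assumes "a \<in> A"
 shows "proj a \<in> K'" "norm (proj a) < 1" "1 - norm (proj a) ^ q = 1 / (1 + norm a ^ q)"
  "(1 + norm a ^ q) *\<^sub>R f' x (proj a) = f x a" "(1 + norm a ^ q) * l' x (proj a) = l x a"
proof -
 let ?r = "root q (1 + norm a ^ q)"
 have p: "0 < 1 + norm a ^ q" by (simp add: add_pos_nonneg)
 have r: "0 < ?r" "?r ^ q = 1 + norm a ^ q" using p q by (auto simp: real_root_gt_zero)
 have n: "norm (proj a) = norm a / ?r" using r by (simp add: proj_def divide_inverse mult.commute)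
 then have nq: "norm (proj a) ^ q = norm a ^ q / (1 + norm a ^ q)" using r by (simp add: power_divide)
 then have "norm (proj a) ^ q < 1" using p by simp
 then show lt: "norm (proj a) < 1" using q by (simp add: power_less_one_iff)
 show e: "1 - norm (proj a) ^ q = 1 / (1 + norm a ^ q)" using nq p by (simp add: field_simps)
 show "proj a \<in> K'" using lt assms A_scale r by (simp add: K'_def proj_def)
 have "root q (1 - norm (proj a) ^ q) = 1 / ?r" unfolding e using q by (simp add: real_root_divide)
 then have a: "proj a /\<^sub>R root q (1 - norm (proj a) ^ q) = a" using r by (simp add: proj_def)
 show "(1 + norm a ^ q) *\<^sub>R f' x (proj a) = f x a" "(1 + norm a ^ q) * l' x (proj a) = l x a"
  unfolding f'_pos[OF lt] l'_pos[OF lt] a unfolding e using p by simp_all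
qed

lemma proj_cont: "continuous_on S proj"
proof -
 have "root q (1 + norm a ^ q) \<noteq> 0" for a :: "real^'m"
  using q by (simp add: add_pos_nonneg less_imp_neq[symmetric])
 then show ?thesis unfolding proj_def[abs_def] by (intro continuous_intros) simp
qed

lemma controls_total:
 assumes "\<alpha> \<in> controls A q"
 shows "(\<lambda>t. \<alpha> (max 0 t)) \<in> borel_measurable borel" "\<alpha> (max 0 t) \<in> A"
  "0 \<le> t ==> set_integrable lborel {0..t} (\<lambda>s. norm (\<alpha> (max 0 s)) ^ q)"
proof -
 have "\<alpha> \<in> restrict_space borel {0..} \<rightarrow>\<^sub>M restrict_space borel A"
  and i: "\<forall>t\<ge>0. set_integrable lborel {0..t} (\<lambda>s. norm (\<alpha> s) ^ q)"
  using assms not_compact_A by (auto simp: controls_def)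
 then have "(\<lambda>t. \<alpha> (max 0 t)) \<in> borel \<rightarrow>\<^sub>M restrict_space borel A" by (intro control_total)
 then show "(\<lambda>t. \<alpha> (max 0 t)) \<in> borel_measurable borel" "\<alpha> (max 0 t) \<in> A"
  by (auto simp: measurable_restrict_space2_iff)
 assume "0 \<le> t"
 then have "set_integrable lborel {0..t} (\<lambda>s. norm (\<alpha> s) ^ q)" using i by blast
 then show "set_integrable lborel {0..t} (\<lambda>s. norm (\<alpha> (max 0 s)) ^ q)"
  by (rule set_integrable_cong[THEN iffD1, rotated -1]) auto
qed

text \<open>An original control may be unbounded, so its field is not an \<open>lfield\<close> and
  the flow theory does not apply to it. Existence and uniqueness of its trajectory are obtained here
  from the extended system, through the time change of speed 1 + |\<alpha>|^q; the time component of
  the new control is the reciprocal of this speed.\<close>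

lemma original_to_extended:
 assumes \<alpha>: "\<alpha> \<in> controls A q"
 obtains \<beta> \<Theta> where "\<beta> \<in> ctrls" "\<And>s. 0 \<le> s ==> norm (\<beta> s) < 1" "\<And>t. 0 \<le> t ==> t \<le> \<Theta> t"
  "\<And>x y t. sol (\<lambda>s z. f z (\<alpha> s)) x y ==> 0 \<le> t ==> y t = traj \<beta> x (\<Theta> t)"
  "\<And>x. sol (\<lambda>s z. f z (\<alpha> s)) x (\<lambda>t. traj \<beta> x (\<Theta> t))"
  "\<And>x t. 0 \<le> t ==> cost f l {0..t} x \<alpha> = ereal (run \<beta> x (\<Theta> t))"
  "\<And>x t. 0 \<le> t ==> set_integrable lborel {0..t} (\<lambda>s. l (trajectory f x \<alpha> s) (\<alpha> s))"
  "\<And>s. \<exists>t\<ge>0. s \<le> integral {0..t} (\<lambda>r. 1 - norm (\<beta> r) ^ q)"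
proof -
 define a where "a t = \<alpha> (max 0 t)" for t
 have am: "a \<in> borel_measurable borel" and aA: "a t \<in> A" for t
  unfolding a_def[abs_def] using controls_total[OF \<alpha>] by auto
 define \<rho> where "\<rho> t = 1 + norm (a t) ^ q" for t
 have \<rho>1: "1 \<le> \<rho> t" for t by (simp add: \<rho>_def)
 have ii: "set_integrable lborel {0..t} \<rho>" for t
 proof (cases "0 \<le> t")
  case True
  have "set_integrable lborel {0..t} (\<lambda>_. 1 :: real)"
   by (rule borel_integrable_atLeastAtMost'[OF continuous_on_const])
  then show ?thesis unfolding \<rho>_def a_def by (rule set_integral_add(1)[OF _ controls_total(3)[OF \<alpha> True]])
 qed (simp add: set_integrable_def)
 have lb: "t - s \<le> integral {s..t} \<rho>" if "0 \<le> s" "s \<le> t" for s t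
 proof -
  have i: "\<rho> integrable_on {s..t}"
   by (rule integrable_on_subinterval[OF set_integrable_imp_HK(1)[OF ii[of t]]]) (use that in auto)
  have "integral {s..t} (\<lambda>_. 1 :: real) \<le> integral {s..t} \<rho>"
   by (intro integral_le i integrable_const_ivl) (use \<rho>1 in auto)
  then show ?thesis using that by simp
 qed
 interpret time_change \<rho>
 proof
  show "\<rho> \<in> borel_measurable borel" unfolding \<rho>_def[abs_def] using am by measurable
  show "0 \<le> \<rho> t" for t using \<rho>1[of t] by simp
  show "set_integrable lborel {0..t} \<rho>" for t by (rule ii)
  show "\<exists>t\<ge>0. s \<le> integral {0..t} \<rho>" for s
   using lb[of 0 "max 0 s"] by (intro exI[of _ "max 0 s"]) auto
 qed
 have \<Theta>_grow: "t - s \<le> \<Theta> t - \<Theta> s" if "0 \<le> s" "s \<le> t" for s t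
  using \<Theta>_diff[OF that] lb[OF that] by simp
 \<comment> \<open>The speed is at least 1, so \<Theta> is strictly increasing and \<tau> is a true
   inverse.\<close>
 have \<tau>\<Theta>: "\<tau> (\<Theta> r) = r" if "0 \<le> r" for r
  using \<Theta>_grow[OF \<tau>_nonneg \<tau>_\<Theta>_le[OF that]] \<Theta>_\<tau>[OF \<Theta>_nonneg[of r]] \<tau>_\<Theta>_le[OF that] by simp
 define \<beta> where "\<beta> s = proj (a (\<tau> s))" for s
 note pr = proj[OF aA]
 have "(\<lambda>s. a (\<tau> s)) \<in> borel_measurable borel" using measurable_compose[OF \<tau>_measurable am] .
 from measurable_compose[OF this borel_measurable_continuous_onI[OF proj_cont]]
 have \<beta>m: "\<beta> \<in> borel_measurable borel" by (simp add: \<beta>_def[abs_def])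
 have \<beta>K: "\<beta> s \<in> K'" "norm (\<beta> s) < 1" for s unfolding \<beta>_def by (rule pr)+
 have \<beta>: "\<beta> \<in> ctrls"
  unfolding ctrls_def by (intro measurable_restrict_space1 measurable_restrict_space2) (use \<beta>m \<beta>K in auto)
 interpret adm "2 * M" "\<lambda>R. 2 * B R" "\<lambda>R. 2 * L R" "FF \<beta>" "LL \<beta>" by (rule adm_ctrl[OF \<beta>])
 have \<rho>f: "\<rho> r *\<^sub>R f' z (\<beta> (\<Theta> r)) = f z (\<alpha> r)" and \<rho>l: "\<rho> r * l' z (\<beta> (\<Theta> r)) = l z (\<alpha> r)"
  and \<rho>i: "\<rho> r * (1 - norm (\<beta> (\<Theta> r)) ^ q) = 1" if "0 \<le> r" for r z
 proof -
  have b: "\<beta> (\<Theta> r) = proj (a r)" "a r = \<alpha> r" using that by (simp_all add: \<beta>_def \<tau>\<Theta> a_def)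
  show "\<rho> r *\<^sub>R f' z (\<beta> (\<Theta> r)) = f z (\<alpha> r)" "\<rho> r * l' z (\<beta> (\<Theta> r)) = l z (\<alpha> r)"
   using pr(4,5)[of r z] by (simp_all add: b \<rho>_def)
  show "\<rho> r * (1 - norm (\<beta> (\<Theta> r)) ^ q) = 1"
   unfolding b(1) pr(3) \<rho>_def[symmetric] using \<rho>1[of r] by simp
 qed
 have trm: "(\<lambda>r. traj \<beta> x (\<Theta> r)) \<in> borel_measurable borel" for x
  by (intro borel_measurable_continuous_onI continuous_on_compose2[OF continuous_on_atLeast \<Theta>_continuous])
    (use flow_continuous \<Theta>_nonneg in auto)
 have meas: "set_borel_measurable borel {0..t} (\<lambda>r. g (traj \<beta> x (\<Theta> r)) (\<alpha> r))"
  if "continuous_on (UNIV \<times> A) (\<lambda>(x, a). g x a)" for g :: "real^'n \<Rightarrow> real^'m \<Rightarrow> 'z::euclidean_space" and x t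
 proof -
  have "(\<lambda>r. indicator {0..t} r *\<^sub>R g (traj \<beta> x (\<Theta> r)) (a r)) \<in> borel_measurable borel"
   using comp_measurable[OF that trm am aA] by simp
  moreover have "(\<lambda>r. indicator {0..t} r *\<^sub>R g (traj \<beta> x (\<Theta> r)) (a r)) = (\<lambda>r. indicator {0..t} r *\<^sub>R g (traj \<beta> x (\<Theta> r)) (\<alpha> r))"
   by (auto simp: a_def split: split_indicator)
  ultimately show ?thesis unfolding set_borel_measurable_def by simp
 qed
 have fwd: "solon t (\<lambda>s z. f z (\<alpha> s)) x (\<lambda>r. traj \<beta> x (\<Theta> r))" if "0 \<le> t" for t x
  by (rule solon_forward[where ?F2.0 = "FF \<beta>"])
    (use flow_solon that meas[OF f_cont, of t x] in \<open>auto simp: FF_def \<rho>f\<close>)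
 have sf: "sol (\<lambda>s z. f z (\<alpha> s)) x (\<lambda>r. traj \<beta> x (\<Theta> r))" for x unfolding sol_def
 proof
  fix S show "solon S (\<lambda>s z. f z (\<alpha> s)) x (\<lambda>r. traj \<beta> x (\<Theta> r))"
   by (rule solon_mono[OF fwd[of "max 0 S"]]) auto
 qed
 \<comment> \<open>Any solution of the original equation, read in the new time, solves the extended
   one, for which uniqueness is known. Replacing r by \<open>max 0 r\<close> discards the arbitrary
   values at negative times.\<close>
 have unique: "y t = traj \<beta> x (\<Theta> t)" if y: "sol (\<lambda>s z. f z (\<alpha> s)) x y" and t: "0 \<le> t" for x y t
 proof -
  have "solon S (FF \<beta>) x (\<lambda>s. (\<lambda>r. y (max 0 r)) (\<tau> s))" for S
  proof (rule solon_backward[where ?F1.0 = "\<lambda>s z. f z (\<alpha> s)"])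
   show "solon S (\<lambda>s z. f z (\<alpha> s)) x (\<lambda>r. y (max 0 r))" for S
    using y[unfolded sol_def, rule_format, of S] by (rule solon_cong[THEN iffD1, rotated -1]) auto
   have "continuous_on {0..S} y" for S using y unfolding sol_def by (blast intro: solon_continuous)
   then have "continuous_on {0..} y" by (rule continuous_on_atLeast)
   from comp_measurable[OF csys.f_cont[OF csys_ball] measurable_compose[OF \<tau>_measurable borel_measurable_max_0[OF this]] \<beta>m \<beta>K(1)]
   show "(\<lambda>s. FF \<beta> s (y (max 0 (\<tau> s)))) \<in> borel_measurable borel" by (simp add: FF_def)
   show "f (y (max 0 r)) (\<alpha> r) = \<rho> r *\<^sub>R FF \<beta> (\<Theta> r) (y (max 0 r))" if "0 \<le> r" for r
    by (simp add: FF_def \<rho>f that)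
   show "f (y (max 0 r)) (\<alpha> r) = 0" if "\<rho> r = 0" for r using \<rho>1[of r] that by simp
  qed
  from flow_eqI[OF F lg this \<Theta>_nonneg order_refl, of t]
  show ?thesis using \<tau>\<Theta>[OF t] t by simp
 qed
 have traj: "trajectory f x \<alpha> t = traj \<beta> x (\<Theta> t)" if "0 \<le> t" for x t
 proof (rule unique[OF _ that])
  show "sol (\<lambda>s z. f z (\<alpha> s)) x (trajectory f x \<alpha>)"
   unfolding trajectory_eq_flow flow_def using someI[of "sol (\<lambda>s z. f z (\<alpha> s)) x", OF sf] by simp
 qed
 have cost: "set_integrable lborel {0..t} (\<lambda>s. l (trajectory f x \<alpha> s) (\<alpha> s)) \<and>
   cost f l {0..t} x \<alpha> = ereal (run \<beta> x (\<Theta> t))" if t: "0 \<le> t" for x t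
 proof -
  have "solon (\<Theta> t) (\<lambda>s _. LL \<beta> s (traj \<beta> x s)) 0 (run \<beta> x)"
   unfolding solon_def rc_def using ell_integrable by auto
  then have "solon t (\<lambda>s _. l (traj \<beta> x (\<Theta> s)) (\<alpha> s)) 0 (\<lambda>r. run \<beta> x (\<Theta> r))"
   by (rule solon_forward) (use t meas[OF l_cont, of t x] in \<open>auto simp: LL_def \<rho>l\<close>)
  from solonD[OF this t order_refl]
  have i: "set_integrable lborel {0..t} (\<lambda>s. l (traj \<beta> x (\<Theta> s)) (\<alpha> s))"
   and e: "run \<beta> x (\<Theta> t) = integral {0..t} (\<lambda>s. l (traj \<beta> x (\<Theta> s)) (\<alpha> s))" by auto
  have i': "set_integrable lborel {0..t} (\<lambda>s. l (trajectory f x \<alpha> s) (\<alpha> s))"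
   using i by (rule set_integrable_cong[THEN iffD1, rotated -1]) (auto simp: traj)
  have "integral {0..t} (\<lambda>s. l (trajectory f x \<alpha> s) (\<alpha> s)) = run \<beta> x (\<Theta> t)"
   unfolding e by (rule HK_integral_cong) (simp add: traj)
  moreover have "0 \<le> l (trajectory f x \<alpha> s) (\<alpha> s)" if "0 \<le> s" for s
   using cost_nonneg[OF aA[of s]] that by (simp add: a_def)
  ultimately show ?thesis unfolding cost_def using enn2ereal_nn_integral_upto[OF i'] i' by simp
 qed
 \<comment> \<open>The integral of the time component up to \<Theta>(S) is the original time S,
   which is arbitrarily large.\<close>
 have inf: "\<exists>t\<ge>0. s \<le> integral {0..t} (\<lambda>r. 1 - norm (\<beta> r) ^ q)" for s
 proof -
  define S where "S = max 0 s"
  have \<phi>: "(\<lambda>r. 1 - norm (\<beta> r) ^ q) \<in> borel_measurable borel" using \<beta>m by measurable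
  have S: "0 \<le> S" by (simp add: S_def)
  have e: "(LINT r:{0..S}|lborel. \<rho> r *\<^sub>R (1 - norm (\<beta> (\<Theta> r)) ^ q)) = (LINT r:{0..S}|lborel. 1)"
   by (rule set_lebesgue_integral_cong) (auto simp: \<rho>i)
  have i: "set_integrable lborel {0..\<Theta> S} (\<lambda>r. 1 - norm (\<beta> r) ^ q)"
   by (rule bounded_set_integrable[where B = 1])
     (use \<phi> \<beta>K(2) in \<open>auto simp: set_borel_measurable_def abs_le_iff power_le_one less_imp_le\<close>)
  have "integral {0..\<Theta> S} (\<lambda>r. 1 - norm (\<beta> r) ^ q) = S"
   using integral_change(2)[OF S \<phi>] e S unfolding set_integrable_imp_HK(2)[OF i]
   by (simp add: set_lebesgue_integral_def)
  then show ?thesis using \<Theta>_nonneg[of S] by (intro exI[of _ "\<Theta> S"]) (auto simp: S_def)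
 qed
 have grow: "t \<le> \<Theta> t" if "0 \<le> t" for t using \<Theta>_grow[of 0 t] that by simp
 show ?thesis by (rule that[of \<beta> \<Theta>])
    (rule \<beta> \<beta>K(2) sf inf | erule grow | erule (1) unique | erule conjunct1[OF cost] | erule conjunct2[OF cost])+
qed

end

context cone_system
begin

lemma cost_mono: "I \<subseteq> I' ==> cost g h I x \<alpha> \<le> cost g h I' x \<alpha>"
 unfolding cost_def less_eq_ennreal.rep_eq[symmetric]
 by (intro nn_integral_mono) (auto split: split_indicator)

lemma J_le_cost:
 assumes \<alpha>: "\<alpha> \<in> controls A q"
 obtains \<beta> where "\<beta> \<in> ctrls" "\<And>s. 0 \<le> s ==> norm (\<beta> s) < 1"
  "\<And>s. \<exists>t\<ge>0. s \<le> integral {0..t} (\<lambda>r. 1 - norm (\<beta> r) ^ q)"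
  "\<And>x. J \<beta> x \<le> cost f l {0..} x \<alpha>" "\<And>x t. 0 \<le> t ==> ereal (run \<beta> x t) \<le> cost f l {0..t} x \<alpha>"
proof (rule original_to_extended[OF \<alpha>])
 fix \<beta> \<Theta>
 assume \<beta>: "\<beta> \<in> ctrls" and n: "\<And>s. 0 \<le> s ==> norm (\<beta> s) < 1" and g: "\<And>t. 0 \<le> t ==> t \<le> \<Theta> t"
  and c: "\<And>x t. 0 \<le> t ==> cost f l {0..t} x \<alpha> = ereal (run \<beta> x (\<Theta> t))"
  and inf: "\<And>s. \<exists>t\<ge>0. s \<le> integral {0..t} (\<lambda>r. 1 - norm (\<beta> r) ^ q)"
 interpret adm "2 * M" "\<lambda>R. 2 * B R" "\<lambda>R. 2 * L R" "FF \<beta>" "LL \<beta>" by (rule adm_ctrl[OF \<beta>])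
 have le: "ereal (run \<beta> x t) \<le> cost f l {0..t} x \<alpha>" if "0 \<le> t" for x t
  unfolding c[OF that] using rc_mono[OF that g[OF that], of x] by simp
 have "J \<beta> x \<le> cost f l {0..} x \<alpha>" for x
  unfolding pcost_le_iff by (intro allI impI order_trans[OF le cost_mono]) auto
 then show ?thesis using that[OF \<beta> n inf _ le] by blast
qed

lemma V_le_value_fun: "V x \<le> value_fun A f l q x" unfolding value_fun_def
proof (rule INF_greatest)
 fix \<alpha> assume "\<alpha> \<in> controls A q"
 then obtain \<beta> where "\<beta> \<in> ctrls" "J \<beta> x \<le> cost f l {0..} x \<alpha>" by (rule J_le_cost) blast
 then show "V x \<le> cost f l {0..} x \<alpha>" using V_le_J order_trans by blast
qed

lemma Sig_le_value_sup: "Sig x \<le> value_sup A f l q x" unfolding Sig_def value_sup_def value_upto_def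
proof (rule SUP_mono, rule bexI, rule INF_greatest)
 fix t :: real and \<alpha> assume t: "t \<in> {0<..}" and \<alpha>: "\<alpha> \<in> controls A q"
 from \<alpha> obtain \<beta> where \<beta>: "\<beta> \<in> ctrls" and le: "0 \<le> t ==> ereal (run \<beta> x t) \<le> cost f l {0..t} x \<alpha>"
  by (rule J_le_cost) blast
 interpret adm "2 * M" "\<lambda>R. 2 * B R" "\<lambda>R. 2 * L R" "FF \<beta>" "LL \<beta>" by (rule adm_ctrl[OF \<beta>])
 have "(INF \<alpha>\<in>ctrls. pcost (FF \<alpha>) (LL \<alpha>) {0..t} x) \<le> pcost (FF \<beta>) (LL \<beta>) {0..t} x"
  using \<beta> by (rule INF_lower)
 also have "\<dots> \<le> cost f l {0..t} x \<alpha>" using le pcost_upto[of t x] t by simp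
 finally show "(INF \<alpha>\<in>ctrls. pcost (FF \<alpha>) (LL \<alpha>) {0..t} x) \<le> cost f l {0..t} x \<alpha>" .
qed

lemma value_sup_le_value_fun: "value_sup A f l q x \<le> value_fun A f l q x"
 unfolding value_sup_def value_upto_def value_fun_def
 by (intro SUP_least INF_mono) (auto intro!: bexI cost_mono)

lemma trajectory_eqI:
 assumes \<alpha>: "\<alpha> \<in> controls A q" and y: "sol (\<lambda>s z. f z (\<alpha> s)) x y" and t: "0 \<le> t"
 shows "trajectory f x \<alpha> t = y t"
proof (rule original_to_extended[OF \<alpha>])
 fix \<beta> \<Theta>
 assume u: "\<And>x y t. sol (\<lambda>s z. f z (\<alpha> s)) x y ==> 0 \<le> t ==> y t = traj \<beta> x (\<Theta> t)"
 have "sol (\<lambda>s z. f z (\<alpha> s)) x (trajectory f x \<alpha>)"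
  unfolding trajectory_eq_flow flow_def using someI[of "sol (\<lambda>s z. f z (\<alpha> s)) x", OF y] by simp
 then show ?thesis using u[OF _ t] y by metis
qed

text \<open>The time component 1 - |\<beta>|^q is positive, so the original control w/w0 is defined;
  its infinite integral makes the original time cover the half line.\<close>

lemma extended_to_original:
 assumes \<beta>: "\<beta> \<in> ctrls" and n: "\<And>s. 0 \<le> s ==> norm (\<beta> s) < 1"
  and inf: "\<And>s. \<exists>t\<ge>0. s \<le> integral {0..t} (\<lambda>r. 1 - norm (\<beta> r) ^ q)"
 shows "value_fun A f l q x \<le> J \<beta> x"
proof -
 define b where "b t = \<beta> (max 0 t)" for t
 have "b \<in> borel \<rightarrow>\<^sub>M restrict_space borel K'"
  unfolding b_def[abs_def] by (rule control_total[OF \<beta>[unfolded ctrls_def]])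
 then have bm: "b \<in> borel_measurable borel" and bK: "b t \<in> K'" for t
  by (auto simp: measurable_restrict_space2_iff)
 have bn: "norm (b t) ^ q < 1" for t using n[of "max 0 t"] q by (simp add: b_def power_less_one_iff)
 have bb: "b t = \<beta> t" if "0 \<le> t" for t using that by (simp add: b_def)
 define \<rho> where "\<rho> t = 1 - norm (b t) ^ q" for t
 have \<rho>p: "0 < \<rho> t" for t using bn[of t] by (simp add: \<rho>_def)
 have \<rho>m: "\<rho> \<in> borel_measurable borel" unfolding \<rho>_def[abs_def] using bm by measurable
 have bi: "set_integrable lborel {0..t} (\<lambda>s. norm (b s) ^ q)" for t
  by (rule bounded_set_integrable[where B = 1])
    (use bm bn less_imp_le in \<open>auto simp: set_borel_measurable_def\<close>)
 have "norm (\<rho> t) \<le> 1" for t using \<rho>p[of t] by (simp add: \<rho>_def)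
 then have \<rho>i: "set_integrable lborel {0..t} \<rho>" for t
  by (intro bounded_set_integrable[where B = 1]) (use \<rho>m in \<open>auto simp: set_borel_measurable_def\<close>)
 interpret time_change \<rho>
 proof
  show "\<exists>t\<ge>0. s \<le> integral {0..t} \<rho>" for s
  proof -
   obtain t where t: "0 \<le> t" "s \<le> integral {0..t} (\<lambda>r. 1 - norm (\<beta> r) ^ q)" using inf by blast
   have "integral {0..t} (\<lambda>r. 1 - norm (\<beta> r) ^ q) = integral {0..t} \<rho>"
    by (rule HK_integral_cong) (simp add: \<rho>_def bb)
   then show ?thesis using t by auto
  qed
 qed (rule \<rho>m less_imp_le[OF \<rho>p] \<rho>i)+
 interpret adm "2 * M" "\<lambda>R. 2 * B R" "\<lambda>R. 2 * L R" "FF \<beta>" "LL \<beta>" by (rule adm_ctrl[OF \<beta>])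
 define \<alpha> where "\<alpha> t = b (\<tau> t) /\<^sub>R root q (\<rho> (\<tau> t))" for t
 have r: "0 < root q (\<rho> t)" "root q (\<rho> t) ^ q = \<rho> t" for t
  using \<rho>p[of t] q by (auto simp: real_root_gt_zero)
 have rm: "(\<lambda>t. root q (\<rho> (\<tau> t))) \<in> borel_measurable borel"
  by (rule measurable_compose[OF measurable_compose[OF \<tau>_measurable \<rho>m] borel_measurable_continuous_onI])
    (intro continuous_intros)
 have \<alpha>m: "\<alpha> \<in> borel_measurable borel"
  unfolding \<alpha>_def[abs_def] using measurable_compose[OF \<tau>_measurable bm] rm by measurable
 have \<alpha>A: "\<alpha> t \<in> A" for t
  unfolding \<alpha>_def by (rule A_scale) (use r bK in \<open>auto simp: K'_def less_imp_le\<close>)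
 have \<alpha>\<Theta>: "\<alpha> (\<Theta> t) = \<beta> t /\<^sub>R root q (1 - norm (\<beta> t) ^ q)" "\<rho> t = 1 - norm (\<beta> t) ^ q"
  if "0 \<le> t" "\<tau> (\<Theta> t) = t" for t using that by (simp_all add: \<alpha>_def bb \<rho>_def)
 have \<rho>0: "\<rho> t = 0 ==> P" for t P using \<rho>p[of t] by simp
 \<comment> \<open>Local integrability of the q-th power is written as a solution with
   state-independent field, so that \<open>solon_backward\<close> delivers it: multiplied by the
   speed, the power of \<alpha> becomes the bounded power of \<beta>.\<close>
 have "solon S (\<lambda>s _. norm (\<alpha> s) ^ q) 0 (\<lambda>s. integral {0..\<tau> s} (\<lambda>r. norm (b r) ^ q))" for S
 proof (rule solon_backward[where ?F1.0 = "\<lambda>s _. norm (b s) ^ q"])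
  show "solon S (\<lambda>s _. norm (b s) ^ q) 0 (\<lambda>s. integral {0..s} (\<lambda>r. norm (b r) ^ q))" for S
   unfolding solon_def using bi by simp
  show "norm (b t) ^ q = \<rho> t *\<^sub>R norm (\<alpha> (\<Theta> t)) ^ q" if t: "0 \<le> t" "\<tau> (\<Theta> t) = t" for t
  proof -
   have "norm (\<alpha> (\<Theta> t)) = norm (b t) / root q (\<rho> t)"
    using t(2) r(1)[of t] by (simp add: \<alpha>_def divide_inverse mult.commute)
   then show ?thesis using r(2)[of t] \<rho>p[of t] by (simp add: power_divide)
  qed
 qed (use \<alpha>m \<rho>0 in auto)
 then have \<alpha>i: "set_integrable lborel {0..t} (\<lambda>s. norm (\<alpha> s) ^ q)" if "0 \<le> t" for t
  using solonD(1)[OF _ that order_refl] by blast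
 have \<alpha>: "\<alpha> \<in> controls A q" unfolding controls_def using \<alpha>i
  by (auto intro!: measurable_restrict_space1 measurable_restrict_space2 \<alpha>m \<alpha>A)
 have ym: "(\<lambda>s. traj \<beta> x (\<tau> s)) \<in> borel_measurable borel"
 proof -
  have "continuous_on {0..} (traj \<beta> x)" by (rule continuous_on_atLeast[OF flow_continuous])
  from measurable_compose[OF \<tau>_measurable borel_measurable_max_0[OF this]]
  show ?thesis using \<tau>_nonneg by simp
 qed
 have "solon S (\<lambda>s z. f z (\<alpha> s)) x (\<lambda>s. traj \<beta> x (\<tau> s))" for S
  by (rule solon_backward[OF flow_solon])
    (use comp_measurable[OF f_cont ym \<alpha>m \<alpha>A] n \<rho>0 in \<open>auto simp: FF_def \<alpha>\<Theta> f'_pos\<close>)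
 then have tr: "trajectory f x \<alpha> t = traj \<beta> x (\<tau> t)" if "0 \<le> t" for t
  by (intro trajectory_eqI[OF \<alpha> _ that]) (simp add: sol_def)
 have rs: "solon S (\<lambda>s _. l (traj \<beta> x (\<tau> s)) (\<alpha> s)) 0 (\<lambda>s. run \<beta> x (\<tau> s))" for S
 proof (rule solon_backward[where ?F1.0 = "\<lambda>s _. LL \<beta> s (traj \<beta> x s)"])
  show "solon S (\<lambda>s _. LL \<beta> s (traj \<beta> x s)) 0 (run \<beta> x)" for S
   unfolding solon_def rc_def using ell_integrable by auto
 qed (use comp_measurable[OF l_cont ym \<alpha>m \<alpha>A] n \<rho>0 in \<open>auto simp: LL_def \<alpha>\<Theta> l'_pos\<close>)
 have li: "set_integrable lborel {0..t} (\<lambda>s. l (traj \<beta> x (\<tau> s)) (\<alpha> s))"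
  "integral {0..t} (\<lambda>s. l (traj \<beta> x (\<tau> s)) (\<alpha> s)) = run \<beta> x (\<tau> t)" if "0 \<le> t" for t
  using solonD[OF rs that order_refl] by auto
 have eq: "cost f l I x \<alpha> = enn2ereal (\<integral>\<^sup>+ s\<in>I. ennreal (l (traj \<beta> x (\<tau> s)) (\<alpha> s)) \<partial>lborel)" if "I \<subseteq> {0..}" for I
  unfolding cost_def using that
  by (intro arg_cong[of _ _ enn2ereal] nn_integral_cong) (auto simp: tr split: split_indicator)
 have "set_integrable lborel {0..t} (\<lambda>s. l (traj \<beta> x (\<tau> s)) (\<alpha> s))" for t
  by (cases "0 \<le> t") (rule li(1), assumption, simp add: set_integrable_def)
 then have "cost f l {0..} x \<alpha> = (SUP n. ereal (run \<beta> x (\<tau> (real n))))"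
  unfolding eq[OF order_refl] by (subst enn2ereal_nn_integral_SUP) (auto simp: li(2) cost_nonneg \<alpha>A)
 also have "\<dots> \<le> J \<beta> x" by (intro SUP_least rc_le_pcost \<tau>_nonneg)
 finally have "cost f l {0..} x \<alpha> \<le> J \<beta> x" .
 then show ?thesis unfolding value_fun_def by (rule order_trans[OF INF_lower[OF \<alpha>]])
qed

end

section \<open>Equality of the original and the extended value\<close>

context csys
begin

lemma uniform_perturbation:
 assumes \<alpha>: "\<alpha> \<in> ctrls" and S: "0 \<le> S" and e: "0 < e"
 obtains \<delta> where "0 < \<delta>" "\<And>\<beta>. \<beta> \<in> ctrls ==> (\<And>s. 0 \<le> s ==> dist (\<beta> s) (\<alpha> s) < \<delta>) ==>
  dist (traj \<beta> x S) (traj \<alpha> x S) < e \<and> \<bar>run \<beta> x S - run \<alpha> x S\<bar> < e"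
proof -
 define R where "R = rb M (norm x) S"
 define D where "D \<epsilon> = 2 * (\<epsilon> * S) * exp (2 * L R * S)" for \<epsilon>
 have "((\<lambda>\<epsilon>. D \<epsilon>) \<longlongrightarrow> D 0) (at_right 0)" "((\<lambda>\<epsilon>. (L R * D \<epsilon> + \<epsilon>) * S) \<longlongrightarrow> (L R * D 0 + 0) * S) (at_right 0)"
  unfolding D_def by (intro tendsto_intros)+
 then have "\<forall>\<^sub>F \<epsilon> in at_right 0. D \<epsilon> < e" "\<forall>\<^sub>F \<epsilon> in at_right 0. (L R * D \<epsilon> + \<epsilon>) * S < e"
  using e by (auto elim!: order_tendstoD simp: D_def)
 then have "\<forall>\<^sub>F \<epsilon> in at_right 0. D \<epsilon> < e \<and> (L R * D \<epsilon> + \<epsilon>) * S < e \<and> 0 < \<epsilon>"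
  using eventually_at_right_less[of "0::real"] by eventually_elim simp
 then obtain \<epsilon> where \<epsilon>: "D \<epsilon> < e" "(L R * D \<epsilon> + \<epsilon>) * S < e" "0 < \<epsilon>"
  using eventually_happens'[OF trivial_limit_at_right_real] by blast
 have sub: "cball 0 R \<times> K \<subseteq> UNIV \<times> K" and cp: "compact (cball 0 R \<times> K :: ('x \<times> 'c) set)"
  by (auto intro!: compact_Times K)
 have uc: "uniformly_continuous_on (cball 0 R \<times> K) (\<lambda>(x, a). f x a)"
  "uniformly_continuous_on (cball 0 R \<times> K) (\<lambda>(x, a). l x a)"
  by (rule compact_uniformly_continuous[OF continuous_on_subset[OF f_cont sub] cp]
    compact_uniformly_continuous[OF continuous_on_subset[OF l_cont sub] cp])+
 obtain d1 where d1: "0 < d1" "\<And>z z'. z \<in> cball 0 R \<times> K ==> z' \<in> cball 0 R \<times> K ==> dist z' z < d1 ==>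
    dist ((\<lambda>(x, a). f x a) z') ((\<lambda>(x, a). f x a) z) < \<epsilon>"
  using uniformly_continuous_onE[OF uc(1) \<epsilon>(3)] by blast
 obtain d2 where d2: "0 < d2" "\<And>z z'. z \<in> cball 0 R \<times> K ==> z' \<in> cball 0 R \<times> K ==> dist z' z < d2 ==>
    dist ((\<lambda>(x, a). l x a) z') ((\<lambda>(x, a). l x a) z) < \<epsilon>"
  using uniformly_continuous_onE[OF uc(2) \<epsilon>(3)] by blast
 show ?thesis
 proof (rule that[of "min d1 d2"])
  show "0 < min d1 d2" using d1 d2 by simp
  fix \<beta> assume \<beta>: "\<beta> \<in> ctrls" and c: "\<And>s. 0 \<le> s ==> dist (\<beta> s) (\<alpha> s) < min d1 d2"
  have "norm (FF \<beta> s z - FF \<alpha> s z) \<le> \<epsilon>" "norm (LL \<beta> s z - LL \<alpha> s z) \<le> \<epsilon>" if s: "0 \<le> s" "norm z \<le> rb M (norm x) S" for s z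
  proof -
   have "(z, \<alpha> s) \<in> cball 0 R \<times> K" "(z, \<beta> s) \<in> cball 0 R \<times> K" "dist (z, \<beta> s) (z, \<alpha> s) < min d1 d2"
    using s ctrls_in[OF \<alpha> s(1)] ctrls_in[OF \<beta> s(1)] c[OF s(1)] by (auto simp: R_def dist_Pair_Pair)
   then show "norm (FF \<beta> s z - FF \<alpha> s z) \<le> \<epsilon>" "norm (LL \<beta> s z - LL \<alpha> s z) \<le> \<epsilon>"
    using d1(2)[of "(z, \<alpha> s)" "(z, \<beta> s)"] d2(2)[of "(z, \<alpha> s)" "(z, \<beta> s)"]
    by (auto simp: FF_def LL_def dist_norm)
  qed
  from flow_rc_perturb[OF adm_ctrl[OF \<beta>] adm_ctrl[OF \<alpha>] S order_refl order_refl this less_imp_le[OF \<epsilon>(3)]]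
  have "norm (traj \<beta> x S - traj \<alpha> x S) \<le> D \<epsilon>" "\<bar>run \<beta> x S - run \<alpha> x S\<bar> \<le> (L R * D \<epsilon> + \<epsilon>) * S"
   unfolding D_def R_def by simp_all
  then show "dist (traj \<beta> x S) (traj \<alpha> x S) < e \<and> \<bar>run \<beta> x S - run \<alpha> x S\<bar> < e"
   using \<epsilon> by (simp add: dist_norm)
 qed
qed

end

locale cone_target = cone_system A f f_inf l l_inf q M B L C1 C2
 for A :: "(real^'m) set" and f f_inf :: "real^'n \<Rightarrow> real^'m \<Rightarrow> real^'n"
  and l l_inf :: "real^'n \<Rightarrow> real^'m \<Rightarrow> real" and q :: nat
  and M :: real and B L :: "real \<Rightarrow> real" and C1 C2 :: real +
 fixes T :: "(real^'n) set"
 assumes T: "closed T" "T \<noteq> {}" "compact (frontier T)"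
  and value_T: "x \<in> T ==> value_fun A f l q x = 0"
  and value_frontier_T: "x \<in> frontier T ==> (value_fun A f l q \<longlongrightarrow> 0) (at x)"
  and approach: "V x < \<infinity> ==> \<exists>\<epsilon>>0. \<forall>\<alpha>\<in>ctrls. J \<alpha> x \<le> V x + ereal \<epsilon> \<longrightarrow>
   Liminf at_top (\<lambda>t. ereal (infdist (traj \<alpha> x t) T)) = 0"
begin

sublocale csys_vec_target K' f' l' "2 * M" "\<lambda>R. 2 * B R" "\<lambda>R. 2 * L R" T
proof unfold_locales
 show "V x = 0" if "x \<in> T" for x using V_le_value_fun[of x] value_T[OF that] V_nonneg[of x] by simp
 show "(V \<longlongrightarrow> 0) (at x)" if "x \<in> frontier T" for x
  by (rule tendsto_sandwich[OF _ _ tendsto_const value_frontier_T[OF that]])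
    (simp_all add: V_nonneg V_le_value_fun)
qed (rule T approach | assumption)+

text \<open>A near-optimal extended trajectory reaches a small neighbourhood of \<open>T\<close>, from where the
  original problem is cheap. Up to that time its control is shrunk slightly, so that the time
  component stays away from \<open>0\<close>.\<close>

lemma value_fun_le_V: "value_fun A f l q x \<le> V x"
proof (rule ereal_le_epsilon2)
 fix e' :: real assume "0 < e'"
 \<comment> \<open>One third each for the almost optimal extended control, the effect of shrinking
   it, and the original control used near the target.\<close>
 define e where "e = e' / 3"
 have e: "0 < e" using \<open>0 < e'\<close> by (simp add: e_def)
 show "value_fun A f l q x \<le> V x + ereal e'"
 proof (cases "V x < \<infinity>")
  case False
  then show ?thesis by simp
 next
  case True
  obtain \<delta> where \<delta>: "0 < \<delta>" "\<And>z. infdist z T < \<delta> ==> value_fun A f l q z < ereal e"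
   by (rule small_near_target[OF T, where u = "value_fun A f l q"]) (use value_T value_frontier_T e in auto)
  obtain \<alpha> S where \<alpha>: "\<alpha> \<in> ctrls" and S: "0 < S" and J: "J \<alpha> x \<le> V x + ereal e"
   and near: "infdist (traj \<alpha> x S) T < \<delta>" using reach_near[OF True e \<delta>(1)] by blast
  interpret adm "2 * M" "\<lambda>R. 2 * B R" "\<lambda>R. 2 * L R" "FF \<alpha>" "LL \<alpha>" by (rule adm_ctrl[OF \<alpha>])
  define g where "g = min e (\<delta> - infdist (traj \<alpha> x S) T)"
  have g: "0 < g" using e near by (simp add: g_def)
  obtain \<eta> where \<eta>: "0 < \<eta>" "\<And>\<beta>. \<beta> \<in> ctrls ==> (\<And>s. 0 \<le> s ==> dist (\<beta> s) (\<alpha> s) < \<eta>) ==>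
    dist (traj \<beta> x S) (traj \<alpha> x S) < g \<and> \<bar>run \<beta> x S - run \<alpha> x S\<bar> < g"
   using uniform_perturbation[OF \<alpha> less_imp_le[OF S] g, where x = x] by blast
  \<comment> \<open>The shrinking factor is below 1, so the time component becomes positive, and 1 -
    c < \<eta> keeps the control within the allowed perturbation.\<close>
  define c where "c = 1 - min 1 \<eta> / 2"
  have c: "0 \<le> c" "c < 1" "1 - c < \<eta>" using \<eta>(1) by (auto simp: c_def min_def)
  define \<beta> where "\<beta> s = c *\<^sub>R \<alpha> s" for s
  have n\<alpha>: "norm (\<alpha> s) \<le> 1" if "0 \<le> s" for s using ctrls_in[OF \<alpha> that] by (simp add: K'_def)
  have n\<beta>: "norm (\<beta> s) < 1" if "0 \<le> s" for s
   using mult_left_mono[OF n\<alpha>[OF that] c(1)] c by (simp add: \<beta>_def)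
  have "(\<lambda>a. c *\<^sub>R a) \<in> restrict_space borel K' \<rightarrow>\<^sub>M restrict_space borel K'"
  proof (rule measurable_restrict_space2)
   show "(\<lambda>a. c *\<^sub>R a) \<in> space (restrict_space borel K') \<rightarrow> K'"
    using c A_scale[OF c(1)] by (auto simp: K'_def space_restrict_space mult_le_one)
  qed (intro measurable_restrict_space1, simp)
  then have \<beta>: "\<beta> \<in> ctrls"
   using \<alpha> unfolding ctrls_def \<beta>_def[abs_def] by (rule measurable_compose[rotated])
  have "dist (\<beta> s) (\<alpha> s) < \<eta>" if "0 \<le> s" for s
  proof -
   have "\<beta> s - \<alpha> s = (c - 1) *\<^sub>R \<alpha> s" by (simp add: \<beta>_def algebra_simps)
   then have "dist (\<beta> s) (\<alpha> s) = (1 - c) * norm (\<alpha> s)" using c by (simp add: dist_norm)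
   also have "\<dots> \<le> 1 - c" using n\<alpha>[OF that] c by (simp add: mult_left_le)
   finally show ?thesis using c by simp
  qed
  from \<eta>(2)[OF \<beta> this] have d: "dist (traj \<beta> x S) (traj \<alpha> x S) < g" "run \<beta> x S \<le> run \<alpha> x S + e"
   by (auto simp: g_def)
  have "infdist (traj \<beta> x S) T \<le> infdist (traj \<alpha> x S) T + dist (traj \<beta> x S) (traj \<alpha> x S)"
   by (rule infdist_triangle)
  then have "infdist (traj \<beta> x S) T < \<delta>" using d(1) by (simp add: g_def)
  then obtain \<gamma> where \<gamma>: "\<gamma> \<in> controls A q" "cost f l {0..} (traj \<beta> x S) \<gamma> < ereal e"
   using \<delta>(2) unfolding value_fun_def INF_less_iff by blast
  obtain \<beta>' where \<beta>': "\<beta>' \<in> ctrls" "\<And>s. 0 \<le> s ==> norm (\<beta>' s) < 1"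
   "\<And>s. \<exists>t\<ge>0. s \<le> integral {0..t} (\<lambda>r. 1 - norm (\<beta>' r) ^ q)"
   "\<And>x. J \<beta>' x \<le> cost f l {0..} x \<gamma>" by (rule J_le_cost[OF \<gamma>(1)]) blast
  have S0: "0 \<le> S" using S by simp
  let ?\<kappa> = "cat S \<beta> \<beta>'"
  have \<kappa>: "?\<kappa> \<in> ctrls" by (rule ctrls_cat[OF \<beta> \<beta>'(1) S0])
  have n\<kappa>: "norm (?\<kappa> s) < 1" if "0 \<le> s" for s using that n\<beta> \<beta>'(2) by (simp add: cat_def)
  have i: "set_integrable lborel {0..t} (\<lambda>r. 1 - norm (\<omega> r) ^ q)" if \<omega>: "\<omega> \<in> ctrls" "\<And>s. 0 \<le> s ==> norm (\<omega> s) < 1" for \<omega> t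
  proof (rule bounded_set_integrable[where B = 1])
   have "\<omega> \<in> borel_measurable (restrict_space borel {0..})"
    using \<omega>(1) by (simp add: ctrls_def measurable_restrict_space2_iff)
   then have "(\<lambda>r. 1 - norm (\<omega> r) ^ q) \<in> borel_measurable (restrict_space borel {0..})" by measurable
   then have "set_borel_measurable borel {0..} (\<lambda>r. 1 - norm (\<omega> r) ^ q)"
    unfolding set_borel_measurable_def by (subst (asm) borel_measurable_restrict_space_iff) auto
   then show "set_borel_measurable borel {0..t} (\<lambda>r. 1 - norm (\<omega> r) ^ q)"
    by (rule set_borel_measurable_sub) auto
   show "norm (1 - norm (\<omega> s) ^ q) \<le> 1" if "s \<in> {0..t}" for s
    using \<omega>(2)[of s] that power_le_one[of "norm (\<omega> s)" q] by auto
  qed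
  have inf: "\<exists>t\<ge>0. s \<le> integral {0..t} (\<lambda>r. 1 - norm (?\<kappa> r) ^ q)" for s
  proof -
   obtain t where t: "0 \<le> t" "s \<le> integral {0..t} (\<lambda>r. 1 - norm (\<beta>' r) ^ q)" using \<beta>'(3) by blast
   have "integral {0..t} (\<lambda>r. 1 - norm (\<beta>' r) ^ q) = integral {S..S + t} (\<lambda>r. 1 - norm (\<beta>' (r - S)) ^ q)"
    using integral_shift_real[OF i[where t = t, OF \<beta>'(1,2)], of S] by (simp add: add.commute)
   also have "\<dots> = integral {S..S + t} (\<lambda>r. 1 - norm (?\<kappa> r) ^ q)"
    by (rule HK_integral_cong) (simp add: cat_def)
   also have "\<dots> \<le> integral {0..S + t} (\<lambda>r. 1 - norm (?\<kappa> r) ^ q)"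
   proof -
    have a: "(\<lambda>r. 1 - norm (?\<kappa> r) ^ q) integrable_on {0..S + t}"
     by (rule set_integrable_imp_HK(1)[OF i[OF \<kappa> n\<kappa>]])
    then have b: "(\<lambda>r. 1 - norm (?\<kappa> r) ^ q) integrable_on {S..S + t}"
     by (rule integrable_on_subinterval) (use S in auto)
    have n0: "0 \<le> 1 - norm (?\<kappa> r) ^ q" if "r \<in> {0..S + t}" for r
     using n\<kappa>[of r] that by (simp add: power_le_one)
    have sb: "{S..S + t} \<subseteq> {0..S + t}" using S by auto
    show ?thesis by (rule integral_subset_le[OF sb b a]) (rule ballI, rule n0)
   qed
   finally have "s \<le> integral {0..S + t} (\<lambda>r. 1 - norm (?\<kappa> r) ^ q)" by (rule order_trans[OF t(2)])
   moreover have "0 \<le> S + t" using t(1) S by simp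
   ultimately show ?thesis by blast
  qed
  have "value_fun A f l q x \<le> J ?\<kappa> x" by (rule extended_to_original[OF \<kappa> n\<kappa> inf])
  also have "\<dots> = ereal (run \<beta> x S) + J \<beta>' (traj \<beta> x S)" by (rule cat_props(5)[OF \<beta> \<beta>'(1) S0])
  also have "\<dots> \<le> ereal (run \<alpha> x S + e) + ereal e"
   using \<beta>'(4)[of "traj \<beta> x S"] \<gamma>(2) d(2) by (intro add_mono) auto
  also have "\<dots> = ereal (run \<alpha> x S) + ereal (2 * e)" by simp
  also have "\<dots> \<le> (V x + ereal e) + ereal (2 * e)"
   by (intro add_right_mono order_trans[OF rc_le_pcost[OF S0] J])
  also have "\<dots> = V x + ereal e'" by (cases "V x") (auto simp: e_def)
  finally show ?thesis .
 qed
qed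

lemma value_fun_eq_V: "value_fun A f l q = V"
 using V_le_value_fun value_fun_le_V by (intro ext antisym)

end

section \<open>Controls in the box\<close>

lemma borel_measurable_fst_snd:
 fixes d :: "real \<Rightarrow> 'a::euclidean_space \<times> 'b::euclidean_space"
 assumes "d \<in> borel_measurable borel"
 shows "(\<lambda>s. fst (d s)) \<in> borel_measurable borel" "(\<lambda>s. snd (d s)) \<in> borel_measurable borel"
 by (rule measurable_compose[OF assms borel_measurable_continuous_onI]; intro continuous_intros)+

context cone_system
begin

lemma ext_0: "fe x (0, 0) = 0" "le x (0, 0) = 0"
 using fe_growth[OF order_refl A_0, of x] le_bound[OF order_refl A_0 order_refl, of x] le_nonneg[OF order_refl A_0, of x] q
 by (auto simp: zero_power)

text \<open>By homogeneity a box control acts like a normalized control at speed \<rho>. If \<rho> =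
  0, the convention for division gives v = 0, and both sides vanish.\<close>

lemma normalize:
 assumes d: "(w0, w) \<in> Bx"
 defines "\<rho> \<equiv> w0 ^ q + norm w ^ q"
 defines "v \<equiv> w /\<^sub>R root q \<rho>"
 shows "v \<in> K'" "fe x (w0, w) = \<rho> *\<^sub>R f' x v" "le x (w0, w) = \<rho> * l' x v"
proof -
 note s = Bx_sum[OF d, folded \<rho>_def]
 have "v \<in> K' \<and> fe x (w0, w) = \<rho> *\<^sub>R f' x v \<and> le x (w0, w) = \<rho> * l' x v"
 proof (cases "\<rho> = 0")
  case True
  then have "w0 ^ q = 0" "norm w ^ q = 0"
   using s zero_le_power[of w0 q] zero_le_power[of "norm w" q] by (auto simp: \<rho>_def add_nonneg_eq_0_iff)
  then have "w0 = 0" "w = 0" using q by auto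
  then show ?thesis using True A_0 by (simp add: v_def K'_def ext_0)
 next
  case False
  then have r: "0 < root q \<rho>" "root q \<rho> ^ q = \<rho>" using s q by (auto simp: real_root_gt_zero)
  define w0' where "w0' = w0 / root q \<rho>"
  have eq: "w0 = root q \<rho> * w0'" "w = root q \<rho> *\<^sub>R v" using r by (simp_all add: w0'_def v_def)
  have n: "w0' ^ q = w0 ^ q / \<rho>" "norm v ^ q = norm w ^ q / \<rho>"
   using r by (simp_all add: w0'_def v_def power_divide power_mult_distrib power_inverse divide_inverse)
  have vA: "v \<in> A" "0 \<le> w0'" unfolding v_def w0'_def using s r by (auto intro!: A_scale)
  have "w0' ^ q + norm v ^ q = \<rho> / \<rho>" unfolding n \<rho>_def by (rule add_divide_distrib[symmetric])
  then have "(w0', v) \<in> ext_set A q" using vA False by (simp add: ext_set_def)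
  then have \<sigma>: "v \<in> K'" "\<sigma> v = (w0', v)" using \<sigma>_snd[of "(w0', v)"] by auto
  have "fe x (w0, w) = \<rho> *\<^sub>R f' x v" "le x (w0, w) = \<rho> * l' x v"
   using fe_scale[OF vA(2,1) r(1), of x] le_scale[OF vA(2,1) r(1), of x] r(2)
   by (simp_all add: f'_def l'_def \<sigma>(2) flip: eq)
  then show ?thesis using \<sigma> by blast
 qed
 then show "v \<in> K'" "fe x (w0, w) = \<rho> *\<^sub>R f' x v" "le x (w0, w) = \<rho> * l' x v" by blast+
qed

text \<open>Time change with the speed from \<open>normalize\<close>. While the speed is 0 the box
  trajectory stands still, and such periods disappear in the new time.\<close>

lemma box_to_ball:
 assumes d: "d \<in> borel_measurable borel" "\<And>s. d s \<in> Bx"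
 defines "\<rho> \<equiv> \<lambda>s. fst (d s) ^ q + norm (snd (d s)) ^ q"
 assumes inf: "\<And>s. \<exists>t\<ge>0. s \<le> integral {0..t} \<rho>"
 obtains \<beta> \<Theta> where "\<beta> \<in> ctrls" "\<And>t. 0 \<le> \<Theta> t" "\<And>s. \<exists>t\<ge>0. s \<le> \<Theta> t"
  "\<And>x t. 0 \<le> t ==> bx.traj d x t = traj \<beta> x (\<Theta> t)" "\<And>x t. 0 \<le> t ==> bx.run d x t = run \<beta> x (\<Theta> t)"
proof -
 have b: "0 \<le> \<rho> s" "\<rho> s \<le> 2" for s
  using Bx_sum[of "fst (d s)" "snd (d s)"] d(2)[of s] by (auto simp: \<rho>_def)
 have \<rho>m: "\<rho> \<in> borel_measurable borel" unfolding \<rho>_def using borel_measurable_fst_snd[OF d(1)] by measurable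
 interpret time_change \<rho>
 proof
  show "set_integrable lborel {0..t} \<rho>" for t
   by (rule bounded_set_integrable[where B = 2]) (use \<rho>m b in \<open>auto simp: set_borel_measurable_def\<close>)
 qed (rule \<rho>m b inf)+
 define v where "v s = snd (d s) /\<^sub>R root q (\<rho> s)" for s
 have nv: "v s \<in> K'" "fe z (d s) = \<rho> s *\<^sub>R f' z (v s)" "le z (d s) = \<rho> s * l' z (v s)" for s z
  using normalize[of "fst (d s)" "snd (d s)"] d(2)[of s] by (auto simp: v_def \<rho>_def)
 have vm: "v \<in> borel_measurable borel"
 proof -
  have "(\<lambda>s. root q (\<rho> s)) \<in> borel_measurable borel"
   by (rule measurable_compose[OF \<rho>m borel_measurable_continuous_onI]) (intro continuous_intros)
  then show ?thesis unfolding v_def[abs_def] using borel_measurable_fst_snd[OF d(1)] by measurable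
 qed
 define \<beta> where "\<beta> s = v (\<tau> s)" for s
 have \<beta>m: "\<beta> \<in> borel_measurable borel" unfolding \<beta>_def[abs_def] by (rule measurable_compose[OF \<tau>_measurable vm])
 have \<beta>: "\<beta> \<in> ctrls" unfolding ctrls_def
  by (intro measurable_restrict_space1 measurable_restrict_space2) (use \<beta>m nv in \<open>auto simp: \<beta>_def\<close>)
 have dc: "d \<in> bx.ctrls"
  unfolding bx.ctrls_def by (intro measurable_restrict_space1 measurable_restrict_space2) (use d in auto)
 interpret adm "2 * M" "\<lambda>R. 2 * B R" "\<lambda>R. 2 * L R" "FF \<beta>" "LL \<beta>" by (rule adm_ctrl[OF \<beta>])
 interpret b: adm "2 * M" "\<lambda>R. 2 * B R" "\<lambda>R. 2 * L R" "bx.FF d" "bx.LL d" by (rule bx.adm_ctrl[OF dc])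
 have \<Theta>c: "continuous_on {0..t} (\<lambda>r. traj \<beta> x (\<Theta> r))" for x t
  by (rule continuous_on_compose2[OF continuous_on_atLeast[OF flow_continuous] \<Theta>_continuous]) (use \<Theta>_nonneg in auto)
 have tr: "bx.traj d x t = traj \<beta> x (\<Theta> t)" if t: "0 \<le> t" for x t
 proof -
  have "AE r in lborel. 0 \<le> r \<longrightarrow> r \<le> t \<longrightarrow> bx.FF d r (traj \<beta> x (\<Theta> r)) = \<rho> r *\<^sub>R FF \<beta> (\<Theta> r) (traj \<beta> x (\<Theta> r))"
   using \<tau>_\<Theta>_AE by eventually_elim (auto simp: FF_def bx.FF_def \<beta>_def nv)
  then have "solon t (bx.FF d) x (\<lambda>r. traj \<beta> x (\<Theta> r))"
   by (intro solon_forward[OF flow_solon t]) (intro set_borel_measurable_sub[OF lfield_measurable_comp[OF b.F \<Theta>c]], auto)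
  then show ?thesis by (rule flow_eqI[OF b.F b.lg _ t order_refl])
 qed
 have rn: "bx.run d x t = run \<beta> x (\<Theta> t)" if t: "0 \<le> t" for x t
 proof -
  have s: "solon (\<Theta> t) (\<lambda>s _. LL \<beta> s (traj \<beta> x s)) 0 (run \<beta> x)"
   unfolding solon_def rc_def using ell_integrable by auto
  have "AE r in lborel. 0 \<le> r \<longrightarrow> r \<le> t \<longrightarrow> bx.LL d r (traj \<beta> x (\<Theta> r)) = \<rho> r *\<^sub>R LL \<beta> (\<Theta> r) (traj \<beta> x (\<Theta> r))"
   using \<tau>_\<Theta>_AE by eventually_elim (auto simp: LL_def bx.LL_def \<beta>_def nv)
  from s t _ this have "solon t (\<lambda>r _. bx.LL d r (traj \<beta> x (\<Theta> r))) 0 (\<lambda>r. run \<beta> x (\<Theta> r))"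
   by (rule solon_forward) (intro lfield_measurable_comp[OF b.ell \<Theta>c], simp)
  then have "run \<beta> x (\<Theta> t) = integral {0..t} (\<lambda>r. bx.LL d r (traj \<beta> x (\<Theta> r)))"
   using solonD(2)[OF _ t order_refl] by fastforce
  also have "\<dots> = bx.run d x t" unfolding rc_def by (rule HK_integral_cong) (simp add: tr)
  finally show ?thesis by simp
 qed
 show ?thesis by (rule that[OF \<beta> \<Theta>_nonneg \<Theta>_unbounded]) (erule tr rn)+
qed

end

context cone_target
begin

text \<open>The bound below on the cost of a box control is affine in the time component \<open>w\<^sub>0\<^sup>q\<close>, hence
  passes to weak limits; it ensures that limits of controls still run over an infinite time.\<close>

lemma closure_if_convex_ext:
 assumes conv: "\<And>x. x \<notin> T ==> convex {(v0, v, \<gamma>). \<exists>w0\<in>{0..1}. \<exists>w\<in>cball 0 1 \<inter> A.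
   v0 = w0 ^ q \<and> v = fe x (w0, w) \<and> le x (w0, w) \<le> \<gamma>}"
  and \<alpha>: "\<And>n. \<alpha> n \<in> ctrls" and xs: "xs \<longlonglongrightarrow> x"
  and cn: "\<And>n. run (\<alpha> n) (xs n) (real n) \<le> c n" and c: "c \<longlonglongrightarrow> cl"
 shows "V x \<le> ereal cl"
proof -
 \<comment> \<open>The power of the time component is recorded with the velocity, as in the
   convexity condition, so that the bound in \<open>m\<close> below is affine in the recorded
   data.\<close>
 define e where "e x d = (fst d ^ q, fe x d)" for x and d :: "real \<times> (real^'m)"
 \<comment> \<open>For normalized controls |w|^q = 1 - w0^q turns the coercivity bound into
   \<open>C2 - (C1 + C2) * w0 ^ q\<close>, so there \<open>m\<close> equals the cost; on the rest of
   the box the bound is imposed.\<close>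
 define m where "m x d = max (le x d) (C2 - (C1 + C2) * fst d ^ q)" for x and d :: "real \<times> (real^'m)"
 define eK where "eK x w = (1 - norm w ^ q, f' x w)" for x w
 interpret cc: csys_convex K' f' l' "2 * M" "\<lambda>R. 2 * B R" "\<lambda>R. 2 * L R" Bx e m eK snd T
 proof unfold_locales
  show "compact Bx" "Bx \<noteq> {}" by (rule bx.K)+
  show "continuous_on (UNIV \<times> Bx) (\<lambda>(x, d). e x d)"
   using bx.f_cont unfolding e_def case_prod_unfold by (intro continuous_intros)
  show "continuous_on (UNIV \<times> Bx) (\<lambda>(x, d). m x d)"
   using bx.l_cont unfolding m_def case_prod_unfold by (intro continuous_intros)
  show "0 \<le> m x d" if "d \<in> Bx" for x d using bx.l_nonneg[OF that, of x] by (simp add: m_def)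
  show "continuous_on (UNIV \<times> K') (\<lambda>(x, a). eK x a)"
   using csys.f_cont[OF csys_ball] unfolding eK_def case_prod_unfold by (intro continuous_intros)
  show "snd (eK x a) = f' x a" for x a by (simp add: eK_def)
  show "convex {(\<epsilon>, \<gamma>). \<exists>d\<in>Bx. \<epsilon> = e x d \<and> m x d \<le> \<gamma>}" if "x \<notin> T" for x
  proof -
   \<comment> \<open>After regrouping coordinates, the set for \<open>e\<close> and \<open>m\<close>
     is the given convex set cut by the half-space C2 \<le> (C1 + C2) v0 + \<gamma>.\<close>
   let ?g = "\<lambda>z :: (real \<times> (real^'n)) \<times> real. (fst (fst z), snd (fst z), snd z)"
   have "linear ?g" by (rule linearI) auto
   from convex_linear_vimage[OF this conv[OF that]]
   have "convex (?g -` {(v0, v, \<gamma>). \<exists>w0\<in>{0..1}. \<exists>w\<in>cball 0 1 \<inter> A.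
     v0 = w0 ^ q \<and> v = fe x (w0, w) \<and> le x (w0, w) \<le> \<gamma>} \<inter> {z. C2 \<le> inner ((C1 + C2, 0), 1) z})"
    (is "convex ?S") by (rule convex_Int[OF _ convex_halfspace_ge])
   also have "?S = {(\<epsilon>, \<gamma>). \<exists>d\<in>Bx. \<epsilon> = e x d \<and> m x d \<le> \<gamma>}"
    by (force simp: e_def m_def Bx_def inner_prod_def)
   finally show ?thesis .
  qed
  show "\<exists>d\<in>Bx. eK x a = e x d \<and> m x d \<le> l' x a" if "a \<in> K'" for x a
  proof (intro bexI conjI)
   show s: "\<sigma> a \<in> Bx" by (rule \<sigma>_in(2)[OF that])
   have r: "root q (1 - norm a ^ q) ^ q = 1 - norm a ^ q" "0 \<le> root q (1 - norm a ^ q)"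
    using K'_norm[OF that] q by auto
   show "eK x a = e x (\<sigma> a)" using r by (simp add: eK_def e_def f'_def \<sigma>_def)
   have "C2 * norm a ^ q - C1 * (1 - norm a ^ q) \<le> le x (\<sigma> a)"
    using le_coercive[OF r(2), of a x] that r(1) by (simp add: \<sigma>_def K'_def)
   moreover have fq: "fst (\<sigma> a) ^ q = 1 - norm a ^ q" using r(1) by (simp add: \<sigma>_def)
   have "C2 - (C1 + C2) * fst (\<sigma> a) ^ q = C2 * norm a ^ q - C1 * (1 - norm a ^ q)"
    unfolding fq by (simp add: algebra_simps)
   ultimately show "m x (\<sigma> a) \<le> l' x a" by (simp add: m_def l'_def)
  qed
 qed (rule snd_add snd_scaleR bounded_linear.bounded[OF bounded_linear_snd])+
 obtain y d where y0: "y 0 = x" and yc: "continuous_on {0..} y" and d: "d \<in> borel_measurable borel" "\<And>s. d s \<in> Bx"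
  and sol: "\<And>t. 0 \<le> t ==> (\<And>s. 0 \<le> s ==> s < t ==> y s \<notin> T) ==> solon t (\<lambda>s z. fe z (d s)) x y \<and>
    set_integrable lborel {0..t} (\<lambda>s. m (y s) (d s)) \<and> integral {0..t} (\<lambda>s. m (y s) (d s)) \<le> cl"
  using cc.closure_control[where \<alpha> = \<alpha> and xs = xs and c = c, OF \<alpha> xs cn c] by (auto simp: e_def)
 have run_le: "bx.traj d' x t = y t \<and> bx.run d' x t \<le> cl"
  if d': "d' \<in> bx.ctrls" "\<And>s. 0 \<le> s ==> s \<le> t ==> d' s = d s" and t: "0 \<le> t"
   and out: "\<And>s. 0 \<le> s ==> s < t ==> y s \<notin> T" for d' t
 proof -
  interpret b: adm "2 * M" "\<lambda>R. 2 * B R" "\<lambda>R. 2 * L R" "bx.FF d'" "bx.LL d'" by (rule bx.adm_ctrl[OF d'(1)])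
  note s = sol[OF t out]
  have "solon t (bx.FF d') x y"
   using conjunct1[OF s] by (rule solon_cong[THEN iffD1, rotated -1]) (auto simp: bx.FF_def d'(2))
  then have tr: "bx.traj d' x r = y r" if "0 \<le> r" "r \<le> t" for r
   using flow_eqI[OF b.F b.lg _ that] by blast
  have "bx.run d' x t \<le> integral {0..t} (\<lambda>s. m (y s) (d s))" unfolding rc_def
  proof (rule integral_le)
   show "(\<lambda>s. bx.LL d' s (bx.traj d' x s)) integrable_on {0..t}" by (rule b.ell_integrable_HK) simp
   show "(\<lambda>s. m (y s) (d s)) integrable_on {0..t}" using s set_integrable_imp_HK(1) by blast
   show "bx.LL d' r (bx.traj d' x r) \<le> m (y r) (d r)" if "r \<in> {0..t}" for r
    using that by (simp add: bx.LL_def tr d'(2) m_def)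
  qed
  then show ?thesis using s tr[OF t order_refl] by linarith
 qed
 show ?thesis
 proof (cases "\<exists>t\<ge>0. y t \<in> T")
  case False
  then have out: "0 \<le> s ==> y s \<notin> T" for s by blast
  have dc: "d \<in> bx.ctrls"
   unfolding bx.ctrls_def by (intro measurable_restrict_space1 measurable_restrict_space2) (use d in auto)
  let ?\<rho> = "\<lambda>s. fst (d s) ^ q + norm (snd (d s)) ^ q"
  have bd: "0 \<le> fst (d s) \<and> fst (d s) \<le> 1 \<and> norm (snd (d s)) \<le> 1" for s using d(2)[of s] by (auto simp: Bx_def)
  have inf: "\<exists>t\<ge>0. s \<le> integral {0..t} ?\<rho>" for s
  proof -
   \<comment> \<open>At this time the cost bound \<open>cl\<close> forces the integral of the time
     component to be at least s, because C2 t - (C1 + C2) times that integral is at most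
     \<open>cl\<close>.\<close>
   define t where "t = max 0 ((cl + (C1 + C2) * s) / C2)"
   have t: "0 \<le> t" "cl + (C1 + C2) * s \<le> C2 * t" using C2 by (auto simp: t_def max_def field_simps)
   have wi: "(\<lambda>s. fst (d s) ^ q) integrable_on {0..t}"
    by (rule set_integrable_imp_HK(1), rule bounded_set_integrable[where B = 1])
      (use borel_measurable_fst_snd[OF d(1)] bd in \<open>auto simp: set_borel_measurable_def power_le_one\<close>)
   have vi: "?\<rho> integrable_on {0..t}"
    by (rule set_integrable_imp_HK(1), rule bounded_set_integrable[where B = 2])
      (use borel_measurable_fst_snd[OF d(1)] d(2) Bx_sum[of "fst (d s)" "snd (d s)" for s] in \<open>auto simp: set_borel_measurable_def\<close>)
   have ci: "(\<lambda>s. C2 - (C1 + C2) * fst (d s) ^ q) integrable_on {0..t}"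
    by (intro HK_integrable_diff integrable_const_ivl integrable_on_mult_right wi)
   have "integral {0..t} (\<lambda>s. C2 - (C1 + C2) * fst (d s) ^ q) \<le> integral {0..t} (\<lambda>s. m (y s) (d s))"
    by (rule integral_le[OF ci]) (use sol[OF t(1)] out set_integrable_imp_HK(1) in \<open>auto simp: m_def\<close>)
   also have "\<dots> \<le> cl" using sol[OF t(1)] out by blast
   finally have "integral {0..t} (\<lambda>s. C2 - (C1 + C2) * fst (d s) ^ q) \<le> cl" .
   moreover have "integral {0..t} (\<lambda>s. C2 - (C1 + C2) * fst (d s) ^ q) = C2 * t - (C1 + C2) * integral {0..t} (\<lambda>s. fst (d s) ^ q)"
    using wi t(1) by (subst HK_integral_diff) (auto intro!: integrable_on_mult_right)
   ultimately have "(C1 + C2) * s \<le> (C1 + C2) * integral {0..t} (\<lambda>s. fst (d s) ^ q)" using t(2) by linarith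
   then have "s \<le> integral {0..t} (\<lambda>s. fst (d s) ^ q)" using C1 C2 by (simp add: mult_le_cancel_left)
   also have "\<dots> \<le> integral {0..t} ?\<rho>" by (rule integral_le[OF wi vi]) simp
   finally show ?thesis using t(1) by blast
  qed
  show ?thesis
  proof (rule box_to_ball[OF d inf])
   fix \<beta> \<Theta>
   assume \<beta>: "\<beta> \<in> ctrls" and u: "\<And>s. \<exists>t\<ge>0. s \<le> \<Theta> t"
    and rn: "\<And>x t. 0 \<le> t ==> bx.run d x t = run \<beta> x (\<Theta> t)"
   interpret adm "2 * M" "\<lambda>R. 2 * B R" "\<lambda>R. 2 * L R" "FF \<beta>" "LL \<beta>" by (rule adm_ctrl[OF \<beta>])
   have "run \<beta> x s \<le> cl" if "0 \<le> s" for s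
   proof -
    obtain t where t: "0 \<le> t" "s \<le> \<Theta> t" using u by blast
    have "run \<beta> x s \<le> bx.run d x t" unfolding rn[OF t(1)] by (rule rc_mono[OF that t(2)])
    also have "\<dots> \<le> cl" using run_le[OF dc _ t(1)] out by blast
    finally show ?thesis .
   qed
   then have "J \<beta> x \<le> ereal cl" by (simp add: pcost_le_iff)
   then show ?thesis using V_le_J[OF \<beta>, of x] by (rule order_trans[rotated])
  qed
 next
  case True
  then have "{0..} \<inter> y -` T \<noteq> {}" by auto
  moreover have "closed ({0..} \<inter> y -` T)" using continuous_closed_preimage[OF yc _ T(1)] by simp
  moreover have bb: "bdd_below ({0..} \<inter> y -` T)" by (rule bdd_belowI[of _ 0]) auto
  ultimately have ts: "Inf ({0..} \<inter> y -` T) \<in> {0..} \<inter> y -` T" by (intro closed_contains_Inf)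
  \<comment> \<open>The first hitting time of T. Up to it the limit control obeys the cost bound,
    and from there on the value is 0.\<close>
  define t where "t = Inf ({0..} \<inter> y -` T)"
  have t: "0 \<le> t" "y t \<in> T" using ts by (auto simp: t_def)
  have out: "y s \<notin> T" if "0 \<le> s" "s < t" for s
   using cInf_lower[OF _ bb, of s] that unfolding t_def by auto
  \<comment> \<open>After the hitting time the control (1, 0) is a filler of speed 1, which makes
    the total integral of the speed infinite as \<open>box_to_ball\<close> requires.\<close>
  define d' where "d' s = (if s \<le> t then d s else (1, 0))" for s
  have d': "d' \<in> borel_measurable borel" "d' s \<in> Bx" for s
   unfolding d'_def using d A_0 by (auto simp: Bx_def intro!: measurable_If)
  have dc: "d' \<in> bx.ctrls"
   unfolding bx.ctrls_def by (intro measurable_restrict_space1 measurable_restrict_space2) (use d' in auto)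
  let ?\<rho> = "\<lambda>s. fst (d' s) ^ q + norm (snd (d' s)) ^ q"
  have inf: "\<exists>r\<ge>0. s \<le> integral {0..r} ?\<rho>" for s
  proof -
   define r where "r = t + max 0 s"
   have r: "t \<le> r" "s \<le> r - t" by (auto simp: r_def)
   have i: "?\<rho> integrable_on {0..r}"
    by (rule set_integrable_imp_HK(1), rule bounded_set_integrable[where B = 2])
      (use borel_measurable_fst_snd[OF d'(1)] d'(2) Bx_sum[of "fst (d' s)" "snd (d' s)" for s] in \<open>auto simp: set_borel_measurable_def\<close>)
   have i': "?\<rho> integrable_on {t..r}" by (rule integrable_on_subinterval[OF i]) (use t in auto)
   have "integral {t..r} ?\<rho> = integral {t..r} (\<lambda>_. 1)"
    by (rule integral_spike[of "{t}"]) (use q in \<open>auto simp: d'_def zero_power\<close>)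
   then have "s \<le> integral {t..r} ?\<rho>" using r by simp
   also have "\<dots> \<le> integral {0..r} ?\<rho>"
    by (rule integral_subset_le[OF _ i' i]) (use t Bx_sum[of "fst (d' s)" "snd (d' s)" for s] d' in auto)
   finally show ?thesis using r t by (intro exI[of _ r]) simp
  qed
  show ?thesis
  proof (rule box_to_ball[OF d' inf])
   fix \<beta> \<Theta>
   assume \<beta>: "\<beta> \<in> ctrls" and u: "\<And>t. 0 \<le> \<Theta> t"
    and tr: "\<And>x t. 0 \<le> t ==> bx.traj d' x t = traj \<beta> x (\<Theta> t)"
    and rn: "\<And>x t. 0 \<le> t ==> bx.run d' x t = run \<beta> x (\<Theta> t)"
   have "bx.traj d' x t = y t \<and> bx.run d' x t \<le> cl"
    by (rule run_le[OF dc _ t(1) out]) (auto simp: d'_def)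
   then have "traj \<beta> x (\<Theta> t) = y t" "run \<beta> x (\<Theta> t) \<le> cl" unfolding tr[OF t(1)] rn[OF t(1)] by auto
   then show ?thesis using V_dpp_le[OF \<beta> u, of x t] V_T[OF t(2)] by (simp add: order_trans)
  qed
 qed
qed

end

section \<open>Characterization of the value function\<close>

text \<open>The p-th power is absorbed through 1 + |a|^p \<le> 2 (1 + |a|^q), and the linear form of
  the modulus supplies the Lipschitz constant of the cost.\<close>

lemma standing_bounds:
 fixes A :: "(real^'m) set" and f f_inf :: "real^'n \<Rightarrow> real^'m \<Rightarrow> real^'n" and l l_inf :: "real^'n \<Rightarrow> real^'m \<Rightarrow> real"
 assumes "standing_assumptions A f l f_inf l_inf p q \<omega>"
 obtains M B L where "data_bounds A f l q M B L"
proof -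
 obtain L B M where sb: "structural_bounds A f l p q L B \<omega>"
  and M: "0 < M" "\<And>x a. a \<in> A ==> norm (f x a) \<le> M * (1 + norm a ^ p) * (1 + norm x)"
  and w: "\<And>R. 0 < R ==> \<exists>Lb>0. \<forall>r\<ge>0. \<omega> r R = Lb * r" and pq: "p \<le> q"
  using assms unfolding standing_assumptions_def by metis
 obtain Lb where Lb: "\<And>R. 0 < R ==> 0 < Lb R" "\<And>R r. 0 < R ==> 0 \<le> r ==> \<omega> r R = Lb R * r"
  using w by metis
 \<comment> \<open>The structural bounds concern positive radii only; enlarging the radius to at
   least 1 gives constants for every real R.\<close>
 define R1 where "R1 R = max R 1" for R :: real
 have R1: "0 < R1 R" "R \<le> R1 R" for R by (auto simp: R1_def)
 note sb = sb[unfolded structural_bounds_def]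
 have LB: "0 < L (R1 R)" "0 < B (R1 R)" for R using sb R1 by blast+
 have fl: "norm (f x a - f y a) \<le> L R * (1 + norm a ^ p) * norm (x - y)"
  and ll: "\<bar>l x a - l y a\<bar> \<le> (1 + norm a ^ q) * \<omega> (norm (x - y)) R"
  if "0 < R" "a \<in> A" "norm x \<le> R" "norm y \<le> R" for R a x y using sb that by blast+
 have lb: "0 \<le> l x a" "l x a \<le> B R * (1 + norm a ^ q)" if "0 < R" "a \<in> A" "norm x \<le> R" for R a x
  using sb that by blast+
 have pw: "1 + norm a ^ p \<le> 2 * (1 + norm a ^ q)" for a :: "real^'m"
 proof (cases "norm a \<le> 1")
  case True
  then have "norm a ^ p \<le> 1" by (simp add: power_le_one)
  then show ?thesis using zero_le_power[OF norm_ge_zero, of a q] by argo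
 next
  case False
  then have "norm a ^ p \<le> norm a ^ q" using pq by (intro power_increasing) auto
  then show ?thesis using zero_le_power[OF norm_ge_zero, of a q] by argo
 qed
 have N0: "0 \<le> 1 + norm a ^ q" for a :: "real^'m" by simp
 have g: "norm (f x a) \<le> (2 * M) * (1 + norm a ^ q) * (1 + norm x)" if "a \<in> A" for a x
 proof -
  have "M * (1 + norm a ^ p) * (1 + norm x) \<le> M * (2 * (1 + norm a ^ q)) * (1 + norm x)"
   using M(1) pw by (intro mult_right_mono mult_left_mono) auto
  then show ?thesis using M(2)[OF that, of x] by (simp add: ac_simps)
 qed
 show ?thesis
 proof (rule that[of "2 * M" "\<lambda>R. (2 * M) * (1 + R1 R) + B (R1 R)" "\<lambda>R. 2 * L (R1 R) + Lb (R1 R)"], unfold_locales)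
  show "0 \<le> 2 * M" using M(1) by simp
  show "0 \<le> 2 * L (R1 R) + Lb (R1 R)" for R using LB(1)[of R] Lb(1)[OF R1(1)] by (simp add: add_nonneg_nonneg less_imp_le)
  show "norm (f x a) \<le> 2 * M * (1 + norm a ^ q) * (1 + norm x)" if "a \<in> A" for a x by (rule g[OF that])
  fix a :: "real^'m" and x :: "real^'n" and R :: real assume a: "a \<in> A" and x: "norm x \<le> R"
  have x': "norm x \<le> R1 R" using x R1(2)[of R] by linarith
  have "(2 * M) * (1 + norm a ^ q) * (1 + norm x) \<le> (2 * M) * (1 + norm a ^ q) * (1 + R1 R)"
   using x' M(1) N0[of a] by (intro mult_left_mono) auto
  also have "\<dots> = (2 * M) * (1 + R1 R) * (1 + norm a ^ q)" by simp
  also have "\<dots> \<le> ((2 * M) * (1 + R1 R) + B (R1 R)) * (1 + norm a ^ q)"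
   using LB(2)[of R] N0[of a] by (intro mult_right_mono) auto
  finally show "norm (f x a) \<le> ((2 * M) * (1 + R1 R) + B (R1 R)) * (1 + norm a ^ q)" using g[OF a, of x] by simp
  have "B (R1 R) * (1 + norm a ^ q) \<le> ((2 * M) * (1 + R1 R) + B (R1 R)) * (1 + norm a ^ q)"
   using M(1) R1(1)[of R] N0[of a] by (intro mult_right_mono) auto
  then show "l x a \<le> ((2 * M) * (1 + R1 R) + B (R1 R)) * (1 + norm a ^ q)"
   using lb(2)[OF R1(1) a x'] by simp
  fix y :: "real^'n" assume y: "norm y \<le> R"
  have y': "norm y \<le> R1 R" using y R1(2)[of R] by linarith
  have "norm (f x a - f y a) \<le> L (R1 R) * (1 + norm a ^ p) * norm (x - y)" by (rule fl[OF R1(1) a x' y'])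
  also have "\<dots> \<le> L (R1 R) * (2 * (1 + norm a ^ q)) * norm (x - y)"
   using LB(1)[of R] pw by (intro mult_right_mono mult_left_mono) auto
  also have "\<dots> = 2 * L (R1 R) * (1 + norm a ^ q) * norm (x - y)" by simp
  also have "\<dots> \<le> (2 * L (R1 R) + Lb (R1 R)) * (1 + norm a ^ q) * norm (x - y)"
   using Lb(1)[OF R1(1), of R] N0[of a] by (intro mult_right_mono) auto
  finally show "norm (f x a - f y a) \<le> (2 * L (R1 R) + Lb (R1 R)) * (1 + norm a ^ q) * norm (x - y)" .
  have "\<bar>l x a - l y a\<bar> \<le> (1 + norm a ^ q) * (Lb (R1 R) * norm (x - y))"
   using ll[OF R1(1) a x' y'] Lb(2)[OF R1(1), of "norm (x - y)" R] by simp
  also have "\<dots> = Lb (R1 R) * (1 + norm a ^ q) * norm (x - y)" by simp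
  also have "\<dots> \<le> (2 * L (R1 R) + Lb (R1 R)) * (1 + norm a ^ q) * norm (x - y)"
   using LB(1)[of R] N0[of a] by (intro mult_right_mono) auto
  finally show "\<bar>l x a - l y a\<bar> \<le> (2 * L (R1 R) + Lb (R1 R)) * (1 + norm a ^ q) * norm (x - y)" .
 next
  show "0 \<le> l x a" if "a \<in> A" for a x
   by (rule lb(1)[of "norm x + 1"]) (use that in \<open>auto intro: add_nonneg_pos\<close>)
 qed
qed

section \<open>Translation to the notions of the statement\<close>

lemma csys_vec_values:
 fixes A :: "(real^'m) set" and f f_inf :: "real^'n \<Rightarrow> real^'m \<Rightarrow> real^'n" and l l_inf :: "real^'n \<Rightarrow> real^'m \<Rightarrow> real"
 assumes "csys_vec A f l M B L" and A: "compact A"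
 shows "controls A q = csys.ctrls A" "cost f l I x \<alpha> = pcost (csys.FF f \<alpha>) (csys.LL l \<alpha>) I x"
  "trajectory f x \<alpha> = flow (csys.FF f \<alpha>) x"
  "value_fun A f l q = csys.V A f l" "value_sup A f l q = csys.Sig A f l"
  "hamiltonian A f l f_inf l_inf q = csys.Ham A f l"
  "relaxed_value A f l f_inf l_inf q = csys_vec.Vrel A f l"
proof -
 interpret csys_vec A f l M B L by fact
 show c: "controls A q = ctrls" using A by (simp add: controls_def ctrls_def)
 show e: "cost f l I x \<alpha> = pcost (FF \<alpha>) (LL \<alpha>) I x" for I x \<alpha>
  by (simp add: cost_eq_pcost FF_def LL_def)
 show "trajectory f x \<alpha> = traj \<alpha> x" by (simp add: trajectory_eq_flow FF_def)
 show "value_fun A f l q = V" by (rule ext) (simp add: value_fun_def V_def c e)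
 show "value_sup A f l q = Sig" by (rule ext) (simp add: value_sup_def value_upto_def Sig_def c e)
 show "hamiltonian A f l f_inf l_inf q = Ham" by (intro ext) (simp add: hamiltonian_def Ham_def A)
 show "relaxed_value A f l f_inf l_inf q = Vrel"
  by (rule ext) (simp add: relaxed_value_def relaxed_base_def relaxed_fun_def A Vrel_def cost_eq_pcost
    relax_def Frel_def Lrel_def)
qed

context cone_system
begin

lemma ext_control:
 assumes "\<beta> \<in> ctrls"
 shows "(\<lambda>s. \<sigma> (\<beta> s)) \<in> ext_controls A q"
proof -
 have "\<sigma> \<in> restrict_space borel K' \<rightarrow>\<^sub>M restrict_space borel (ext_set A q)"
  by (intro measurable_restrict_space2 measurable_restrict_space1 borel_measurable_continuous_onI \<sigma>_cont)
    (auto simp: space_restrict_space \<sigma>_in)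
 from measurable_compose[OF _ this] show ?thesis
  using assms unfolding ext_controls_def ctrls_def by blast
qed

lemma ext_cost: "cost fe le I x (\<lambda>s. \<sigma> (\<beta> s)) = pcost (FF \<beta>) (LL \<beta>) I x"
 and ext_trajectory: "trajectory fe x (\<lambda>s. \<sigma> (\<beta> s)) = traj \<beta> x"
 by (simp_all add: cost_eq_pcost trajectory_eq_flow FF_def[abs_def] LL_def[abs_def] f'_def l'_def)

lemma ext_control_snd:
 assumes w: "w \<in> ext_controls A q"
 shows "(\<lambda>s. snd (w s)) \<in> ctrls" "cost fe le {0..} x w = J (\<lambda>s. snd (w s)) x"
proof -
 have m: "snd \<in> borel_measurable (borel :: (real \<times> (real^'m)) measure)"
  by (rule borel_measurable_continuous_onI) (intro continuous_intros)
 have "snd \<in> restrict_space borel (ext_set A q) \<rightarrow>\<^sub>M restrict_space borel K'"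
  by (intro measurable_restrict_space2 measurable_restrict_space1 m)
    (use \<sigma>_snd in \<open>auto simp: space_restrict_space\<close>)
 from measurable_compose[OF _ this] show "(\<lambda>s. snd (w s)) \<in> ctrls"
  using w unfolding ext_controls_def ctrls_def by blast
 have "w s \<in> ext_set A q" if "0 \<le> s" for s
  using w that unfolding ext_controls_def by (auto dest!: measurable_space simp: space_restrict_space)
 then have "\<sigma> (snd (w s)) = w s" if "0 \<le> s" for s using \<sigma>_snd that by blast
 then show "cost fe le {0..} x w = J (\<lambda>s. snd (w s)) x"
  unfolding ext_cost[symmetric] cost_eq_pcost by (intro pcost_cong) auto
qed

text \<open>Normalized extended controls and controls in \<open>K'\<close> correspond to each other
  through \<open>\<sigma>\<close> and \<open>snd\<close>, with equal costs.\<close>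

lemma ext_value_eq_V: "ext_value A f l f_inf l_inf q x = V x" unfolding ext_value_def V_def
proof (rule antisym)
 show "(INF w\<in>ext_controls A q. cost fe le {0..} x w) \<le> (INF \<alpha>\<in>ctrls. J \<alpha> x)"
  by (rule INF_mono) (metis ext_control ext_cost order_refl)
 show "(INF \<alpha>\<in>ctrls. J \<alpha> x) \<le> (INF w\<in>ext_controls A q. cost fe le {0..} x w)"
  by (rule INF_mono) (metis ext_control_snd order_refl)
qed

lemma relaxed_value_eq_Vrel: "relaxed_value A f l f_inf l_inf q = Vrel" by (rule ext)
   (simp add: relaxed_value_def relaxed_base_def relaxed_fun_def not_compact_A Vrel_def cost_eq_pcost
    relax_def Frel_def Lrel_def f'_def l'_def \<sigma>_def flip: K'_def)

lemma hamiltonian_eq_Ham: "hamiltonian A f l f_inf l_inf q = Ham"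
 by (intro ext) (simp add: hamiltonian_def Ham_def not_compact_A f'_def l'_def image_image flip: \<sigma>_image)

end

locale problem =
 fixes A :: "(real^'m) set" and f f_inf :: "real^'n \<Rightarrow> real^'m \<Rightarrow> real^'n"
  and l l_inf :: "real^'n \<Rightarrow> real^'m \<Rightarrow> real" and p q :: nat and \<omega> :: "real \<Rightarrow> real \<Rightarrow> real"
  and T :: "(real^'n) set"
 assumes standing: "standing_assumptions A f l f_inf l_inf p q \<omega>"
  and H2: "H2 A f l q T" and H3: "H3 A f l f_inf l_inf q T"
begin

abbreviation "W \<equiv> value_fun A f l q"
abbreviation "characterized \<equiv>
 W = relaxed_value A f l f_inf l_inf q \<and> W = value_sup A f l q \<and>
 (W, Dom W) \<in> target_solution_pairs (hamiltonian A f l f_inf l_inf q) T \<and>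
 (\<forall>u \<Omega>. (u, \<Omega>) \<in> target_solution_pairs (hamiltonian A f l f_inf l_inf q) T \<longrightarrow> \<Omega> = Dom W \<and> u = W) \<and>
 continuous_on UNIV W"

lemma characterized_compact:
 assumes A: "compact A"
  and alt: "continuous_on (Dom W) W \<and> (\<forall>x\<in>frontier (Dom W). (W \<longlongrightarrow> \<infinity>) (at x)) \<or> CV A f l"
 shows characterized
proof -
 have ne: "A \<noteq> {}" and fc: "continuous_on (UNIV \<times> A) (\<lambda>(x, a). f x a)"
  and lc: "continuous_on (UNIV \<times> A) (\<lambda>(x, a). l x a)"
  using standing A unfolding standing_assumptions_def by (auto dest: compact_imp_bounded)
 obtain M B L where "data_bounds A f l q M B L" by (rule standing_bounds[OF standing])
 then interpret b: data_bounds A f l q M B L .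
 obtain r where r: "\<And>a. a \<in> A ==> norm a \<le> r" using compact_imp_bounded[OF A] by (auto simp: bounded_iff)
 \<comment> \<open>Bounds the factor 1 + |a|^q over the compact control set, which makes the data
   bounds uniform in the control.\<close>
 define N where "N = 1 + \<bar>r\<bar> ^ q"
 have N: "1 + norm a ^ q \<le> N" "0 \<le> 1 + norm a ^ q" if "a \<in> A" for a
  unfolding N_def using r[OF that] by (auto intro!: power_mono)
 have N0: "0 \<le> N" by (simp add: N_def)
 have cs: "csys_vec A f l (M * N) (\<lambda>R. \<bar>B R\<bar> * N) (\<lambda>R. L R * N)"
 proof
  fix a assume a: "a \<in> A"
  show "norm (f x a) \<le> M * N * (1 + norm x)" for x
   by (rule order_trans[OF b.growth[OF a]]) (use N[OF a] b.M_nonneg in \<open>auto intro!: mult_right_mono mult_left_mono\<close>)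
  show "norm (f x a) \<le> \<bar>B R\<bar> * N" if "norm x \<le> R" for x R
   by (rule order_trans[OF b.f_bound[OF a that]]) (use N[OF a] in \<open>auto intro!: mult_mono\<close>)
  show "l x a \<le> \<bar>B R\<bar> * N" if "norm x \<le> R" for x R
   by (rule order_trans[OF b.l_bound[OF a that]]) (use N[OF a] in \<open>auto intro!: mult_mono\<close>)
  show "norm (f x a - f y a) \<le> L R * N * norm (x - y)" if "norm x \<le> R" "norm y \<le> R" for x y R
   by (rule order_trans[OF b.f_lip[OF a that]]) (use N[OF a] b.L_nonneg in \<open>auto intro!: mult_right_mono mult_left_mono\<close>)
  show "\<bar>l x a - l y a\<bar> \<le> L R * N * norm (x - y)" if "norm x \<le> R" "norm y \<le> R" for x y R
   by (rule order_trans[OF b.l_lip[OF a that]]) (use N[OF a] b.L_nonneg in \<open>auto intro!: mult_right_mono mult_left_mono\<close>)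
  show "0 \<le> l x a" for x by (rule b.cost_nonneg[OF a])
 qed (use A ne fc lc b.M_nonneg b.L_nonneg N0 in auto)
 interpret v: csys_vec A f l "M * N" "\<lambda>R. \<bar>B R\<bar> * N" "\<lambda>R. L R * N" by (rule cs)
 note id = csys_vec_values[OF cs A]
 interpret t: csys_vec_target A f l "M * N" "\<lambda>R. \<bar>B R\<bar> * N" "\<lambda>R. L R * N" T
 proof unfold_locales
  show "closed T" "T \<noteq> {}" "compact (frontier T)" "\<And>x. x \<in> T ==> v.V x = 0"
   "\<And>x. x \<in> frontier T ==> (v.V \<longlongrightarrow> 0) (at x)" using H2[unfolded H2_def id(4)] by blast+
  show "\<exists>\<epsilon>>0. \<forall>\<alpha>\<in>v.ctrls. v.J \<alpha> x \<le> v.V x + ereal \<epsilon> \<longrightarrow>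
    Liminf at_top (\<lambda>t. ereal (infdist (v.traj \<alpha> x t) T)) = 0" if "v.V x < \<infinity>" for x
   using H3 A that unfolding H3_def id(1-4) by simp
 qed
 show ?thesis using alt
 proof
  assume "CV A f l"
  then have conv: "convex {(v, \<gamma>). \<exists>a\<in>A. v = f x a \<and> l x a \<le> \<gamma>}" for x unfolding CV_def by blast
  show ?thesis
   unfolding id(4-7) by (rule t.unique_solution_if_closure) (rule v.closure_if_convex[OF conv])
 next
  assume c: "continuous_on (Dom W) W \<and> (\<forall>x\<in>frontier (Dom W). (W \<longlongrightarrow> \<infinity>) (at x))"
  show ?thesis using c unfolding id(4-7) by (intro t.unique_solution_if_continuous) blast+
 qed
qed

lemma characterized_unbounded:
 assumes A: "\<not> bounded A"
  and alt: "continuous_on (Dom W) W \<and> (\<forall>x\<in>frontier (Dom W). (W \<longlongrightarrow> \<infinity>) (at x)) \<or> CV' A f l f_inf l_inf q T"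
 shows characterized
proof -
 have "\<not> compact A" using A compact_imp_bounded by blast
 with standing A have rc: "recession A q f f_inf" "recession A q l l_inf"
  and cone: "closed A" "convex_cone A"
  and fc: "continuous_on (UNIV \<times> A) (\<lambda>(x, a). f x a)" and lc: "continuous_on (UNIV \<times> A) (\<lambda>(x, a). l x a)"
  and "1 \<le> p" "p \<le> q"
  and "\<exists>C1\<ge>0. \<exists>C2>0. \<forall>x. \<forall>a\<in>A. l x a \<ge> C2 * norm a ^ q - C1"
  unfolding standing_assumptions_def by blast+
 then obtain C1 C2 where C: "0 \<le> C1" "0 < C2" "\<And>x a. a \<in> A ==> C2 * norm a ^ q - C1 \<le> l x a"
  and q: "0 < q" by auto
 obtain M B L where "data_bounds A f l q M B L" by (rule standing_bounds[OF standing])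
 then interpret b: data_bounds A f l q M B L .
 interpret c: cone_system A f f_inf l l_inf q M B L C1 C2
  by unfold_locales (fact cone A fc lc q C rc)+
 interpret t: cone_target A f f_inf l l_inf q M B L C1 C2 T
 proof unfold_locales
  show "closed T" "T \<noteq> {}" "compact (frontier T)" "\<And>x. x \<in> T ==> W x = 0"
   "\<And>x. x \<in> frontier T ==> (W \<longlongrightarrow> 0) (at x)" using H2[unfolded H2_def] by blast+
  show "\<exists>\<epsilon>>0. \<forall>\<alpha>\<in>c.ctrls. c.J \<alpha> x \<le> c.V x + ereal \<epsilon> \<longrightarrow>
    Liminf at_top (\<lambda>t. ereal (infdist (c.traj \<alpha> x t) T)) = 0" if fin: "c.V x < \<infinity>" for x
  proof -
   obtain \<epsilon> where \<epsilon>: "\<epsilon> > 0" "\<And>w. w \<in> ext_controls A q ==>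
     cost (ext_fun q f f_inf) (ext_fun q l l_inf) {0..} x w \<le> c.V x + ereal \<epsilon> ==>
     Liminf at_top (\<lambda>s. ereal (infdist (trajectory (ext_fun q f f_inf) x w s) T)) = 0"
    using H3 fin unfolding H3_def if_not_P[OF c.not_compact_A] c.ext_value_eq_V by blast
   have "Liminf at_top (\<lambda>t. ereal (infdist (c.traj \<alpha> x t) T)) = 0"
    if "\<alpha> \<in> c.ctrls" "c.J \<alpha> x \<le> c.V x + ereal \<epsilon>" for \<alpha>
    using \<epsilon>(2)[OF c.ext_control[OF that(1)]] that(2) by (simp add: c.ext_cost c.ext_trajectory)
   with \<epsilon>(1) show ?thesis by blast
  qed
 qed
 note id = t.value_fun_eq_V c.hamiltonian_eq_Ham c.relaxed_value_eq_Vrel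
 \<comment> \<open>The original finite-horizon supremum lies between \<open>Sig\<close> of the
   extended system and the original value, which equals \<open>V\<close>.\<close>
 have sup: "value_sup A f l q = c.V" if "c.V = c.Sig"
  using c.Sig_le_value_sup c.value_sup_le_value_fun that unfolding id by (intro ext antisym) (simp_all add: fun_eq_iff)
 have "t.unique_solution" using alt
 proof
  assume "CV' A f l f_inf l_inf q T"
  then have conv: "x \<notin> T ==> convex {(v0, v, \<gamma>). \<exists>w0\<in>{0..1}. \<exists>w\<in>cball 0 1 \<inter> A.
    v0 = w0 ^ q \<and> v = ext_fun q f f_inf x (w0, w) \<and> ext_fun q l l_inf x (w0, w) \<le> \<gamma>}" for x
   unfolding CV'_def by blast
  show ?thesis by (rule t.unique_solution_if_closure) (rule t.closure_if_convex_ext[OF conv])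
 next
  assume "continuous_on (Dom W) W \<and> (\<forall>x\<in>frontier (Dom W). (W \<longlongrightarrow> \<infinity>) (at x))"
  then show ?thesis unfolding id by (intro t.unique_solution_if_continuous) blast+
 qed
 moreover from this have "value_sup A f l q = c.V" by (intro sup) blast
 ultimately show ?thesis unfolding id by metis
qed

lemma characterized:
 assumes "continuous_on (Dom W) W \<and> (\<forall>x\<in>frontier (Dom W). (W \<longlongrightarrow> \<infinity>) (at x)) \<or> CV A f l \<or> CV' A f l f_inf l_inf q T"
 shows characterized
proof (cases "compact A")
 case True
 then have "\<not> CV' A f l f_inf l_inf q T" using compact_imp_bounded unfolding CV'_def by blast
 with True show ?thesis using assms by (intro characterized_compact) blast+
next
 case False
 then have "\<not> bounded A" using standing unfolding standing_assumptions_def by blast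
 moreover have "\<not> CV A f l" using False unfolding CV_def by blast
 ultimately show ?thesis using assms by (intro characterized_unbounded) blast+
qed

end

theorem theorem5p3:
  fixes A :: "(real^'m) set"
    and f f_inf :: "real^'n \<Rightarrow> real^'m \<Rightarrow> real^'n"
    and l l_inf :: "real^'n \<Rightarrow> real^'m \<Rightarrow> real"
    and p q :: nat
    and \<omega> :: "real \<Rightarrow> real \<Rightarrow> real"
    and T :: "(real^'n) set"
  assumes "standing_assumptions A f l f_inf l_inf p q \<omega>"
    and "H2 A f l q T"
    and "H3 A f l f_inf l_inf q T"
  shows
    "((H0_1 A f l p q \<or> H0_2 A f l f_inf l_inf q \<omega>) \<and>
        continuous_on (Dom (value_fun A f l q)) (value_fun A f l q) \<and>
        (\<forall>x\<in>frontier (Dom (value_fun A f l q)). (value_fun A f l q \<longlongrightarrow> \<infinity>) (at x))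
      \<or> CV A f l \<or> CV' A f l f_inf l_inf q T
      \<longrightarrow>
        value_fun A f l q = relaxed_value A f l f_inf l_inf q \<and>
        value_fun A f l q = value_sup A f l q \<and>
        (value_fun A f l q, Dom (value_fun A f l q))
          \<in> target_solution_pairs (hamiltonian A f l f_inf l_inf q) T \<and>
        (\<forall>u \<Omega>. (u, \<Omega>) \<in> target_solution_pairs (hamiltonian A f l f_inf l_inf q) T \<longrightarrow>
           \<Omega> = Dom (value_fun A f l q) \<and> u = value_fun A f l q) \<and>
        continuous_on UNIV (value_fun A f l q))
     \<and>
     (continuous_on (Dom (value_fun A f l q)) (value_fun A f l q) \<and>
        (\<forall>x\<in>frontier (Dom (value_fun A f l q)). (value_fun A f l q \<longlongrightarrow> \<infinity>) (at x))
      \<longrightarrow>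
        (value_fun A f l q, Dom (value_fun A f l q))
          \<in> target_solution_pairs (hamiltonian A f l f_inf l_inf q) T \<and>
        (\<forall>u \<Omega>. (u, \<Omega>) \<in> target_solution_pairs (hamiltonian A f l f_inf l_inf q) T \<and>
           continuous_on UNIV u \<longrightarrow>
           \<Omega> = Dom (value_fun A f l q) \<and> u = value_fun A f l q) \<and>
        continuous_on UNIV (value_fun A f l q))"
proof -
  interpret problem A f f_inf l l_inf p q \<omega> T by unfold_locales (rule assms)+
  show ?thesis using characterized by blast
qed

end
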